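(* The following is provable in $\mathbf{RCA}_0$ extended by the principle of $\Pi^1_1$-bar induction: If $T$ is a normal dilator, then so is $\partial T$.
   Context: We work in second order arithmetic; all orders have fields contained in $\mathbb N$, and finite objects are coded by natural numbers. $\Pi^1_1$-bar induction is the principle that for every well-order $X=(X,<_X)$ and every $\Pi^1_1$-formula $\varphi(x)$ (with parameters) we have $\forall_{x\in X}(\forall_{y<_Xx}\varphi(y)\rightarrow\varphi(x))\rightarrow\forall_{x\in X}\varphi(x)$. Basic notation. Morphisms of linear orders are strictly increasing maps (embeddings). $[X]^{<\omega}$ is the set of finite subsets of $X$, and $[f]^{<\omega}(a)=\{f(x)\mid x\in a\}$. Write $n=\{0,\dots,n-1\}$ with the usual order; the category of natural numbers has these finite orders as objects and strictly increasing maps as morphisms. For a finite linear order $a$, $|a|$ is its cardinality (also viewed as the order $\{0,\dots,|a|-1\}$) and $\mathrm{en}_a:|a|\to a$ is the increasing enumeration. For an embedding $f:a\to b$ of finite orders, $|f|:|a|\to|b|$ is the unique increasing map with $\mathrm{en}_b\circ|f|=f\circ\mathrm{en}_a$. For $a\subseteq c$, $\iota_a^c:a\hookrightarrow c$ is the inclusion. For $a\in[X]^{<\omega}$ and $x\in X$, $a<^{\mathrm{fin}}_X x$ means $y<_Xx$ for all $y\in a$. Prae-dilators. A (coded) prae-dilator consists of a functor $T$ from the category of natural numbers to linear orders with fields $T_n\subseteq\mathbb N$ (action on morphisms written $T_f$) and a natural transformation $\mathrm{supp}^T:T\Rightarrow[\cdot]^{<\omega}$ such that any $\sigma\in T_n$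 lies in the range of $T_{\iota\circ\mathrm{en}_a}$, where $a=\mathrm{supp}^T_n(\sigma)$ and $\iota:a\hookrightarrow n$ is the inclusion. For a linear order $X$ put $D^T_X=\{\langle a,\sigma\rangle\mid a\in[X]^{<\omega},\ \sigma\in T_{|a|},\ \mathrm{supp}^T_{|a|}(\sigma)=|a|\}$, ordered by $\langle a,\sigma\rangle<\langle b,\tau\rangle$ iff $T_{|\iota_a^{a\cup b}|}(\sigma)<_{T_{|a\cup b|}}T_{|\iota_b^{a\cup b}|}(\tau)$. $T$ is a dilator if $D^T_X$ is well-founded for every well-order $X$. A normal prae-dilator is a prae-dilator $T$ with a natural family of order embeddings $\mu^T_n:n\to T_n$ such that $\sigma<_{T_n}\mu^T_n(m)\Leftrightarrow\mathrm{supp}^T_n(\sigma)<^{\mathrm{fin}}m$ for all $m<n$ and $\sigma\in T_n$; a normal dilator is a normal prae-dilator that is a dilator. The construction $\partial T$. Given a normal prae-dilator $T$, the term systems $\partial T_n$ are defined inductively: (i) there is a term $\mu_m\in\partial T_n$ for each $m<n$; (ii) for each finite set $a\subseteq\partial T_n$ of terms and each $\sigma\in T_{|a|}$ with $\mathrm{supp}^T_{|a|}(\sigma)=|a|$ there is a term $\xi\langle a,\sigma\rangle\in\partial T_n$, provided that if $a=\{\mu_m\}$ for some $m<n$ then $\sigma\neq\mu^T_1(0)$. With $\ulcorner s\urcorner$ the Gödel number of $s$, put $L_n(\mu_m)=\ulcorner\mu_m\urcorner$ and $L_n(\xi\langle a,\sigma\rangle)=\max\{\ulcorner\xi\langle a,\sigma\rangle\urcorner,1+\sum_{t\in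 a}2\cdot L_n(t)\}$. By recursion on $L_n(s)+L_n(t)$, $s<_{\partial T_n}t$ holds iff one of the following does: $s=\mu_m$, $t=\mu_k$ and $m<k$; or $s=\mu_m$, $t=\xi\langle b,\tau\rangle$ and $s\leq_{\partial T_n}r$ for some $r\in b$ ($\leq$ means $<$ or equality of terms); or $s=\xi\langle a,\sigma\rangle$, $t=\mu_k$ and $r<_{\partial T_n}t$ for all $r\in a$; or $s=\xi\langle a,\sigma\rangle$, $t=\xi\langle b,\tau\rangle$, the restriction of $<_{\partial T_n}$ to $a\cup b$ is linear, and $T_{|\iota_a^{a\cup b}|}(\sigma)<_{T_{|a\cup b|}}T_{|\iota_b^{a\cup b}|}(\tau)$. For strictly increasing $f:n\to l$ put $\partial T_f(\mu_m)=\mu_{f(m)}$, $\partial T_f(\xi\langle a,\sigma\rangle)=\xi\langle[\partial T_f]^{<\omega}(a),\sigma\rangle$. Put $\mathrm{supp}^{\partial T}_n(\mu_m)=\{m\}$, $\mathrm{supp}^{\partial T}_n(\xi\langle a,\sigma\rangle)=\bigcup_{t\in a}\mathrm{supp}^{\partial T}_n(t)$ and $\mu^{\partial T}_n(m)=\mu_m$. Then $\partial T=(\partial T,\mathrm{supp}^{\partial T},\mu^{\partial T})$. *)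

theory Defs
  imports Main
begin

section \<open>Second order arithmetic\<close>

text \<open>
  The language has number variables and set variables, each with its own de Bruijn
  indices: \<open>AllN\<close> binds number variable 0 and \<open>AllS\<close> binds set variable 0.
\<close>

datatype tm = Var nat | Zero | One | Add tm tm | Mul tm tm

datatype fm =
    Fls
  | Eq tm tm
  | Less tm tm
  | Mem tm nat
  | Imp fm fm
  | AllN fm
  | AllS fm

abbreviation Neg :: "fm \<Rightarrow> fm" where "Neg p \<equiv> Imp p Fls"
abbreviation ExN :: "fm \<Rightarrow> fm" where "ExN p \<equiv> Neg (AllN (Neg p))"
abbreviation ExS :: "fm \<Rightarrow> fm" where "ExS p \<equiv> Neg (AllS (Neg p))"

fun subst_tm :: "(nat \<Rightarrow> tm) \<Rightarrow> tm \<Rightarrow> tm" where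
  "subst_tm s (Var n) = s n"
| "subst_tm s Zero = Zero"
| "subst_tm s One = One"
| "subst_tm s (Add t u) = Add (subst_tm s t) (subst_tm s u)"
| "subst_tm s (Mul t u) = Mul (subst_tm s t) (subst_tm s u)"

definition lift_tm :: "tm \<Rightarrow> tm" where
  "lift_tm = subst_tm (\<lambda>n. Var (Suc n))"

text \<open>Simultaneous capture-avoiding substitution: terms for number variables,
  set variables for set variables.\<close>

fun subst :: "(nat \<Rightarrow> tm) \<Rightarrow> (nat \<Rightarrow> nat) \<Rightarrow> fm \<Rightarrow> fm" where
  "subst s r Fls = Fls"
| "subst s r (Eq t u) = Eq (subst_tm s t) (subst_tm s u)"
| "subst s r (Less t u) = Less (subst_tm s t) (subst_tm s u)"
| "subst s r (Mem t X) = Mem (subst_tm s t) (r X)"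
| "subst s r (Imp p q) = Imp (subst s r p) (subst s r q)"
| "subst s r (AllN p) = AllN (subst (case_nat (Var 0) (\<lambda>n. lift_tm (s n))) r p)"
| "subst s r (AllS p) = AllS (subst s (case_nat 0 (\<lambda>n. Suc (r n))) p)"

abbreviation lift :: "fm \<Rightarrow> fm" where "lift \<equiv> subst (\<lambda>n. Var (Suc n)) id"
abbreviation liftS :: "fm \<Rightarrow> fm" where "liftS \<equiv> subst Var Suc"
abbreviation inst :: "tm \<Rightarrow> fm \<Rightarrow> fm" where "inst t \<equiv> subst (case_nat t Var) id"
abbreviation instS :: "nat \<Rightarrow> fm \<Rightarrow> fm" where "instS X \<equiv> subst Var (case_nat X id)"

text \<open>
  Natural deduction for classical two-sorted logic with equality on numbers. Formulas in
  \<open>Ax\<close> are the nonlogical axioms, and their free variables are understood universally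
  (the eigenvariable conditions only concern the list of hypotheses).
\<close>

inductive proves :: "fm set \<Rightarrow> fm list \<Rightarrow> fm \<Rightarrow> bool"  ("_; _ \<turnstile> _" [50, 50, 50] 50)
  for Ax :: "fm set" where
  Ax: "p \<in> Ax \<Longrightarrow> Ax; G \<turnstile> p"
| Assm: "p \<in> set G \<Longrightarrow> Ax; G \<turnstile> p"
| ImpI: "Ax; p # G \<turnstile> q \<Longrightarrow> Ax; G \<turnstile> Imp p q"
| ImpE: "Ax; G \<turnstile> Imp p q \<Longrightarrow> Ax; G \<turnstile> p \<Longrightarrow> Ax; G \<turnstile> q"
| Raa: "Ax; Neg p # G \<turnstile> Fls \<Longrightarrow> Ax; G \<turnstile> p"
| AllNI: "Ax; map lift G \<turnstile> p \<Longrightarrow> Ax; G \<turnstile> AllN p"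
| AllNE: "Ax; G \<turnstile> AllN p \<Longrightarrow> Ax; G \<turnstile> inst t p"
| AllSI: "Ax; map liftS G \<turnstile> p \<Longrightarrow> Ax; G \<turnstile> AllS p"
| AllSE: "Ax; G \<turnstile> AllS p \<Longrightarrow> Ax; G \<turnstile> instS X p"
| EqRefl: "Ax; G \<turnstile> Eq t t"
| EqSubst: "Ax; G \<turnstile> Eq t u \<Longrightarrow> Ax; G \<turnstile> inst t p \<Longrightarrow> Ax; G \<turnstile> inst u p"


section \<open>Writing formulas with HOL binders\<close>

text \<open>
  To make formulas readable we compose them from \<^emph>\<open>forms\<close>: a form yields a formula once
  the numbers \<open>d\<close> and \<open>e\<close> of enclosing number and set binders are known. A variable
  bound by the binder with \<open>d\<close> binders around it has, below \<open>d'\<close> binders, the de Bruijn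
  index \<open>d' - Suc d\<close>. A closed form \<open>P\<close> denotes the sentence \<open>P 0 0\<close>.
\<close>

type_synonym nterm = "nat \<Rightarrow> tm"
type_synonym sterm = "nat \<Rightarrow> nat"
type_synonym form = "nat \<Rightarrow> nat \<Rightarrow> fm"

definition fzero :: nterm ("\<^bold>0") where "\<^bold>0 = (\<lambda>d. Zero)"
definition fone :: nterm ("\<^bold>1") where "\<^bold>1 = (\<lambda>d. One)"
definition fadd :: "nterm \<Rightarrow> nterm \<Rightarrow> nterm" (infixl "\<^bold>+" 65) where
  "(x \<^bold>+ y) = (\<lambda>d. Add (x d) (y d))"
definition fmul :: "nterm \<Rightarrow> nterm \<Rightarrow> nterm" (infixl "\<^bold>*" 70) where
  "(x \<^bold>* y) = (\<lambda>d. Mul (x d) (y d))"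

definition feq :: "nterm \<Rightarrow> nterm \<Rightarrow> form" (infix "\<^bold>=" 50) where
  "(x \<^bold>= y) = (\<lambda>d e. Eq (x d) (y d))"
definition fless :: "nterm \<Rightarrow> nterm \<Rightarrow> form" (infix "\<^bold><" 50) where
  "(x \<^bold>< y) = (\<lambda>d e. Less (x d) (y d))"
definition fmem :: "nterm \<Rightarrow> sterm \<Rightarrow> form" (infix "\<^bold>\<in>" 50) where
  "(x \<^bold>\<in> X) = (\<lambda>d e. Mem (x d) (X e))"
definition fimp :: "form \<Rightarrow> form \<Rightarrow> form" (infixr "\<^bold>\<longrightarrow>" 25) where
  "(P \<^bold>\<longrightarrow> Q) = (\<lambda>d e. Imp (P d e) (Q d e))"
definition fnot :: "form \<Rightarrow> form" ("\<^bold>\<not> _" [40] 40) where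
  "(\<^bold>\<not> P) = (\<lambda>d e. Neg (P d e))"
definition fand :: "form \<Rightarrow> form \<Rightarrow> form" (infixr "\<^bold>\<and>" 35) where
  "(P \<^bold>\<and> Q) = (\<^bold>\<not> (P \<^bold>\<longrightarrow> \<^bold>\<not> Q))"
definition fdisj :: "form \<Rightarrow> form \<Rightarrow> form" (infixr "\<^bold>\<or>" 30) where
  "(P \<^bold>\<or> Q) = ((\<^bold>\<not> P) \<^bold>\<longrightarrow> Q)"
definition fiff :: "form \<Rightarrow> form \<Rightarrow> form" (infixr "\<^bold>\<longleftrightarrow>" 25) where
  "(P \<^bold>\<longleftrightarrow> Q) = ((P \<^bold>\<longrightarrow> Q) \<^bold>\<and> (Q \<^bold>\<longrightarrow> P))"

definition fall :: "(nterm \<Rightarrow> form) \<Rightarrow> form" (binder "\<^bold>\<forall>" 10) where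
  "fall P = (\<lambda>d e. AllN (P (\<lambda>d'. Var (d' - Suc d)) (Suc d) e))"
definition fex :: "(nterm \<Rightarrow> form) \<Rightarrow> form" (binder "\<^bold>\<exists>" 10) where
  "fex P = (\<^bold>\<not> (\<^bold>\<forall>x. \<^bold>\<not> P x))"
definition fex1 :: "(nterm \<Rightarrow> form) \<Rightarrow> form" (binder "\<^bold>\<exists>\<^bold>!" 10) where
  "fex1 P = (\<^bold>\<exists>x. P x \<^bold>\<and> (\<^bold>\<forall>y. P y \<^bold>\<longrightarrow> y \<^bold>= x))"
definition fallS :: "(sterm \<Rightarrow> form) \<Rightarrow> form" (binder "\<^bold>\<forall>\<^sub>2" 10) where
  "fallS P = (\<lambda>d e. AllS (P (\<lambda>e'. e' - Suc e) d (Suc e)))"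
definition fexS :: "(sterm \<Rightarrow> form) \<Rightarrow> form" (binder "\<^bold>\<exists>\<^sub>2" 10) where
  "fexS P = (\<^bold>\<not> (\<^bold>\<forall>\<^sub>2X. \<^bold>\<not> P X))"

text \<open>
  \<open>p\<lbrakk>x\<rbrakk>\<close> is the formula \<open>p\<close> with \<open>x\<close> for its number variable 0. The remaining free
  variables of \<open>p\<close> are parameters, i.e. variables that are free in the whole sentence
  under construction; \<open>param i\<close> is the set variable \<open>i\<close> as such a parameter.
\<close>

definition app :: "fm \<Rightarrow> nterm \<Rightarrow> form" ("_\<lbrakk>_\<rbrakk>" [1000, 0] 1000) where
  "p\<lbrakk>x\<rbrakk> = (\<lambda>d e. subst (case_nat (x d) (\<lambda>n. Var (n + d))) (\<lambda>X. X + e) p)"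
definition param :: "nat \<Rightarrow> sterm" where "param i = (\<lambda>e. i + e)"


section \<open>Axiom systems\<close>

inductive Delta00 :: "fm \<Rightarrow> bool" where
  "Delta00 Fls"
| "Delta00 (Eq t u)"
| "Delta00 (Less t u)"
| "Delta00 (Mem t X)"
| "Delta00 p \<Longrightarrow> Delta00 q \<Longrightarrow> Delta00 (Imp p q)"
| "Delta00 p \<Longrightarrow> Delta00 (AllN (Imp (Less (Var 0) (lift_tm t)) p))"

definition Sigma01 :: "fm \<Rightarrow> bool" where "Sigma01 p \<longleftrightarrow> (\<exists>q. Delta00 q \<and> p = ExN q)"
definition Pi01 :: "fm \<Rightarrow> bool" where "Pi01 p \<longleftrightarrow> (\<exists>q. Delta00 q \<and> p = AllN q)"

fun arithmetical :: "fm \<Rightarrow> bool" where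
  "arithmetical (Imp p q) \<longleftrightarrow> arithmetical p \<and> arithmetical q"
| "arithmetical (AllN p) \<longleftrightarrow> arithmetical p"
| "arithmetical (AllS p) \<longleftrightarrow> False"
| "arithmetical _ \<longleftrightarrow> True"

definition Pi11 :: "fm \<Rightarrow> bool" where "Pi11 p \<longleftrightarrow> (\<exists>q. arithmetical q \<and> p = AllS q)"

definition basic_axioms :: "fm set" where
  "basic_axioms = {P 0 0 | P. P \<in>
    {\<^bold>\<forall>n. \<^bold>\<not> n \<^bold>+ \<^bold>1 \<^bold>= \<^bold>0,
     \<^bold>\<forall>m. \<^bold>\<forall>n. m \<^bold>+ \<^bold>1 \<^bold>= n \<^bold>+ \<^bold>1 \<^bold>\<longrightarrow> m \<^bold>= n,
     \<^bold>\<forall>m. m \<^bold>+ \<^bold>0 \<^bold>= m,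
     \<^bold>\<forall>m. \<^bold>\<forall>n. m \<^bold>+ (n \<^bold>+ \<^bold>1) \<^bold>= (m \<^bold>+ n) \<^bold>+ \<^bold>1,
     \<^bold>\<forall>m. m \<^bold>* \<^bold>0 \<^bold>= \<^bold>0,
     \<^bold>\<forall>m. \<^bold>\<forall>n. m \<^bold>* (n \<^bold>+ \<^bold>1) \<^bold>= (m \<^bold>* n) \<^bold>+ m,
     \<^bold>\<forall>m. \<^bold>\<not> m \<^bold>< \<^bold>0,
     \<^bold>\<forall>m. \<^bold>\<forall>n. m \<^bold>< n \<^bold>+ \<^bold>1 \<^bold>\<longleftrightarrow> m \<^bold>< n \<^bold>\<or> m \<^bold>= n}}"

definition Sigma01_IND :: "fm set" where
  "Sigma01_IND = {(p\<lbrakk>\<^bold>0\<rbrakk> \<^bold>\<and> (\<^bold>\<forall>n. p\<lbrakk>n\<rbrakk> \<^bold>\<longrightarrow> p\<lbrakk>n \<^bold>+ \<^bold>1\<rbrakk>) \<^bold>\<longrightarrow> (\<^bold>\<forall>n. p\<lbrakk>n\<rbrakk>)) 0 0 | p. Sigma01 p}"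

definition Delta01_CA :: "fm set" where
  "Delta01_CA = {((\<^bold>\<forall>n. p\<lbrakk>n\<rbrakk> \<^bold>\<longleftrightarrow> q\<lbrakk>n\<rbrakk>) \<^bold>\<longrightarrow> (\<^bold>\<exists>\<^sub>2X. \<^bold>\<forall>n. n \<^bold>\<in> X \<^bold>\<longleftrightarrow> p\<lbrakk>n\<rbrakk>)) 0 0 | p q.
     Sigma01 p \<and> Pi01 q}"

definition RCA0 :: "fm set" where
  "RCA0 = basic_axioms \<union> Sigma01_IND \<union> Delta01_CA"

definition pair :: "nterm \<Rightarrow> nterm \<Rightarrow> nterm" ("\<langle>_,/ _\<rangle>") where
  "\<langle>x, y\<rangle> = (x \<^bold>+ y) \<^bold>* (x \<^bold>+ y) \<^bold>+ x"

text \<open>Orders are given by a field and a strict order relation on it.\<close>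

definition linear_order :: "(nterm \<Rightarrow> form) \<Rightarrow> (nterm \<Rightarrow> nterm \<Rightarrow> form) \<Rightarrow> form" where
  "linear_order fld lt =
    ((\<^bold>\<forall>x. \<^bold>\<forall>y. lt x y \<^bold>\<longrightarrow> fld x \<^bold>\<and> fld y) \<^bold>\<and>
     (\<^bold>\<forall>x. \<^bold>\<not> lt x x) \<^bold>\<and>
     (\<^bold>\<forall>x. \<^bold>\<forall>y. \<^bold>\<forall>z. lt x y \<^bold>\<and> lt y z \<^bold>\<longrightarrow> lt x z) \<^bold>\<and>
     (\<^bold>\<forall>x. \<^bold>\<forall>y. fld x \<^bold>\<and> fld y \<^bold>\<longrightarrow> lt x y \<^bold>\<or> x \<^bold>= y \<^bold>\<or> lt y x))"

text \<open>No infinite descending sequence, sequences being sets of pairs.\<close>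

definition well_founded :: "(nterm \<Rightarrow> nterm \<Rightarrow> form) \<Rightarrow> form" where
  "well_founded lt =
    (\<^bold>\<not> (\<^bold>\<exists>\<^sub>2F. (\<^bold>\<forall>n. \<^bold>\<exists>\<^bold>!x. \<langle>n, x\<rangle> \<^bold>\<in> F) \<^bold>\<and>
            (\<^bold>\<forall>n. \<^bold>\<forall>x. \<^bold>\<forall>y. \<langle>n, x\<rangle> \<^bold>\<in> F \<^bold>\<and> \<langle>n \<^bold>+ \<^bold>1, y\<rangle> \<^bold>\<in> F \<^bold>\<longrightarrow> lt y x)))"

definition well_order :: "(nterm \<Rightarrow> form) \<Rightarrow> (nterm \<Rightarrow> nterm \<Rightarrow> form) \<Rightarrow> form" where
  "well_order fld lt = (linear_order fld lt \<^bold>\<and> well_founded lt)"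

text \<open>Bar induction along the order with field \<open>X\<close> and relation \<open>R\<close>; both may occur
  in the induction formula.\<close>

definition Pi11_BI :: "fm set" where
  "Pi11_BI =
    {(let X = param i; R = param j in
      well_order (\<lambda>x. x \<^bold>\<in> X) (\<lambda>y x. \<langle>y, x\<rangle> \<^bold>\<in> R) \<^bold>\<longrightarrow>
      (\<^bold>\<forall>x. x \<^bold>\<in> X \<^bold>\<longrightarrow> (\<^bold>\<forall>y. \<langle>y, x\<rangle> \<^bold>\<in> R \<^bold>\<longrightarrow> p\<lbrakk>y\<rbrakk>) \<^bold>\<longrightarrow> p\<lbrakk>x\<rbrakk>) \<^bold>\<longrightarrow>
      (\<^bold>\<forall>x. x \<^bold>\<in> X \<^bold>\<longrightarrow> p\<lbrakk>x\<rbrakk>)) 0 0 | i j p. Pi11 p}"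


section \<open>Finite sets and finite functions\<close>

text \<open>
  As usual in RCA0, a finite set \<open>{x. x < k \<and> m * (x + 1) + 1 dvd n}\<close> is represented
  by the number \<open>\<langle>k, \<langle>m, n\<rangle>\<rangle>\<close>; its code is the least such number. Numbers that are not
  of this form have no elements, and the code of the empty set is 0. The elements of a set
  are smaller than any of its representations.
\<close>

definition fin_mem :: "nterm \<Rightarrow> nterm \<Rightarrow> form" (infix "\<^bold>\<epsilon>" 50) where
  "(x \<^bold>\<epsilon> c) = (\<^bold>\<exists>k. \<^bold>\<exists>m. \<^bold>\<exists>n. c \<^bold>= \<langle>k, \<langle>m, n\<rangle>\<rangle> \<^bold>\<and> x \<^bold>< k \<^bold>\<and>
              (\<^bold>\<exists>q. n \<^bold>= q \<^bold>* (m \<^bold>* (x \<^bold>+ \<^bold>1) \<^bold>+ \<^bold>1)))"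

definition fin_set :: "nterm \<Rightarrow> form" where
  "fin_set c = (\<^bold>\<forall>b. b \<^bold>< c \<^bold>\<longrightarrow> \<^bold>\<not> (\<^bold>\<forall>x. x \<^bold>\<epsilon> b \<^bold>\<longleftrightarrow> x \<^bold>\<epsilon> c))"

definition fin_union :: "nterm \<Rightarrow> nterm \<Rightarrow> nterm \<Rightarrow> form" where
  "fin_union c a b = (fin_set c \<^bold>\<and> (\<^bold>\<forall>x. x \<^bold>\<epsilon> c \<^bold>\<longleftrightarrow> x \<^bold>\<epsilon> a \<^bold>\<or> x \<^bold>\<epsilon> b))"

text \<open>\<open>f\<close> codes (the graph of) a function from \<open>{0, ..., n - 1}\<close> to the class \<open>B\<close>.\<close>

definition fin_fun :: "nterm \<Rightarrow> nterm \<Rightarrow> (nterm \<Rightarrow> form) \<Rightarrow> form" where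
  "fin_fun f n B =
    (fin_set f \<^bold>\<and>
     (\<^bold>\<forall>z. z \<^bold>\<epsilon> f \<^bold>\<longrightarrow> (\<^bold>\<exists>i. \<^bold>\<exists>x. z \<^bold>= \<langle>i, x\<rangle> \<^bold>\<and> i \<^bold>< n \<^bold>\<and> B x)) \<^bold>\<and>
     (\<^bold>\<forall>i. i \<^bold>< n \<^bold>\<longrightarrow> (\<^bold>\<exists>\<^bold>!x. \<langle>i, x\<rangle> \<^bold>\<epsilon> f)))"

text \<open>\<open>f\<close> is a morphism \<open>n \<rightarrow> l\<close> in the category of natural numbers.\<close>

definition morph :: "nterm \<Rightarrow> nterm \<Rightarrow> nterm \<Rightarrow> form" where
  "morph f n l =
    (fin_fun f n (\<lambda>x. x \<^bold>< l) \<^bold>\<and>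
     (\<^bold>\<forall>i. \<^bold>\<forall>j. \<^bold>\<forall>x. \<^bold>\<forall>y. \<langle>i, x\<rangle> \<^bold>\<epsilon> f \<^bold>\<and> \<langle>j, y\<rangle> \<^bold>\<epsilon> f \<^bold>\<and> i \<^bold>< j \<^bold>\<longrightarrow> x \<^bold>< y))"

definition fin_card :: "nterm \<Rightarrow> nterm \<Rightarrow> form" where
  "fin_card a n =
    (\<^bold>\<exists>f. fin_fun f n (\<lambda>x. x \<^bold>\<epsilon> a) \<^bold>\<and> (\<^bold>\<forall>x. x \<^bold>\<epsilon> a \<^bold>\<longrightarrow> (\<^bold>\<exists>\<^bold>!i. \<langle>i, x\<rangle> \<^bold>\<epsilon> f)))"

text \<open>\<open>n\<close> is \<open>|a|\<close> and \<open>f\<close> is \<open>en\<^sub>a\<close>, with respect to the (linear) order \<open>lt\<close> on \<open>a\<close>.\<close>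

definition enum :: "nterm \<Rightarrow> nterm \<Rightarrow> nterm \<Rightarrow> (nterm \<Rightarrow> nterm \<Rightarrow> form) \<Rightarrow> form" where
  "enum f n a lt =
    (fin_fun f n (\<lambda>x. x \<^bold>\<epsilon> a) \<^bold>\<and>
     (\<^bold>\<forall>x. x \<^bold>\<epsilon> a \<^bold>\<longrightarrow> (\<^bold>\<exists>i. \<langle>i, x\<rangle> \<^bold>\<epsilon> f)) \<^bold>\<and>
     (\<^bold>\<forall>i. \<^bold>\<forall>j. \<^bold>\<forall>x. \<^bold>\<forall>y. \<langle>i, x\<rangle> \<^bold>\<epsilon> f \<^bold>\<and> \<langle>j, y\<rangle> \<^bold>\<epsilon> f \<^bold>\<and> i \<^bold>< j \<^bold>\<longrightarrow> lt x y))"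

text \<open>For \<open>a \<subseteq> c\<close>: \<open>g\<close> is \<open>|\<iota>\<^sub>a\<^sup>c| : p \<rightarrow> r\<close> where \<open>p = |a|\<close> and \<open>r = |c|\<close>, i.e. the morphism
  with \<open>en\<^sub>c \<circ> g = \<iota>\<^sub>a\<^sup>c \<circ> en\<^sub>a\<close>.\<close>

definition incl :: "nterm \<Rightarrow> nterm \<Rightarrow> nterm \<Rightarrow> nterm \<Rightarrow> nterm \<Rightarrow> (nterm \<Rightarrow> nterm \<Rightarrow> form) \<Rightarrow> form" where
  "incl g p r a c lt =
    (morph g p r \<^bold>\<and>
     (\<^bold>\<exists>f. \<^bold>\<exists>h. enum f p a lt \<^bold>\<and> enum h r c lt \<^bold>\<and>
        (\<^bold>\<forall>i. \<^bold>\<forall>j. \<langle>i, j\<rangle> \<^bold>\<epsilon> g \<^bold>\<longrightarrow> (\<^bold>\<exists>x. \<langle>i, x\<rangle> \<^bold>\<epsilon> f \<^bold>\<and> \<langle>j, x\<rangle> \<^bold>\<epsilon> h))))"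


section \<open>Normal dilators\<close>

text \<open>
  A (normal) prae-dilator is coded by a single set \<open>T\<close>, which has as its sections
  the field of \<open>T\<^sub>n\<close>, its order, the graph of the action on morphisms, and the graphs
  of \<open>supp\<close> and \<open>\<mu>\<close>. So \<open>act T n l f s t\<close> says \<open>T\<^sub>f(s) = t\<close> for \<open>f : n \<rightarrow> l\<close>.
\<close>

definition tag_field :: nterm where "tag_field = \<^bold>0"
definition tag_less :: nterm where "tag_less = \<^bold>1"
definition tag_act :: nterm where "tag_act = \<^bold>1 \<^bold>+ \<^bold>1"
definition tag_supp :: nterm where "tag_supp = \<^bold>1 \<^bold>+ \<^bold>1 \<^bold>+ \<^bold>1"
definition tag_mu :: nterm where "tag_mu = \<^bold>1 \<^bold>+ \<^bold>1 \<^bold>+ \<^bold>1 \<^bold>+ \<^bold>1"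

definition elt :: "sterm \<Rightarrow> nterm \<Rightarrow> nterm \<Rightarrow> form" where
  "elt T n s = (\<langle>tag_field, \<langle>n, s\<rangle>\<rangle> \<^bold>\<in> T)"
definition below :: "sterm \<Rightarrow> nterm \<Rightarrow> nterm \<Rightarrow> nterm \<Rightarrow> form" where
  "below T n s t = (\<langle>tag_less, \<langle>n, \<langle>s, t\<rangle>\<rangle>\<rangle> \<^bold>\<in> T)"
definition act :: "sterm \<Rightarrow> nterm \<Rightarrow> nterm \<Rightarrow> nterm \<Rightarrow> nterm \<Rightarrow> nterm \<Rightarrow> form" where
  "act T n l f s t = (\<langle>tag_act, \<langle>n, \<langle>l, \<langle>f, \<langle>s, t\<rangle>\<rangle>\<rangle>\<rangle>\<rangle> \<^bold>\<in> T)"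
definition supp :: "sterm \<Rightarrow> nterm \<Rightarrow> nterm \<Rightarrow> nterm \<Rightarrow> form" where
  "supp T n s a = (\<langle>tag_supp, \<langle>n, \<langle>s, a\<rangle>\<rangle>\<rangle> \<^bold>\<in> T)"
definition mu :: "sterm \<Rightarrow> nterm \<Rightarrow> nterm \<Rightarrow> nterm \<Rightarrow> form" where
  "mu T n m s = (\<langle>tag_mu, \<langle>n, \<langle>m, s\<rangle>\<rangle>\<rangle> \<^bold>\<in> T)"

definition prae_dilator :: "sterm \<Rightarrow> form" where
  "prae_dilator T =
    ((\<^bold>\<forall>n. linear_order (elt T n) (below T n)) \<^bold>\<and>
     (\<^bold>\<forall>n. \<^bold>\<forall>l. \<^bold>\<forall>f. \<^bold>\<forall>s. \<^bold>\<forall>t. act T n l f s t \<^bold>\<longrightarrow> morph f n l \<^bold>\<and> elt T n s \<^bold>\<and> elt T l t) \<^bold>\<and>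
     (\<^bold>\<forall>n. \<^bold>\<forall>l. \<^bold>\<forall>f. \<^bold>\<forall>s. morph f n l \<^bold>\<and> elt T n s \<^bold>\<longrightarrow> (\<^bold>\<exists>\<^bold>!t. act T n l f s t)) \<^bold>\<and>
     (\<^bold>\<forall>n. \<^bold>\<forall>l. \<^bold>\<forall>f. \<^bold>\<forall>s. \<^bold>\<forall>t. \<^bold>\<forall>s'. \<^bold>\<forall>t'.
        act T n l f s s' \<^bold>\<and> act T n l f t t' \<^bold>\<and> below T n s t \<^bold>\<longrightarrow> below T l s' t') \<^bold>\<and>
     (\<^bold>\<forall>n. \<^bold>\<forall>f. \<^bold>\<forall>s. morph f n n \<^bold>\<and> (\<^bold>\<forall>i. i \<^bold>< n \<^bold>\<longrightarrow> \<langle>i, i\<rangle> \<^bold>\<epsilon> f) \<^bold>\<and> elt T n s \<^bold>\<longrightarrow>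
        act T n n f s s) \<^bold>\<and>
     (\<^bold>\<forall>k. \<^bold>\<forall>n. \<^bold>\<forall>l. \<^bold>\<forall>f. \<^bold>\<forall>g. \<^bold>\<forall>h. \<^bold>\<forall>s. \<^bold>\<forall>t. \<^bold>\<forall>u.
        morph h k l \<^bold>\<and> (\<^bold>\<forall>i. \<^bold>\<forall>j. \<^bold>\<forall>m. \<langle>i, j\<rangle> \<^bold>\<epsilon> f \<^bold>\<and> \<langle>j, m\<rangle> \<^bold>\<epsilon> g \<^bold>\<longrightarrow> \<langle>i, m\<rangle> \<^bold>\<epsilon> h) \<^bold>\<and>
        act T k n f s t \<^bold>\<and> act T n l g t u \<^bold>\<longrightarrow> act T k l h s u) \<^bold>\<and>
     (\<^bold>\<forall>n. \<^bold>\<forall>s. \<^bold>\<forall>a. supp T n s a \<^bold>\<longrightarrow>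
        elt T n s \<^bold>\<and> fin_set a \<^bold>\<and> (\<^bold>\<forall>x. x \<^bold>\<epsilon> a \<^bold>\<longrightarrow> x \<^bold>< n)) \<^bold>\<and>
     (\<^bold>\<forall>n. \<^bold>\<forall>s. elt T n s \<^bold>\<longrightarrow> (\<^bold>\<exists>\<^bold>!a. supp T n s a)) \<^bold>\<and>
     (\<^bold>\<forall>n. \<^bold>\<forall>l. \<^bold>\<forall>f. \<^bold>\<forall>s. \<^bold>\<forall>t. \<^bold>\<forall>a. \<^bold>\<forall>b.
        act T n l f s t \<^bold>\<and> supp T n s a \<^bold>\<and> supp T l t b \<^bold>\<longrightarrow>
        (\<^bold>\<forall>y. y \<^bold>\<epsilon> b \<^bold>\<longleftrightarrow> (\<^bold>\<exists>x. x \<^bold>\<epsilon> a \<^bold>\<and> \<langle>x, y\<rangle> \<^bold>\<epsilon> f))) \<^bold>\<and>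
     \<comment> \<open>the graph of \<open>en\<^sub>a : k \<rightarrow> a\<close> is also that of \<open>\<iota> \<circ> en\<^sub>a : k \<rightarrow> n\<close>\<close>
     (\<^bold>\<forall>n. \<^bold>\<forall>s. \<^bold>\<forall>a. supp T n s a \<^bold>\<longrightarrow>
        (\<^bold>\<exists>k. \<^bold>\<exists>f. \<^bold>\<exists>r. enum f k a (\<lambda>x y. x \<^bold>< y) \<^bold>\<and> act T k n f r s)))"

definition normal_prae_dilator :: "sterm \<Rightarrow> form" where
  "normal_prae_dilator T =
    (prae_dilator T \<^bold>\<and>
     (\<^bold>\<forall>n. \<^bold>\<forall>m. \<^bold>\<forall>s. mu T n m s \<^bold>\<longrightarrow> m \<^bold>< n \<^bold>\<and> elt T n s) \<^bold>\<and>
     (\<^bold>\<forall>n. \<^bold>\<forall>m. m \<^bold>< n \<^bold>\<longrightarrow> (\<^bold>\<exists>\<^bold>!s. mu T n m s)) \<^bold>\<and>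
     (\<^bold>\<forall>n. \<^bold>\<forall>m. \<^bold>\<forall>m'. \<^bold>\<forall>s. \<^bold>\<forall>s'. mu T n m s \<^bold>\<and> mu T n m' s' \<^bold>\<and> m \<^bold>< m' \<^bold>\<longrightarrow> below T n s s') \<^bold>\<and>
     (\<^bold>\<forall>n. \<^bold>\<forall>l. \<^bold>\<forall>f. \<^bold>\<forall>m. \<^bold>\<forall>m'. \<^bold>\<forall>s. \<^bold>\<forall>s'.
        morph f n l \<^bold>\<and> \<langle>m, m'\<rangle> \<^bold>\<epsilon> f \<^bold>\<and> mu T n m s \<^bold>\<and> mu T l m' s' \<^bold>\<longrightarrow> act T n l f s s') \<^bold>\<and>
     (\<^bold>\<forall>n. \<^bold>\<forall>m. \<^bold>\<forall>u. \<^bold>\<forall>s. \<^bold>\<forall>a. mu T n m u \<^bold>\<and> supp T n s a \<^bold>\<longrightarrow>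
        (below T n s u \<^bold>\<longleftrightarrow> (\<^bold>\<forall>x. x \<^bold>\<epsilon> a \<^bold>\<longrightarrow> x \<^bold>< m))))"

text \<open>\<open>|a| = n\<close>, \<open>s \<in> T\<^sub>n\<close> and \<open>supp\<^sub>n(s) = {0, ..., n - 1}\<close>.\<close>

definition full_supp :: "sterm \<Rightarrow> nterm \<Rightarrow> nterm \<Rightarrow> form" where
  "full_supp T a s =
    (\<^bold>\<exists>n. fin_card a n \<^bold>\<and> elt T n s \<^bold>\<and> (\<^bold>\<exists>b. supp T n s b \<^bold>\<and> (\<^bold>\<forall>x. x \<^bold>\<epsilon> b \<^bold>\<longleftrightarrow> x \<^bold>< n)))"

text \<open>The image of \<open>s\<close> under \<open>|\<iota>\<^sub>a| : |a| \<rightarrow> |c|\<close> is below that of \<open>t\<close> under \<open>|\<iota>\<^sub>b| : |b| \<rightarrow> |c|\<close>,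
  where \<open>c = a \<union> b\<close> is ordered by \<open>lt\<close>.\<close>

definition pair_less ::
    "sterm \<Rightarrow> (nterm \<Rightarrow> nterm \<Rightarrow> form) \<Rightarrow> nterm \<Rightarrow> nterm \<Rightarrow> nterm \<Rightarrow> nterm \<Rightarrow> form" where
  "pair_less T lt a s b t =
    (\<^bold>\<exists>c. \<^bold>\<exists>p. \<^bold>\<exists>q. \<^bold>\<exists>r. \<^bold>\<exists>g. \<^bold>\<exists>h. \<^bold>\<exists>s'. \<^bold>\<exists>t'.
       fin_union c a b \<^bold>\<and> incl g p r a c lt \<^bold>\<and> incl h q r b c lt \<^bold>\<and>
       act T p r g s s' \<^bold>\<and> act T q r h t t' \<^bold>\<and> below T r s' t')"

definition D_field :: "sterm \<Rightarrow> (nterm \<Rightarrow> form) \<Rightarrow> nterm \<Rightarrow> form" where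
  "D_field T fld x =
    (\<^bold>\<exists>a. \<^bold>\<exists>s. x \<^bold>= \<langle>a, s\<rangle> \<^bold>\<and> fin_set a \<^bold>\<and> (\<^bold>\<forall>y. y \<^bold>\<epsilon> a \<^bold>\<longrightarrow> fld y) \<^bold>\<and> full_supp T a s)"

definition D_less ::
    "sterm \<Rightarrow> (nterm \<Rightarrow> form) \<Rightarrow> (nterm \<Rightarrow> nterm \<Rightarrow> form) \<Rightarrow> nterm \<Rightarrow> nterm \<Rightarrow> form" where
  "D_less T fld lt x y =
    (D_field T fld x \<^bold>\<and> D_field T fld y \<^bold>\<and>
     (\<^bold>\<exists>a. \<^bold>\<exists>s. \<^bold>\<exists>b. \<^bold>\<exists>t. x \<^bold>= \<langle>a, s\<rangle> \<^bold>\<and> y \<^bold>= \<langle>b, t\<rangle> \<^bold>\<and> pair_less T lt a s b t))"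

definition dilator :: "sterm \<Rightarrow> form" where
  "dilator T =
    (prae_dilator T \<^bold>\<and>
     (\<^bold>\<forall>\<^sub>2X. \<^bold>\<forall>\<^sub>2R. well_order (\<lambda>x. x \<^bold>\<in> X) (\<lambda>x y. \<langle>x, y\<rangle> \<^bold>\<in> R) \<^bold>\<longrightarrow>
        well_founded (D_less T (\<lambda>x. x \<^bold>\<in> X) (\<lambda>x y. \<langle>x, y\<rangle> \<^bold>\<in> R))))"

definition normal_dilator :: "sterm \<Rightarrow> form" where
  "normal_dilator T = (normal_prae_dilator T \<^bold>\<and> dilator T)"


section \<open>The derivative\<close>

definition mu_term :: "nterm \<Rightarrow> nterm" where "mu_term m = \<langle>\<^bold>0, m\<rangle>"
definition xi_term :: "nterm \<Rightarrow> nterm \<Rightarrow> nterm" where "xi_term a s = \<langle>\<^bold>1, \<langle>a, s\<rangle>\<rangle>"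

text \<open>
  \<open>derivative T D\<close> says that \<open>D\<close> codes \<open>\<partial>T\<close>. Terms are identified with their Goedel
  numbers, and the recursive definitions are expressed by their defining equations.
  These determine the components of \<open>D\<close>: for the order by recursion on
  \<open>L\<^sub>n(s) + L\<^sub>n(t)\<close>, for the other components by recursion on Goedel numbers (the elements
  of \<open>a\<close> are smaller than the code \<open>a\<close>, hence smaller than \<open>\<xi>\<langle>a, \<sigma>\<rangle>\<close>).
\<close>

definition derivative :: "sterm \<Rightarrow> sterm \<Rightarrow> form" where
  "derivative T D =
    ((\<^bold>\<forall>n. \<^bold>\<forall>s. elt D n s \<^bold>\<longleftrightarrow>
        (\<^bold>\<exists>m. m \<^bold>< n \<^bold>\<and> s \<^bold>= mu_term m) \<^bold>\<or>
        (\<^bold>\<exists>a. \<^bold>\<exists>r. s \<^bold>= xi_term a r \<^bold>\<and> fin_set a \<^bold>\<and> (\<^bold>\<forall>t. t \<^bold>\<epsilon> a \<^bold>\<longrightarrow> elt D n t) \<^bold>\<and>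
           full_supp T a r \<^bold>\<and>
           \<^bold>\<not> ((\<^bold>\<exists>m. m \<^bold>< n \<^bold>\<and> (\<^bold>\<forall>t. t \<^bold>\<epsilon> a \<^bold>\<longleftrightarrow> t \<^bold>= mu_term m)) \<^bold>\<and> mu T \<^bold>1 \<^bold>0 r))) \<^bold>\<and>
     (\<^bold>\<forall>n. \<^bold>\<forall>s. \<^bold>\<forall>t. below D n s t \<^bold>\<longleftrightarrow> elt D n s \<^bold>\<and> elt D n t \<^bold>\<and>
        ((\<^bold>\<exists>m. \<^bold>\<exists>k. s \<^bold>= mu_term m \<^bold>\<and> t \<^bold>= mu_term k \<^bold>\<and> m \<^bold>< k) \<^bold>\<or>
         (\<^bold>\<exists>m. \<^bold>\<exists>b. \<^bold>\<exists>u. s \<^bold>= mu_term m \<^bold>\<and> t \<^bold>= xi_term b u \<^bold>\<and>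
            (\<^bold>\<exists>r. r \<^bold>\<epsilon> b \<^bold>\<and> (below D n s r \<^bold>\<or> s \<^bold>= r))) \<^bold>\<or>
         (\<^bold>\<exists>a. \<^bold>\<exists>u. \<^bold>\<exists>k. s \<^bold>= xi_term a u \<^bold>\<and> t \<^bold>= mu_term k \<^bold>\<and> (\<^bold>\<forall>r. r \<^bold>\<epsilon> a \<^bold>\<longrightarrow> below D n r t)) \<^bold>\<or>
         (\<^bold>\<exists>a. \<^bold>\<exists>u. \<^bold>\<exists>b. \<^bold>\<exists>v. s \<^bold>= xi_term a u \<^bold>\<and> t \<^bold>= xi_term b v \<^bold>\<and>
            linear_order (\<lambda>x. x \<^bold>\<epsilon> a \<^bold>\<or> x \<^bold>\<epsilon> b)
              (\<lambda>x y. (x \<^bold>\<epsilon> a \<^bold>\<or> x \<^bold>\<epsilon> b) \<^bold>\<and> (y \<^bold>\<epsilon> a \<^bold>\<or> y \<^bold>\<epsilon> b) \<^bold>\<and> below D n x y) \<^bold>\<and>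
            pair_less T (below D n) a u b v))) \<^bold>\<and>
     (\<^bold>\<forall>n. \<^bold>\<forall>l. \<^bold>\<forall>f. \<^bold>\<forall>s. \<^bold>\<forall>t. act D n l f s t \<^bold>\<longleftrightarrow> morph f n l \<^bold>\<and> elt D n s \<^bold>\<and>
        ((\<^bold>\<exists>m. \<^bold>\<exists>k. s \<^bold>= mu_term m \<^bold>\<and> \<langle>m, k\<rangle> \<^bold>\<epsilon> f \<^bold>\<and> t \<^bold>= mu_term k) \<^bold>\<or>
         (\<^bold>\<exists>a. \<^bold>\<exists>b. \<^bold>\<exists>u. s \<^bold>= xi_term a u \<^bold>\<and> t \<^bold>= xi_term b u \<^bold>\<and> fin_set b \<^bold>\<and>
            (\<^bold>\<forall>y. y \<^bold>\<epsilon> b \<^bold>\<longleftrightarrow> (\<^bold>\<exists>x. x \<^bold>\<epsilon> a \<^bold>\<and> act D n l f x y))))) \<^bold>\<and>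
     (\<^bold>\<forall>n. \<^bold>\<forall>s. \<^bold>\<forall>c. supp D n s c \<^bold>\<longleftrightarrow> elt D n s \<^bold>\<and> fin_set c \<^bold>\<and>
        ((\<^bold>\<exists>m. s \<^bold>= mu_term m \<^bold>\<and> (\<^bold>\<forall>x. x \<^bold>\<epsilon> c \<^bold>\<longleftrightarrow> x \<^bold>= m)) \<^bold>\<or>
         (\<^bold>\<exists>a. \<^bold>\<exists>u. s \<^bold>= xi_term a u \<^bold>\<and>
            (\<^bold>\<forall>x. x \<^bold>\<epsilon> c \<^bold>\<longleftrightarrow> (\<^bold>\<exists>t. \<^bold>\<exists>b. t \<^bold>\<epsilon> a \<^bold>\<and> supp D n t b \<^bold>\<and> x \<^bold>\<epsilon> b))))) \<^bold>\<and>
     (\<^bold>\<forall>n. \<^bold>\<forall>m. \<^bold>\<forall>s. mu D n m s \<^bold>\<longleftrightarrow> m \<^bold>< n \<^bold>\<and> s \<^bold>= mu_term m))"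

end

theory Submission
  imports Defs "HOL-Library.Countable_Set"
begin

text \<open>
  By the completeness theorem it suffices to argue in an arbitrary countable model, where
  \<open>\<Pi>\<^sup>1\<^sub>1\<close>-bar induction yields arithmetical comprehension.

  For a linear order \<open>X\<close> let \<open>\<partial>T(X)\<close> be the term system with constants \<open>\<mu>\<^sub>x\<close> for \<open>x \<in> X\<close>. By
  simultaneous induction on codes, \<open>\<partial>T(X)\<close> is linear and \<open>s < t\<close> implies that the support of \<open>s\<close>
  is dominated by that of \<open>t\<close>. Now let \<open>X\<close> be a well-order and call a term accessible if no descending
  sequence starts from it. If \<open>\<mu>\<^sub>y\<close> is accessible for all \<open>y\<close> in some set \<open>A\<close> of indices, then so
  is each term \<open>s = \<xi>\<langle>a, \<sigma>\<rangle>\<close> over \<open>A\<close>, by induction on codes: the terms that are bounded by an element of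
  \<open>a\<close> form a well-order \<open>W\<close>. The terms \<open>\<mu>\<^sub>x\<close> below \<open>s\<close> lie in \<open>W\<close>, and since \<open>T\<close> is normal,
  \<open>\<xi>\<langle>b, \<tau>\<rangle> < s\<close> implies \<open>b \<subseteq> W\<close>. So a descending sequence from \<open>s\<close> either meets \<open>W\<close> or yields one
  in \<open>D\<^sup>T(W)\<close>. As the terms below \<open>\<mu>\<^sub>x\<close> only contain indices below \<open>x\<close>, bar
  induction along \<open>X\<close> shows that all \<open>\<mu>\<^sub>x\<close>, and hence all terms, are accessible.
\<close>

section \<open>Completeness\<close>

text \<open>The model may be nonstandard, so that induction, minimal elements, finite sets and
  recursion of HOL are of no use inside it. Each such argument needs a formula, which accounts for
  the many goals \<open>D0\<close> (bounded) and \<open>A0\<close> (arithmetical) and for the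
  internal theory of codes, cardinalities and enumerations. Accessibility quantifies over all
  sequences of the model and escapes \<open>A0\<close>; for it even induction on codes is an
  instance of bar induction, along the order of the numbers.

  Linearity and domination need each other: domination between two \<open>\<xi>\<close>-terms rests
  on normality of \<open>T\<close>, applied to linearly ordered arguments, while transitivity
  through a term \<open>\<mu>\<^sub>k\<close> rests on domination. Arithmetical comprehension makes
  \<open>W\<close> a set of the model, so that the hypothesis on \<open>T\<close> applies to it.

  Dilators and term systems are related as follows: a pair \<open>\<langle>a, s\<rangle>\<close>
  with \<open>a \<subseteq> X\<close>, \<open>n = |a|\<close> and \<open>s\<close> in
  \<open>\<partial>T\<^sub>n\<close> is sent to the term that arises from \<open>s\<close> when each
  index is replaced by the element of \<open>a\<close> in that position. This embeds the order of
  the dilator at \<open>X\<close> into \<open>\<partial>T(X)\<close>.\<close>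

instance tm :: countable
  by countable_datatype

instance fm :: countable
  by countable_datatype

section \<open>Simultaneous substitution\<close>

abbreviation upN :: "(nat \<Rightarrow> tm) \<Rightarrow> nat \<Rightarrow> tm" where
  "upN s \<equiv> case_nat (Var 0) (\<lambda>n. lift_tm (s n))"

abbreviation upS :: "(nat \<Rightarrow> nat) \<Rightarrow> nat \<Rightarrow> nat" where
  "upS r \<equiv> case_nat 0 (\<lambda>n. Suc (r n))"

lemma subst_tm_subst_tm: "subst_tm s' (subst_tm s t) = subst_tm (\<lambda>n. subst_tm s' (s n)) t"
  by (induction t) auto

lemma subst_tm_Var [simp]: "subst_tm Var t = t"
  by (induction t) auto

lemma lift_tm_simps [simp]:
  "lift_tm (Var n) = Var (Suc n)" "lift_tm Zero = Zero" "lift_tm One = One"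
  "lift_tm (Add t u) = Add (lift_tm t) (lift_tm u)"
  "lift_tm (Mul t u) = Mul (lift_tm t) (lift_tm u)"
  by (simp_all add: lift_tm_def)

lemma subst_tm_lift_tm: "subst_tm s (lift_tm t) = subst_tm (\<lambda>n. s (Suc n)) t"
  by (simp add: lift_tm_def subst_tm_subst_tm)

lemma lift_tm_subst_tm: "lift_tm (subst_tm s t) = subst_tm (\<lambda>n. lift_tm (s n)) t"
  by (simp add: lift_tm_def subst_tm_subst_tm)

lemma subst_subst: "subst s' r' (subst s r p) = subst (\<lambda>n. subst_tm s' (s n)) (\<lambda>n. r' (r n)) p"
proof (induction p arbitrary: s r s' r')
  case (AllN p)
  have "(\<lambda>n. subst_tm (upN s') (upN s n)) = upN (\<lambda>n. subst_tm s' (s n))"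
    by (rule ext) (simp split: nat.split add: subst_tm_lift_tm lift_tm_subst_tm)
  then show ?case by (simp add: AllN)
next
  case (AllS p)
  have "(\<lambda>n. upS r' (upS r n)) = upS (\<lambda>n. r' (r n))"
    by (rule ext) (simp split: nat.split)
  then show ?case by (simp add: AllS)
qed (auto simp: subst_tm_subst_tm)

lemma upN_Var [simp]: "case_nat (Var 0) (\<lambda>n. Var (Suc n)) = Var"
  by (rule ext) (simp split: nat.split)

lemma upS_id [simp]: "upS (\<lambda>n. n) = (\<lambda>n. n)"
  by (rule ext) (simp split: nat.split)

lemma subst_Var [simp]: "subst Var (\<lambda>n. n) p = p"
  by (induction p) auto

section \<open>Bounds on free variables\<close>

text \<open>Expressed through the effect of substitutions instead of a recursive set of free
  variables, because freshness is only ever used to replace one substitution by another. One bound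
  serves both sorts of variables.\<close>

definition fv_below :: "nat \<Rightarrow> fm \<Rightarrow> bool" where
  "fv_below k p \<longleftrightarrow>
    (\<forall>s s' r r'. (\<forall>n<k. s n = s' n \<and> r n = r' n) \<longrightarrow> subst s r p = subst s' r' p)"

lemma fv_belowD:
  "fv_below k p \<Longrightarrow> (\<And>n. n < k \<Longrightarrow> s n = s' n) \<Longrightarrow> (\<And>n. n < k \<Longrightarrow> r n = r' n) \<Longrightarrow>
    subst s r p = subst s' r' p"
  unfolding fv_below_def by blast

lemma fv_below_mono: "fv_below k p \<Longrightarrow> k \<le> l \<Longrightarrow> fv_below l p"
  unfolding fv_below_def by (meson order_less_le_trans)

definition tv_below :: "nat \<Rightarrow> tm \<Rightarrow> bool" where
  "tv_below k t \<longleftrightarrow> (\<forall>s s'. (\<forall>n<k. s n = s' n) \<longrightarrow> subst_tm s t = subst_tm s' t)"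

lemma tv_below_mono: "tv_below k t \<Longrightarrow> k \<le> l \<Longrightarrow> tv_below l t"
  unfolding tv_below_def by (meson order_less_le_trans)

lemma tv_below_ex: "\<exists>k. tv_below k t"
proof (induction t)
  case (Var n)
  have "tv_below (Suc n) (Var n)" by (simp add: tv_below_def)
  then show ?case by blast
next
  case (Add t u)
  then obtain k l where kl: "tv_below k t" "tv_below l u" by blast
  have "tv_below (max k l) t" "tv_below (max k l) u"
    using kl tv_below_mono max.cobounded1 max.cobounded2 by blast+
  then have "tv_below (max k l) (Add t u)"
    unfolding tv_below_def subst_tm.simps by blast
  then show ?case by blast
next
  case (Mul t u)
  then obtain k l where kl: "tv_below k t" "tv_below l u" by blast
  have "tv_below (max k l) t" "tv_below (max k l) u"
    using kl tv_below_mono max.cobounded1 max.cobounded2 by blast+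
  then have "tv_below (max k l) (Mul t u)"
    unfolding tv_below_def subst_tm.simps by blast
  then show ?case by blast
qed (auto simp: tv_below_def)

lemma tv_below_ex2: "\<exists>k. tv_below k t \<and> tv_below k u"
  using tv_below_ex tv_below_mono max.cobounded1 max.cobounded2 by meson

lemma fv_below_ex: "\<exists>k. fv_below k p"
proof (induction p)
  case (Eq t u)
  obtain k where "tv_below k t" "tv_below k u" using tv_below_ex2 by blast
  then have "fv_below k (Eq t u)"
    unfolding fv_below_def tv_below_def subst.simps by blast
  then show ?case by blast
next
  case (Less t u)
  obtain k where "tv_below k t" "tv_below k u" using tv_below_ex2 by blast
  then have "fv_below k (Less t u)"
    unfolding fv_below_def tv_below_def subst.simps by blast
  then show ?case by blast
next
  case (Mem t X)
  obtain k where "tv_below k t" using tv_below_ex by blast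
  then have "tv_below (max k (Suc X)) t" using tv_below_mono by (metis max.cobounded1)
  then have "fv_below (max k (Suc X)) (Mem t X)"
    unfolding fv_below_def tv_below_def subst.simps
    by (metis lessI max.strict_coboundedI2)
  then show ?case by blast
next
  case (Imp p q)
  then obtain k l where kl: "fv_below k p" "fv_below l q" by blast
  have "fv_below (max k l) p" "fv_below (max k l) q"
    using kl fv_below_mono max.cobounded1 max.cobounded2 by blast+
  then have "fv_below (max k l) (Imp p q)"
    unfolding fv_below_def by simp
  then show ?case by blast
next
  case (AllN p)
  then obtain k where k: "fv_below k p" by blast
  have "fv_below k (AllN p)"
    unfolding fv_below_def by (auto intro!: fv_belowD[OF k] split: nat.split)
  then show ?case by blast
next
  case (AllS p)
  then obtain k where k: "fv_below k p" by blast
  have "fv_below k (AllS p)"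
    unfolding fv_below_def by (auto intro!: fv_belowD[OF k] split: nat.split)
  then show ?case by blast
qed (auto simp: fv_below_def)

lemma fv_below_list_ex: "\<exists>k. \<forall>p\<in>set G. fv_below k p"
proof (induction G)
  case (Cons p G)
  then obtain k l where kl: "\<forall>p\<in>set G. fv_below k p" "fv_below l p"
    using fv_below_ex by blast
  then have "\<forall>q\<in>set (p # G). fv_below (max k l) q"
    using fv_below_mono max.cobounded1 max.cobounded2 by (metis set_ConsD)
  then show ?case by blast
qed simp

section \<open>Weakening, substitution and fresh variables in derivations\<close>

lemma proves_weaken: "Ax; G \<turnstile> p \<Longrightarrow> set G \<subseteq> set G' \<Longrightarrow> Ax; G' \<turnstile> p"
proof (induction G p arbitrary: G' rule: proves.induct)
  case (ImpI p G q)
  have "set (p # G) \<subseteq> set (p # G')" using ImpI.prems by auto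
  then show ?case using ImpI.IH proves.ImpI by blast
next
  case (Raa p G)
  have "set (Neg p # G) \<subseteq> set (Neg p # G')" using Raa.prems by auto
  then show ?case using Raa.IH proves.Raa by blast
next
  case (AllNI G p)
  then show ?case by (simp add: image_mono proves.AllNI)
next
  case (AllSI G p)
  then show ?case by (simp add: image_mono proves.AllSI)
next
  case (EqSubst G t u p)
  then show ?case using proves.EqSubst by blast
qed (auto intro: proves.intros)

text \<open>Axioms count as universally closed, and the eigenvariable conditions ignore them.
  Closure under substitution is what allows variables to be renamed in a derivation that uses
  axioms.\<close>

locale subst_closed =
  fixes Ax :: "fm set"
  assumes subst_Ax: "p \<in> Ax \<Longrightarrow> subst s r p \<in> Ax"
begin

lemma proves_subst: "Ax; G \<turnstile> p \<Longrightarrow> Ax; map (subst s r) G \<turnstile> subst s r p"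
proof (induction G p arbitrary: s r rule: proves.induct)
  case (Ax p G)
  then show ?case by (simp add: subst_Ax proves.Ax)
next
  case (ImpI p G q)
  then show ?case by (simp add: proves.ImpI)
next
  case (ImpE G p q)
  then show ?case by (metis proves.ImpE subst.simps(5))
next
  case (Raa p G)
  then show ?case using proves.Raa by (metis list.simps(9) subst.simps(1) subst.simps(5))
next
  case (AllNI G p)
  have "map (subst (upN s) r) (map lift G) = map lift (map (subst s r) G)"
    by (simp add: subst_subst lift_tm_def id_def)
  then show ?case using AllNI.IH[of "upN s" r] by (metis proves.AllNI subst.simps(6))
next
  case (AllNE G p t)
  have "inst (subst_tm s t) (subst (upN s) r p) = subst s r (inst t p)"
  proof -
    have "(\<lambda>n. subst_tm (case_nat (subst_tm s t) Var) (upN s n)) = (\<lambda>n. subst_tm s (case_nat t Var n))"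
      by (rule ext) (simp split: nat.split add: subst_tm_lift_tm)
    then show ?thesis by (simp add: subst_subst id_def)
  qed
  then show ?case using AllNE.IH[of s r] proves.AllNE by (metis subst.simps(6))
next
  case (AllSI G p)
  have "map (subst s (upS r)) (map liftS G) = map liftS (map (subst s r) G)"
    by (simp add: subst_subst)
  then show ?case using AllSI.IH[of s "upS r"] by (metis proves.AllSI subst.simps(7))
next
  case (AllSE G p X)
  have "instS (r X) (subst s (upS r) p) = subst s r (instS X p)"
  proof -
    have "(\<lambda>n. case_nat (r X) id (upS r n)) = (\<lambda>n. r (case_nat X id n))"
      by (rule ext) (simp split: nat.split)
    then show ?thesis by (simp add: subst_subst)
  qed
  then show ?case using AllSE.IH[of s r] proves.AllSE by (metis subst.simps(7))
next
  case (EqSubst G t u p)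
  have eq: "subst s r (inst t p) = inst (subst_tm s t) (subst (upN s) r p)" for t
  proof -
    have "(\<lambda>n. subst_tm (case_nat (subst_tm s t) Var) (upN s n)) = (\<lambda>n. subst_tm s (case_nat t Var n))"
      by (rule ext) (simp split: nat.split add: subst_tm_lift_tm)
    then show ?thesis by (simp add: subst_subst id_def)
  qed
  show ?case using EqSubst.IH(1)[of s r] EqSubst.IH(2)[of s r]
    unfolding eq by (auto intro: proves.EqSubst)
qed (auto intro: proves.intros)

text \<open>The substitution \<open>?s\<close> turns the fresh variable \<open>k\<close> into the
  variable to be bound and shifts all others, so the premise becomes literally the premise of the de
  Bruijn introduction rule.\<close>

lemma proves_AllN_fresh:
  assumes G: "\<forall>q\<in>set G. fv_below k q" and p: "fv_below k p" and "Ax; G \<turnstile> inst (Var k) p"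
  shows "Ax; G \<turnstile> AllN p"
proof -
  let ?s = "\<lambda>n. if n = k then Var 0 else Var (Suc n)"
  have "subst ?s id (inst (Var k) p) = subst Var (\<lambda>n. n) p"
    by (simp only: subst_subst id_apply) (rule fv_belowD[OF p], auto split: nat.split)
  moreover have "map (subst ?s id) G = map lift G"
    using G by (auto intro!: fv_belowD)
  ultimately show ?thesis
    using proves_subst[OF assms(3), of ?s id] subst_Var proves.AllNI by metis
qed

lemma proves_AllS_fresh:
  assumes G: "\<forall>q\<in>set G. fv_below k q" and p: "fv_below k p" and "Ax; G \<turnstile> instS k p"
  shows "Ax; G \<turnstile> AllS p"
proof -
  let ?r = "\<lambda>n. if n = k then 0 else Suc n"
  have "subst Var ?r (instS k p) = subst Var (\<lambda>n. n) p"
    by (simp only: subst_subst subst_tm_Var) (rule fv_belowD[OF p], auto split: nat.split)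
  moreover have "map (subst Var ?r) G = map liftS G"
    using G by (auto intro!: fv_belowD)
  ultimately show ?thesis
    using proves_subst[OF assms(3), of Var ?r] subst_Var proves.AllSI by metis
qed

section \<open>Henkin extension of a consistent formula\<close>

text \<open>Witnesses are given to negated universal formulas, which are the existential statements
  of this language. Variables that do not occur so far play the role of Henkin constants.\<close>

fun counterexample :: "nat \<Rightarrow> fm \<Rightarrow> fm list" where
  "counterexample k (Imp (AllN p) Fls) = [Neg (inst (Var k) p)]"
| "counterexample k (Imp (AllS p) Fls) = [Neg (instS k p)]"
| "counterexample k p = []"

lemma counterexample_cases:
  "(\<exists>p. q = Neg (AllN p)) \<or> (\<exists>p. q = Neg (AllS p)) \<or> counterexample k q = []"
  by (cases "(k, q)" rule: counterexample.cases) auto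

text \<open>The chosen \<open>k\<close> bounds the variables of the list, of \<open>q\<close> and of
  the body under its quantifier, as the lemmas on fresh variables require.\<close>

definition henkin_witness :: "fm list \<Rightarrow> fm \<Rightarrow> fm list" where
  "henkin_witness G q =
    counterexample (SOME k. \<forall>p\<in>set (q # G). fv_below k p \<and>
      (\<forall>p'. (q = Neg (AllN p') \<or> q = Neg (AllS p')) \<longrightarrow> fv_below k p')) q"

text \<open>Each stage is a finite list, so a fresh variable is always left.\<close>

definition henkin_step :: "fm list \<Rightarrow> fm \<Rightarrow> fm list" where
  "henkin_step G q = (if Ax; q # G \<turnstile> Fls then G else henkin_witness G q @ q # G)"

fun henkin_chain :: "fm \<Rightarrow> nat \<Rightarrow> fm list" where
  "henkin_chain p 0 = [p]"
| "henkin_chain p (Suc n) = henkin_step (henkin_chain p n) (from_nat n)"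

lemma henkin_witness_consistent:
  assumes "\<not> Ax; q # G \<turnstile> Fls"
  shows "\<not> Ax; henkin_witness G q @ q # G \<turnstile> Fls"
proof -
  define k where "k = (SOME k. \<forall>p\<in>set (q # G). fv_below k p \<and>
    (\<forall>p'. (q = Neg (AllN p') \<or> q = Neg (AllS p')) \<longrightarrow> fv_below k p'))"
  \<comment> \<open>At most one body can occur, since \<open>q\<close> has at most one of the two
    shapes; it is added to the list for which a common bound is taken.\<close>
  obtain p0 where p0: "\<forall>p'. (q = Neg (AllN p') \<or> q = Neg (AllS p')) \<longrightarrow> p' = p0"
    by (cases "\<exists>p'. q = Neg (AllN p') \<or> q = Neg (AllS p')") auto
  obtain k0 where "\<forall>p\<in>set (p0 # q # G). fv_below k0 p" using fv_below_list_ex by blast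
  then have "\<exists>k. \<forall>p\<in>set (q # G). fv_below k p \<and>
    (\<forall>p'. (q = Neg (AllN p') \<or> q = Neg (AllS p')) \<longrightarrow> fv_below k p')"
    using p0 by (metis list.set_intros(1) list.set_intros(2))
  then have k: "\<forall>p\<in>set (q # G). fv_below k p \<and>
    (\<forall>p'. (q = Neg (AllN p') \<or> q = Neg (AllS p')) \<longrightarrow> fv_below k p')"
    unfolding k_def by (rule someI_ex)
  consider (N) p where "q = Neg (AllN p)" | (S) p where "q = Neg (AllS p)"
    | (O) "henkin_witness G q = []"
    using counterexample_cases[of q k] unfolding henkin_witness_def k_def by blast
  then show ?thesis
  proof cases
    case N
    then have w: "henkin_witness G q = [Neg (inst (Var k) p)]"
      unfolding henkin_witness_def k_def by simp
    show ?thesis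
    proof
      assume "Ax; henkin_witness G q @ q # G \<turnstile> Fls"
      then have "Ax; q # G \<turnstile> inst (Var k) p" unfolding w by (auto intro: Raa)
      then have "Ax; q # G \<turnstile> AllN p" using k N by (intro proves_AllN_fresh[of _ k]) auto
      then have "Ax; q # G \<turnstile> Fls" using N by (meson Assm ImpE list.set_intros(1))
      then show False using assms by blast
    qed
  next
    case S
    then have w: "henkin_witness G q = [Neg (instS k p)]"
      unfolding henkin_witness_def k_def by simp
    show ?thesis
    proof
      assume "Ax; henkin_witness G q @ q # G \<turnstile> Fls"
      then have "Ax; q # G \<turnstile> instS k p" unfolding w by (auto intro: Raa)
      then have "Ax; q # G \<turnstile> AllS p" using k S by (intro proves_AllS_fresh[of _ k]) auto
      then have "Ax; q # G \<turnstile> Fls" using S by (meson Assm ImpE list.set_intros(1))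
      then show False using assms by blast
    qed
  next
    case O
    then show ?thesis using assms by simp
  qed
qed

lemma henkin_chain_mono: "m \<le> n \<Longrightarrow> set (henkin_chain p m) \<subseteq> set (henkin_chain p n)"
proof (induction n)
  case (Suc n)
  have "set (henkin_chain p n) \<subseteq> set (henkin_chain p (Suc n))"
    by (auto simp: henkin_step_def)
  then show ?case using Suc by (metis le_SucE subset_trans order_refl)
qed simp

lemma henkin_chain_consistent:
  assumes "\<not> Ax; [p] \<turnstile> Fls"
  shows "\<not> Ax; henkin_chain p n \<turnstile> Fls"
  by (induction n) (use assms henkin_witness_consistent in \<open>auto simp: henkin_step_def\<close>)

definition henkin_set :: "fm \<Rightarrow> fm set" where
  "henkin_set p = {q. \<exists>n. Ax; henkin_chain p n \<turnstile> q}"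

end

text \<open>What the truth lemma consumes: the theory commutes with implication and decides both
  kinds of quantifiers by their instances.\<close>

locale henkin_theory =
  fixes H :: "fm set"
  assumes ImpE: "Imp p q \<in> H \<Longrightarrow> p \<in> H \<Longrightarrow> q \<in> H"
    and ImpI: "(p \<in> H \<Longrightarrow> q \<in> H) \<Longrightarrow> Imp p q \<in> H"
    and Fls: "Fls \<notin> H"
    and AllN: "AllN p \<in> H \<longleftrightarrow> (\<forall>t. inst t p \<in> H)"
    and AllS: "AllS p \<in> H \<longleftrightarrow> (\<forall>X. instS X p \<in> H)"
    and EqRefl: "Eq t t \<in> H"
    and EqSubst: "Eq t u \<in> H \<Longrightarrow> inst t p \<in> H \<Longrightarrow> inst u p \<in> H"

lemma (in subst_closed) henkin_theory:
  assumes cons: "\<not> Ax; [p] \<turnstile> Fls"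
  shows "henkin_theory (henkin_set p)" "Ax \<subseteq> henkin_set p" "p \<in> henkin_set p"
proof -
  let ?H = "henkin_set p"
  have mono: "Ax; henkin_chain p n \<turnstile> q" if "Ax; henkin_chain p m \<turnstile> q" "m \<le> n" for m n q
    using proves_weaken[OF that(1)] henkin_chain_mono[OF that(2)] by blast
  have two: "\<exists>n. Ax; henkin_chain p n \<turnstile> q \<and> Ax; henkin_chain p n \<turnstile> q'"
    if "q \<in> ?H" "q' \<in> ?H" for q q'
    using that mono unfolding henkin_set_def mem_Collect_eq by (meson nat_le_linear)
  have ImpE: "q' \<in> ?H" if "Imp q q' \<in> ?H" "q \<in> ?H" for q q'
    using two[OF that] unfolding henkin_set_def by (auto intro: proves.ImpE)
  have Fls: "Fls \<notin> ?H"
    using henkin_chain_consistent[OF cons] unfolding henkin_set_def by blast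
  \<comment> \<open>The formula \<open>q\<close> is treated at the stage given by its own code: it
    is refuted there, or it enters together with its witness.\<close>
  have decide: "Neg q \<in> ?H \<or> set (henkin_witness (henkin_chain p (to_nat q)) q) \<union> {q} \<subseteq> ?H" for q
  proof (cases "Ax; q # henkin_chain p (to_nat q) \<turnstile> Fls")
    case True
    then show ?thesis unfolding henkin_set_def by (auto intro: proves.ImpI)
  next
    case False
    then have "set (henkin_witness (henkin_chain p (to_nat q)) q) \<union> {q}
        \<subseteq> set (henkin_chain p (Suc (to_nat q)))"
      by (auto simp: henkin_step_def)
    then show ?thesis unfolding henkin_set_def using proves.Assm by blast
  qed
  have AllN: "AllN q \<in> ?H" if q: "\<forall>t. inst t q \<in> ?H" for q
  proof (rule ccontr)
    assume "AllN q \<notin> ?H"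
    \<comment> \<open>If \<open>AllN q\<close> is missing, then so is its double negation; hence its
      negation entered with a counterexample, which clashes with the instances of
      \<open>q\<close>.\<close>
    moreover have "AllN q \<in> ?H" if "Neg (Neg (AllN q)) \<in> ?H"
    proof -
      from that obtain n where "Ax; henkin_chain p n \<turnstile> Neg (Neg (AllN q))"
        unfolding henkin_set_def by blast
      then have "Ax; Neg (AllN q) # henkin_chain p n \<turnstile> Neg (Neg (AllN q))"
        by (rule proves_weaken) auto
      then have "Ax; Neg (AllN q) # henkin_chain p n \<turnstile> Fls"
        by (meson Assm proves.ImpE list.set_intros(1))
      then show ?thesis unfolding henkin_set_def using Raa by blast
    qed
    ultimately have "set (henkin_witness (henkin_chain p (to_nat (Neg (AllN q)))) (Neg (AllN q))) \<subseteq> ?H"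
      using decide[of "Neg (AllN q)"] by blast
    then obtain k where "Neg (inst (Var k) q) \<in> ?H"
      unfolding henkin_witness_def by auto
    then show False using q ImpE Fls by blast
  qed
  have AllS: "AllS q \<in> ?H" if q: "\<forall>t. instS t q \<in> ?H" for q
  proof (rule ccontr)
    assume "AllS q \<notin> ?H"
    moreover have "AllS q \<in> ?H" if "Neg (Neg (AllS q)) \<in> ?H"
    proof -
      from that obtain n where "Ax; henkin_chain p n \<turnstile> Neg (Neg (AllS q))"
        unfolding henkin_set_def by blast
      then have "Ax; Neg (AllS q) # henkin_chain p n \<turnstile> Neg (Neg (AllS q))"
        by (rule proves_weaken) auto
      then have "Ax; Neg (AllS q) # henkin_chain p n \<turnstile> Fls"
        by (meson Assm proves.ImpE list.set_intros(1))
      then show ?thesis unfolding henkin_set_def using Raa by blast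
    qed
    ultimately have "set (henkin_witness (henkin_chain p (to_nat (Neg (AllS q)))) (Neg (AllS q))) \<subseteq> ?H"
      using decide[of "Neg (AllS q)"] by blast
    then obtain k where "Neg (instS k q) \<in> ?H"
      unfolding henkin_witness_def by auto
    then show False using q ImpE Fls by blast
  qed
  show "henkin_theory ?H"
  proof
    show "Imp q q' \<in> ?H" if "q \<in> ?H \<Longrightarrow> q' \<in> ?H" for q q'
    proof (cases "q \<in> ?H")
      case True
      then show ?thesis using that unfolding henkin_set_def mem_Collect_eq
        by (meson proves.ImpI proves_weaken set_subset_Cons)
    next
      case False
      then obtain n where "Ax; henkin_chain p n \<turnstile> Neg q"
        using decide[of q] unfolding henkin_set_def by auto
      then have "Ax; Neg q' # q # henkin_chain p n \<turnstile> Neg q"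
        by (rule proves_weaken) auto
      then have "Ax; Neg q' # q # henkin_chain p n \<turnstile> Fls"
        by (rule proves.ImpE) (simp add: Assm)
      then show ?thesis unfolding henkin_set_def using Raa proves.ImpI by blast
    qed
    show "AllN q \<in> ?H \<longleftrightarrow> (\<forall>t. inst t q \<in> ?H)" for q
    proof
      show "\<forall>t. inst t q \<in> ?H" if "AllN q \<in> ?H"
        using that proves.AllNE unfolding henkin_set_def by blast
    qed (rule AllN)
    show "AllS q \<in> ?H \<longleftrightarrow> (\<forall>t. instS t q \<in> ?H)" for q
    proof
      show "\<forall>t. instS t q \<in> ?H" if "AllS q \<in> ?H"
        using that proves.AllSE unfolding henkin_set_def by blast
    qed (rule AllS)
    show "Eq t t \<in> ?H" for t unfolding henkin_set_def by (auto intro: proves.EqRefl)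
    show "inst u q \<in> ?H" if "Eq t u \<in> ?H" "inst t q \<in> ?H" for t u q
      using two[OF that] proves.EqSubst unfolding henkin_set_def by blast
  qed (use ImpE Fls in auto)
  show "Ax \<subseteq> ?H" unfolding henkin_set_def using proves.Ax by blast
  have "Ax; henkin_chain p 0 \<turnstile> p" by (simp add: Assm)
  then show "p \<in> ?H" unfolding henkin_set_def by blast
qed

section \<open>Structures and satisfaction\<close>

text \<open>Set variables range over a family \<open>\<S>\<close> of subsets rather than over all of
  them. This is the semantics for which the calculus is complete.\<close>

locale struct =
  fixes zero :: 'a ("\<zero>") and one :: 'a ("\<one>")
    and plus :: "'a \<Rightarrow> 'a \<Rightarrow> 'a" (infixl "\<oplus>" 65)
    and times :: "'a \<Rightarrow> 'a \<Rightarrow> 'a" (infixl "\<otimes>" 70)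
    and lt :: "'a \<Rightarrow> 'a \<Rightarrow> bool" (infix "\<lhd>" 50)
    and \<S> :: "'a set set"
begin

fun tval :: "(nat \<Rightarrow> 'a) \<Rightarrow> tm \<Rightarrow> 'a" where
  "tval v (Var n) = v n"
| "tval v Zero = \<zero>"
| "tval v One = \<one>"
| "tval v (Add t u) = tval v t \<oplus> tval v u"
| "tval v (Mul t u) = tval v t \<otimes> tval v u"

fun sat :: "(nat \<Rightarrow> 'a) \<Rightarrow> (nat \<Rightarrow> 'a set) \<Rightarrow> fm \<Rightarrow> bool" where
  "sat v V Fls \<longleftrightarrow> False"
| "sat v V (Eq t u) \<longleftrightarrow> tval v t = tval v u"
| "sat v V (Less t u) \<longleftrightarrow> tval v t \<lhd> tval v u"
| "sat v V (Mem t X) \<longleftrightarrow> tval v t \<in> V X"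
| "sat v V (Imp p q) \<longleftrightarrow> (sat v V p \<longrightarrow> sat v V q)"
| "sat v V (AllN p) \<longleftrightarrow> (\<forall>x. sat (case_nat x v) V p)"
| "sat v V (AllS p) \<longleftrightarrow> (\<forall>A\<in>\<S>. sat v (case_nat A V) p)"

lemma tval_subst: "tval v (subst_tm s t) = tval (\<lambda>n. tval v (s n)) t"
  by (induction t) auto

lemma sat_subst: "sat v V (subst s r p) \<longleftrightarrow> sat (\<lambda>n. tval v (s n)) (\<lambda>X. V (r X)) p"
proof (induction p arbitrary: v V s r)
  case (AllN p)
  have "(\<lambda>n. tval (case_nat x v) (upN s n)) = case_nat x (\<lambda>n. tval v (s n))" for x
    by (rule ext) (simp split: nat.split add: lift_tm_def tval_subst)
  then show ?case by (simp add: AllN)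
next
  case (AllS p)
  have "(\<lambda>n. case_nat A V (upS r n)) = case_nat A (\<lambda>n. V (r n))" for A
    by (rule ext) (simp split: nat.split)
  then show ?case by (simp add: AllS)
qed (auto simp: tval_subst)

end

section \<open>Equality in a Henkin theory, the term model and completeness\<close>

lemma (in henkin_theory) Eq_symp: "Eq t u \<in> H \<Longrightarrow> Eq u t \<in> H"
  using EqSubst[of t u "Eq (Var 0) (lift_tm t)"] EqRefl[of t] by (simp add: subst_tm_lift_tm)

lemma (in henkin_theory) Eq_transp: "Eq t u \<in> H \<Longrightarrow> Eq u w \<in> H \<Longrightarrow> Eq t w \<in> H"
  using EqSubst[of u w "Eq (lift_tm t) (Var 0)"] by (simp add: subst_tm_lift_tm)

lemma (in henkin_theory) Eq_inst:
  assumes "Eq t u \<in> H" shows "inst t p \<in> H \<longleftrightarrow> inst u p \<in> H"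
  using assms EqSubst Eq_symp by blast

lemma (in henkin_theory) Eq_cong_tm:
  assumes "Eq t u \<in> H"
  shows "Eq (subst_tm (case_nat t Var) w) (subst_tm (case_nat u Var) w) \<in> H"
proof -
  \<comment> \<open>Only the right-hand side of \<open>?p\<close> varies with the instance. On the
    left \<open>t\<close> is already inserted, so that the instance at \<open>t\<close> is
    reflexivity.\<close>
  let ?p = "Eq (subst_tm (case_nat (lift_tm t) (\<lambda>n. Var (Suc n))) w) w"
  have eq: "inst z ?p = Eq (subst_tm (case_nat t Var) w) (subst_tm (case_nat z Var) w)" for z
  proof -
    have "(\<lambda>n. subst_tm (case_nat z Var) (case_nat (lift_tm t) (\<lambda>n. Var (Suc n)) n)) = case_nat t Var"
      by (rule ext) (simp split: nat.split add: subst_tm_lift_tm)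
    then show ?thesis by (simp add: subst_tm_subst_tm)
  qed
  show ?thesis using EqSubst[OF assms, of ?p] EqRefl by (simp only: eq)
qed

lemma (in henkin_theory) Neg_iff: "Neg p \<in> H \<longleftrightarrow> p \<notin> H"
  using ImpE ImpI Fls by blast

text \<open>The term model is infinite and countable, so that its elements can be taken to be
  the natural numbers.\<close>

lemma (in henkin_theory) term_model:
  assumes ax1: "AllN (Neg (Eq (Add (Var 0) One) Zero)) \<in> H"
    and ax2: "AllN (AllN (Imp (Eq (Add (Var 1) One) (Add (Var 0) One)) (Eq (Var 1) (Var 0)))) \<in> H"
  obtains zero :: nat and one plus times lt \<S> v V
  where "range V \<subseteq> \<S>" "\<And>p. struct.sat zero one plus times lt \<S> v V p \<longleftrightarrow> p \<in> H"
    "\<And>(v' :: nat \<Rightarrow> nat) (V' :: nat \<Rightarrow> nat set) p. range V' \<subseteq> \<S> \<Longrightarrow>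
      \<exists>s r. struct.sat zero one plus times lt \<S> v' V' p \<longleftrightarrow> subst s r p \<in> H"
proof -
  define cls where "cls t = {u. Eq t u \<in> H}" for t
  have cls_eq: "cls t = cls u \<longleftrightarrow> Eq t u \<in> H" for t u
    unfolding cls_def using Eq_symp Eq_transp EqRefl by blast
  have suc0: "Eq (Add t One) Zero \<notin> H" for t
    using ax1 AllN Neg_iff by (force simp: Neg_iff)
  have inj: "Eq t u \<in> H" if "Eq (Add t One) (Add u One) \<in> H" for t u
  proof -
    have "inst t (AllN (Imp (Eq (Add (Var 1) One) (Add (Var 0) One)) (Eq (Var 1) (Var 0)))) \<in> H"
      using ax2 AllN[THEN iffD1] by blast
    then have "inst u (subst (upN (case_nat t Var)) id
       (Imp (Eq (Add (Var 1) One) (Add (Var 0) One)) (Eq (Var 1) (Var 0)))) \<in> H"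
      unfolding subst.simps(6) by (rule AllN[THEN iffD1, THEN spec])
    then have "Imp (Eq (Add t One) (Add u One)) (Eq t u) \<in> H"
      by (simp add: subst_tm_lift_tm)
    then show ?thesis using that ImpE by blast
  qed
  \<comment> \<open>By the two successor axioms the numerals lie in pairwise distinct classes, hence
    there are infinitely many classes.\<close>
  define num where "num = rec_nat Zero (\<lambda>_ t. Add t One)"
  have [simp]: "num 0 = Zero" "num (Suc n) = Add (num n) One" for n by (simp_all add: num_def)
  have num: "Eq (num m) (num n) \<in> H \<longrightarrow> m = n" for m n
  proof (induction m arbitrary: n)
    case 0
    then show ?case using suc0 Eq_symp by (cases n) auto
  next
    case (Suc m)
    then show ?case using suc0 inj by (cases n) auto
  qed
  have "inj (cls \<circ> num)" using num cls_eq by (auto simp: inj_def)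
  then have "infinite (range cls)"
    by (metis finite_subset image_comp infinite_UNIV_char_0 range_inj_infinite range_subsetD image_subsetI subset_UNIV image_mono)
  moreover have "countable (range cls)" by simp
  ultimately obtain e :: "nat \<Rightarrow> tm set" where e: "bij_betw e UNIV (range cls)"
    using bij_betw_from_nat_into by blast
  define h where "h t = the_inv e (cls t)" for t
  have inje: "inj e" using e bij_betw_def by blast
  have eh: "e (h t) = cls t" for t
    unfolding h_def using e by (metis bij_betw_def f_the_inv_into_f rangeI)
  have h_eq: "h t = h u \<longleftrightarrow> Eq t u \<in> H" for t u
    using eh cls_eq by (metis h_def)
  have "\<exists>t. n = h t" for n
    using e eh inje by (metis bij_betw_def injD rangeE rangeI)
  define r where "r n = (SOME t. n = h t)" for n
  have hr: "h (r n) = n" for n unfolding r_def using \<open>\<exists>t. n = h t\<close> by (metis (mono_tags) someI_ex)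
  have rh: "Eq (r (h t)) t \<in> H" for t using hr h_eq by blast
  define plus where "plus m n = h (Add (r m) (r n))" for m n
  define times where "times m n = h (Mul (r m) (r n))" for m n
  define lt where "lt m n \<longleftrightarrow> Less (r m) (r n) \<in> H" for m n
  define U where "U X = {n. Mem (r n) X \<in> H}" for X
  have plus: "plus (h t) (h u) = h (Add t u)" for t u
  proof -
    have "Eq (Add (r (h t)) (r (h u))) (Add t (r (h u))) \<in> H"
      using Eq_cong_tm[OF rh[of t], of "Add (Var 0) (lift_tm (r (h u)))"]
      by (simp add: subst_tm_lift_tm)
    moreover have "Eq (Add t (r (h u))) (Add t u) \<in> H"
      using Eq_cong_tm[OF rh[of u], of "Add (lift_tm t) (Var 0)"] by (simp add: subst_tm_lift_tm)
    ultimately show ?thesis unfolding plus_def h_eq by (rule Eq_transp)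
  qed
  have times: "times (h t) (h u) = h (Mul t u)" for t u
  proof -
    have "Eq (Mul (r (h t)) (r (h u))) (Mul t (r (h u))) \<in> H"
      using Eq_cong_tm[OF rh[of t], of "Mul (Var 0) (lift_tm (r (h u)))"]
      by (simp add: subst_tm_lift_tm)
    moreover have "Eq (Mul t (r (h u))) (Mul t u) \<in> H"
      using Eq_cong_tm[OF rh[of u], of "Mul (lift_tm t) (Var 0)"] by (simp add: subst_tm_lift_tm)
    ultimately show ?thesis unfolding times_def h_eq by (rule Eq_transp)
  qed
  have lt: "lt (h t) (h u) \<longleftrightarrow> Less t u \<in> H" for t u
  proof -
    have "Less (r (h t)) (r (h u)) \<in> H \<longleftrightarrow> Less t (r (h u)) \<in> H"
      using Eq_inst[OF rh[of t], of "Less (Var 0) (lift_tm (r (h u)))"]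
      by (simp add: subst_tm_lift_tm)
    moreover have "Less t (r (h u)) \<in> H \<longleftrightarrow> Less t u \<in> H"
      using Eq_inst[OF rh[of u], of "Less (lift_tm t) (Var 0)"] by (simp add: subst_tm_lift_tm)
    ultimately show ?thesis unfolding lt_def by blast
  qed
  have U: "h t \<in> U X \<longleftrightarrow> Mem t X \<in> H" for t X
    using Eq_inst[OF rh[of t], of "Mem (Var 0) X"] unfolding U_def by simp
  interpret M: struct "h Zero" "h One" plus times lt "range U" .
  have tval: "M.tval (\<lambda>n. h (s n)) t = h (subst_tm s t)" for s t
    by (induction t) (auto simp: plus times)
  \<comment> \<open>The truth lemma is stated for all substitutions; in the quantifier cases the
    bound variable is then simply sent to another term or set variable.\<close>
  have sat: "M.sat (\<lambda>n. h (s n)) (\<lambda>X. U (g X)) p \<longleftrightarrow> subst s g p \<in> H" for s g p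
  proof (induction p arbitrary: s g)
    case (AllN p)
    have 1: "case_nat (h t) (\<lambda>n. h (s n)) = (\<lambda>n. h (case_nat t s n))" for t
      by (rule ext) (simp split: nat.split)
    have 2: "inst t (subst (upN s) g p) = subst (case_nat t s) g p" for t
    proof -
      have "(\<lambda>n. subst_tm (case_nat t Var) (upN s n)) = case_nat t s"
        by (rule ext) (simp split: nat.split add: subst_tm_lift_tm)
      then show ?thesis by (simp add: subst_subst id_def)
    qed
    have "M.sat (\<lambda>n. h (s n)) (\<lambda>X. U (g X)) (AllN p) \<longleftrightarrow>
        (\<forall>t. M.sat (case_nat (h t) (\<lambda>n. h (s n))) (\<lambda>X. U (g X)) p)"
      unfolding M.sat.simps by (metis hr)
    then show ?case unfolding 1 AllN by (simp add: henkin_theory.AllN[OF henkin_theory_axioms] 2)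
  next
    case (AllS p)
    have 1: "case_nat (U X) (\<lambda>n. U (g n)) = (\<lambda>n. U (case_nat X g n))" for X
      by (rule ext) (simp split: nat.split)
    have 2: "instS X (subst s (upS g) p) = subst s (case_nat X g) p" for X
    proof -
      have "(\<lambda>n. case_nat X id (upS g n)) = case_nat X g"
        by (rule ext) (simp split: nat.split)
      then show ?thesis by (simp add: subst_subst)
    qed
    show ?case by (simp add: henkin_theory.AllS[OF henkin_theory_axioms] 1 2 AllS)
  next
    case (Imp p q)
    then show ?case using ImpE ImpI by (metis M.sat.simps(5) subst.simps(5))
  qed (auto simp: tval h_eq lt U Fls)
  show thesis
  proof (rule that)
    show "range U \<subseteq> range U" by simp
    show "M.sat (\<lambda>n. h (Var n)) U p \<longleftrightarrow> p \<in> H" for p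
      using sat[of Var "\<lambda>n. n"] by simp
    \<comment> \<open>Each element and each set of the model is named, so an arbitrary assignment
      amounts to a substitution. This is how axioms become true under all assignments.\<close>
    fix v' :: "nat \<Rightarrow> nat" and V' :: "nat \<Rightarrow> nat set" and p assume "range V' \<subseteq> range U"
    then have "\<forall>X. \<exists>Y. V' X = U Y" by blast
    then obtain g where "V' = (\<lambda>X. U (g X))" by metis
    moreover have "v' = (\<lambda>n. h (r (v' n)))" using hr by simp
    ultimately show "\<exists>s r. M.sat v' V' p \<longleftrightarrow> subst s r p \<in> H"
      using sat by metis
  qed
qed

text \<open>Validity is demanded on the single carrier \<open>nat\<close>, since a statement of HOL
  cannot quantify over types. The two successor axioms among the premises make the term model
  infinite, hence isomorphic to a structure on \<open>nat\<close>.\<close>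

theorem (in subst_closed) completeness:
  assumes ax1: "AllN (Neg (Eq (Add (Var 0) One) Zero)) \<in> Ax"
    and ax2: "AllN (AllN (Imp (Eq (Add (Var 1) One) (Add (Var 0) One)) (Eq (Var 1) (Var 0)))) \<in> Ax"
    and valid: "\<And>(zero::nat) one plus times lt \<S> v V. \<lbrakk>\<And>p v V. p \<in> Ax \<Longrightarrow> range V \<subseteq> \<S> \<Longrightarrow>
        struct.sat zero one plus times lt \<S> v V p; range V \<subseteq> \<S>\<rbrakk> \<Longrightarrow>
      struct.sat zero one plus times lt \<S> v V p"
  shows "Ax; [] \<turnstile> p"
proof (rule ccontr)
  assume "\<not> Ax; [] \<turnstile> p"
  then have cons: "\<not> Ax; [Neg p] \<turnstile> Fls" using Raa by blast
  interpret H: henkin_theory "henkin_set (Neg p)" by (rule henkin_theory[OF cons])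
  note Ax = henkin_theory(2)[OF cons]
  obtain zero :: nat and one plus times lt \<S> v V where M: "range V \<subseteq> \<S>"
    "\<And>q. struct.sat zero one plus times lt \<S> v V q \<longleftrightarrow> q \<in> henkin_set (Neg p)"
    "\<And>v' V' q. range V' \<subseteq> \<S> \<Longrightarrow>
      \<exists>s r. struct.sat zero one plus times lt \<S> v' V' q \<longleftrightarrow> subst s r q \<in> henkin_set (Neg p)"
    using H.term_model[OF subsetD[OF Ax ax1] subsetD[OF Ax ax2]] by metis
  have "struct.sat zero one plus times lt \<S> v V p"
  proof (rule valid)
    show "struct.sat zero one plus times lt \<S> v' V' q" if "q \<in> Ax" "range V' \<subseteq> \<S>" for q v' V'
      using M(3)[OF that(2), of v' q] subst_Ax[OF that(1)] Ax by blast
  qed (rule M(1))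
  then have "p \<in> henkin_set (Neg p)" using M(2) by blast
  then show False using H.Neg_iff henkin_theory(3)[OF cons] by blast
qed

section \<open>Truth of forms in a structure\<close>

context struct
begin

type_synonym 'b env = "nat \<times> nat \<times> (nat \<Rightarrow> 'b) \<times> (nat \<Rightarrow> 'b set)"

text \<open>An environment records the numbers of enclosing binders and the values of the variables.
  Passing below further binders extends it.\<close>

definition ext :: "'a env \<Rightarrow> 'a env \<Rightarrow> bool" where
  "ext = (\<lambda>(d, e, v, V) (d', e', v', V'). d \<le> d' \<and> e \<le> e' \<and>
     (\<forall>i. v' (i + (d' - d)) = v i) \<and> (\<forall>i. V' (i + (e' - e)) = V i))"

text \<open>A form is an arbitrary HOL function of the binder depths. Demanding the same value in
  every extension of the environment expresses that it behaves like a genuine expression, and makes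
  the notion stable when it is carried below further binders.\<close>

definition den_t :: "'a env \<Rightarrow> nterm \<Rightarrow> 'a \<Rightarrow> bool" where
  "den_t E x a \<longleftrightarrow> (\<forall>d e v V. ext E (d, e, v, V) \<longrightarrow> tval v (x d) = a)"

definition den_s :: "'a env \<Rightarrow> sterm \<Rightarrow> 'a set \<Rightarrow> bool" where
  "den_s E X A \<longleftrightarrow> (\<forall>d e v V. ext E (d, e, v, V) \<longrightarrow> V (X e) = A)"

definition den :: "'a env \<Rightarrow> form \<Rightarrow> bool \<Rightarrow> bool" where
  "den E P b \<longleftrightarrow> (\<forall>d e v V. ext E (d, e, v, V) \<longrightarrow> sat v V (P d e) = b)"

text \<open>A logical relation: related arguments in any extended environment give related results.
  This treats notions such as orders, which take predicates as arguments.\<close>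

definition den1 :: "'a env \<Rightarrow> (nterm \<Rightarrow> form) \<Rightarrow> ('a \<Rightarrow> bool) \<Rightarrow> bool" where
  "den1 E P B \<longleftrightarrow> (\<forall>E' x a. ext E E' \<longrightarrow> den_t E' x a \<longrightarrow> den E' (P x) (B a))"

definition den2 :: "'a env \<Rightarrow> (nterm \<Rightarrow> nterm \<Rightarrow> form) \<Rightarrow> ('a \<Rightarrow> 'a \<Rightarrow> bool) \<Rightarrow> bool" where
  "den2 E P B \<longleftrightarrow>
    (\<forall>E' x a y b. ext E E' \<longrightarrow> den_t E' x a \<longrightarrow> den_t E' y b \<longrightarrow> den E' (P x y) (B a b))"

lemma ext_refl: "ext E E"
  by (auto simp: ext_def split: prod.split)

lemma ext_trans: "ext E E' \<Longrightarrow> ext E' E'' \<Longrightarrow> ext E E''"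
proof -
  assume 1: "ext E E'" and 2: "ext E' E''"
  obtain d e v V where E: "E = (d, e, v, V)" by (cases E)
  obtain d' e' v' V' where E': "E' = (d', e', v', V')" by (cases E')
  obtain d'' e'' v'' V'' where E'': "E'' = (d'', e'', v'', V'')" by (cases E'')
  have v: "v'' (j + (d'' - d')) = v' j" "v' (j + (d' - d)) = v j"
    "V'' (j + (e'' - e')) = V' j" "V' (j + (e' - e)) = V j" for j
    using 1 2 by (auto simp: ext_def E E' E'' simp del: add_diff_assoc add_diff_assoc2 Nat.diff_add_assoc Nat.add_diff_assoc)
  have "i + (d'' - d) = (i + (d' - d)) + (d'' - d')" "i + (e'' - e) = (i + (e' - e)) + (e'' - e')" for i
    using 1 2 by (simp_all add: ext_def E E' E'')
  then have "v'' (i + (d'' - d)) = v i" "V'' (i + (e'' - e)) = V i" for i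
    using v by metis+
  then show ?thesis using 1 2 by (simp add: ext_def E E' E'')
qed

lemma ext_extend: "ext E' E'' \<Longrightarrow> ext E E' \<Longrightarrow> ext E E''"
  by (rule ext_trans)

named_theorems den_rules

lemma den_t_mono: "den_t E x a \<Longrightarrow> ext E E' \<Longrightarrow> den_t E' x a"
  unfolding den_t_def using ext_trans by blast

lemma den_s_mono: "den_s E x a \<Longrightarrow> ext E E' \<Longrightarrow> den_s E' x a"
  unfolding den_s_def using ext_trans by blast

lemma den1D: "den1 E P B \<Longrightarrow> ext E E' \<Longrightarrow> den_t E' x a \<Longrightarrow> den E' (P x) (B a)"
  unfolding den1_def by blast

lemma den2D:
  "den2 E P B \<Longrightarrow> ext E E' \<Longrightarrow> den_t E' x a \<Longrightarrow> den_t E' y b \<Longrightarrow> den E' (P x y) (B a b)"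
  unfolding den2_def by blast

lemma den1_mono: "den1 E P B \<Longrightarrow> ext E E' \<Longrightarrow> den1 E' P B"
  unfolding den1_def using ext_trans by blast

lemma den2_mono: "den2 E P B \<Longrightarrow> ext E E' \<Longrightarrow> den2 E' P B"
  unfolding den2_def using ext_trans by blast

lemma den1I [den_rules]:
  "(\<And>E' x a. ext E E' \<Longrightarrow> den_t E' x a \<Longrightarrow> den E' (P x) (B a)) \<Longrightarrow> den1 E P B"
  unfolding den1_def by blast

lemma den2I [den_rules]:
  "(\<And>E' x a y b. ext E E' \<Longrightarrow> den_t E' x a \<Longrightarrow> den_t E' y b \<Longrightarrow> den E' (P x y) (B a b)) \<Longrightarrow>
    den2 E P B"
  unfolding den2_def by blast

lemmas den_mono = den_t_mono den_s_mono den1_mono den2_mono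

definition pr :: "'a \<Rightarrow> 'a \<Rightarrow> 'a" where
  "pr x y = (x \<oplus> y) \<otimes> (x \<oplus> y) \<oplus> x"

lemma den_terms [den_rules]:
  "den_t E fzero \<zero>" "den_t E fone \<one>"
  "den_t E x a \<Longrightarrow> den_t E y b \<Longrightarrow> den_t E (x \<^bold>+ y) (a \<oplus> b)"
  "den_t E x a \<Longrightarrow> den_t E y b \<Longrightarrow> den_t E (x \<^bold>* y) (a \<otimes> b)"
  "den_t E x a \<Longrightarrow> den_t E y b \<Longrightarrow> den_t E \<langle>x, y\<rangle> (pr a b)"
  by (simp_all add: den_t_def fzero_def fone_def fadd_def fmul_def pair_def pr_def)

lemma den_atoms [den_rules]:
  "den_t E x a \<Longrightarrow> den_t E y b \<Longrightarrow> den E (x \<^bold>= y) (a = b)"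
  "den_t E x a \<Longrightarrow> den_t E y b \<Longrightarrow> den E (x \<^bold>< y) (a \<lhd> b)"
  "den_t E x a \<Longrightarrow> den_s E X A \<Longrightarrow> den E (x \<^bold>\<in> X) (a \<in> A)"
  unfolding den_t_def den_s_def den_def feq_def fless_def fmem_def sat.simps by (simp, simp, blast)

lemma den_connectives [den_rules]:
  "den E P p \<Longrightarrow> den E Q q \<Longrightarrow> den E (P \<^bold>\<longrightarrow> Q) (p \<longrightarrow> q)"
  "den E P p \<Longrightarrow> den E (\<^bold>\<not> P) (\<not> p)"
  "den E P p \<Longrightarrow> den E Q q \<Longrightarrow> den E (P \<^bold>\<and> Q) (p \<and> q)"
  "den E P p \<Longrightarrow> den E Q q \<Longrightarrow> den E (P \<^bold>\<or> Q) (p \<or> q)"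
  "den E P p \<Longrightarrow> den E Q q \<Longrightarrow> den E (P \<^bold>\<longleftrightarrow> Q) (p \<longleftrightarrow> q)"
  unfolding den_def fimp_def fnot_def fand_def fdisj_def fiff_def sat.simps by auto

lemma den_fall [den_rules]:
  assumes "\<And>E' x a. ext E E' \<Longrightarrow> den_t E' x a \<Longrightarrow> den E' (P x) (b a)"
  shows "den E (fall P) (\<forall>a. b a)"
  unfolding den_def
proof (intro allI impI)
  fix d e v V assume E: "ext E (d, e, v, V)"
  have "sat (case_nat a v) V (P (\<lambda>d'. Var (d' - Suc d)) (Suc d) e) = b a" for a
  proof -
    let ?E = "(Suc d, e, case_nat a v, V)"
    have e: "ext E ?E"
      by (rule ext_trans[OF E]) (simp add: ext_def)
    moreover have "den_t ?E (\<lambda>d'. Var (d' - Suc d)) a"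
      unfolding den_t_def ext_def by (auto dest!: spec[of "\<lambda>i. _ i = case_nat a v i" 0])
    ultimately have "den ?E (P (\<lambda>d'. Var (d' - Suc d))) (b a)" by (rule assms)
    then show ?thesis unfolding den_def using ext_refl by blast
  qed
  then show "sat v V (fall P d e) = (\<forall>a. b a)"
    by (simp add: fall_def)
qed

lemma den_fex [den_rules]:
  assumes "\<And>E' x a. ext E E' \<Longrightarrow> den_t E' x a \<Longrightarrow> den E' (P x) (b a)"
  shows "den E (fex P) (\<exists>a. b a)"
proof -
  have "den E (fex P) (\<not> (\<forall>a. \<not> b a))"
    unfolding fex_def by (intro den_rules assms)
  then show ?thesis by simp
qed

lemma den_fex1 [den_rules]:
  assumes P: "\<And>E' x a. ext E E' \<Longrightarrow> den_t E' x a \<Longrightarrow> den E' (P x) (b a)"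
  shows "den E (fex1 P) (\<exists>!a. b a)"
proof -
  have "den E (fex1 P) (\<exists>a. b a \<and> (\<forall>y. b y \<longrightarrow> y = a))"
    unfolding fex1_def
    by (intro den_rules) (auto intro: P ext_trans den_t_mono)
  then show ?thesis unfolding Ex1_def .
qed

lemma den_fallS [den_rules]:
  assumes "\<And>E' X A. ext E E' \<Longrightarrow> A \<in> \<S> \<Longrightarrow> den_s E' X A \<Longrightarrow> den E' (P X) (b A)"
  shows "den E (fallS P) (\<forall>A\<in>\<S>. b A)"
  unfolding den_def
proof (intro allI impI)
  fix d e v V assume E: "ext E (d, e, v, V)"
  have "sat v (case_nat A V) (P (\<lambda>e'. e' - Suc e) d (Suc e)) = b A" if "A \<in> \<S>" for A
  proof -
    let ?E = "(d, Suc e, v, case_nat A V)"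
    have e: "ext E ?E"
      by (rule ext_trans[OF E]) (simp add: ext_def)
    moreover have "den_s ?E (\<lambda>d'. d' - Suc e) A"
      unfolding den_s_def ext_def by (auto dest!: spec[of "\<lambda>i. _ i = case_nat A V i" 0])
    ultimately have "den ?E (P (\<lambda>e'. e' - Suc e)) (b A)" using assms that by blast
    then show ?thesis unfolding den_def using ext_refl by blast
  qed
  then show "sat v V (fallS P d e) = (\<forall>A\<in>\<S>. b A)"
    by (simp add: fallS_def)
qed

lemma den_fexS [den_rules]:
  assumes "\<And>E' X A. ext E E' \<Longrightarrow> A \<in> \<S> \<Longrightarrow> den_s E' X A \<Longrightarrow> den E' (P X) (b A)"
  shows "den E (fexS P) (\<exists>A\<in>\<S>. b A)"
proof -
  have "den E (fexS P) (\<not> (\<forall>A\<in>\<S>. \<not> b A))"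
    unfolding fexS_def by (intro den_rules assms)
  then show ?thesis by simp
qed

text \<open>The formula \<open>p\<close> is evaluated with the outermost assignment, because its
  parameters are free variables of the whole sentence and are not captured by the binders around
  it.\<close>

lemma den_app:
  assumes "ext (0, 0, v0, V0) E" "den_t E x a"
  shows "den E p\<lbrakk>x\<rbrakk> (sat (case_nat a v0) V0 p)"
  unfolding den_def
proof (intro allI impI)
  fix d e v V assume E: "ext E (d, e, v, V)"
  have *: "ext (0, 0, v0, V0) (d, e, v, V)" by (rule ext_trans[OF assms(1) E])
  have "tval v (x d) = a" using assms(2) E unfolding den_t_def by blast
  then have "(\<lambda>n. tval v (case_nat (x d) (\<lambda>n. Var (n + d)) n)) = case_nat a v0"
    using * by (intro ext) (auto simp: ext_def split: nat.split)
  moreover have "(\<lambda>X. V (X + e)) = V0"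
    using * by (intro ext) (auto simp: ext_def)
  ultimately show "sat v V (p\<lbrakk>x\<rbrakk> d e) = sat (case_nat a v0) V0 p"
    by (simp add: app_def sat_subst)
qed

lemma den_param: "ext (0, 0, v0, V0) E \<Longrightarrow> den_s E (param i) (V0 i)"
  unfolding den_s_def param_def
proof (intro allI impI)
  fix d e v V assume "ext (0, 0, v0, V0) E" "ext E (d, e, v, V)"
  then have "ext (0, 0, v0, V0) (d, e, v, V)" by (rule ext_trans)
  then show "V (i + e) = V0 i" by (simp add: ext_def)
qed

lemma den_sat: "den (0, 0, v, V) P b \<Longrightarrow> sat v V (P 0 0) \<longleftrightarrow> b"
  unfolding den_def using ext_refl by blast

section \<open>The notions of the theorem read in a structure\<close>

definition lin :: "('a \<Rightarrow> bool) \<Rightarrow> ('a \<Rightarrow> 'a \<Rightarrow> bool) \<Rightarrow> bool" where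
  "lin X R \<longleftrightarrow> (\<forall>x y. R x y \<longrightarrow> X x \<and> X y) \<and> (\<forall>x. \<not> R x x) \<and>
     (\<forall>x y z. R x y \<and> R y z \<longrightarrow> R x z) \<and> (\<forall>x y. X x \<and> X y \<longrightarrow> R x y \<or> x = y \<or> R y x)"

definition desc :: "('a \<Rightarrow> 'a \<Rightarrow> bool) \<Rightarrow> 'a set \<Rightarrow> bool" where
  "desc R F \<longleftrightarrow> (\<forall>n. \<exists>!x. pr n x \<in> F) \<and>
     (\<forall>n x y. pr n x \<in> F \<and> pr (n \<oplus> \<one>) y \<in> F \<longrightarrow> R y x)"

definition wfd :: "('a \<Rightarrow> 'a \<Rightarrow> bool) \<Rightarrow> bool" where
  "wfd R \<longleftrightarrow> \<not> (\<exists>F\<in>\<S>. desc R F)"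

definition wo :: "('a \<Rightarrow> bool) \<Rightarrow> ('a \<Rightarrow> 'a \<Rightarrow> bool) \<Rightarrow> bool" where
  "wo X R \<longleftrightarrow> lin X R \<and> wfd R"

definition mem :: "'a \<Rightarrow> 'a \<Rightarrow> bool" where
  "mem x c \<longleftrightarrow> (\<exists>k m n. c = pr k (pr m n) \<and> x \<lhd> k \<and> (\<exists>q. n = q \<otimes> (m \<otimes> (x \<oplus> \<one>) \<oplus> \<one>)))"

definition fset :: "'a \<Rightarrow> bool" where
  "fset c \<longleftrightarrow> (\<forall>b. b \<lhd> c \<longrightarrow> \<not> (\<forall>x. mem x b \<longleftrightarrow> mem x c))"

definition funion :: "'a \<Rightarrow> 'a \<Rightarrow> 'a \<Rightarrow> bool" where
  "funion c a b \<longleftrightarrow> fset c \<and> (\<forall>x. mem x c \<longleftrightarrow> mem x a \<or> mem x b)"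

definition ffun :: "'a \<Rightarrow> 'a \<Rightarrow> ('a \<Rightarrow> bool) \<Rightarrow> bool" where
  "ffun f n B \<longleftrightarrow> fset f \<and> (\<forall>z. mem z f \<longrightarrow> (\<exists>i x. z = pr i x \<and> i \<lhd> n \<and> B x)) \<and>
     (\<forall>i. i \<lhd> n \<longrightarrow> (\<exists>!x. mem (pr i x) f))"

definition mor :: "'a \<Rightarrow> 'a \<Rightarrow> 'a \<Rightarrow> bool" where
  "mor f n l \<longleftrightarrow> ffun f n (\<lambda>x. x \<lhd> l) \<and>
     (\<forall>i j x y. mem (pr i x) f \<and> mem (pr j y) f \<and> i \<lhd> j \<longrightarrow> x \<lhd> y)"

definition fcard :: "'a \<Rightarrow> 'a \<Rightarrow> bool" where
  "fcard a n \<longleftrightarrow> (\<exists>f. ffun f n (\<lambda>x. mem x a) \<and> (\<forall>x. mem x a \<longrightarrow> (\<exists>!i. mem (pr i x) f)))"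

definition enm :: "'a \<Rightarrow> 'a \<Rightarrow> 'a \<Rightarrow> ('a \<Rightarrow> 'a \<Rightarrow> bool) \<Rightarrow> bool" where
  "enm f n a R \<longleftrightarrow> ffun f n (\<lambda>x. mem x a) \<and> (\<forall>x. mem x a \<longrightarrow> (\<exists>i. mem (pr i x) f)) \<and>
     (\<forall>i j x y. mem (pr i x) f \<and> mem (pr j y) f \<and> i \<lhd> j \<longrightarrow> R x y)"

definition inc :: "'a \<Rightarrow> 'a \<Rightarrow> 'a \<Rightarrow> 'a \<Rightarrow> 'a \<Rightarrow> ('a \<Rightarrow> 'a \<Rightarrow> bool) \<Rightarrow> bool" where
  "inc g p r a c R \<longleftrightarrow> mor g p r \<and> (\<exists>f h. enm f p a R \<and> enm h r c R \<and>
     (\<forall>i j. mem (pr i j) g \<longrightarrow> (\<exists>x. mem (pr i x) f \<and> mem (pr j x) h)))"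

definition Elt :: "'a set \<Rightarrow> 'a \<Rightarrow> 'a \<Rightarrow> bool" where
  "Elt T n s \<longleftrightarrow> pr \<zero> (pr n s) \<in> T"
definition Below :: "'a set \<Rightarrow> 'a \<Rightarrow> 'a \<Rightarrow> 'a \<Rightarrow> bool" where
  "Below T n s t \<longleftrightarrow> pr \<one> (pr n (pr s t)) \<in> T"
definition Act :: "'a set \<Rightarrow> 'a \<Rightarrow> 'a \<Rightarrow> 'a \<Rightarrow> 'a \<Rightarrow> 'a \<Rightarrow> bool" where
  "Act T n l f s t \<longleftrightarrow> pr (\<one> \<oplus> \<one>) (pr n (pr l (pr f (pr s t)))) \<in> T"
definition Supp :: "'a set \<Rightarrow> 'a \<Rightarrow> 'a \<Rightarrow> 'a \<Rightarrow> bool" where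
  "Supp T n s a \<longleftrightarrow> pr (\<one> \<oplus> \<one> \<oplus> \<one>) (pr n (pr s a)) \<in> T"
definition Mu :: "'a set \<Rightarrow> 'a \<Rightarrow> 'a \<Rightarrow> 'a \<Rightarrow> bool" where
  "Mu T n m s \<longleftrightarrow> pr (\<one> \<oplus> \<one> \<oplus> \<one> \<oplus> \<one>) (pr n (pr m s)) \<in> T"

definition prae :: "'a set \<Rightarrow> bool" where
  "prae T \<longleftrightarrow>
    ((\<forall>n. lin (Elt T n) (Below T n)) \<and>
     (\<forall>n l f s t. Act T n l f s t \<longrightarrow> mor f n l \<and> Elt T n s \<and> Elt T l t) \<and>
     (\<forall>n l f s. mor f n l \<and> Elt T n s \<longrightarrow> (\<exists>!t. Act T n l f s t)) \<and>
     (\<forall>n l f s t s' t'.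
        Act T n l f s s' \<and> Act T n l f t t' \<and> Below T n s t \<longrightarrow> Below T l s' t') \<and>
     (\<forall>n f s. mor f n n \<and> (\<forall>i. i \<lhd> n \<longrightarrow> mem (pr i i) f) \<and> Elt T n s \<longrightarrow> Act T n n f s s) \<and>
     (\<forall>k n l f g h s t u.
        mor h k l \<and> (\<forall>i j m. mem (pr i j) f \<and> mem (pr j m) g \<longrightarrow> mem (pr i m) h) \<and>
        Act T k n f s t \<and> Act T n l g t u \<longrightarrow> Act T k l h s u) \<and>
     (\<forall>n s a. Supp T n s a \<longrightarrow> Elt T n s \<and> fset a \<and> (\<forall>x. mem x a \<longrightarrow> x \<lhd> n)) \<and>
     (\<forall>n s. Elt T n s \<longrightarrow> (\<exists>!a. Supp T n s a)) \<and>
     (\<forall>n l f s t a b.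
        Act T n l f s t \<and> Supp T n s a \<and> Supp T l t b \<longrightarrow>
        (\<forall>y. mem y b \<longleftrightarrow> (\<exists>x. mem x a \<and> mem (pr x y) f))) \<and>
     (\<forall>n s a. Supp T n s a \<longrightarrow> (\<exists>k f r. enm f k a (\<lambda>x y. x \<lhd> y) \<and> Act T k n f r s)))"

definition nprae :: "'a set \<Rightarrow> bool" where
  "nprae T \<longleftrightarrow>
    (prae T \<and>
     (\<forall>n m s. Mu T n m s \<longrightarrow> m \<lhd> n \<and> Elt T n s) \<and>
     (\<forall>n m. m \<lhd> n \<longrightarrow> (\<exists>!s. Mu T n m s)) \<and>
     (\<forall>n m m' s s'. Mu T n m s \<and> Mu T n m' s' \<and> m \<lhd> m' \<longrightarrow> Below T n s s') \<and>
     (\<forall>n l f m m' s s'.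
        mor f n l \<and> mem (pr m m') f \<and> Mu T n m s \<and> Mu T l m' s' \<longrightarrow> Act T n l f s s') \<and>
     (\<forall>n m u s a. Mu T n m u \<and> Supp T n s a \<longrightarrow>
        (Below T n s u \<longleftrightarrow> (\<forall>x. mem x a \<longrightarrow> x \<lhd> m))))"

definition full :: "'a set \<Rightarrow> 'a \<Rightarrow> 'a \<Rightarrow> bool" where
  "full T a s \<longleftrightarrow>
    (\<exists>n. fcard a n \<and> Elt T n s \<and> (\<exists>b. Supp T n s b \<and> (\<forall>x. mem x b \<longleftrightarrow> x \<lhd> n)))"

definition pless :: "'a set \<Rightarrow> ('a \<Rightarrow> 'a \<Rightarrow> bool) \<Rightarrow> 'a \<Rightarrow> 'a \<Rightarrow> 'a \<Rightarrow> 'a \<Rightarrow> bool" where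
  "pless T R a s b t \<longleftrightarrow>
    (\<exists>c p q r g h s' t'. funion c a b \<and> inc g p r a c R \<and> inc h q r b c R \<and>
       Act T p r g s s' \<and> Act T q r h t t' \<and> Below T r s' t')"

definition Dfield :: "'a set \<Rightarrow> ('a \<Rightarrow> bool) \<Rightarrow> 'a \<Rightarrow> bool" where
  "Dfield T X x \<longleftrightarrow> (\<exists>a s. x = pr a s \<and> fset a \<and> (\<forall>y. mem y a \<longrightarrow> X y) \<and> full T a s)"

definition Dless :: "'a set \<Rightarrow> ('a \<Rightarrow> bool) \<Rightarrow> ('a \<Rightarrow> 'a \<Rightarrow> bool) \<Rightarrow> 'a \<Rightarrow> 'a \<Rightarrow> bool" where
  "Dless T X R x y \<longleftrightarrow> Dfield T X x \<and> Dfield T X y \<and>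
     (\<exists>a s b t. x = pr a s \<and> y = pr b t \<and> pless T R a s b t)"

definition dil :: "'a set \<Rightarrow> bool" where
  "dil T \<longleftrightarrow> prae T \<and> (\<forall>X\<in>\<S>. \<forall>R\<in>\<S>. wo (\<lambda>x. x \<in> X) (\<lambda>x y. pr x y \<in> R) \<longrightarrow>
     wfd (Dless T (\<lambda>x. x \<in> X) (\<lambda>x y. pr x y \<in> R)))"

definition ndil :: "'a set \<Rightarrow> bool" where
  "ndil T \<longleftrightarrow> nprae T \<and> dil T"

definition mt :: "'a \<Rightarrow> 'a" where "mt m = pr \<zero> m"
definition xt :: "'a \<Rightarrow> 'a \<Rightarrow> 'a" where "xt a s = pr \<one> (pr a s)"

definition deriv_elt :: "'a set \<Rightarrow> 'a set \<Rightarrow> bool" where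
  "deriv_elt T D \<longleftrightarrow> (\<forall>n s. Elt D n s \<longleftrightarrow> (\<exists>m. m \<lhd> n \<and> s = mt m) \<or>
     (\<exists>a r. s = xt a r \<and> fset a \<and> (\<forall>t. mem t a \<longrightarrow> Elt D n t) \<and> full T a r \<and>
        \<not> ((\<exists>m. m \<lhd> n \<and> (\<forall>t. mem t a \<longleftrightarrow> t = mt m)) \<and> Mu T \<one> \<zero> r)))"

definition deriv_below :: "'a set \<Rightarrow> 'a set \<Rightarrow> bool" where
  "deriv_below T D \<longleftrightarrow> (\<forall>n s t. Below D n s t \<longleftrightarrow> Elt D n s \<and> Elt D n t \<and>
     ((\<exists>m k. s = mt m \<and> t = mt k \<and> m \<lhd> k) \<or>
      (\<exists>m b u. s = mt m \<and> t = xt b u \<and> (\<exists>r. mem r b \<and> (Below D n s r \<or> s = r))) \<or>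
      (\<exists>a u k. s = xt a u \<and> t = mt k \<and> (\<forall>r. mem r a \<longrightarrow> Below D n r t)) \<or>
      (\<exists>a u b v. s = xt a u \<and> t = xt b v \<and>
         lin (\<lambda>x. mem x a \<or> mem x b)
           (\<lambda>x y. (mem x a \<or> mem x b) \<and> (mem y a \<or> mem y b) \<and> Below D n x y) \<and>
         pless T (Below D n) a u b v)))"

definition deriv_act :: "'a set \<Rightarrow> bool" where
  "deriv_act D \<longleftrightarrow> (\<forall>n l f s t. Act D n l f s t \<longleftrightarrow> mor f n l \<and> Elt D n s \<and>
     ((\<exists>m k. s = mt m \<and> mem (pr m k) f \<and> t = mt k) \<or>
      (\<exists>a b u. s = xt a u \<and> t = xt b u \<and> fset b \<and>
         (\<forall>y. mem y b \<longleftrightarrow> (\<exists>x. mem x a \<and> Act D n l f x y)))))"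

definition deriv_supp :: "'a set \<Rightarrow> bool" where
  "deriv_supp D \<longleftrightarrow> (\<forall>n s c. Supp D n s c \<longleftrightarrow> Elt D n s \<and> fset c \<and>
     ((\<exists>m. s = mt m \<and> (\<forall>x. mem x c \<longleftrightarrow> x = m)) \<or>
      (\<exists>a u. s = xt a u \<and> (\<forall>x. mem x c \<longleftrightarrow> (\<exists>t b. mem t a \<and> Supp D n t b \<and> mem x b)))))"

definition deriv :: "'a set \<Rightarrow> 'a set \<Rightarrow> bool" where
  "deriv T D \<longleftrightarrow> deriv_elt T D \<and> deriv_below T D \<and> deriv_act D \<and> deriv_supp D \<and>
     (\<forall>n m s. Mu D n m s \<longleftrightarrow> m \<lhd> n \<and> s = mt m)"

section \<open>Agreement of the formal notions with their readings\<close>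

lemma den_lin [den_rules]:
  "den1 E X X' \<Longrightarrow> den2 E R R' \<Longrightarrow> den E (linear_order X R) (lin X' R')"
  unfolding linear_order_def lin_def
  by (rule den_rules | assumption | (erule den_mono, rule ext_refl) | (erule den1D den2D, rule ext_refl)
    | erule den_mono | erule den1D den2D | erule ext_extend)+

lemma den_wfd [den_rules]:
  "den2 E R R' \<Longrightarrow> den E (well_founded R) (wfd R')"
  unfolding well_founded_def wfd_def desc_def
  by (rule den_rules | assumption | (erule den_mono, rule ext_refl) | (erule den1D den2D, rule ext_refl)
    | erule den_mono | erule den1D den2D | erule ext_extend)+

lemma den_wo [den_rules]:
  "den1 E X X' \<Longrightarrow> den2 E R R' \<Longrightarrow> den E (well_order X R) (wo X' R')"
  unfolding well_order_def wo_def
  by (rule den_rules | assumption | (erule den_mono, rule ext_refl) | (erule den1D den2D, rule ext_refl)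
    | erule den_mono | erule den1D den2D | erule ext_extend)+

lemma den_mem [den_rules]:
  "den_t E x x' \<Longrightarrow> den_t E c c' \<Longrightarrow> den E (x \<^bold>\<epsilon> c) (mem x' c')"
  unfolding fin_mem_def mem_def
  by (rule den_rules | assumption | (erule den_mono, rule ext_refl) | (erule den1D den2D, rule ext_refl)
    | erule den_mono | erule den1D den2D | erule ext_extend)+

lemma den_fset [den_rules]:
  "den_t E c c' \<Longrightarrow> den E (fin_set c) (fset c')"
  unfolding fin_set_def fset_def
  by (rule den_rules | assumption | (erule den_mono, rule ext_refl) | (erule den1D den2D, rule ext_refl)
    | erule den_mono | erule den1D den2D | erule ext_extend)+

lemma den_funion [den_rules]:
  "den_t E c c' \<Longrightarrow> den_t E a a' \<Longrightarrow> den_t E b b' \<Longrightarrow> den E (fin_union c a b) (funion c' a' b')"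
  unfolding fin_union_def funion_def
  by (rule den_rules | assumption | (erule den_mono, rule ext_refl) | (erule den1D den2D, rule ext_refl)
    | erule den_mono | erule den1D den2D | erule ext_extend)+

lemma den_ffun [den_rules]:
  "den_t E f f' \<Longrightarrow> den_t E n n' \<Longrightarrow> den1 E X X' \<Longrightarrow> den E (fin_fun f n X) (ffun f' n' X')"
  unfolding fin_fun_def ffun_def
  by (rule den_rules | assumption | (erule den_mono, rule ext_refl) | (erule den1D den2D, rule ext_refl)
    | erule den_mono | erule den1D den2D | erule ext_extend)+

lemma den_mor [den_rules]:
  "den_t E f f' \<Longrightarrow> den_t E n n' \<Longrightarrow> den_t E l l' \<Longrightarrow> den E (morph f n l) (mor f' n' l')"
  unfolding morph_def mor_def
  by (rule den_rules | assumption | (erule den_mono, rule ext_refl) | (erule den1D den2D, rule ext_refl)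
    | erule den_mono | erule den1D den2D | erule ext_extend)+

lemma den_fcard [den_rules]:
  "den_t E a a' \<Longrightarrow> den_t E n n' \<Longrightarrow> den E (fin_card a n) (fcard a' n')"
  unfolding fin_card_def fcard_def
  by (rule den_rules | assumption | (erule den_mono, rule ext_refl) | (erule den1D den2D, rule ext_refl)
    | erule den_mono | erule den1D den2D | erule ext_extend)+

lemma den_enm [den_rules]:
  "den_t E f f' \<Longrightarrow> den_t E n n' \<Longrightarrow> den_t E a a' \<Longrightarrow> den2 E R R' \<Longrightarrow> den E (enum f n a R) (enm f' n' a' R')"
  unfolding enum_def enm_def
  by (rule den_rules | assumption | (erule den_mono, rule ext_refl) | (erule den1D den2D, rule ext_refl)
    | erule den_mono | erule den1D den2D | erule ext_extend)+

lemma den_inc [den_rules]: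
  "den_t E g g' \<Longrightarrow> den_t E p p' \<Longrightarrow> den_t E r r' \<Longrightarrow> den_t E a a' \<Longrightarrow> den_t E c c' \<Longrightarrow> den2 E R R' \<Longrightarrow> den E (incl g p r a c R) (inc g' p' r' a' c' R')"
  unfolding incl_def inc_def
  by (rule den_rules | assumption | (erule den_mono, rule ext_refl) | (erule den1D den2D, rule ext_refl)
    | erule den_mono | erule den1D den2D | erule ext_extend)+

lemma den_Elt [den_rules]:
  "den_s E T T' \<Longrightarrow> den_t E n n' \<Longrightarrow> den_t E s s' \<Longrightarrow> den E (elt T n s) (Elt T' n' s')"
  unfolding elt_def Elt_def tag_field_def
  by (rule den_rules | assumption | (erule den_mono, rule ext_refl) | (erule den1D den2D, rule ext_refl)
    | erule den_mono | erule den1D den2D | erule ext_extend)+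

lemma den_Below [den_rules]:
  "den_s E T T' \<Longrightarrow> den_t E n n' \<Longrightarrow> den_t E s s' \<Longrightarrow> den_t E t t' \<Longrightarrow> den E (below T n s t) (Below T' n' s' t')"
  unfolding below_def Below_def tag_less_def
  by (rule den_rules | assumption | (erule den_mono, rule ext_refl) | (erule den1D den2D, rule ext_refl)
    | erule den_mono | erule den1D den2D | erule ext_extend)+

lemma den_Act [den_rules]:
  "den_s E T T' \<Longrightarrow> den_t E n n' \<Longrightarrow> den_t E l l' \<Longrightarrow> den_t E f f' \<Longrightarrow> den_t E s s' \<Longrightarrow> den_t E t t' \<Longrightarrow> den E (act T n l f s t) (Act T' n' l' f' s' t')"
  unfolding act_def Act_def tag_act_def
  by (rule den_rules | assumption | (erule den_mono, rule ext_refl) | (erule den1D den2D, rule ext_refl)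
    | erule den_mono | erule den1D den2D | erule ext_extend)+

lemma den_Supp [den_rules]:
  "den_s E T T' \<Longrightarrow> den_t E n n' \<Longrightarrow> den_t E s s' \<Longrightarrow> den_t E a a' \<Longrightarrow> den E (supp T n s a) (Supp T' n' s' a')"
  unfolding supp_def Supp_def tag_supp_def
  by (rule den_rules | assumption | (erule den_mono, rule ext_refl) | (erule den1D den2D, rule ext_refl)
    | erule den_mono | erule den1D den2D | erule ext_extend)+

lemma den_Mu [den_rules]:
  "den_s E T T' \<Longrightarrow> den_t E n n' \<Longrightarrow> den_t E m m' \<Longrightarrow> den_t E s s' \<Longrightarrow> den E (mu T n m s) (Mu T' n' m' s')"
  unfolding mu_def Mu_def tag_mu_def
  by (rule den_rules | assumption | (erule den_mono, rule ext_refl) | (erule den1D den2D, rule ext_refl)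
    | erule den_mono | erule den1D den2D | erule ext_extend)+

lemma den_prae [den_rules]:
  "den_s E T T' \<Longrightarrow> den E (prae_dilator T) (prae T')"
  unfolding prae_dilator_def prae_def
  by (rule den_rules | assumption | (erule den_mono, rule ext_refl) | (erule den1D den2D, rule ext_refl)
    | erule den_mono | erule den1D den2D | erule ext_extend)+

lemma den_nprae [den_rules]:
  "den_s E T T' \<Longrightarrow> den E (normal_prae_dilator T) (nprae T')"
  unfolding normal_prae_dilator_def nprae_def
  by (rule den_rules | assumption | (erule den_mono, rule ext_refl) | (erule den1D den2D, rule ext_refl)
    | erule den_mono | erule den1D den2D | erule ext_extend)+

lemma den_full [den_rules]:
  "den_s E T T' \<Longrightarrow> den_t E a a' \<Longrightarrow> den_t E s s' \<Longrightarrow> den E (full_supp T a s) (full T' a' s')"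
  unfolding full_supp_def full_def
  by (rule den_rules | assumption | (erule den_mono, rule ext_refl) | (erule den1D den2D, rule ext_refl)
    | erule den_mono | erule den1D den2D | erule ext_extend)+

lemma den_pless [den_rules]:
  "den_s E T T' \<Longrightarrow> den2 E R R' \<Longrightarrow> den_t E a a' \<Longrightarrow> den_t E s s' \<Longrightarrow> den_t E b b' \<Longrightarrow> den_t E t t' \<Longrightarrow> den E (pair_less T R a s b t) (pless T' R' a' s' b' t')"
  unfolding pair_less_def pless_def
  by (rule den_rules | assumption | (erule den_mono, rule ext_refl) | (erule den1D den2D, rule ext_refl)
    | erule den_mono | erule den1D den2D | erule ext_extend)+

lemma den_Dfield [den_rules]:
  "den_s E T T' \<Longrightarrow> den1 E X X' \<Longrightarrow> den_t E x x' \<Longrightarrow> den E (D_field T X x) (Dfield T' X' x')"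
  unfolding D_field_def Dfield_def
  by (rule den_rules | assumption | (erule den_mono, rule ext_refl) | (erule den1D den2D, rule ext_refl)
    | erule den_mono | erule den1D den2D | erule ext_extend)+

lemma den_Dless [den_rules]:
  "den_s E T T' \<Longrightarrow> den1 E X X' \<Longrightarrow> den2 E R R' \<Longrightarrow> den_t E x x' \<Longrightarrow> den_t E y y' \<Longrightarrow> den E (D_less T X R x y) (Dless T' X' R' x' y')"
  unfolding D_less_def Dless_def
  by (rule den_rules | assumption | (erule den_mono, rule ext_refl) | (erule den1D den2D, rule ext_refl)
    | erule den_mono | erule den1D den2D | erule ext_extend)+

lemma den_dil [den_rules]:
  "den_s E T T' \<Longrightarrow> den E (dilator T) (dil T')"
  unfolding dilator_def dil_def
  by (rule den_rules | assumption | (erule den_mono, rule ext_refl) | (erule den1D den2D, rule ext_refl)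
    | erule den_mono | erule den1D den2D | erule ext_extend)+

lemma den_ndil [den_rules]:
  "den_s E T T' \<Longrightarrow> den E (normal_dilator T) (ndil T')"
  unfolding normal_dilator_def ndil_def
  by (rule den_rules | assumption | (erule den_mono, rule ext_refl) | (erule den1D den2D, rule ext_refl)
    | erule den_mono | erule den1D den2D | erule ext_extend)+

lemma den_mt [den_rules]:
  "den_t E m m' \<Longrightarrow> den_t E (mu_term m) (mt m')"
  unfolding mu_term_def mt_def
  by (rule den_rules | assumption | (erule den_mono, rule ext_refl) | (erule den1D den2D, rule ext_refl)
    | erule den_mono | erule den1D den2D | erule ext_extend)+

lemma den_xt [den_rules]:
  "den_t E a a' \<Longrightarrow> den_t E s s' \<Longrightarrow> den_t E (xi_term a s) (xt a' s')"
  unfolding xi_term_def xt_def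
  by (rule den_rules | assumption | (erule den_mono, rule ext_refl) | (erule den1D den2D, rule ext_refl)
    | erule den_mono | erule den1D den2D | erule ext_extend)+

lemma den_deriv [den_rules]:
  "den_s E T T' \<Longrightarrow> den_s E D D' \<Longrightarrow> den E (derivative T D) (deriv T' D')"
  unfolding derivative_def deriv_def deriv_elt_def deriv_below_def deriv_act_def deriv_supp_def
  by (rule den_rules | assumption | (erule den_mono, rule ext_refl) | (erule den1D den2D, rule ext_refl)
    | erule den_mono | erule den1D den2D | erule ext_extend)+

text \<open>Translates the formal sentence into a statement about the sets in \<open>\<S>\<close>,
  so that the remaining argument can be semantic.\<close>

lemma den_theorem:
  "den E (\<^bold>\<forall>\<^sub>2T. normal_dilator T \<^bold>\<longrightarrow>
       (\<^bold>\<exists>\<^sub>2D. derivative T D) \<^bold>\<and> (\<^bold>\<forall>\<^sub>2D. derivative T D \<^bold>\<longrightarrow> normal_dilator D))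
    (\<forall>T\<in>\<S>. ndil T \<longrightarrow> (\<exists>D\<in>\<S>. deriv T D) \<and> (\<forall>D\<in>\<S>. deriv T D \<longrightarrow> ndil D))"
  by (rule den_rules | assumption | (erule den_mono, rule ext_refl) | (erule den1D den2D, rule ext_refl)
    | erule den_mono | erule den1D den2D | erule ext_extend)+

end

section \<open>Models of the axioms\<close>

lemma Delta00_subst: "Delta00 p \<Longrightarrow> Delta00 (subst s r p)"
proof (induction p arbitrary: s r rule: Delta00.induct)
  case (6 p t)
  have "subst s r (AllN (Imp (Less (Var 0) (lift_tm t)) p)) =
    AllN (Imp (Less (Var 0) (lift_tm (subst_tm s t))) (subst (upN s) r p))"
    by (simp add: subst_tm_lift_tm lift_tm_subst_tm)
  then show ?case using 6 by (simp add: Delta00.intros)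
qed (auto intro: Delta00.intros)

lemma arithmetical_subst: "arithmetical (subst s r p) \<longleftrightarrow> arithmetical p"
  by (induction p arbitrary: s r) auto

lemma arithmetical_Delta00: "Delta00 p \<Longrightarrow> arithmetical p"
  by (induction p rule: Delta00.induct) auto

text \<open>Nonemptiness is listed because the axioms are asserted relative to assignments of sets,
  and there are none for an empty family.\<close>

locale model = struct zero one plus times lt \<S>
  for zero :: 'a ("\<zero>") and one :: 'a ("\<one>")
    and plus :: "'a \<Rightarrow> 'a \<Rightarrow> 'a" (infixl "\<oplus>" 65)
    and times :: "'a \<Rightarrow> 'a \<Rightarrow> 'a" (infixl "\<otimes>" 70)
    and lt :: "'a \<Rightarrow> 'a \<Rightarrow> bool" (infix "\<lhd>" 50)
    and \<S> :: "'a set set" +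
  assumes axioms: "p \<in> RCA0 \<union> Pi11_BI \<Longrightarrow> range V \<subseteq> \<S> \<Longrightarrow> sat v V p"
    and nonempty: "\<S> \<noteq> {}"
begin

section \<open>Definable functions and predicates\<close>

definition sh :: "nat \<Rightarrow> (nat \<Rightarrow> 'a) \<Rightarrow> (nat \<Rightarrow> 'a) \<Rightarrow> nat \<Rightarrow> 'a" where
  "sh k v w = (\<lambda>n. if n < k then v n else w (n - k))"

text \<open>Only the first \<open>k\<close> arguments of a definable function or predicate are variable; the values
  \<open>w\<close> and \<open>V\<close> serve as parameters.\<close>

definition tdef :: "nat \<Rightarrow> (nat \<Rightarrow> 'a) \<Rightarrow> ((nat \<Rightarrow> 'a) \<Rightarrow> 'a) \<Rightarrow> bool" where
  "tdef k w f \<longleftrightarrow> (\<exists>t. \<forall>v. f v = tval (sh k v w) t)"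

definition fdef :: "(fm \<Rightarrow> bool) \<Rightarrow> nat \<Rightarrow> (nat \<Rightarrow> 'a) \<Rightarrow> (nat \<Rightarrow> 'a set) \<Rightarrow> ((nat \<Rightarrow> 'a) \<Rightarrow> bool) \<Rightarrow> bool" where
  "fdef K k w V P \<longleftrightarrow> range V \<subseteq> \<S> \<and> (\<exists>p. K p \<and> (\<forall>v. P v = sat (sh k v w) V p))"

definition dt :: "((nat \<Rightarrow> 'a) \<Rightarrow> 'a) \<Rightarrow> bool" where
  "dt f \<longleftrightarrow> (\<exists>k w. tdef k w f)"

definition df :: "(fm \<Rightarrow> bool) \<Rightarrow> ((nat \<Rightarrow> 'a) \<Rightarrow> bool) \<Rightarrow> bool" where
  "df K P \<longleftrightarrow> (\<exists>k w V. fdef K k w V P)"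

lemma sh_mono:
  assumes "k \<le> k'" "range w \<subseteq> range w'"
  shows "\<exists>s. \<forall>v. sh k v w = (\<lambda>n. tval (sh k' v w') (s n))"
proof -
  from assms(2) have "\<forall>n. \<exists>m. w n = w' m" by blast
  then obtain m where m: "\<And>n. w n = w' (m n)" by metis
  have "sh k v w = (\<lambda>n. tval (sh k' v w') (if n < k then Var n else Var (k' + m (n - k))))" for v
    using assms(1) by (auto simp: sh_def m)
  then show ?thesis by (intro exI allI)
qed

lemma tdef_mono: "tdef k w f \<Longrightarrow> k \<le> k' \<Longrightarrow> range w \<subseteq> range w' \<Longrightarrow> tdef k' w' f"
  unfolding tdef_def using sh_mono[of k k' w w'] by (metis tval_subst)

text \<open>The closure properties shared by bounded and by arithmetical formulas, so that the rules
  for both can be derived at once.\<close>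

definition definability_class :: "(fm \<Rightarrow> bool) \<Rightarrow> bool" where
  "definability_class K \<longleftrightarrow> (\<forall>p s r. K p \<longrightarrow> K (subst s r p)) \<and>
    (\<forall>p. Delta00 p \<longrightarrow> K p) \<and> (\<forall>p q. K p \<longrightarrow> K q \<longrightarrow> K (Imp p q)) \<and>
    (\<forall>p t. K p \<longrightarrow> K (AllN (Imp (Less (Var 0) (lift_tm t)) p)))"

lemma definability_class: "definability_class Delta00" "definability_class arithmetical"
  by (auto simp: definability_class_def Delta00_subst arithmetical_subst arithmetical_Delta00
      intro: Delta00.intros)

lemma K_subst: "definability_class K \<Longrightarrow> K p \<Longrightarrow> K (subst s r p)"
  unfolding definability_class_def by blast

lemma K_Delta00: "definability_class K \<Longrightarrow> Delta00 p \<Longrightarrow> K p"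
  unfolding definability_class_def by blast

lemma fdef_mono:
  assumes K: "definability_class K"
    and P: "fdef K k w V P" and k: "k \<le> k'" and w: "range w \<subseteq> range w'"
    and V: "range V \<subseteq> range V'" "range V' \<subseteq> \<S>"
  shows "fdef K k' w' V' P"
proof -
  obtain s where s: "\<forall>v. sh k v w = (\<lambda>n. tval (sh k' v w') (s n))"
    using sh_mono[OF k w] by blast
  from V(1) have "\<forall>n. \<exists>m. V n = V' m" by blast
  then obtain r where "\<And>n. V n = V' (r n)" by metis
  then have r: "V = (\<lambda>n. V' (r n))" by blast
  obtain p where p: "K p" "\<forall>v. P v = sat (sh k v w) V p" using P unfolding fdef_def by blast
  have "P v = sat (sh k' v w') V' (subst s r p)" for v
    unfolding sat_subst using p(2) r s by simp
  then show ?thesis unfolding fdef_def using V(2) K_subst[OF K] p(1) by blast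
qed

text \<open>A definable predicate carries a single sequence of parameters. To combine two predicates
  their sequences are interleaved at even and odd places.\<close>

lemma merge:
  fixes w w' :: "nat \<Rightarrow> 'b"
  obtains u :: "nat \<Rightarrow> 'b" where "range u = range w \<union> range w'"
proof
  let ?u = "\<lambda>n. if even n then w (n div 2) else w' (n div 2)"
  have "w n \<in> range ?u" for n by (rule range_eqI[of _ _ "2 * n"]) simp
  moreover have "w' n \<in> range ?u" for n by (rule range_eqI[of _ _ "2 * n + 1"]) simp
  ultimately show "range ?u = range w \<union> range w'" by auto
qed

lemma dt_two:
  assumes "dt f" "dt g" obtains k w where "tdef k w f" "tdef k w g"
proof -
  obtain k w k' w' where f: "tdef k w f" and g: "tdef k' w' g" using assms unfolding dt_def by blast
  obtain u :: "nat \<Rightarrow> 'a" where u: "range u = range w \<union> range w'" by (rule merge[of w w'])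
  have "tdef (max k k') u f" "tdef (max k k') u g"
    using f g u by (auto elim: tdef_mono)
  then show thesis by (rule that)
qed

lemma df_two:
  assumes K: "definability_class K" and "df K P" "df K Q"
  obtains k w V where "fdef K k w V P" "fdef K k w V Q"
proof -
  obtain k w V k' w' V' where P: "fdef K k w V P" and Q: "fdef K k' w' V' Q"
    using assms unfolding df_def by blast
  obtain u :: "nat \<Rightarrow> 'a" where u: "range u = range w \<union> range w'" by (rule merge[of w w'])
  obtain U :: "nat \<Rightarrow> 'a set" where U: "range U = range V \<union> range V'" by (rule merge[of V V'])
  have VU: "range V \<subseteq> range U" "range V' \<subseteq> range U" using U by auto
  have US: "range U \<subseteq> \<S>" using P Q U unfolding fdef_def by simp
  then have "fdef K (max k k') u U P" "fdef K (max k k') u U Q"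
    using u by (auto intro: fdef_mono[OF K P _ _ VU(1) US] fdef_mono[OF K Q _ _ VU(2) US])
  then show thesis by (rule that)
qed

lemma fdef_tdef:
  assumes K: "definability_class K" and "df K P" "dt f"
  obtains k w V where "fdef K (Suc k) w V P" "tdef k w f"
proof -
  obtain k w V k' w' where P: "fdef K k w V P" and f: "tdef k' w' f"
    using assms unfolding df_def dt_def by blast
  obtain u :: "nat \<Rightarrow> 'a" where u: "range u = range w \<union> range w'" by (rule merge[of w w'])
  have "range V \<subseteq> \<S>" using P unfolding fdef_def by auto
  then have "fdef K (Suc (max k k')) u V P"
    using P u by (auto elim!: fdef_mono[OF K])
  moreover have "tdef (max k k') u f" using f u by (auto elim!: tdef_mono)
  ultimately show thesis by (rule that)
qed

named_theorems df_rules

lemma dt_var [df_rules]: "dt (\<lambda>v. v n)"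
  unfolding dt_def tdef_def by (rule exI[of _ "Suc n"]) (auto simp: sh_def intro!: exI[of _ "Var n"])

lemma dt_const [df_rules]: "dt (\<lambda>v. c)"
  unfolding dt_def tdef_def
  by (rule exI[of _ 0], rule exI[of _ "\<lambda>_. c"]) (auto simp: sh_def intro!: exI[of _ "Var 0"])

lemma dt_plus [df_rules]: assumes "dt f" "dt g" shows "dt (\<lambda>v. f v \<oplus> g v)"
proof -
  obtain k w where "tdef k w f" "tdef k w g" using assms by (rule dt_two)
  then obtain t u where "\<forall>v. f v = tval (sh k v w) t" "\<forall>v. g v = tval (sh k v w) u"
    unfolding tdef_def by blast
  then have "\<forall>v. f v \<oplus> g v = tval (sh k v w) (Add t u)" by simp
  then show ?thesis unfolding dt_def tdef_def by blast
qed

lemma dt_times [df_rules]: assumes "dt f" "dt g" shows "dt (\<lambda>v. f v \<otimes> g v)"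
proof -
  obtain k w where "tdef k w f" "tdef k w g" using assms by (rule dt_two)
  then obtain t u where "\<forall>v. f v = tval (sh k v w) t" "\<forall>v. g v = tval (sh k v w) u"
    unfolding tdef_def by blast
  then have "\<forall>v. f v \<otimes> g v = tval (sh k v w) (Mul t u)" by simp
  then show ?thesis unfolding dt_def tdef_def by blast
qed

lemma dt_pr [df_rules]: "dt f \<Longrightarrow> dt g \<Longrightarrow> dt (\<lambda>v. pr (f v) (g v))"
  unfolding pr_def by (intro df_rules)

context
  fixes K assumes K: "definability_class K"
begin

lemma df_False: "df K (\<lambda>v. False)"
proof -
  obtain A where "A \<in> \<S>" using nonempty by blast
  then show ?thesis unfolding df_def fdef_def
    by (intro exI[of _ 0] exI[of _ undefined] exI[of _ "\<lambda>_. A"])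
      (auto intro!: exI[of _ Fls] K_Delta00[OF K] Delta00.intros)
qed

lemma df_atom_aux:
  assumes "dt f" "dt g"
    "\<And>t u. Delta00 (F t u)" "\<And>t u v V. sat v V (F t u) \<longleftrightarrow> R (tval v t) (tval v u)"
  shows "df K (\<lambda>v. R (f v) (g v))"
proof -
  obtain A where A: "A \<in> \<S>" using nonempty by blast
  obtain k w where "tdef k w f" "tdef k w g" using assms(1,2) by (rule dt_two)
  then obtain t u where "\<forall>v. f v = tval (sh k v w) t" "\<forall>v. g v = tval (sh k v w) u"
    unfolding tdef_def by blast
  then show ?thesis using A assms(3,4) unfolding df_def fdef_def
    by (intro exI[of _ k] exI[of _ w] exI[of _ "\<lambda>_. A"])
      (auto intro!: exI[of _ "F t u"] K_Delta00[OF K])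
qed

lemma df_eq: "dt f \<Longrightarrow> dt g \<Longrightarrow> df K (\<lambda>v. f v = g v)"
  by (rule df_atom_aux[of f g Eq]) (auto intro: Delta00.intros)

lemma df_lt: "dt f \<Longrightarrow> dt g \<Longrightarrow> df K (\<lambda>v. f v \<lhd> g v)"
  by (rule df_atom_aux[of f g Less]) (auto intro: Delta00.intros)

lemma df_mem: "dt f \<Longrightarrow> A \<in> \<S> \<Longrightarrow> df K (\<lambda>v. f v \<in> A)"
proof -
  assume "dt f" and A: "A \<in> \<S>"
  then obtain k w t where "\<forall>v. f v = tval (sh k v w) t"
    unfolding dt_def tdef_def by blast
  then show ?thesis using A unfolding df_def fdef_def
    by (intro exI[of _ k] exI[of _ w] exI[of _ "\<lambda>_. A"])
      (auto intro!: exI[of _ "Mem t 0"] K_Delta00[OF K] Delta00.intros)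
qed

lemma df_imp: "df K P \<Longrightarrow> df K Q \<Longrightarrow> df K (\<lambda>v. P v \<longrightarrow> Q v)"
proof -
  assume "df K P" "df K Q"
  then obtain k w V where "fdef K k w V P" "fdef K k w V Q" by (rule df_two[OF K])
  then obtain p q where "range V \<subseteq> \<S>" "K p" "K q"
    "\<forall>v. P v = sat (sh k v w) V p" "\<forall>v. Q v = sat (sh k v w) V q" unfolding fdef_def by blast
  moreover from this have "K (Imp p q)" using K unfolding definability_class_def by blast
  ultimately have "fdef K k w V (\<lambda>v. P v \<longrightarrow> Q v)" unfolding fdef_def
    by (intro conjI exI[of _ "Imp p q"]) auto
  then show ?thesis unfolding df_def by blast
qed

lemma df_not: "df K P \<Longrightarrow> df K (\<lambda>v. \<not> P v)"
  using df_imp[OF _ df_False] by simp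

lemma df_conj: "df K P \<Longrightarrow> df K Q \<Longrightarrow> df K (\<lambda>v. P v \<and> Q v)"
  using df_not[OF df_imp[OF _ df_not], of P Q] by simp

lemma df_disj: "df K P \<Longrightarrow> df K Q \<Longrightarrow> df K (\<lambda>v. P v \<or> Q v)"
  using df_imp[OF df_not, of P Q] by (simp add: disj_imp)

lemma df_iff: "df K P \<Longrightarrow> df K Q \<Longrightarrow> df K (\<lambda>v. P v \<longleftrightarrow> Q v)"
  using df_conj[OF df_imp[of P Q] df_imp[of Q P]] unfolding iff_conv_conj_imp .

lemma sh_Suc: "sh (Suc k) (case_nat x v) w = case_nat x (sh k v w)"
  by (rule ext) (auto simp: sh_def split: nat.split)

text \<open>The premise is in de Bruijn style: \<open>v 0\<close> is the bound variable and all
  other places are shifted. Higher-order matching thus peels a HOL quantifier off the predicate, and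
  definability is proved by \<open>intro\<close> along its syntax.\<close>

lemma df_ball:
  assumes "dt f" "df K (\<lambda>v. Q (\<lambda>n. v (Suc n)) (v 0))"
  shows "df K (\<lambda>v. \<forall>x. x \<lhd> f v \<longrightarrow> Q v x)"
proof -
  obtain k w V where "fdef K (Suc k) w V (\<lambda>v. Q (\<lambda>n. v (Suc n)) (v 0))" and f: "tdef k w f"
    by (rule fdef_tdef[OF K assms(2,1)])
  then obtain p where V: "range V \<subseteq> \<S>" and p: "K p"
    "\<And>v. Q (\<lambda>n. v (Suc n)) (v 0) = sat (sh (Suc k) v w) V p"
    unfolding fdef_def by blast
  obtain t where t: "\<And>v. f v = tval (sh k v w) t" using f unfolding tdef_def by blast
  have "Q v x = sat (case_nat x (sh k v w)) V p" for v x
    using p(2)[of "case_nat x v"] by (simp add: sh_Suc)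
  then have "(\<forall>x. x \<lhd> f v \<longrightarrow> Q v x) = sat (sh k v w) V (AllN (Imp (Less (Var 0) (lift_tm t)) p))"
    for v by (simp add: t lift_tm_def tval_subst)
  moreover have "K (AllN (Imp (Less (Var 0) (lift_tm t)) p))"
    using K p(1) unfolding definability_class_def by blast
  ultimately have "fdef K k w V (\<lambda>v. \<forall>x. x \<lhd> f v \<longrightarrow> Q v x)" unfolding fdef_def using V by blast
  then show ?thesis unfolding df_def by blast
qed

lemma df_bex:
  assumes "dt f" "df K (\<lambda>v. Q (\<lambda>n. v (Suc n)) (v 0))"
  shows "df K (\<lambda>v. \<exists>x. x \<lhd> f v \<and> Q v x)"
  using df_not[OF df_ball[OF assms(1), of "\<lambda>v x. \<not> Q v x"]] df_not[OF assms(2)] by simp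

end

abbreviation "D0 \<equiv> df Delta00"
abbreviation "A0 \<equiv> df arithmetical"

lemmas D0_rules [df_rules] = df_False[OF definability_class(1)] df_eq[OF definability_class(1)]
  df_lt[OF definability_class(1)] df_mem[OF definability_class(1)] df_imp[OF definability_class(1)]
  df_not[OF definability_class(1)] df_conj[OF definability_class(1)] df_disj[OF definability_class(1)]
  df_iff[OF definability_class(1)] df_ball[OF definability_class(1)] df_bex[OF definability_class(1)]

lemmas A0_rules [df_rules] = df_False[OF definability_class(2)] df_eq[OF definability_class(2)]
  df_lt[OF definability_class(2)] df_mem[OF definability_class(2)] df_imp[OF definability_class(2)]
  df_not[OF definability_class(2)] df_conj[OF definability_class(2)] df_disj[OF definability_class(2)]
  df_iff[OF definability_class(2)]

lemma A0_all [df_rules]: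
  assumes "A0 (\<lambda>v. Q (\<lambda>n. v (Suc n)) (v 0))" shows "A0 (\<lambda>v. \<forall>x. Q v x)"
proof -
  obtain k w V where "fdef arithmetical (Suc k) w V (\<lambda>v. Q (\<lambda>n. v (Suc n)) (v 0))"
    by (rule fdef_tdef[OF definability_class(2) assms dt_const])
  then obtain p where V: "range V \<subseteq> \<S>" and p: "arithmetical p"
    "\<And>v. Q (\<lambda>n. v (Suc n)) (v 0) = sat (sh (Suc k) v w) V p"
    unfolding fdef_def by blast
  have "Q v x = sat (case_nat x (sh k v w)) V p" for v x
    using p(2)[of "case_nat x v"] by (simp add: sh_Suc[OF definability_class(1)])
  then have "fdef arithmetical k w V (\<lambda>v. \<forall>x. Q v x)" unfolding fdef_def using V p(1)
    by (intro conjI exI[of _ "AllN p"]) auto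
  then show ?thesis unfolding df_def by blast
qed

lemma A0_ex [df_rules]:
  assumes "A0 (\<lambda>v. Q (\<lambda>n. v (Suc n)) (v 0))" shows "A0 (\<lambda>v. \<exists>x. Q v x)"
  using A0_rules(6)[OF A0_all[of "\<lambda>v x. \<not> Q v x"]] A0_rules(6)[OF assms] by simp

section \<open>Induction, comprehension and bar induction as semantic principles\<close>

lemma unary_formula:
  assumes K: "definability_class K" and "df K (\<lambda>v. P (v 0))"
  obtains p v V where "K p" "range V \<subseteq> \<S>" "\<And>x. P x \<longleftrightarrow> sat (case_nat x v) V p"
proof -
  obtain k w V where "fdef K (Suc k) w V (\<lambda>v. P (v 0))"
    by (rule fdef_tdef[OF K assms(2) dt_const])
  then obtain p where p: "K p" "range V \<subseteq> \<S>" "\<And>v. P (v 0) = sat (sh (Suc k) v w) V p"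
    unfolding fdef_def by blast
  have "P x \<longleftrightarrow> sat (case_nat x (sh k (\<lambda>_. \<zero>) w)) V p" for x
    using p(3)[of "case_nat x (\<lambda>_. \<zero>)"] by (simp add: sh_Suc[OF K])
  then show thesis using p that by blast
qed

lemma D0_induct:
  assumes "D0 (\<lambda>v. P (v 0))" "P \<zero>" "\<And>n. P n \<Longrightarrow> P (n \<oplus> \<one>)"
  shows "P n"
proof -
  obtain p v V where p: "Delta00 p" "range V \<subseteq> \<S>" "\<And>x. P x \<longleftrightarrow> sat (case_nat x v) V p"
    by (rule unary_formula[OF definability_class(1) assms(1)]) (rule that)
  \<comment> \<open>A vacuous existential quantifier brings the bounded formula into the shape
    required by the induction axiom.\<close>
  let ?q = "ExN (lift p)"
  have q: "sat (case_nat x v) V ?q \<longleftrightarrow> P x" for x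
    by (simp add: p(3) sat_subst)
  have "Sigma01 ?q" unfolding Sigma01_def using Delta00_subst[OF p(1)] by blast
  then have "sat v V ((?q\<lbrakk>\<^bold>0\<rbrakk> \<^bold>\<and> (\<^bold>\<forall>n. ?q\<lbrakk>n\<rbrakk> \<^bold>\<longrightarrow> ?q\<lbrakk>n \<^bold>+ \<^bold>1\<rbrakk>) \<^bold>\<longrightarrow> (\<^bold>\<forall>n. ?q\<lbrakk>n\<rbrakk>)) 0 0)"
    using p(2) by (intro axioms) (auto simp: RCA0_def Sigma01_IND_def)
  moreover have "den (0, 0, v, V) (?q\<lbrakk>\<^bold>0\<rbrakk> \<^bold>\<and> (\<^bold>\<forall>n. ?q\<lbrakk>n\<rbrakk> \<^bold>\<longrightarrow> ?q\<lbrakk>n \<^bold>+ \<^bold>1\<rbrakk>) \<^bold>\<longrightarrow> (\<^bold>\<forall>n. ?q\<lbrakk>n\<rbrakk>))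
    (P \<zero> \<and> (\<forall>n. P n \<longrightarrow> P (n \<oplus> \<one>)) \<longrightarrow> (\<forall>n. P n))"
    unfolding q[symmetric]
    by (rule den_rules | rule den_app | assumption | rule ext_refl)+
  ultimately have "P \<zero> \<and> (\<forall>n. P n \<longrightarrow> P (n \<oplus> \<one>)) \<longrightarrow> (\<forall>n. P n)"
    using den_sat by blast
  then show ?thesis using assms(2,3) by blast
qed

lemma D1_CA:
  assumes "D0 (\<lambda>v. P (v 0) (v (Suc 0)))" "D0 (\<lambda>v. Q (v 0) (v (Suc 0)))"
    and PQ: "\<And>x. (\<exists>y. P y x) \<longleftrightarrow> (\<forall>y. Q y x)"
  shows "{x. \<exists>y. P y x} \<in> \<S>"
proof -
  obtain k w V where kw: "fdef Delta00 k w V (\<lambda>v. P (v 0) (v (Suc 0)))"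
    "fdef Delta00 k w V (\<lambda>v. Q (v 0) (v (Suc 0)))"
    by (rule df_two[OF definability_class(1) assms(1,2)])
  \<comment> \<open>Padding by two places ensures that \<open>v 0\<close> and
    \<open>v (Suc 0)\<close> are arguments and not parameters.\<close>
  have "fdef Delta00 (Suc (Suc k)) w V (\<lambda>v. P (v 0) (v (Suc 0)))"
    "fdef Delta00 (Suc (Suc k)) w V (\<lambda>v. Q (v 0) (v (Suc 0)))"
    using fdef_mono[OF definability_class(1) kw(1), of "Suc (Suc k)" w V]
      fdef_mono[OF definability_class(1) kw(2), of "Suc (Suc k)" w V] kw unfolding fdef_def by auto
  then obtain p q where p: "Delta00 p" "range V \<subseteq> \<S>"
    "\<And>v. P (v 0) (v (Suc 0)) = sat (sh (Suc (Suc k)) v w) V p"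
    and q: "Delta00 q" "\<And>v. Q (v 0) (v (Suc 0)) = sat (sh (Suc (Suc k)) v w) V q"
    unfolding fdef_def by blast
  define v where "v = sh k (\<lambda>_. \<zero>) w"
  have P: "P y x = sat (case_nat y (case_nat x v)) V p" for x y
    using p(3)[of "case_nat y (case_nat x (\<lambda>_. \<zero>))"]
    by (simp add: sh_Suc[OF definability_class(1)] v_def)
  have Q: "Q y x = sat (case_nat y (case_nat x v)) V q" for x y
    using q(2)[of "case_nat y (case_nat x (\<lambda>_. \<zero>))"]
    by (simp add: sh_Suc[OF definability_class(1)] v_def)
  have ex: "(\<exists>y. P y x) = sat (case_nat x v) V (ExN p)" for x by (simp add: P)
  have all: "(\<forall>y. Q y x) = sat (case_nat x v) V (AllN q)" for x by (simp add: Q)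
  have "sat v V (((\<^bold>\<forall>n. (ExN p)\<lbrakk>n\<rbrakk> \<^bold>\<longleftrightarrow> (AllN q)\<lbrakk>n\<rbrakk>) \<^bold>\<longrightarrow> (\<^bold>\<exists>\<^sub>2X. \<^bold>\<forall>n. n \<^bold>\<in> X \<^bold>\<longleftrightarrow> (ExN p)\<lbrakk>n\<rbrakk>)) 0 0)"
    using p(1,2) q(1) by (intro axioms) (auto simp: RCA0_def Delta01_CA_def Sigma01_def Pi01_def)
  moreover have "den (0, 0, v, V) ((\<^bold>\<forall>n. (ExN p)\<lbrakk>n\<rbrakk> \<^bold>\<longleftrightarrow> (AllN q)\<lbrakk>n\<rbrakk>) \<^bold>\<longrightarrow> (\<^bold>\<exists>\<^sub>2X. \<^bold>\<forall>n. n \<^bold>\<in> X \<^bold>\<longleftrightarrow> (ExN p)\<lbrakk>n\<rbrakk>))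
    ((\<forall>n. (\<exists>y. P y n) \<longleftrightarrow> (\<forall>y. Q y n)) \<longrightarrow> (\<exists>X\<in>\<S>. \<forall>n. n \<in> X \<longleftrightarrow> (\<exists>y. P y n)))"
    unfolding ex all
    by (rule den_rules | rule den_app | assumption | rule ext_refl | erule den_mono | erule ext_extend)+
  ultimately have "\<exists>X\<in>\<S>. \<forall>n. n \<in> X \<longleftrightarrow> (\<exists>y. P y n)" using PQ by (simp add: den_sat)
  then obtain X where "X \<in> \<S>" "X = {n. \<exists>y. P y n}" by blast
  then show ?thesis by simp
qed

lemma df_rename:
  assumes K: "definability_class K" and P: "df K P"
  shows "df K (\<lambda>v. P (\<lambda>n. v (\<sigma> n)))"
proof -
  obtain k w V p where p: "range V \<subseteq> \<S>" "K p" "\<And>v. P v = sat (sh k v w) V p"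
    using P unfolding df_def fdef_def by blast
  \<comment> \<open>Parameters start at \<open>k'\<close>, beyond every place to which
    \<open>\<sigma>\<close> sends one of the first \<open>k\<close> arguments.\<close>
  define k' where "k' = Suc (Max (insert 0 (\<sigma> ` {..<k})))"
  have k': "\<sigma> n < k'" if "n < k" for n
    unfolding k'_def using that by (simp add: le_imp_less_Suc)
  let ?s = "\<lambda>n. if n < k then Var (\<sigma> n) else Var (k' + (n - k))"
  have "sh k (\<lambda>n. v (\<sigma> n)) w = (\<lambda>n. tval (sh k' v w) (?s n))" for v
  proof
    fix n show "sh k (\<lambda>n. v (\<sigma> n)) w n = tval (sh k' v w) (?s n)"
      by (cases "n < k") (auto simp: sh_def k' dest!: le_Suc_ex simp: not_less)
  qed
  then have "P (\<lambda>n. v (\<sigma> n)) = sat (sh k' v w) V (subst ?s id p)" for v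
    by (simp add: p(3) sat_subst)
  then show ?thesis using p(1) K_subst[OF K p(2)] unfolding df_def fdef_def by blast
qed

lemma D0_CA:
  assumes "D0 (\<lambda>v. P (v 0))" shows "{x. P x} \<in> \<S>"
  using D1_CA[of "\<lambda>y x. P x" "\<lambda>y x. P x"] df_rename[OF definability_class(1) assms, of Suc] by simp

lemma bar_induction:
  assumes X: "X \<in> \<S>" "R \<in> \<S>" "wo (\<lambda>x. x \<in> X) (\<lambda>y x. pr y x \<in> R)"
    and p: "arithmetical p" "range V \<subseteq> \<S>"
      "\<And>x. P x \<longleftrightarrow> (\<forall>Z\<in>\<S>. sat (case_nat x v) (case_nat Z V) p)"
    and step: "\<And>x. x \<in> X \<Longrightarrow> (\<And>y. pr y x \<in> R \<Longrightarrow> P y) \<Longrightarrow> P x"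
    and x: "x \<in> X"
  shows "P x"
proof -
  \<comment> \<open>The order occupies the set variables 0 and 1 of the axiom. Below the set
    quantifier these are 1 and 2, so the parameters of \<open>p\<close> are moved to 3 and
    beyond.\<close>
  let ?q = "AllS (subst Var (case_nat 0 (\<lambda>n. Suc (Suc (Suc n)))) p)"
  let ?V = "case_nat X (case_nat R V)"
  have "(\<lambda>n. case_nat Z ?V (case_nat 0 (\<lambda>n. Suc (Suc (Suc n))) n)) = case_nat Z V" for Z
    by (rule ext) (simp split: nat.split)
  then have q: "sat (case_nat x v) ?V ?q \<longleftrightarrow> P x" for x
    by (simp add: p(3) sat_subst)
  have "Pi11 ?q" unfolding Pi11_def using p(1) arithmetical_subst by blast
  moreover have "range ?V \<subseteq> \<S>" using X(1,2) p(2) by (auto split: nat.split simp: image_subset_iff)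
  ultimately have "sat v ?V ((let X = param 0; R = param 1 in
      well_order (\<lambda>x. x \<^bold>\<in> X) (\<lambda>y x. \<langle>y, x\<rangle> \<^bold>\<in> R) \<^bold>\<longrightarrow>
      (\<^bold>\<forall>x. x \<^bold>\<in> X \<^bold>\<longrightarrow> (\<^bold>\<forall>y. \<langle>y, x\<rangle> \<^bold>\<in> R \<^bold>\<longrightarrow> ?q\<lbrakk>y\<rbrakk>) \<^bold>\<longrightarrow> ?q\<lbrakk>x\<rbrakk>) \<^bold>\<longrightarrow>
      (\<^bold>\<forall>x. x \<^bold>\<in> X \<^bold>\<longrightarrow> ?q\<lbrakk>x\<rbrakk>)) 0 0)"
    by (intro axioms) (auto simp: Pi11_BI_def)
  moreover have "den (0, 0, v, ?V) (let X = param 0; R = param 1 in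
      well_order (\<lambda>x. x \<^bold>\<in> X) (\<lambda>y x. \<langle>y, x\<rangle> \<^bold>\<in> R) \<^bold>\<longrightarrow>
      (\<^bold>\<forall>x. x \<^bold>\<in> X \<^bold>\<longrightarrow> (\<^bold>\<forall>y. \<langle>y, x\<rangle> \<^bold>\<in> R \<^bold>\<longrightarrow> ?q\<lbrakk>y\<rbrakk>) \<^bold>\<longrightarrow> ?q\<lbrakk>x\<rbrakk>) \<^bold>\<longrightarrow>
      (\<^bold>\<forall>x. x \<^bold>\<in> X \<^bold>\<longrightarrow> ?q\<lbrakk>x\<rbrakk>))
    (wo (\<lambda>x. x \<in> ?V 0) (\<lambda>y x. pr y x \<in> ?V 1) \<longrightarrow>
      (\<forall>x. x \<in> ?V 0 \<longrightarrow> (\<forall>y. pr y x \<in> ?V 1 \<longrightarrow> P y) \<longrightarrow> P x) \<longrightarrow> (\<forall>x. x \<in> ?V 0 \<longrightarrow> P x))"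
    unfolding Let_def q[symmetric]
    by (rule den_rules | rule den_app den_param | assumption | rule ext_refl | erule den_mono | erule ext_extend)+
  ultimately have "wo (\<lambda>x. x \<in> ?V 0) (\<lambda>y x. pr y x \<in> ?V 1) \<longrightarrow>
      (\<forall>x. x \<in> ?V 0 \<longrightarrow> (\<forall>y. pr y x \<in> ?V 1 \<longrightarrow> P y) \<longrightarrow> P x) \<longrightarrow> (\<forall>x. x \<in> ?V 0 \<longrightarrow> P x)"
    by (simp only: den_sat)
  then show ?thesis using X(3) step x by simp
qed

lemma A0_bar_induction:
  assumes X: "X \<in> \<S>" "R \<in> \<S>" "wo (\<lambda>x. x \<in> X) (\<lambda>y x. pr y x \<in> R)"
    and P: "A0 (\<lambda>v. P (v 0))"
    and step: "\<And>x. x \<in> X \<Longrightarrow> (\<And>y. pr y x \<in> R \<Longrightarrow> P y) \<Longrightarrow> P x"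
    and x: "x \<in> X"
  shows "P x"
proof -
  obtain p v V where p: "arithmetical p" "range V \<subseteq> \<S>" "\<And>x. P x \<longleftrightarrow> sat (case_nat x v) V p"
    by (rule unary_formula[OF definability_class(2) P]) (rule that)
  \<comment> \<open>A vacuous set quantifier turns the arithmetical formula into one to which bar
    induction applies.\<close>
  have "P x \<longleftrightarrow> (\<forall>Z\<in>\<S>. sat (case_nat x v) (case_nat Z V) (liftS p))" for x
    using nonempty by (auto simp: p(3) sat_subst)
  then show ?thesis
    using p(1) arithmetical_subst step
    by (intro bar_induction[OF X _ p(2) _ _ x, of "liftS p" P v]) blast+
qed

section \<open>The basic axioms as facts about the model\<close>

lemma basic_axiom:
  assumes "P 0 0 \<in> basic_axioms" and b: "\<And>E. den E P b"
  shows b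
proof -
  obtain A where "A \<in> \<S>" using nonempty by blast
  then have "range (\<lambda>_ :: nat. A) \<subseteq> \<S>" by blast
  moreover have "P 0 0 \<in> RCA0 \<union> Pi11_BI" using assms(1) unfolding RCA0_def by blast
  ultimately show ?thesis using axioms den_sat[OF b] by blast
qed

lemma suc_nonzero: "n \<oplus> \<one> \<noteq> \<zero>"
proof -
  have "\<forall>n. \<not> n \<oplus> \<one> = \<zero>"
    by (rule basic_axiom[of "\<^bold>\<forall>n. \<^bold>\<not> n \<^bold>+ \<^bold>1 \<^bold>= \<^bold>0"], unfold basic_axioms_def, blast)
       ((rule den_rules | assumption | rule ext_refl | erule den_mono | erule ext_extend)+)
  then show ?thesis by blast
qed

lemma suc_inject: "m \<oplus> \<one> = n \<oplus> \<one> \<longleftrightarrow> m = n"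
proof -
  have "\<forall>m. \<forall>n. m \<oplus> \<one> = n \<oplus> \<one> \<longrightarrow> m = n"
    by (rule basic_axiom[of "\<^bold>\<forall>m. \<^bold>\<forall>n. m \<^bold>+ \<^bold>1 \<^bold>= n \<^bold>+ \<^bold>1 \<^bold>\<longrightarrow> m \<^bold>= n"], unfold basic_axioms_def, blast)
       ((rule den_rules | assumption | rule ext_refl | erule den_mono | erule ext_extend)+)
  then show ?thesis by blast
qed

lemma plus_zero: "m \<oplus> \<zero> = m"
proof -
  have "\<forall>m. m \<oplus> \<zero> = m"
    by (rule basic_axiom[of "\<^bold>\<forall>m. m \<^bold>+ \<^bold>0 \<^bold>= m"], unfold basic_axioms_def, blast)
       ((rule den_rules | assumption | rule ext_refl | erule den_mono | erule ext_extend)+)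
  then show ?thesis by blast
qed

lemma plus_suc: "m \<oplus> (n \<oplus> \<one>) = (m \<oplus> n) \<oplus> \<one>"
proof -
  have "\<forall>m. \<forall>n. m \<oplus> (n \<oplus> \<one>) = (m \<oplus> n) \<oplus> \<one>"
    by (rule basic_axiom[of "\<^bold>\<forall>m. \<^bold>\<forall>n. m \<^bold>+ (n \<^bold>+ \<^bold>1) \<^bold>= (m \<^bold>+ n) \<^bold>+ \<^bold>1"], unfold basic_axioms_def, blast)
       ((rule den_rules | assumption | rule ext_refl | erule den_mono | erule ext_extend)+)
  then show ?thesis by blast
qed

lemma times_zero: "m \<otimes> \<zero> = \<zero>"
proof -
  have "\<forall>m. m \<otimes> \<zero> = \<zero>"
    by (rule basic_axiom[of "\<^bold>\<forall>m. m \<^bold>* \<^bold>0 \<^bold>= \<^bold>0"], unfold basic_axioms_def, blast)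
       ((rule den_rules | assumption | rule ext_refl | erule den_mono | erule ext_extend)+)
  then show ?thesis by blast
qed

lemma times_suc: "m \<otimes> (n \<oplus> \<one>) = (m \<otimes> n) \<oplus> m"
proof -
  have "\<forall>m. \<forall>n. m \<otimes> (n \<oplus> \<one>) = (m \<otimes> n) \<oplus> m"
    by (rule basic_axiom[of "\<^bold>\<forall>m. \<^bold>\<forall>n. m \<^bold>* (n \<^bold>+ \<^bold>1) \<^bold>= (m \<^bold>* n) \<^bold>+ m"], unfold basic_axioms_def, blast)
       ((rule den_rules | assumption | rule ext_refl | erule den_mono | erule ext_extend)+)
  then show ?thesis by blast
qed

lemma not_lt_zero: "\<not> m \<lhd> \<zero>"
proof -
  have "\<forall>m. \<not> m \<lhd> \<zero>"
    by (rule basic_axiom[of "\<^bold>\<forall>m. \<^bold>\<not> m \<^bold>< \<^bold>0"], unfold basic_axioms_def, blast)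
       ((rule den_rules | assumption | rule ext_refl | erule den_mono | erule ext_extend)+)
  then show ?thesis by blast
qed

lemma lt_suc: "m \<lhd> n \<oplus> \<one> \<longleftrightarrow> m \<lhd> n \<or> m = n"
proof -
  have "\<forall>m. \<forall>n. m \<lhd> n \<oplus> \<one> \<longleftrightarrow> m \<lhd> n \<or> m = n"
    by (rule basic_axiom[of "\<^bold>\<forall>m. \<^bold>\<forall>n. m \<^bold>< n \<^bold>+ \<^bold>1 \<^bold>\<longleftrightarrow> m \<^bold>< n \<^bold>\<or> m \<^bold>= n"], unfold basic_axioms_def, blast)
       ((rule den_rules | assumption | rule ext_refl | erule den_mono | erule ext_extend)+)
  then show ?thesis by blast
qed

end

section \<open>Arithmetic in a model\<close>

context model
begin

lemma plus_assoc': "(a \<oplus> b) \<oplus> c = a \<oplus> (b \<oplus> c)"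
proof (rule D0_induct[where P = "\<lambda>c. (a \<oplus> b) \<oplus> c = a \<oplus> (b \<oplus> c)"])
  show "D0 (\<lambda>v. (a \<oplus> b) \<oplus> v 0 = a \<oplus> (b \<oplus> v 0))" by (intro df_rules)
qed (simp_all add: plus_zero plus_suc)

lemma zero_plus: "\<zero> \<oplus> a = a"
proof (rule D0_induct[where P = "\<lambda>a. \<zero> \<oplus> a = a"])
  show "D0 (\<lambda>v. \<zero> \<oplus> v 0 = v 0)" by (intro df_rules)
qed (simp_all add: plus_zero plus_suc)

lemma suc_plus: "(a \<oplus> \<one>) \<oplus> b = (a \<oplus> b) \<oplus> \<one>"
proof (rule D0_induct[where P = "\<lambda>b. (a \<oplus> \<one>) \<oplus> b = (a \<oplus> b) \<oplus> \<one>"])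
  show "D0 (\<lambda>v. (a \<oplus> \<one>) \<oplus> v 0 = (a \<oplus> v 0) \<oplus> \<one>)" by (intro df_rules)
qed (simp_all add: plus_zero plus_suc)

lemma plus_comm: "a \<oplus> b = b \<oplus> a"
proof (rule D0_induct[where P = "\<lambda>b. a \<oplus> b = b \<oplus> a"])
  show "D0 (\<lambda>v. a \<oplus> v 0 = v 0 \<oplus> a)" by (intro df_rules)
qed (simp_all add: plus_zero zero_plus plus_suc suc_plus)

lemma plus_cancel: "a \<oplus> b = a \<oplus> c \<longleftrightarrow> b = c"
proof (rule D0_induct[where P = "\<lambda>a. a \<oplus> b = a \<oplus> c \<longleftrightarrow> b = c"])
  show "D0 (\<lambda>v. v 0 \<oplus> b = v 0 \<oplus> c \<longleftrightarrow> b = c)" by (intro df_rules)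
qed (simp_all add: zero_plus suc_plus suc_inject)

lemma zero_times: "\<zero> \<otimes> a = \<zero>"
proof (rule D0_induct[where P = "\<lambda>a. \<zero> \<otimes> a = \<zero>"])
  show "D0 (\<lambda>v. \<zero> \<otimes> v 0 = \<zero>)" by (intro df_rules)
qed (simp_all add: times_zero times_suc plus_zero)

lemma suc_times: "(a \<oplus> \<one>) \<otimes> b = (a \<otimes> b) \<oplus> b"
proof (rule D0_induct[where P = "\<lambda>b. (a \<oplus> \<one>) \<otimes> b = (a \<otimes> b) \<oplus> b"])
  show "D0 (\<lambda>v. (a \<oplus> \<one>) \<otimes> v 0 = (a \<otimes> v 0) \<oplus> v 0)" by (intro df_rules)
  show "(a \<oplus> \<one>) \<otimes> (n \<oplus> \<one>) = (a \<otimes> (n \<oplus> \<one>)) \<oplus> (n \<oplus> \<one>)"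
    if "(a \<oplus> \<one>) \<otimes> n = (a \<otimes> n) \<oplus> n" for n
    using that unfolding times_suc plus_suc by (metis plus_assoc' plus_comm)
qed (simp add: times_zero plus_zero)

lemma times_comm: "a \<otimes> b = b \<otimes> a"
proof (rule D0_induct[where P = "\<lambda>b. a \<otimes> b = b \<otimes> a"])
  show "D0 (\<lambda>v. a \<otimes> v 0 = v 0 \<otimes> a)" by (intro df_rules)
qed (simp_all add: times_zero zero_times times_suc suc_times)

lemma times_distrib: "a \<otimes> (b \<oplus> c) = (a \<otimes> b) \<oplus> (a \<otimes> c)"
proof (rule D0_induct[where P = "\<lambda>c. a \<otimes> (b \<oplus> c) = (a \<otimes> b) \<oplus> (a \<otimes> c)"])
  show "D0 (\<lambda>v. a \<otimes> (b \<oplus> v 0) = (a \<otimes> b) \<oplus> (a \<otimes> v 0))" by (intro df_rules)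
  show "a \<otimes> (b \<oplus> (n \<oplus> \<one>)) = (a \<otimes> b) \<oplus> (a \<otimes> (n \<oplus> \<one>))"
    if "a \<otimes> (b \<oplus> n) = (a \<otimes> b) \<oplus> (a \<otimes> n)" for n
    using that unfolding plus_suc times_suc by (simp add: plus_assoc')
qed (simp add: plus_zero times_zero)

lemma times_assoc: "(a \<otimes> b) \<otimes> c = a \<otimes> (b \<otimes> c)"
proof (rule D0_induct[where P = "\<lambda>c. (a \<otimes> b) \<otimes> c = a \<otimes> (b \<otimes> c)"])
  show "D0 (\<lambda>v. (a \<otimes> b) \<otimes> v 0 = a \<otimes> (b \<otimes> v 0))" by (intro df_rules)
  show "(a \<otimes> b) \<otimes> (n \<oplus> \<one>) = a \<otimes> (b \<otimes> (n \<oplus> \<one>))"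
    if "(a \<otimes> b) \<otimes> n = a \<otimes> (b \<otimes> n)" for n
    using that unfolding times_suc by (simp add: times_distrib)
qed (simp add: times_zero)

lemma times_one: "a \<otimes> \<one> = a"
  using times_suc[of a \<zero>] by (simp add: zero_plus times_zero)

lemma zero_lt_suc: "\<zero> \<lhd> a \<oplus> \<one>"
proof (rule D0_induct[where P = "\<lambda>a. \<zero> \<lhd> a \<oplus> \<one>"])
  show "D0 (\<lambda>v. \<zero> \<lhd> v 0 \<oplus> \<one>)" by (intro df_rules)
qed (use lt_suc in blast)+

lemma zero_or_suc: "a = \<zero> \<or> (\<exists>b. a = b \<oplus> \<one>)"
proof -
  have "a = \<zero> \<or> (\<exists>b. b \<lhd> a \<and> a = b \<oplus> \<one>)"
  proof (rule D0_induct[where P = "\<lambda>a. a = \<zero> \<or> (\<exists>b. b \<lhd> a \<and> a = b \<oplus> \<one>)"])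
    show "D0 (\<lambda>v. v 0 = \<zero> \<or> (\<exists>b. b \<lhd> v 0 \<and> v 0 = b \<oplus> \<one>))" by (intro df_rules)
  qed (use lt_suc in blast)+
  then show ?thesis by blast
qed

lemma lt_plus_suc: "a \<lhd> (a \<oplus> d) \<oplus> \<one>"
proof (rule D0_induct[where P = "\<lambda>d. a \<lhd> (a \<oplus> d) \<oplus> \<one>"])
  show "D0 (\<lambda>v. a \<lhd> (a \<oplus> v 0) \<oplus> \<one>)" by (intro df_rules)
qed (simp_all add: plus_zero plus_suc lt_suc)

lemma lt_iff: "a \<lhd> b \<longleftrightarrow> (\<exists>d. b = (a \<oplus> d) \<oplus> \<one>)"
proof -
  have s: "d \<lhd> b \<longrightarrow> d \<oplus> \<one> \<lhd> b \<oplus> \<one>" for b d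
  proof (rule D0_induct[where P = "\<lambda>b. d \<lhd> b \<longrightarrow> d \<oplus> \<one> \<lhd> b \<oplus> \<one>"])
    show "D0 (\<lambda>v. d \<lhd> v 0 \<longrightarrow> d \<oplus> \<one> \<lhd> v 0 \<oplus> \<one>)" by (intro df_rules)
  qed (use lt_suc not_lt_zero in blast)+
  \<comment> \<open>The witness is bounded by \<open>b\<close>, since so far induction is only
    available for bounded formulas.\<close>
  have "a \<lhd> b \<longrightarrow> (\<exists>d. d \<lhd> b \<and> b = (a \<oplus> d) \<oplus> \<one>)"
  proof (rule D0_induct[where P = "\<lambda>b. a \<lhd> b \<longrightarrow> (\<exists>d. d \<lhd> b \<and> b = (a \<oplus> d) \<oplus> \<one>)"])
    show "D0 (\<lambda>v. a \<lhd> v 0 \<longrightarrow> (\<exists>d. d \<lhd> v 0 \<and> v 0 = (a \<oplus> d) \<oplus> \<one>))" by (intro df_rules)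
    fix n assume IH: "a \<lhd> n \<longrightarrow> (\<exists>d. d \<lhd> n \<and> n = (a \<oplus> d) \<oplus> \<one>)"
    show "a \<lhd> n \<oplus> \<one> \<longrightarrow> (\<exists>d. d \<lhd> n \<oplus> \<one> \<and> n \<oplus> \<one> = (a \<oplus> d) \<oplus> \<one>)"
    proof
      assume "a \<lhd> n \<oplus> \<one>"
      then consider "a \<lhd> n" | "a = n" using lt_suc by blast
      then show "\<exists>d. d \<lhd> n \<oplus> \<one> \<and> n \<oplus> \<one> = (a \<oplus> d) \<oplus> \<one>"
      proof cases
        case 1
        then obtain d where "d \<lhd> n" "n = (a \<oplus> d) \<oplus> \<one>" using IH by blast
        then have "d \<oplus> \<one> \<lhd> n \<oplus> \<one>" "n \<oplus> \<one> = (a \<oplus> (d \<oplus> \<one>)) \<oplus> \<one>"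
          using s plus_suc by auto
        then show ?thesis by blast
      next
        case 2
        then show ?thesis using zero_lt_suc plus_zero by metis
      qed
    qed
  qed (simp add: not_lt_zero)
  then show ?thesis using lt_plus_suc by blast
qed

lemma lt_irrefl: "\<not> a \<lhd> a"
proof
  assume "a \<lhd> a"
  then obtain d where "a = a \<oplus> (d \<oplus> \<one>)" unfolding lt_iff plus_suc by blast
  then have "a \<oplus> \<zero> = a \<oplus> (d \<oplus> \<one>)" using plus_zero by simp
  then show False using plus_cancel suc_nonzero by metis
qed

lemma lt_trans: "a \<lhd> b \<Longrightarrow> b \<lhd> c \<Longrightarrow> a \<lhd> c"
proof -
  assume "a \<lhd> b" "b \<lhd> c"
  then obtain d e where "b = (a \<oplus> d) \<oplus> \<one>" "c = (b \<oplus> e) \<oplus> \<one>" unfolding lt_iff by blast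
  then have "c = (a \<oplus> (d \<oplus> (\<one> \<oplus> e))) \<oplus> \<one>" by (simp add: plus_assoc')
  then show ?thesis unfolding lt_iff by blast
qed

lemma lt_total: "a \<lhd> b \<or> a = b \<or> b \<lhd> a"
proof (rule D0_induct[where P = "\<lambda>b. a \<lhd> b \<or> a = b \<or> b \<lhd> a"])
  show "D0 (\<lambda>v. a \<lhd> v 0 \<or> a = v 0 \<or> v 0 \<lhd> a)" by (intro df_rules)
  show "a \<lhd> \<zero> \<or> a = \<zero> \<or> \<zero> \<lhd> a" using zero_or_suc[of a] zero_lt_suc by blast
  fix n assume "a \<lhd> n \<or> a = n \<or> n \<lhd> a"
  moreover have "n \<oplus> \<one> = a \<or> n \<oplus> \<one> \<lhd> a" if "n \<lhd> a"
  proof -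
    obtain d where d: "a = (n \<oplus> d) \<oplus> \<one>" using \<open>n \<lhd> a\<close> lt_iff by blast
    consider "d = \<zero>" | e where "d = e \<oplus> \<one>" using zero_or_suc by blast
    then show ?thesis
    proof cases
      case 2
      have "n \<oplus> d = (n \<oplus> \<one>) \<oplus> e" unfolding 2 plus_suc suc_plus ..
      then have "a = ((n \<oplus> \<one>) \<oplus> e) \<oplus> \<one>" using d by simp
      then show ?thesis unfolding lt_iff by blast
    qed (simp add: d plus_zero)
  qed
  ultimately show "a \<lhd> n \<oplus> \<one> \<or> a = n \<oplus> \<one> \<or> n \<oplus> \<one> \<lhd> a" using lt_suc by blast
qed

definition le :: "'a \<Rightarrow> 'a \<Rightarrow> bool" (infix "\<unlhd>" 50) where
  "a \<unlhd> b \<longleftrightarrow> a \<lhd> b \<or> a = b"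

text \<open>Truncated subtraction, with value zero where it is not possible; it belongs to the
  signature of the algebraic locale interpreted next.\<close>

definition minus :: "'a \<Rightarrow> 'a \<Rightarrow> 'a" where
  "minus a b = (if b \<unlhd> a then THE d. a = b \<oplus> d else \<zero>)"

lemma le_iff: "a \<unlhd> b \<longleftrightarrow> (\<exists>d. b = a \<oplus> d)"
  unfolding le_def lt_iff by (metis plus_suc plus_zero zero_or_suc)

lemma minus_plus: "minus (a \<oplus> b) a = b"
proof -
  have "a \<unlhd> a \<oplus> b" using le_iff by blast
  then show ?thesis unfolding minus_def by (simp add: plus_cancel)
qed

lemma minus_zero: "a \<unlhd> b \<Longrightarrow> minus a b = \<zero>"
proof (cases "b \<unlhd> a")
  case True
  moreover assume "a \<unlhd> b"
  ultimately have "a = b" unfolding le_def using lt_irrefl lt_trans by blast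
  then show ?thesis using minus_plus[of a \<zero>] plus_zero by simp
qed (simp add: minus_def)

text \<open>Gives access to the HOL library on ordered semirings, under the prefix \<open>M\<close>,
  for the possibly nonstandard numbers.\<close>

sublocale M: linordered_semidom
  where plus = "(\<oplus>)" and times = "(\<otimes>)" and zero = \<zero> and one = \<one> and less = "(\<lhd>)"
    and less_eq = "(\<unlhd>)" and minus = minus
proof
  fix a b c
  show "(a \<lhd> b) = (a \<unlhd> b \<and> \<not> b \<unlhd> a)"
    unfolding le_def using lt_irrefl lt_trans by blast
  show "a \<unlhd> a" by (simp add: le_def)
  show "a \<unlhd> b \<Longrightarrow> b \<unlhd> c \<Longrightarrow> a \<unlhd> c" unfolding le_def using lt_trans by blast
  show "a \<unlhd> b \<Longrightarrow> b \<unlhd> a \<Longrightarrow> a = b" unfolding le_def using lt_irrefl lt_trans by blast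
  show "a \<unlhd> b \<or> b \<unlhd> a" unfolding le_def using lt_total by blast
  show "a \<oplus> b \<oplus> c = a \<oplus> (b \<oplus> c)" by (rule plus_assoc')
  show "a \<oplus> b = b \<oplus> a" by (rule plus_comm)
  show "\<zero> \<oplus> a = a" by (rule zero_plus)
  show "a \<otimes> b \<otimes> c = a \<otimes> (b \<otimes> c)" by (rule times_assoc)
  show "a \<otimes> b = b \<otimes> a" by (rule times_comm)
  show "\<one> \<otimes> a = a" using times_one times_comm by simp
  show "(a \<oplus> b) \<otimes> c = a \<otimes> c \<oplus> b \<otimes> c" using times_distrib times_comm by metis
  show "a \<otimes> (b \<oplus> c) = a \<otimes> b \<oplus> a \<otimes> c" by (rule times_distrib)
  show "a \<otimes> minus b c = minus (a \<otimes> b) (a \<otimes> c)"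
  proof (cases "c \<unlhd> b")
    case True
    then show ?thesis unfolding le_iff by (auto simp: times_distrib minus_plus)
  next
    case False
    then obtain d where "c = b \<oplus> d" unfolding le_def using lt_total le_def le_iff by metis
    then have "a \<otimes> b \<unlhd> a \<otimes> c" using times_distrib le_iff by metis
    moreover have "b \<unlhd> c" using \<open>c = b \<oplus> d\<close> le_iff by blast
    ultimately show ?thesis by (simp add: minus_zero times_zero)
  qed
  show "minus (a \<oplus> b) a = b" by (rule minus_plus)
  show "minus (minus a b) c = minus a (b \<oplus> c)"
  proof (cases "b \<oplus> c \<unlhd> a")
    case True
    then obtain d where "a = b \<oplus> (c \<oplus> d)" unfolding le_iff plus_assoc' by blast
    then show ?thesis by (metis minus_plus plus_assoc')
  next
    case False
    then have "minus a (b \<oplus> c) = \<zero>" by (simp add: minus_def)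
    moreover have "minus (minus a b) c = \<zero>"
    proof (cases "b \<unlhd> a")
      case True
      then obtain d where d: "a = b \<oplus> d" unfolding le_iff by blast
      then have "\<not> c \<unlhd> d" using False unfolding le_iff by (metis plus_assoc')
      then show ?thesis using d by (metis minus_plus minus_def)
    next
      case False
      then have "minus a b = \<zero>" by (simp add: minus_def)
      moreover have "minus \<zero> c = \<zero>"
        using minus_zero le_iff zero_plus by metis
      ultimately show ?thesis by simp
    qed
    ultimately show ?thesis by simp
  qed
  show "\<zero> \<noteq> \<one>" using suc_nonzero[of \<zero>] zero_plus by simp
  show "\<zero> \<otimes> a = \<zero>" by (rule zero_times)
  show "a \<otimes> \<zero> = \<zero>" by (rule times_zero)
  show "a \<unlhd> b \<Longrightarrow> c \<oplus> a \<unlhd> c \<oplus> b" unfolding le_iff by (metis plus_assoc')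
  show "\<zero> \<lhd> \<one>" using zero_lt_suc[of \<zero>] zero_plus by simp
  show "a \<lhd> b \<Longrightarrow> \<zero> \<lhd> c \<Longrightarrow> c \<otimes> a \<lhd> c \<otimes> b"
  proof -
    assume "a \<lhd> b" "\<zero> \<lhd> c"
    then obtain d e where "b = (a \<oplus> d) \<oplus> \<one>" "c = (\<zero> \<oplus> e) \<oplus> \<one>" unfolding lt_iff by blast
    then have "c \<otimes> b = (c \<otimes> a \<oplus> (c \<otimes> d \<oplus> e)) \<oplus> \<one>"
      by (simp add: times_distrib times_one zero_plus plus_assoc')
    then show ?thesis unfolding lt_iff by blast
  qed
  show "b \<unlhd> a \<Longrightarrow> minus a b \<oplus> b = a" unfolding le_iff using minus_plus plus_comm by metis
  show "a \<noteq> \<zero> \<Longrightarrow> b \<noteq> \<zero> \<Longrightarrow> a \<otimes> b \<noteq> \<zero>"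
    by (metis plus_suc suc_nonzero times_suc zero_or_suc)
qed

end

section \<open>Arithmetical comprehension\<close>

context model
begin

lemma zero_le [simp]: "\<zero> \<unlhd> a"
  unfolding le_iff by (metis zero_plus)

lemma zero_lt_iff: "\<zero> \<lhd> a \<longleftrightarrow> a \<noteq> \<zero>"
  using zero_le[of a] lt_irrefl unfolding le_def by blast

lemma lt_suc_iff [simp]: "a \<lhd> b \<oplus> \<one> \<longleftrightarrow> a \<unlhd> b"
  unfolding le_def lt_suc ..

lemma suc_le_iff [simp]: "a \<oplus> \<one> \<unlhd> b \<longleftrightarrow> a \<lhd> b"
  by (metis lt_suc_iff M.not_less)

lemma suc_lt_suc [simp]: "a \<oplus> \<one> \<lhd> b \<oplus> \<one> \<longleftrightarrow> a \<lhd> b"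
  by simp

lemma le_plus1 [simp]: "a \<unlhd> a \<oplus> b" and le_plus2 [simp]: "b \<unlhd> a \<oplus> b"
  unfolding le_iff by (auto intro: plus_comm)

lemma le_times: "\<zero> \<lhd> b \<Longrightarrow> a \<unlhd> a \<otimes> b"
  using M.mult_left_mono[of \<one> b a] suc_le_iff[of \<zero> b] by (simp add: times_one)

text \<open>With \<open>s = x \<oplus> y\<close> the code lies between the square of
  \<open>s\<close> and that of \<open>s \<oplus> \<one>\<close>, as \<open>x \<unlhd> s\<close>.
  Codes are thus ordered first by the sum of the components, which also gives injectivity.\<close>

lemma pr_lt:
  assumes "x \<oplus> y \<lhd> u \<oplus> v" shows "pr x y \<lhd> pr u v"
proof -
  let ?s = "x \<oplus> y" and ?t = "u \<oplus> v"
  have "?s \<oplus> \<one> \<unlhd> ?t" using assms by simp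
  then have "(?s \<oplus> \<one>) \<otimes> (?s \<oplus> \<one>) \<unlhd> ?t \<otimes> ?t" by (intro M.mult_mono) simp_all
  moreover have "?s \<otimes> ?s \<oplus> x \<lhd> (?s \<oplus> \<one>) \<otimes> (?s \<oplus> \<one>)"
  proof -
    have "(?s \<oplus> \<one>) \<otimes> (?s \<oplus> \<one>) = ((?s \<otimes> ?s \<oplus> x) \<oplus> (y \<oplus> ?s)) \<oplus> \<one>"
      unfolding times_suc suc_times plus_suc by (simp add: plus_assoc')
    then show ?thesis unfolding lt_iff by blast
  qed
  ultimately show ?thesis unfolding pr_def
    by (meson M.less_le_trans M.order.trans le_plus1)
qed

lemma pr_inject [simp]: "pr x y = pr u v \<longleftrightarrow> x = u \<and> y = v"
proof
  assume eq: "pr x y = pr u v"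
  then have "x \<oplus> y = u \<oplus> v" using pr_lt lt_total lt_irrefl by metis
  moreover from this have "x = u" using eq unfolding pr_def by (simp add: plus_cancel)
  ultimately show "x = u \<and> y = v" by (simp add: plus_cancel)
qed simp

lemma le_pr1 [simp]: "x \<unlhd> pr x y" by (simp add: pr_def)

lemma le_pr2 [simp]: "y \<unlhd> pr x y"
proof -
  have "x \<oplus> y \<unlhd> (x \<oplus> y) \<otimes> (x \<oplus> y)"
    using le_times[of "x \<oplus> y" "x \<oplus> y"] unfolding le_def
    by (metis M.mult_zero_left le_def zero_le)
  then show ?thesis unfolding pr_def
    by (meson M.order.trans le_plus1 le_plus2)
qed

lemma pr_mono: "x \<unlhd> x' \<Longrightarrow> y \<lhd> y' \<Longrightarrow> pr x y \<lhd> pr x' y'"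
  by (intro pr_lt M.add_le_less_mono)

lemma pr_mono1: "x \<lhd> x' \<Longrightarrow> y \<unlhd> y' \<Longrightarrow> pr x y \<lhd> pr x' y'"
  by (intro pr_lt M.add_less_le_mono)

lemma A0_bool: "A0 (\<lambda>v. b)"
  using A0_rules(6)[OF A0_rules(1)] A0_rules(1) by (cases b) simp_all

lemma D0_bool: "D0 (\<lambda>v. b)"
  using D0_rules(6)[OF D0_rules(1)] D0_rules(1) by (cases b) simp_all

lemma D0_A0: "D0 P \<Longrightarrow> A0 P"
  unfolding df_def fdef_def by (metis arithmetical_Delta00)

text \<open>Components are bounded by the code of the pair, so decoding is a bounded search.\<close>

lemma pr_in_setof: "D0 (\<lambda>v. R (v 0) (v (Suc 0))) \<Longrightarrow> \<exists>A\<in>\<S>. \<forall>x y. pr x y \<in> A \<longleftrightarrow> R x y"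
proof -
  assume R: "D0 (\<lambda>v. R (v 0) (v (Suc 0)))"
  let ?P = "\<lambda>z. \<exists>x. x \<lhd> z \<oplus> \<one> \<and> (\<exists>y. y \<lhd> z \<oplus> \<one> \<and> z = pr x y \<and> R x y)"
  have "D0 (\<lambda>v. R (v (Suc 0)) (v 0))"
    using df_rename[OF definability_class(1) R, of "case_nat (Suc 0) (\<lambda>_. 0)"] by simp
  then have "D0 (\<lambda>v. ?P (v 0))" by (intro df_rules)
  then have "{z. ?P z} \<in> \<S>" by (rule D0_CA)
  moreover have "pr x y \<in> {z. ?P z} \<longleftrightarrow> R x y" for x y by auto
  ultimately show ?thesis by blast
qed

lemma UNIV_S: "UNIV \<in> \<S>"
  using D0_CA[of "\<lambda>_. True"] D0_bool by simp

section \<open>Arithmetical induction and minimal elements\<close>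

text \<open>If a descending sequence starts with \<open>x0\<close>, then its \<open>n\<close>-th
  member plus \<open>n\<close> is at most \<open>x0\<close>, which fails at
  \<open>n = x0 \<oplus> \<one>\<close>. The bounded form of this claim fits the induction available
  so far.\<close>

lemma lt_wo: "\<exists>R\<in>\<S>. (\<forall>x y. pr y x \<in> R \<longleftrightarrow> y \<lhd> x) \<and> wo (\<lambda>x. x \<in> UNIV) (\<lambda>y x. pr y x \<in> R)"
proof -
  obtain R where R: "R \<in> \<S>" "\<And>x y. pr y x \<in> R \<longleftrightarrow> y \<lhd> x"
    using pr_in_setof[of "\<lambda>y x. y \<lhd> x", OF D0_rules(3)[OF dt_var dt_var]] by blast
  have "\<not> desc (\<lhd>) F" if F: "F \<in> \<S>" for F
  proof
    assume desc: "desc (\<lhd>) F"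
    then obtain x0 where x0: "pr \<zero> x0 \<in> F" unfolding desc_def by blast
    have "\<exists>x. x \<lhd> x0 \<oplus> \<one> \<and> pr n x \<in> F \<and> x \<oplus> n \<lhd> x0 \<oplus> \<one>" for n
    proof (rule D0_induct[where P = "\<lambda>n. \<exists>x. x \<lhd> x0 \<oplus> \<one> \<and> pr n x \<in> F \<and> x \<oplus> n \<lhd> x0 \<oplus> \<one>"])
      show "D0 (\<lambda>v. \<exists>x. x \<lhd> x0 \<oplus> \<one> \<and> pr (v 0) x \<in> F \<and> x \<oplus> v 0 \<lhd> x0 \<oplus> \<one>)"
        by (intro df_rules F)
      show "\<exists>x. x \<lhd> x0 \<oplus> \<one> \<and> pr \<zero> x \<in> F \<and> x \<oplus> \<zero> \<lhd> x0 \<oplus> \<one>"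
        using x0 by (auto simp: plus_zero)
      fix n assume "\<exists>x. x \<lhd> x0 \<oplus> \<one> \<and> pr n x \<in> F \<and> x \<oplus> n \<lhd> x0 \<oplus> \<one>"
      then obtain x where x: "pr n x \<in> F" "x \<oplus> n \<unlhd> x0" by auto
      obtain y where y: "pr (n \<oplus> \<one>) y \<in> F" using desc unfolding desc_def by blast
      then have "y \<oplus> \<one> \<unlhd> x" using desc x(1) unfolding desc_def by simp
      then have "y \<oplus> (n \<oplus> \<one>) \<unlhd> x0"
        using x(2) M.add_right_mono[of "y \<oplus> \<one>" x n]
        by (metis M.add.commute M.add.left_commute M.order.trans)
      then show "\<exists>x. x \<lhd> x0 \<oplus> \<one> \<and> pr (n \<oplus> \<one>) x \<in> F \<and> x \<oplus> (n \<oplus> \<one>) \<lhd> x0 \<oplus> \<one>"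
        using y by (metis M.order.trans le_plus1 lt_suc_iff)
    qed
    from this[of "x0 \<oplus> \<one>"] obtain x where "x \<oplus> (x0 \<oplus> \<one>) \<unlhd> x0" by auto
    then show False using M.order.trans le_plus2 suc_le_iff lt_irrefl by metis
  qed
  then have "wo (\<lambda>x. x \<in> UNIV) (\<lambda>y x. pr y x \<in> R)"
    unfolding wo_def wfd_def lin_def R using lt_trans lt_irrefl lt_total by auto
  then show ?thesis using R by blast
qed

text \<open>Bar induction along the order of the numbers extends induction from bounded to
  arithmetical formulas.\<close>

lemma A0_less_induct:
  assumes "A0 (\<lambda>v. P (v 0))" "\<And>x. (\<And>y. y \<lhd> x \<Longrightarrow> P y) \<Longrightarrow> P x"
  shows "P x"
proof -
  obtain R where R: "R \<in> \<S>" "\<And>x y. pr y x \<in> R \<longleftrightarrow> y \<lhd> x"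
    "wo (\<lambda>x. x \<in> UNIV) (\<lambda>y x. pr y x \<in> R)" using lt_wo by blast
  show ?thesis
    using A0_bar_induction[OF UNIV_S R(1,3) assms(1)] assms(2) R(2) by blast
qed

lemma A0_induct:
  assumes "A0 (\<lambda>v. P (v 0))" "P \<zero>" "\<And>n. P n \<Longrightarrow> P (n \<oplus> \<one>)"
  shows "P n"
proof (rule A0_less_induct[OF assms(1)])
  fix x assume "\<And>y. y \<lhd> x \<Longrightarrow> P y"
  then show "P x" using zero_or_suc[of x] assms(2,3) by (metis lt_suc)
qed

lemma A0_least:
  assumes "A0 (\<lambda>v. P (v 0))" "P x"
  shows "\<exists>m. P m \<and> (\<forall>k. k \<lhd> m \<longrightarrow> \<not> P k)"
proof (rule ccontr)
  assume none: "\<not> ?thesis"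
  have "\<not> P x"
  proof (rule A0_less_induct[where P = "\<lambda>x. \<not> P x"])
    show "A0 (\<lambda>v. \<not> P (v 0))" using assms(1) by (intro df_rules)
  qed (use none in blast)
  then show False using assms(2) by blast
qed

text \<open>The internal version of minimal elements in finite strict partial orders. When the bound
  grows by one, the old minimum is kept unless the new number lies below it; in that case
  transitivity makes the new number minimal.\<close>

lemma bounded_minimal:
  assumes P: "A0 (\<lambda>v. P (v 0))" and R: "A0 (\<lambda>v. R (v 0) (v (Suc 0)))"
    and irrefl: "\<And>x. P x \<Longrightarrow> \<not> R x x"
    and trans: "\<And>x y z. P x \<Longrightarrow> P y \<Longrightarrow> P z \<Longrightarrow> R x y \<Longrightarrow> R y z \<Longrightarrow> R x z"
    and ex: "P x" "\<And>x. P x \<Longrightarrow> x \<lhd> u"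
  shows "\<exists>x. P x \<and> (\<forall>y. P y \<longrightarrow> \<not> R y x)"
proof -
  have "A0 (\<lambda>v. P (v (Suc 0)))" "A0 (\<lambda>v. R (v 0) (v (Suc 0)))"
    using df_rename[OF definability_class(2) P, of Suc] R by auto
  have "(\<exists>x. x \<lhd> u \<and> P x) \<longrightarrow> (\<exists>x. x \<lhd> u \<and> P x \<and> (\<forall>y. y \<lhd> u \<and> P y \<longrightarrow> \<not> R y x))"
  proof (rule A0_induct[where P = "\<lambda>u. (\<exists>x. x \<lhd> u \<and> P x) \<longrightarrow> (\<exists>x. x \<lhd> u \<and> P x \<and> (\<forall>y. y \<lhd> u \<and> P y \<longrightarrow> \<not> R y x))"])
    show "A0 (\<lambda>v. (\<exists>x. x \<lhd> v 0 \<and> P x) \<longrightarrow> (\<exists>x. x \<lhd> v 0 \<and> P x \<and> (\<forall>y. y \<lhd> v 0 \<and> P y \<longrightarrow> \<not> R y x)))"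
      by (intro df_rules P R)
    fix n assume IH: "(\<exists>x. x \<lhd> n \<and> P x) \<longrightarrow> (\<exists>x. x \<lhd> n \<and> P x \<and> (\<forall>y. y \<lhd> n \<and> P y \<longrightarrow> \<not> R y x))"
    show "(\<exists>x. x \<lhd> n \<oplus> \<one> \<and> P x) \<longrightarrow>
      (\<exists>x. x \<lhd> n \<oplus> \<one> \<and> P x \<and> (\<forall>y. y \<lhd> n \<oplus> \<one> \<and> P y \<longrightarrow> \<not> R y x))"
    proof (cases "\<exists>x. x \<lhd> n \<and> P x")
      case True
      then obtain x where x: "x \<lhd> n" "P x" "\<And>y. y \<lhd> n \<Longrightarrow> P y \<Longrightarrow> \<not> R y x" using IH by blast
      show ?thesis
      proof (cases "P n \<and> R n x")
        case True
        then have "\<not> R y n" if "y \<lhd> n \<oplus> \<one>" "P y" for y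
          using that x trans irrefl unfolding lt_suc by blast
        then show ?thesis using True lt_suc by blast
      next
        case False
        then have "\<not> R y x" if "y \<lhd> n \<oplus> \<one>" "P y" for y
          using that x unfolding lt_suc by blast
        then show ?thesis using x lt_suc by blast
      qed
    next
      case False
      then show ?thesis unfolding lt_suc using irrefl by blast
    qed
  qed (simp add: not_lt_zero)
  then show ?thesis using ex by blast
qed

text \<open>The stages \<open>z\<close> at which an element \<open>n\<close> is enumerated into the projection of \<open>X\<close> are ordered so
  that the true stages (after which no smaller element appears) come in reverse order
  after all other ones. A descending sequence would consist of true stages, so
  the projection can be decided from it; without descending sequences, bar induction excludes
  true stages altogether.\<close>

lemma Sigma01_CA:
  assumes X: "X \<in> \<S>" shows "{n. \<exists>m. pr n m \<in> X} \<in> \<S>"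
proof (rule ccontr)
  assume notS: "\<not> ?thesis"
  \<comment> \<open>Only the least witness \<open>m\<close> counts, so that a stage and the number
    enumerated there determine each other.\<close>
  define e where "e z n \<longleftrightarrow> (\<exists>m. m \<lhd> z \<oplus> \<one> \<and> z = pr n m \<and> z \<in> X \<and> (\<forall>k. k \<lhd> m \<longrightarrow> \<not> pr n k \<in> X))" for z n
  have e_D0 [df_rules]: "D0 (\<lambda>v. e (v i) (v j))" for i j
    unfolding e_def by (intro df_rules X)
  note e_A0 [df_rules] = D0_A0[OF e_D0]
  have e_le: "n \<unlhd> z" if "e z n" for z n using that unfolding e_def by auto
  have e_inj: "z = z'" if "e z n" "e z' n" for z z' n
  proof -
    obtain m m' where m: "z = pr n m" "z' = pr n m'" "pr n m \<in> X" "pr n m' \<in> X"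
      "\<forall>k. k \<lhd> m \<longrightarrow> \<not> pr n k \<in> X" "\<forall>k. k \<lhd> m' \<longrightarrow> \<not> pr n k \<in> X"
      using \<open>e z n\<close> \<open>e z' n\<close> unfolding e_def by auto
    then have "m = m'" using lt_total by metis
    then show ?thesis using m by simp
  qed
  have e_fun: "n = n'" if "e z n" "e z n'" for z n n'
    using that unfolding e_def by auto
  have e_ex: "(\<exists>m. pr n m \<in> X) \<longleftrightarrow> (\<exists>z. e z n)" for n
  proof
    assume "\<exists>m. pr n m \<in> X"
    then obtain m where "pr n m \<in> X" "\<forall>k. k \<lhd> m \<longrightarrow> \<not> pr n k \<in> X"
      using A0_least[of "\<lambda>m. pr n m \<in> X", OF A0_rules(4)[OF _ X]] dt_pr[OF dt_const dt_var] by blast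
    then have "e (pr n m) n" unfolding e_def by auto
    then show "\<exists>z. e z n" by blast
  qed (auto simp: e_def)
  \<comment> \<open>If the stages were bounded, bounded search would already decide the
    projection.\<close>
  have unbounded: "\<exists>z n. e z n \<and> b \<lhd> z" for b
  proof (rule ccontr)
    assume "\<not> ?thesis"
    then have "(\<exists>z. e z n) \<longleftrightarrow> (\<exists>z. z \<lhd> b \<oplus> \<one> \<and> e z n)" for n
      by (metis M.not_less lt_suc_iff)
    moreover have "{n. \<exists>z. z \<lhd> b \<oplus> \<one> \<and> e z n} \<in> \<S>"
      by (rule D0_CA) (intro df_rules)
    ultimately show False using notS e_ex by simp
  qed
  \<comment> \<open>Up to \<open>t\<close> the stage \<open>s\<close> looks true: no stage in
    between, nor \<open>t\<close> itself, enumerates a smaller number. All quantifiers are bounded,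
    so the order built from this is a set of the model.\<close>
  define tr where "tr s t \<longleftrightarrow> (\<forall>u. u \<lhd> t \<oplus> \<one> \<longrightarrow> s \<lhd> u \<longrightarrow> (\<forall>n. n \<lhd> t \<oplus> \<one> \<longrightarrow> e u n \<longrightarrow>
     (\<forall>k. k \<lhd> s \<oplus> \<one> \<longrightarrow> e s k \<longrightarrow> k \<lhd> n)))" for s t
  have trI: "tr s t" if "\<And>u n k. u \<unlhd> t \<Longrightarrow> s \<lhd> u \<Longrightarrow> e u n \<Longrightarrow> e s k \<Longrightarrow> k \<lhd> n" for s t
    using that unfolding tr_def by auto
  have trD: "k \<lhd> n" if "tr s t" "u \<unlhd> t" "s \<lhd> u" "e u n" "e s k" for s t u n k
    using that e_le[of u n] e_le[of s k] unfolding tr_def by (auto intro: M.order.trans)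
  have tr_D0 [df_rules]: "D0 (\<lambda>v. tr (v i) (v j))" for i j
    unfolding tr_def by (intro df_rules)
  note tr_A0 [df_rules] = D0_A0[OF tr_D0]
  define Z where "Z z \<longleftrightarrow> (\<exists>n. n \<lhd> z \<oplus> \<one> \<and> e z n)" for z
  have Z: "Z z \<longleftrightarrow> (\<exists>n. e z n)" for z unfolding Z_def using e_le by auto
  have Z_D0 [df_rules]: "D0 (\<lambda>v. Z (v i))" for i
    unfolding Z_def by (intro df_rules)
  note Z_A0 [df_rules] = D0_A0[OF Z_D0]
  \<comment> \<open>For \<open>s \<lhd> t\<close> the later stage \<open>t\<close> comes first as
    long as \<open>s\<close> looks true at \<open>t\<close>; otherwise \<open>s\<close> comes
    first.\<close>
  define before where "before y x \<longleftrightarrow> Z y \<and> Z x \<and> ((x \<lhd> y \<and> tr x y) \<or> (y \<lhd> x \<and> \<not> tr y x))" for y x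
  have before_D0 [df_rules]: "D0 (\<lambda>v. before (v i) (v j))" for i j
    unfolding before_def by (intro df_rules)
  note before_A0 [df_rules] = D0_A0[OF before_D0]
  obtain R where R: "R \<in> \<S>" "\<And>y x. pr y x \<in> R \<longleftrightarrow> before y x"
    using pr_in_setof[of before] before_D0[of 0 "Suc 0"] by blast
  have ZS: "{z. Z z} \<in> \<S>" by (rule D0_CA) (intro df_rules)
  have tr1: "tr s t" if "tr s u" "t \<unlhd> u" for s t u
    by (rule trI) (use that trD in \<open>blast intro: M.order.trans\<close>)
  have tr2: "tr s u" if "tr s t" "tr t u" "s \<lhd> t" "Z t" for s t u
  proof (rule trI)
    fix w n k assume w: "w \<unlhd> u" "s \<lhd> w" "e w n" "e s k"
    obtain m where m: "e t m" using \<open>Z t\<close> Z by blast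
    have "k \<lhd> m" using trD[OF \<open>tr s t\<close> _ \<open>s \<lhd> t\<close> m w(4)] by simp
    show "k \<lhd> n"
    proof (cases "t \<lhd> w")
      case True
      then have "m \<lhd> n" using trD[OF \<open>tr t u\<close> w(1) _ w(3) m] by simp
      then show ?thesis using \<open>k \<lhd> m\<close> lt_trans by blast
    next
      case False
      then show ?thesis using trD[OF \<open>tr s t\<close> _ w(2,3,4)] by (simp add: M.not_less)
    qed
  qed
  have irrefl: "\<not> before x x" for x unfolding before_def using lt_irrefl by blast
  have total: "before x y \<or> x = y \<or> before y x" if "Z x" "Z y" for x y
    unfolding before_def using that lt_total by blast
  \<comment> \<open>By totality a failure would produce a cycle of three stages, and
    \<open>tr1\<close> and \<open>tr2\<close> exclude every such cycle.\<close>
  have trans: "before x z" if "before x y" "before y z" for x y z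
  proof (rule ccontr)
    assume "\<not> before x z"
    moreover have "Z x" "Z y" "Z z" using that unfolding before_def by auto
    moreover have "x \<noteq> z" using that unfolding before_def using lt_irrefl lt_trans by blast
    ultimately have zx: "before z x" using total by blast
    note b = that[unfolded before_def] zx[unfolded before_def]
    show False using b tr1 tr2 lt_trans lt_irrefl M.less_imp_le by metis
  qed
  have lin: "lin (\<lambda>x. x \<in> {z. Z z}) (\<lambda>y x. pr y x \<in> R)"
    unfolding lin_def R using irrefl trans total by (auto simp: before_def)
  define true where "true s \<longleftrightarrow> (\<forall>u. s \<lhd> u \<longrightarrow> (\<forall>n. e u n \<longrightarrow> (\<forall>k. e s k \<longrightarrow> k \<lhd> n)))" for s
  have true_A0 [df_rules]: "A0 (\<lambda>v. true (v i))" for i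
    unfolding true_def by (intro df_rules)
  have true_tr: "true s \<Longrightarrow> tr s t" for s t unfolding true_def by (auto intro: trI)
  have "\<not> desc before F" if F: "F \<in> \<S>" for F
  proof
    assume desc: "desc before F"
    have fun_F: "x = y" if "pr n x \<in> F" "pr n y \<in> F" for n x y
      using desc that unfolding desc_def by blast
    have ex_F: "\<exists>x. pr n x \<in> F" for n using desc unfolding desc_def by blast
    have step: "before y x" if "pr n x \<in> F" "pr (n \<oplus> \<one>) y \<in> F" for n x y
      using desc that unfolding desc_def by blast
    have less: "\<forall>x y. pr i x \<in> F \<and> pr (i \<oplus> \<one> \<oplus> j) y \<in> F \<longrightarrow> before y x" for i j
    proof (rule A0_induct[where P = "\<lambda>j. \<forall>x y. pr i x \<in> F \<and> pr (i \<oplus> \<one> \<oplus> j) y \<in> F \<longrightarrow> before y x"])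
      show "A0 (\<lambda>v. \<forall>x y. pr i x \<in> F \<and> pr (i \<oplus> \<one> \<oplus> v 0) y \<in> F \<longrightarrow> before y x)"
        by (intro df_rules F)
      show "\<forall>x y. pr i x \<in> F \<and> pr (i \<oplus> \<one> \<oplus> \<zero>) y \<in> F \<longrightarrow> before y x"
        using step by (auto simp: plus_zero)
      show "\<forall>x y. pr i x \<in> F \<and> pr (i \<oplus> \<one> \<oplus> (n \<oplus> \<one>)) y \<in> F \<longrightarrow> before y x"
        if IH: "\<forall>x y. pr i x \<in> F \<and> pr (i \<oplus> \<one> \<oplus> n) y \<in> F \<longrightarrow> before y x" for n
      proof (intro allI impI)
        fix x y assume xy: "pr i x \<in> F \<and> pr (i \<oplus> \<one> \<oplus> (n \<oplus> \<one>)) y \<in> F"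
        obtain z where z: "pr (i \<oplus> \<one> \<oplus> n) z \<in> F" using ex_F by blast
        show "before y x" using trans[OF step[OF z]] IH z xy unfolding plus_suc by blast
      qed
    qed
    \<comment> \<open>If a member \<open>x\<close> is not true, a stage \<open>u\<close> reveals
      this, and all stages before \<open>x\<close> are then smaller than \<open>u\<close>. The rest
      of the sequence would be bounded and hence have a minimal member.\<close>
    have all_true: "true x" if x: "pr i x \<in> F" for i x
    proof (rule ccontr)
      assume "\<not> true x"
      then obtain u n k where u: "x \<lhd> u" "e u n" "e x k" "\<not> k \<lhd> n" unfolding true_def by blast
      have "y \<lhd> u" if "before y x" for y
      proof (rule ccontr)
        assume "\<not> y \<lhd> u"
        then have "x \<lhd> y" "u \<unlhd> y" using u(1) by (auto simp: M.not_less intro: M.less_le_trans)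
        then have "tr x y" using that lt_trans lt_irrefl unfolding before_def by blast
        then show False using trD[OF _ \<open>u \<unlhd> y\<close> u(1,2,3)] u(4) by blast
      qed
      then have bd: "y \<lhd> u" if "\<exists>j. pr (i \<oplus> \<one> \<oplus> j) y \<in> F" for y
        using that less x by blast
      obtain y0 where "\<exists>j. pr (i \<oplus> \<one> \<oplus> j) y0 \<in> F" using ex_F by blast
      then have "\<exists>y. (\<exists>j. pr (i \<oplus> \<one> \<oplus> j) y \<in> F) \<and> (\<forall>z. (\<exists>j. pr (i \<oplus> \<one> \<oplus> j) z \<in> F) \<longrightarrow> \<not> before z y)"
        using irrefl trans bd
        by (intro bounded_minimal[where R = before]) (intro df_rules F | blast)+
      then obtain y j where "pr (i \<oplus> \<one> \<oplus> j) y \<in> F" "\<And>z j. pr (i \<oplus> \<one> \<oplus> j) z \<in> F \<Longrightarrow> \<not> before z y"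
        by blast
      then show False using step ex_F plus_suc by metis
    qed
    have incr: "x \<lhd> y" if "pr i x \<in> F" "pr (i \<oplus> \<one>) y \<in> F" for i x y
      using step[OF that] true_tr[OF all_true[OF that(2)]] unfolding before_def by blast
    \<comment> \<open>The members are increasing true stages, so the numbers they enumerate increase
      strictly and the \<open>i\<close>-th one is at least \<open>i\<close>.\<close>
    have large: "\<exists>x n. pr i x \<in> F \<and> e x n \<and> i \<unlhd> n" for i
    proof -
      have "\<exists>x n. pr i x \<in> F \<and> e x n \<and> i \<lhd> n \<oplus> \<one>"
      proof (rule A0_induct[where P = "\<lambda>i. \<exists>x n. pr i x \<in> F \<and> e x n \<and> i \<lhd> n \<oplus> \<one>"])
        show "A0 (\<lambda>v. \<exists>x n. pr (v 0) x \<in> F \<and> e x n \<and> v 0 \<lhd> n \<oplus> \<one>)"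
          by (intro df_rules F)
        have Zx: "Z x" if "pr i x \<in> F" for i x
          using ex_F[of "i \<oplus> \<one>"] step[OF that] unfolding before_def by blast
        show "\<exists>x n. pr \<zero> x \<in> F \<and> e x n \<and> \<zero> \<lhd> n \<oplus> \<one>"
          using Zx ex_F Z by (metis zero_lt_suc)
        fix i assume "\<exists>x n. pr i x \<in> F \<and> e x n \<and> i \<lhd> n \<oplus> \<one>"
        then obtain x n where x: "pr i x \<in> F" "e x n" "i \<unlhd> n" by auto
        obtain y where y: "pr (i \<oplus> \<one>) y \<in> F" using ex_F by blast
        obtain k where k: "e y k" using Zx[OF y] Z by blast
        have "n \<lhd> k" using all_true[OF x(1)] incr[OF x(1) y] k x(2) unfolding true_def by blast
        then have "i \<oplus> \<one> \<lhd> k \<oplus> \<one>" using x(3) by (simp add: M.le_less_trans)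
        then show "\<exists>x n. pr (i \<oplus> \<one>) x \<in> F \<and> e x n \<and> i \<oplus> \<one> \<lhd> n \<oplus> \<one>" using y k by blast
      qed
      then show ?thesis by simp
    qed
    \<comment> \<open>The true stage \<open>w\<close> enumerates a number beyond \<open>n\<close>.
      Nothing smaller is enumerated later, so the stage of \<open>n\<close> precedes
      \<open>w\<close> and can be found by bounded search.\<close>
    have decide: "z \<lhd> w" if w: "pr (n \<oplus> \<one>) w \<in> F" and z: "e z n" for n w z
    proof -
      obtain k where k: "e w k" "n \<lhd> k" using large[of "n \<oplus> \<one>"] fun_F[OF _ w] by (metis suc_le_iff)
      have "z \<noteq> w" using k z e_fun lt_irrefl by blast
      moreover have "\<not> w \<lhd> z"
        using all_true[OF w] k z lt_trans lt_irrefl unfolding true_def by blast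
      ultimately show ?thesis using lt_total by blast
    qed
    have "{n. \<exists>w. pr (n \<oplus> \<one>) w \<in> F \<and> (\<exists>z. z \<lhd> w \<and> e z n)} \<in> \<S>"
    proof (rule D1_CA)
      show "D0 (\<lambda>v. pr (v (Suc 0) \<oplus> \<one>) (v 0) \<in> F \<and> (\<exists>z. z \<lhd> v 0 \<and> e z (v (Suc 0))))"
        by (intro df_rules F)
      show "D0 (\<lambda>v. pr (v (Suc 0) \<oplus> \<one>) (v 0) \<in> F \<longrightarrow> (\<exists>z. z \<lhd> v 0 \<and> e z (v (Suc 0))))"
        by (intro df_rules F)
    qed (use ex_F fun_F in blast)
    moreover have "{n. \<exists>w. pr (n \<oplus> \<one>) w \<in> F \<and> (\<exists>z. z \<lhd> w \<and> e z n)} = {n. \<exists>m. pr n m \<in> X}"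
      using e_ex ex_F decide by blast
    ultimately show False using notS by simp
  qed
  then have wo: "wo (\<lambda>x. x \<in> {z. Z z}) (\<lambda>y x. pr y x \<in> R)"
    using lin unfolding wo_def wfd_def R by auto
  \<comment> \<open>Among the stages after \<open>s\<close>, the one that enumerates the least
    number is true.\<close>
  have least_true: "true t" if t: "e t n" "s \<lhd> t"
    "\<And>u k. s \<lhd> u \<Longrightarrow> e u k \<Longrightarrow> \<not> k \<lhd> n" for s t n
    unfolding true_def
  proof (intro allI impI)
    fix u m k assume u: "t \<lhd> u" "e u m" "e t k"
    then have "k = n" "\<not> m \<lhd> n" "m \<noteq> n" using e_fun e_inj t lt_trans lt_irrefl by blast+
    then show "k \<lhd> m" using lt_total by blast
  qed
  \<comment> \<open>After a true stage \<open>s\<close> there is another true stage, and it precedes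
    \<open>s\<close> in the order; this is the progress step of the bar induction.\<close>
  have false: "\<not> true s" if "s \<in> {z. Z z}" for s
  proof (rule A0_bar_induction[OF ZS R(1) wo _ _ that, where P = "\<lambda>s. \<not> true s"])
    show "A0 (\<lambda>v. \<not> true (v 0))" by (intro df_rules)
    fix s assume s: "s \<in> {z. Z z}" and IH: "\<And>t. pr t s \<in> R \<Longrightarrow> \<not> true t"
    show "\<not> true s"
    proof
      assume true: "true s"
      obtain n0 where "\<exists>t. s \<lhd> t \<and> e t n0" using unbounded by blast
      then have "\<exists>n. (\<exists>t. s \<lhd> t \<and> e t n) \<and> (\<forall>k. k \<lhd> n \<longrightarrow> \<not> (\<exists>t. s \<lhd> t \<and> e t k))"
        by (intro A0_least) (intro df_rules)
      then obtain n t where t: "s \<lhd> t" "e t n" "\<And>k u. k \<lhd> n \<Longrightarrow> s \<lhd> u \<Longrightarrow> \<not> e u k" by blast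
      then have "true t" using least_true by blast
      moreover have "before t s" unfolding before_def using t s true_tr[OF true] Z by blast
      ultimately show False using IH R by blast
    qed
  qed
  obtain n0 where "\<exists>t. \<zero> \<lhd> t \<and> e t n0" using unbounded by blast
  then have "\<exists>n. (\<exists>t. \<zero> \<lhd> t \<and> e t n) \<and> (\<forall>k. k \<lhd> n \<longrightarrow> \<not> (\<exists>t. \<zero> \<lhd> t \<and> e t k))"
    by (intro A0_least) (intro df_rules)
  then obtain n t where t: "\<zero> \<lhd> t" "e t n" "\<And>k u. k \<lhd> n \<Longrightarrow> \<zero> \<lhd> u \<Longrightarrow> \<not> e u k" by blast
  then have "true t" using least_true by blast
  then show False using false t Z by blast
qed

section \<open>From projections to all arithmetical formulas\<close>

text \<open>Total, with value zero off the range of pairing, so that every number can be read as a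
  valuation.\<close>

definition p1 :: "'a \<Rightarrow> 'a" where
  "p1 z = (if \<exists>x y. z = pr x y then THE x. \<exists>y. z = pr x y else \<zero>)"

definition p2 :: "'a \<Rightarrow> 'a" where
  "p2 z = (if \<exists>x y. z = pr x y then THE y. \<exists>x. z = pr x y else \<zero>)"

lemma p1_pr [simp]: "p1 (pr x y) = x" and p2_pr [simp]: "p2 (pr x y) = y"
  by (auto simp: p1_def p2_def)

lemma p1_le [simp]: "p1 z \<unlhd> z" and p2_le [simp]: "p2 z \<unlhd> z"
proof -
  have "p1 z \<unlhd> z \<and> p2 z \<unlhd> z"
  proof (cases "\<exists>x y. z = pr x y")
    case False
    then show ?thesis by (simp add: p1_def p2_def)
  qed auto
  then show "p1 z \<unlhd> z" "p2 z \<unlhd> z" by auto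
qed

lemma p1_D0: "D0 (\<lambda>v. v i = p1 (v j))"
proof -
  have "x = p1 z \<longleftrightarrow> (\<exists>y. y \<lhd> z \<oplus> \<one> \<and> z = pr x y) \<or>
    (x = \<zero> \<and> \<not> (\<exists>x. x \<lhd> z \<oplus> \<one> \<and> (\<exists>y. y \<lhd> z \<oplus> \<one> \<and> z = pr x y)))" for x z
  proof (cases "\<exists>x y. z = pr x y")
    case False
    then show ?thesis by (auto simp: p1_def)
  qed (use le_pr1 le_pr2 in fastforce)
  then show ?thesis by (simp only:) (intro df_rules)
qed

lemma p2_D0: "D0 (\<lambda>v. v i = p2 (v j))"
proof -
  have "y = p2 z \<longleftrightarrow> (\<exists>x. x \<lhd> z \<oplus> \<one> \<and> z = pr x y) \<or>
    (y = \<zero> \<and> \<not> (\<exists>x. x \<lhd> z \<oplus> \<one> \<and> (\<exists>y. y \<lhd> z \<oplus> \<one> \<and> z = pr x y)))" for y z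
  proof (cases "\<exists>x y. z = pr x y")
    case False
    then show ?thesis by (auto simp: p2_def)
  qed (use le_pr1 le_pr2 in fastforce)
  then show ?thesis by (simp only:) (intro df_rules)
qed

text \<open>\<open>proj z\<close> is a whole valuation coded by the number \<open>z\<close>, so that formulas with several number
  variables define sets.\<close>

fun proj :: "'a \<Rightarrow> nat \<Rightarrow> 'a" where
  "proj z 0 = p1 z"
| "proj z (Suc n) = proj (p2 z) n"

lemma proj_pr: "proj (pr x z) = case_nat x (proj z)"
  by (rule ext) (simp split: nat.split)

lemma proj_D0: "D0 (\<lambda>v. v i = proj (v j) n)"
proof (induction n arbitrary: i j)
  case 0
  then show ?case using p1_D0 by simp
next
  case (Suc n)
  have "x = proj z (Suc n) \<longleftrightarrow> (\<exists>u. u \<lhd> z \<oplus> \<one> \<and> u = p2 z \<and> x = proj u n)" for x z by simp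
  then show ?case by (simp only:) (intro df_rules p2_D0 Suc)
qed

lemma tval_proj_D0: "D0 (\<lambda>v. v i = tval (proj (v j)) t)"
proof (induction t arbitrary: i j)
  case (Var n)
  then show ?case using proj_D0 by simp
next
  case (Add t u)
  have "x = tval (proj z) (Add t u) \<longleftrightarrow> (\<exists>a. a \<lhd> x \<oplus> \<one> \<and> a = tval (proj z) t \<and>
    (\<exists>b. b \<lhd> x \<oplus> \<one> \<and> b = tval (proj z) u \<and> x = a \<oplus> b))" for x z by auto
  then show ?case by (simp only:) (intro df_rules Add)
next
  case (Mul t u)
  \<comment> \<open>A product bounds its factors only if neither is zero. The case of a vanishing
    factor is split off to keep the quantifiers bounded.\<close>
  have le: "a \<unlhd> a \<otimes> b" "b \<unlhd> a \<otimes> b" if "a \<noteq> \<zero>" "b \<noteq> \<zero>" for a b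
    using that le_times[of b a] le_times[of a b] times_comm[of b a]
    by (auto simp: zero_lt_iff)
  have "x = tval (proj z) (Mul t u) \<longleftrightarrow>
     (x = \<zero> \<and> (\<zero> = tval (proj z) t \<or> \<zero> = tval (proj z) u)) \<or> (\<exists>a. a \<lhd> x \<oplus> \<one> \<and> a = tval (proj z) t \<and>
    (\<exists>b. b \<lhd> x \<oplus> \<one> \<and> b = tval (proj z) u \<and> x = a \<otimes> b))" for x z
    using le[of "tval (proj z) t" "tval (proj z) u"]
    by (cases "tval (proj z) t = \<zero>"; cases "tval (proj z) u = \<zero>") (auto simp: times_zero zero_times)
  then have *: "x = tval (proj z) (Mul t u) \<longleftrightarrow>
     (x = \<zero> \<and> (\<exists>c. c \<lhd> \<one> \<and> (c = tval (proj z) t \<or> c = tval (proj z) u))) \<or>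
      (\<exists>a. a \<lhd> x \<oplus> \<one> \<and> a = tval (proj z) t \<and>
        (\<exists>b. b \<lhd> x \<oplus> \<one> \<and> b = tval (proj z) u \<and> x = a \<otimes> b))" for x z
    using lt_suc[of _ \<zero>] not_lt_zero by (simp add: zero_plus)
  show ?case unfolding * by (intro df_rules Mul)
qed (simp_all add: D0_rules(2) dt_const dt_var)

text \<open>By induction on the formula: with all variables packed into the number \<open>z\<close>,
  a quantifier is a projection of a set of pairs and needs only one more application of
  \<open>Sigma01_CA\<close>.\<close>

lemma sat_proj_S:
  assumes "arithmetical p" "range V \<subseteq> \<S>" shows "{z. sat (proj z) V p} \<in> \<S>"
  using assms(1)
proof (induction p)
  case Fls
  then show ?case using D0_CA[of "\<lambda>_. False"] D0_bool by simp
next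
  case (Eq t u)
  \<comment> \<open>The value of a term under the valuation coded by \<open>z\<close> is not bounded
    by a term of the language in \<open>z\<close>; its uniqueness provides both an existential and a
    universal definition.\<close>
  have "{z. \<exists>y. y = tval (proj z) t \<and> y = tval (proj z) u} \<in> \<S>"
    by (rule D1_CA[where Q = "\<lambda>y z. y = tval (proj z) t \<longrightarrow> y = tval (proj z) u"])
      ((intro df_rules tval_proj_D0)+, auto)
  moreover have "sat (proj z) V (Eq t u) \<longleftrightarrow> (\<exists>y. y = tval (proj z) t \<and> y = tval (proj z) u)" for z
    by auto
  ultimately show ?case by simp
next
  case (Less t u)
  have "{z. \<exists>y. y = tval (proj z) u \<and> (\<exists>a. a \<lhd> y \<and> a = tval (proj z) t)} \<in> \<S>"
    by (rule D1_CA[where Q = "\<lambda>y z. y = tval (proj z) u \<longrightarrow> (\<exists>a. a \<lhd> y \<and> a = tval (proj z) t)"])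
      ((intro df_rules tval_proj_D0)+, auto)
  moreover have "sat (proj z) V (Less t u) \<longleftrightarrow>
      (\<exists>y. y = tval (proj z) u \<and> (\<exists>a. a \<lhd> y \<and> a = tval (proj z) t))" for z
    by auto
  ultimately show ?case by simp
next
  case (Mem t X)
  have X: "V X \<in> \<S>" using assms(2) by blast
  have "{z. \<exists>y. y = tval (proj z) t \<and> y \<in> V X} \<in> \<S>"
    by (rule D1_CA[where Q = "\<lambda>y z. y = tval (proj z) t \<longrightarrow> y \<in> V X"])
      ((intro df_rules tval_proj_D0 X)+, auto)
  moreover have "sat (proj z) V (Mem t X) \<longleftrightarrow> (\<exists>y. y = tval (proj z) t \<and> y \<in> V X)" for z
    by auto
  ultimately show ?case by simp
next
  case (Imp p q)
  then obtain A B where "A \<in> \<S>" "B \<in> \<S>" "A = {z. sat (proj z) V p}" "B = {z. sat (proj z) V q}"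
    by auto
  moreover from this have "{z. z \<in> A \<longrightarrow> z \<in> B} \<in> \<S>" by (intro D0_CA df_rules)
  ultimately show ?case by simp
next
  case (AllN p)
  then have A: "{z. sat (proj z) V p} \<in> \<S>" by auto
  \<comment> \<open>The universal quantifier is the complement of the projection of the
    complement.\<close>
  have "D0 (\<lambda>v. pr (v (Suc 0)) (v 0) \<notin> {z. sat (proj z) V p})" by (intro df_rules A)
  then obtain B where B: "B \<in> \<S>" "\<And>z x. pr z x \<in> B \<longleftrightarrow> pr x z \<notin> {z. sat (proj z) V p}"
    using pr_in_setof[of "\<lambda>z x. pr x z \<notin> {z. sat (proj z) V p}"] by blast
  obtain C where C: "C \<in> \<S>" "C = {z. \<exists>x. pr z x \<in> B}" using Sigma01_CA[OF B(1)] by blast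
  have "{z. z \<notin> C} \<in> \<S>" by (intro D0_CA df_rules C(1))
  then show ?case by (simp add: B C(2) proj_pr)
qed simp

lemma sat_fv_below:
  assumes "fv_below k p" "\<And>n. n < k \<Longrightarrow> v n = v' n" shows "sat v V p \<longleftrightarrow> sat v' V p"
proof -
  define s where "s n = (if n < k then Var n else Zero)" for n
  have "subst Var (\<lambda>n. n) p = subst s (\<lambda>n. n) p"
    by (rule fv_belowD[OF assms(1)]) (simp_all add: s_def)
  then have p: "p = subst s (\<lambda>n. n) p" by simp
  have "(\<lambda>n. tval v (s n)) = (\<lambda>n. tval v' (s n))" by (rule ext) (simp add: s_def assms(2))
  then show ?thesis using p by (metis sat_subst)
qed

lemma proj_ex: "\<exists>c. \<forall>n<k. proj c n = v n"
proof (induction k arbitrary: v)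
  case (Suc k)
  obtain c where c: "\<forall>n<k. proj c n = v (Suc n)" using Suc[of "\<lambda>n. v (Suc n)"] by blast
  then have "\<forall>n<Suc k. proj (pr (v 0) c) n = v n" unfolding proj_pr by (auto split: nat.split)
  then show ?case by blast
qed simp

lemma A0_CA:
  assumes "A0 (\<lambda>v. P (v 0))" shows "{x. P x} \<in> \<S>"
proof -
  obtain p v V where p: "arithmetical p" "range V \<subseteq> \<S>" "\<And>x. P x \<longleftrightarrow> sat (case_nat x v) V p"
    by (rule unary_formula[OF definability_class(2) assms]) (rule that)
  \<comment> \<open>Only finitely many parameters of the formula matter, and one number
    \<open>c\<close> codes them.\<close>
  obtain k where k: "fv_below k p" using fv_below_ex by blast
  obtain c where c: "\<forall>n<k. proj c n = v n" using proj_ex by blast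
  obtain A where A: "A \<in> \<S>" "A = {z. sat (proj z) V p}" using sat_proj_S[OF p(1,2)] by blast
  have "P x \<longleftrightarrow> pr x c \<in> A" for x
    unfolding p(3) A(2) mem_Collect_eq proj_pr
    by (rule sat_fv_below[OF k]) (use c in \<open>auto split: nat.split\<close>)
  moreover have "{x. pr x c \<in> A} \<in> \<S>" by (intro D0_CA df_rules A(1))
  ultimately show ?thesis by simp
qed

end

section \<open>Finite sets\<close>

context model
begin

section \<open>Functions with arithmetical graph\<close>

text \<open>The value is put in place 0. In contrast to \<open>dt\<close> this covers functions that
  are not terms of the language, such as the projections of pairs.\<close>

definition af :: "((nat \<Rightarrow> 'a) \<Rightarrow> 'a) \<Rightarrow> bool" where
  "af f \<longleftrightarrow> A0 (\<lambda>v. v 0 = f (\<lambda>n. v (Suc n)))"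

lemma af_shift: "af f \<Longrightarrow> af (\<lambda>v. f (\<lambda>n. v (Suc n)))"
  unfolding af_def
  using df_rename[OF definability_class(2), of "\<lambda>v. v 0 = f (\<lambda>n. v (Suc n))" "case_nat 0 (\<lambda>n. Suc (Suc n))"]
  by simp

text \<open>A quantifier names the value of \<open>f\<close>, which does not leave the arithmetical
  formulas.\<close>

lemma A0_let:
  assumes "af f" "A0 (\<lambda>v. P (\<lambda>n. v (Suc n)) (v 0))" shows "A0 (\<lambda>v. P v (f v))"
proof -
  have "A0 (\<lambda>v. \<exists>a. a = f v \<and> P v a)"
    by (intro A0_ex A0_rules(7)) (use assms in \<open>simp_all add: af_def\<close>)
  then show ?thesis by simp
qed

lemma af_let:
  assumes "af f" "af (\<lambda>v. g (\<lambda>n. v (Suc n)) (v 0))" shows "af (\<lambda>v. g v (f v))"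
proof -
  have "A0 (\<lambda>v. v 0 = g (\<lambda>n. v (Suc n)) (f (\<lambda>n. v (Suc n))))"
  proof (rule A0_let[where P = "\<lambda>v a. v 0 = g (\<lambda>n. v (Suc n)) a"])
    show "af (\<lambda>v. f (\<lambda>n. v (Suc n)))" using assms(1) by (rule af_shift)
    show "A0 (\<lambda>v. v (Suc 0) = g (\<lambda>n. v (Suc (Suc n))) (v 0))"
      using df_rename[OF definability_class(2) assms(2)[unfolded af_def],
          of "case_nat (Suc 0) (case_nat 0 (\<lambda>n. Suc (Suc n)))"] by simp
  qed
  then show ?thesis unfolding af_def .
qed

named_theorems ar_rules

lemma af_var [ar_rules]: "af (\<lambda>v. v n)"
  unfolding af_def by (intro df_rules)

lemma af_const [ar_rules]: "af (\<lambda>v. c)"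
  unfolding af_def by (intro df_rules)

lemma af_fun1:
  assumes "A0 (\<lambda>v. v 0 = F (v (Suc 0)))" "af f" shows "af (\<lambda>v. F (f v))"
proof (rule af_let[OF assms(2)])
  show "af (\<lambda>v. F (v 0))" unfolding af_def using assms(1) .
qed

lemma af_fun2:
  assumes "A0 (\<lambda>v. v 0 = F (v (Suc 0)) (v (Suc (Suc 0))))" "af f" "af g" shows "af (\<lambda>v. F (f v) (g v))"
proof (rule af_let[OF assms(2), of "\<lambda>v a. F a (g v)"])
  show "af (\<lambda>v. F (v 0) (g (\<lambda>n. v (Suc n))))"
  proof (rule af_let[OF af_shift[OF assms(3)], of "\<lambda>v b. F (v 0) b"])
    show "af (\<lambda>v. F (v (Suc 0)) (v 0))" unfolding af_def
      using df_rename[OF definability_class(2) assms(1), of "case_nat 0 (case_nat 2 (\<lambda>_. 1))"]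
      by (simp add: numeral_2_eq_2)
  qed
qed

lemma A0_rel1: "A0 (\<lambda>v. R (v 0)) \<Longrightarrow> af f \<Longrightarrow> A0 (\<lambda>v. R (f v))"
  by (rule A0_let)

lemma A0_rel2:
  assumes "A0 (\<lambda>v. R (v 0) (v (Suc 0)))" "af f" "af g" shows "A0 (\<lambda>v. R (f v) (g v))"
proof (rule A0_let[OF assms(2), of "\<lambda>v a. R a (g v)"])
  show "A0 (\<lambda>v. R (v 0) (g (\<lambda>n. v (Suc n))))"
  proof (rule A0_let[OF af_shift[OF assms(3)], of "\<lambda>v b. R (v 0) b"])
    show "A0 (\<lambda>v. R (v (Suc 0)) (v 0))"
      using df_rename[OF definability_class(2) assms(1), of "case_nat 1 (\<lambda>_. 0)"] by simp
  qed
qed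

lemma af_arith [ar_rules]:
  "af f \<Longrightarrow> af g \<Longrightarrow> af (\<lambda>v. f v \<oplus> g v)"
  "af f \<Longrightarrow> af g \<Longrightarrow> af (\<lambda>v. f v \<otimes> g v)"
  "af f \<Longrightarrow> af g \<Longrightarrow> af (\<lambda>v. pr (f v) (g v))"
  by (erule (1) af_fun2[rotated], intro df_rules)+

lemma af_proj [ar_rules]: "af f \<Longrightarrow> af (\<lambda>v. p1 (f v))" "af f \<Longrightarrow> af (\<lambda>v. p2 (f v))"
  by (erule af_fun1[rotated], rule D0_A0, rule p1_D0 p2_D0)+

lemma A0_atoms [ar_rules]:
  "af f \<Longrightarrow> af g \<Longrightarrow> A0 (\<lambda>v. f v = g v)"
  "af f \<Longrightarrow> af g \<Longrightarrow> A0 (\<lambda>v. f v \<lhd> g v)"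
  "A \<in> \<S> \<Longrightarrow> af f \<Longrightarrow> A0 (\<lambda>v. f v \<in> A)"
  by (erule (1) A0_rel2[rotated], intro df_rules)+ (erule A0_rel1[rotated], intro df_rules)

lemma A0_le [ar_rules]: "af f \<Longrightarrow> af g \<Longrightarrow> A0 (\<lambda>v. f v \<unlhd> g v)"
  unfolding le_def by (intro A0_rules(8) ar_rules)

lemmas A0_connectives [ar_rules] = A0_rules(5,6,7,8,9) A0_all A0_ex A0_bool

lemma A0_ex1 [ar_rules]: "A0 (\<lambda>v. Q (\<lambda>n. v (Suc n)) (v 0)) \<Longrightarrow> A0 (\<lambda>v. \<exists>!x. Q v x)"
proof -
  assume Q: "A0 (\<lambda>v. Q (\<lambda>n. v (Suc n)) (v 0))"
  have "A0 (\<lambda>v. Q (\<lambda>n. v (Suc (Suc n))) (v 0))"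
    using df_rename[OF definability_class(2) Q, of "case_nat 0 (\<lambda>n. Suc (Suc n))"] by simp
  then show ?thesis unfolding Ex1_def by (intro ar_rules Q)
qed

lemma A0_set2:
  assumes "A0 (\<lambda>v. R (v 0) (v (Suc 0)))" shows "\<exists>A\<in>\<S>. \<forall>x y. pr x y \<in> A \<longleftrightarrow> R x y"
proof -
  have "{z. R (p1 z) (p2 z)} \<in> \<S>" by (rule A0_CA) (intro A0_rel2[OF assms] ar_rules)
  then show ?thesis by (intro bexI) auto
qed

text \<open>Two arguments are packed into a pair, which reduces the claim to one argument less. The
  next two lemmas repeat this.\<close>

lemma A0_rel3:
  assumes "A0 (\<lambda>v. R (v 0) (v (Suc 0)) (v (Suc (Suc 0))))" "af f" "af g" "af h"
  shows "A0 (\<lambda>v. R (f v) (g v) (h v))"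
proof -
  have "A0 (\<lambda>v. R (v (Suc 0)) (v (Suc (Suc 0))) (v 0))"
    using df_rename[OF definability_class(2) assms(1), of "case_nat 1 (case_nat 2 (\<lambda>_. 0))"]
    by (simp add: numeral_2_eq_2)
  then have "A0 (\<lambda>v. R (p1 (v 0)) (p2 (v 0)) (v (Suc 0)))"
    by (intro A0_let[of "\<lambda>v. p1 (v 0)" "\<lambda>v a. R a (p2 (v 0)) (v (Suc 0))"]
        A0_let[of "\<lambda>v. p2 (v (Suc 0))" "\<lambda>v a. R (v 0) a (v (Suc (Suc 0)))"] ar_rules)
      (use df_rename[OF definability_class(2) assms(1), of "case_nat 1 (case_nat 0 (\<lambda>_. 3))"] in
        \<open>simp add: numeral_3_eq_3\<close>)
  from A0_rel2[OF this, of "\<lambda>v. pr (f v) (g v)" h] show ?thesis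
    using assms(2-4) by (simp add: ar_rules)
qed

lemma A0_rel4:
  assumes "A0 (\<lambda>v. R (v 0) (v (Suc 0)) (v (Suc (Suc 0))) (v (Suc (Suc (Suc 0)))))"
    "af f" "af g" "af h" "af k"
  shows "A0 (\<lambda>v. R (f v) (g v) (h v) (k v))"
proof -
  have "A0 (\<lambda>v. R (p1 (v 0)) (p2 (v 0)) (v (Suc 0)) (v (Suc (Suc 0))))"
    by (intro A0_let[of "\<lambda>v. p1 (v 0)" "\<lambda>v a. R a (p2 (v 0)) (v (Suc 0)) (v (Suc (Suc 0)))"]
        A0_let[of "\<lambda>v. p2 (v (Suc 0))" "\<lambda>v a. R (v 0) a (v (Suc (Suc 0))) (v (Suc (Suc (Suc 0))))"] ar_rules)
      (use df_rename[OF definability_class(2) assms(1), of "case_nat 1 (case_nat 0 (case_nat 3 (\<lambda>_. 4)))"] in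
        \<open>simp add: numeral_eq_Suc\<close>)
  from A0_rel3[OF this, of "\<lambda>v. pr (f v) (g v)" h k] show ?thesis
    using assms(2-) by (simp add: ar_rules)
qed

lemma A0_rel5:
  assumes "A0 (\<lambda>v. R (v 0) (v (Suc 0)) (v (Suc (Suc 0))) (v (Suc (Suc (Suc 0)))) (v (Suc (Suc (Suc (Suc 0))))))"
    "af f" "af g" "af h" "af k" "af l"
  shows "A0 (\<lambda>v. R (f v) (g v) (h v) (k v) (l v))"
proof -
  have "A0 (\<lambda>v. R (p1 (v 0)) (p2 (v 0)) (v (Suc 0)) (v (Suc (Suc 0))) (v (Suc (Suc (Suc 0)))))"
    by (intro A0_let[of "\<lambda>v. p1 (v 0)" "\<lambda>v a. R a (p2 (v 0)) (v (Suc 0)) (v (Suc (Suc 0))) (v (Suc (Suc (Suc 0))))"]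
        A0_let[of "\<lambda>v. p2 (v (Suc 0))" "\<lambda>v a. R (v 0) a (v (Suc (Suc 0))) (v (Suc (Suc (Suc 0)))) (v (Suc (Suc (Suc (Suc 0)))))"] ar_rules)
      (use df_rename[OF definability_class(2) assms(1), of "case_nat 1 (case_nat 0 (case_nat 3 (case_nat 4 (\<lambda>_. 5))))"] in
        \<open>simp add: numeral_eq_Suc\<close>)
  from A0_rel4[OF this, of "\<lambda>v. pr (f v) (g v)" h k l] show ?thesis
    using assms(2-) by (simp add: ar_rules)
qed

section \<open>Codes of bounded sets by divisibility\<close>

definition dv :: "'a \<Rightarrow> 'a \<Rightarrow> bool" where
  "dv a b \<longleftrightarrow> (\<exists>q. b = q \<otimes> a)"

lemma A0_dv [ar_rules]: "af f \<Longrightarrow> af g \<Longrightarrow> A0 (\<lambda>v. dv (f v) (g v))"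
  by (erule (1) A0_rel2[rotated]) (unfold dv_def, intro ar_rules)

lemma A0_mem [ar_rules]: "af f \<Longrightarrow> af g \<Longrightarrow> A0 (\<lambda>v. mem (f v) (g v))"
  by (erule (1) A0_rel2[rotated]) (unfold mem_def, intro ar_rules)

lemma A0_fset [ar_rules]: "af f \<Longrightarrow> A0 (\<lambda>v. fset (f v))"
  by (erule A0_rel1[rotated]) (unfold fset_def, intro ar_rules)

lemma dv_times: "dv a b \<Longrightarrow> dv a (c \<otimes> b)"
  unfolding dv_def by (metis times_assoc)

lemma dv_self: "dv a (c \<otimes> a)"
  unfolding dv_def by blast

lemma dv_diff: assumes "dv a (b \<oplus> c)" "dv a b" shows "dv a c"
proof -
  obtain p q where p: "b \<oplus> c = p \<otimes> a" and q: "b = q \<otimes> a" using assms unfolding dv_def by blast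
  consider r where "p = q \<oplus> r" | "p \<lhd> q" using le_iff M.not_less by blast
  then show ?thesis
  proof cases
    case 1
    then have "q \<otimes> a \<oplus> c = q \<otimes> a \<oplus> r \<otimes> a" using p q by (simp add: M.distrib_right)
    then show ?thesis unfolding plus_cancel dv_def by blast
  next
    case 2
    then have "p \<otimes> a \<unlhd> b" unfolding q by (intro M.mult_right_mono) auto
    then have "b \<oplus> c \<unlhd> b \<oplus> \<zero>" using p by (simp add: plus_zero)
    then have "c = \<zero>" using M.add_le_cancel_left zero_lt_iff M.not_less by blast
    then show ?thesis unfolding dv_def using zero_times by metis
  qed
qed

text \<open>The conclusion of Euclid's lemma taken as a definition. It passes to products at once,
  without greatest common divisors.\<close>

definition coprime_to :: "'a \<Rightarrow> 'a \<Rightarrow> bool" where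
  "coprime_to a b \<longleftrightarrow> (\<forall>c. dv a (b \<otimes> c) \<longrightarrow> dv a c)"

lemma A0_coprime_to [ar_rules]: "af f \<Longrightarrow> af g \<Longrightarrow> A0 (\<lambda>v. coprime_to (f v) (g v))"
  by (erule (1) A0_rel2[rotated]) (unfold coprime_to_def, intro ar_rules)

text \<open>The moduli of Goedel's beta function, as in the definition of
  \<open>mem\<close>.\<close>

definition modulus :: "'a \<Rightarrow> 'a \<Rightarrow> 'a" where
  "modulus m x = m \<otimes> (x \<oplus> \<one>) \<oplus> \<one>"

text \<open>Replaces the factorial, for which no recursion is available yet.\<close>

lemma common_multiple: "\<exists>m. \<zero> \<lhd> m \<and> (\<forall>i. \<zero> \<lhd> i \<and> i \<unlhd> k \<longrightarrow> dv i m)"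
proof (rule A0_induct[where P = "\<lambda>k. \<exists>m. \<zero> \<lhd> m \<and> (\<forall>i. \<zero> \<lhd> i \<and> i \<unlhd> k \<longrightarrow> dv i m)"])
  show "A0 (\<lambda>v. \<exists>m. \<zero> \<lhd> m \<and> (\<forall>i. \<zero> \<lhd> i \<and> i \<unlhd> v 0 \<longrightarrow> dv i m))" by (intro ar_rules)
  show "\<exists>m. \<zero> \<lhd> m \<and> (\<forall>i. \<zero> \<lhd> i \<and> i \<unlhd> \<zero> \<longrightarrow> dv i m)"
    by (auto simp: le_def not_lt_zero lt_irrefl intro!: exI[of _ \<one>])
  fix k assume "\<exists>m. \<zero> \<lhd> m \<and> (\<forall>i. \<zero> \<lhd> i \<and> i \<unlhd> k \<longrightarrow> dv i m)"
  then obtain m where m: "\<zero> \<lhd> m" "\<And>i. \<zero> \<lhd> i \<Longrightarrow> i \<unlhd> k \<Longrightarrow> dv i m" by blast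
  have "\<zero> \<lhd> (k \<oplus> \<one>) \<otimes> m" using m(1) zero_lt_suc by simp
  moreover have "dv i ((k \<oplus> \<one>) \<otimes> m)" if "\<zero> \<lhd> i" "i \<unlhd> k \<oplus> \<one>" for i
  proof (cases "i = k \<oplus> \<one>")
    case True
    then show ?thesis using dv_self[of "k \<oplus> \<one>" m] times_comm by simp
  next
    case False
    then show ?thesis using that m(2) dv_times le_def by simp
  qed
  ultimately show "\<exists>m. \<zero> \<lhd> m \<and> (\<forall>i. \<zero> \<lhd> i \<and> i \<unlhd> k \<oplus> \<one> \<longrightarrow> dv i m)" by blast
qed

text \<open>The products of \<open>modulus m x\<close> with \<open>y \<oplus> \<one>\<close> and of
  \<open>modulus m y\<close> with \<open>x \<oplus> \<one>\<close> differ by the distance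
  \<open>e\<close> of \<open>x\<close> and \<open>y\<close>. So \<open>modulus m y\<close> divides
  \<open>e \<otimes> c\<close>. As \<open>e\<close> divides \<open>m\<close>, and
  \<open>m \<otimes> (y \<oplus> \<one>)\<close> is \<open>\<one>\<close> less than the modulus, it
  divides \<open>c\<close> as well.\<close>

lemma coprime_modulus:
  assumes m: "\<And>i. \<zero> \<lhd> i \<Longrightarrow> i \<unlhd> k \<Longrightarrow> dv i m" and xy: "x \<noteq> y" "x \<lhd> k" "y \<lhd> k"
  shows "coprime_to (modulus m y) (modulus m x)"
  unfolding coprime_to_def
proof (intro allI impI)
  fix c assume dv: "dv (modulus m y) (modulus m x \<otimes> c)"
  have "\<exists>e. \<zero> \<lhd> e \<and> e \<unlhd> k \<and> dv (modulus m y) (e \<otimes> c)"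
  proof (cases "x \<lhd> y")
    case True
    then obtain d where "y = (x \<oplus> d) \<oplus> \<one>" unfolding lt_iff by blast
    then obtain e where e: "y = x \<oplus> e" "\<zero> \<lhd> e" using zero_lt_suc by (metis plus_suc)
    have "(y \<oplus> \<one>) \<otimes> (modulus m x \<otimes> c) = (x \<oplus> \<one>) \<otimes> c \<otimes> modulus m y \<oplus> e \<otimes> c"
      unfolding modulus_def e(1) by (simp add: M.distrib_left M.distrib_right times_one plus_assoc' plus_comm M.add.left_commute times_assoc times_comm M.mult.left_commute)
    then have "dv (modulus m y) (e \<otimes> c)"
      using dv dv_times dv_diff dv_self by metis
    moreover have "e \<unlhd> k" using e(1) xy(3) le_plus2[of e x] M.order.trans le_def by metis
    ultimately show ?thesis using e(2) by blast
  next
    case False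
    then have "y \<lhd> x" using xy(1) lt_total by blast
    then obtain d where "x = (y \<oplus> d) \<oplus> \<one>" unfolding lt_iff by blast
    then obtain e where e: "x = y \<oplus> e" "\<zero> \<lhd> e" using zero_lt_suc by (metis plus_suc)
    have "(x \<oplus> \<one>) \<otimes> c \<otimes> modulus m y = (y \<oplus> \<one>) \<otimes> (modulus m x \<otimes> c) \<oplus> e \<otimes> c"
      unfolding modulus_def e(1) by (simp add: M.distrib_left M.distrib_right times_one plus_assoc' plus_comm M.add.left_commute times_assoc times_comm M.mult.left_commute)
    then have "dv (modulus m y) (e \<otimes> c)"
      using dv dv_times dv_diff dv_self by metis
    moreover have "e \<unlhd> k" using e(1) xy(2) le_plus2[of e y] M.order.trans le_def by metis
    ultimately show ?thesis using e(2) by blast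
  qed
  then obtain e where e: "\<zero> \<lhd> e" "e \<unlhd> k" "dv (modulus m y) (e \<otimes> c)" by blast
  then obtain q where q: "m = q \<otimes> e" using m unfolding dv_def by blast
  have "modulus m y \<otimes> c = (y \<oplus> \<one>) \<otimes> q \<otimes> (e \<otimes> c) \<oplus> c"
    unfolding modulus_def q by (simp add: M.distrib_left M.distrib_right times_one plus_assoc' plus_comm M.add.left_commute times_assoc times_comm M.mult.left_commute)
  then show "dv (modulus m y) c"
    using dv_diff dv_times[OF e(3)] dv_self times_comm by metis
qed

text \<open>The code is the product of the moduli of all elements. It is built by induction on
  \<open>j\<close>, along with the fact that the moduli of all other numbers below \<open>k\<close>
  remain coprime to the product.\<close>

lemma ex_code:
  assumes P: "A0 (\<lambda>v. P (v 0))" shows "\<exists>c. \<forall>x. mem x c \<longleftrightarrow> x \<lhd> k \<and> P x"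
proof -
  obtain m where m: "\<zero> \<lhd> m" "\<And>i. \<zero> \<lhd> i \<Longrightarrow> i \<unlhd> k \<Longrightarrow> dv i m" using common_multiple by blast
  have "j \<unlhd> k \<longrightarrow> (\<exists>n. \<forall>y. y \<lhd> k \<longrightarrow> (y \<lhd> j \<and> P y \<longrightarrow> dv (modulus m y) n) \<and>
     (\<not> (y \<lhd> j \<and> P y) \<longrightarrow> coprime_to (modulus m y) n))" for j
  proof (rule A0_induct[where P = "\<lambda>j. j \<unlhd> k \<longrightarrow> (\<exists>n. \<forall>y. y \<lhd> k \<longrightarrow> (y \<lhd> j \<and> P y \<longrightarrow> dv (modulus m y) n) \<and>
     (\<not> (y \<lhd> j \<and> P y) \<longrightarrow> coprime_to (modulus m y) n))"])
    show "A0 (\<lambda>v. v 0 \<unlhd> k \<longrightarrow> (\<exists>n. \<forall>y. y \<lhd> k \<longrightarrow> (y \<lhd> v 0 \<and> P y \<longrightarrow> dv (modulus m y) n) \<and>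
       (\<not> (y \<lhd> v 0 \<and> P y) \<longrightarrow> coprime_to (modulus m y) n)))"
      unfolding modulus_def by (intro ar_rules A0_rel1[OF P])
    have "coprime_to a \<one>" for a unfolding coprime_to_def by simp
    then show "\<zero> \<unlhd> k \<longrightarrow> (\<exists>n. \<forall>y. y \<lhd> k \<longrightarrow> (y \<lhd> \<zero> \<and> P y \<longrightarrow> dv (modulus m y) n) \<and>
       (\<not> (y \<lhd> \<zero> \<and> P y) \<longrightarrow> coprime_to (modulus m y) n))"
      using not_lt_zero by blast
    fix j assume IH: "j \<unlhd> k \<longrightarrow> (\<exists>n. \<forall>y. y \<lhd> k \<longrightarrow> (y \<lhd> j \<and> P y \<longrightarrow> dv (modulus m y) n) \<and>
     (\<not> (y \<lhd> j \<and> P y) \<longrightarrow> coprime_to (modulus m y) n))"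
    show "j \<oplus> \<one> \<unlhd> k \<longrightarrow> (\<exists>n. \<forall>y. y \<lhd> k \<longrightarrow> (y \<lhd> j \<oplus> \<one> \<and> P y \<longrightarrow> dv (modulus m y) n) \<and>
     (\<not> (y \<lhd> j \<oplus> \<one> \<and> P y) \<longrightarrow> coprime_to (modulus m y) n))"
    proof
      assume "j \<oplus> \<one> \<unlhd> k"
      then have jk: "j \<lhd> k" by simp
      then obtain n where n: "\<And>y. y \<lhd> k \<Longrightarrow> y \<lhd> j \<Longrightarrow> P y \<Longrightarrow> dv (modulus m y) n"
        "\<And>y. y \<lhd> k \<Longrightarrow> \<not> (y \<lhd> j \<and> P y) \<Longrightarrow> coprime_to (modulus m y) n"
        using IH le_def by blast
      show "\<exists>n. \<forall>y. y \<lhd> k \<longrightarrow> (y \<lhd> j \<oplus> \<one> \<and> P y \<longrightarrow> dv (modulus m y) n) \<and>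
        (\<not> (y \<lhd> j \<oplus> \<one> \<and> P y) \<longrightarrow> coprime_to (modulus m y) n)"
      proof (cases "P j")
        case True
        have "coprime_to (modulus m y) (modulus m j \<otimes> n)"
          if "y \<lhd> k" "\<not> (y \<lhd> j \<oplus> \<one> \<and> P y)" for y
        proof -
          have "y \<noteq> j" "\<not> (y \<lhd> j \<and> P y)" using that True lt_suc by blast+
          then have "coprime_to (modulus m y) (modulus m j)" "coprime_to (modulus m y) n"
            using coprime_modulus[of k m j y, OF m(2)] jk that(1) n(2) by auto
          then show ?thesis unfolding coprime_to_def times_assoc by blast
        qed
        moreover have "dv (modulus m y) (modulus m j \<otimes> n)" if "y \<lhd> k" "y \<lhd> j \<oplus> \<one>" "P y" for y
        proof (cases "y = j")
          case True
          then show ?thesis using dv_self times_comm by metis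
        next
          case False
          then show ?thesis using that n(1) dv_times unfolding lt_suc by blast
        qed
        ultimately show ?thesis by blast
      next
        case False
        then have "y \<lhd> j \<oplus> \<one> \<and> P y \<longleftrightarrow> y \<lhd> j \<and> P y" for y unfolding lt_suc by blast
        then show ?thesis using n by blast
      qed
    qed
  qed
  from this[of k] obtain n where n: "\<And>y. y \<lhd> k \<Longrightarrow> P y \<Longrightarrow> dv (modulus m y) n"
    "\<And>y. y \<lhd> k \<Longrightarrow> \<not> P y \<Longrightarrow> coprime_to (modulus m y) n" by auto
  \<comment> \<open>Otherwise coprimality would make the modulus divide \<open>\<one>\<close>,
    although it exceeds \<open>\<one>\<close> because \<open>m\<close> is positive.\<close>
  have "\<not> dv (modulus m y) n" if y: "y \<lhd> k" "\<not> P y" for y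
  proof
    assume "dv (modulus m y) n"
    then have "dv (modulus m y) (n \<otimes> \<one>)" by (simp add: times_one)
    then obtain q where q: "\<one> = q \<otimes> modulus m y" using n(2)[OF y] unfolding coprime_to_def dv_def by blast
    have "\<one> \<lhd> modulus m y"
      unfolding modulus_def using m(1) zero_lt_suc by (simp add: M.less_add_same_cancel2)
    moreover have "\<zero> \<lhd> q" using q zero_times M.zero_neq_one zero_lt_iff by metis
    then have "modulus m y \<unlhd> q \<otimes> modulus m y" using le_times times_comm by metis
    ultimately show False using q M.not_less by metis
  qed
  then have "mem x (pr k (pr m n)) \<longleftrightarrow> x \<lhd> k \<and> P x" for x
    using n(1) unfolding mem_def modulus_def[symmetric] dv_def[symmetric] by auto
  then show ?thesis by blast
qed

section \<open>Finite sets, images and recursion\<close>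

lemma mem_lt: "mem x c \<Longrightarrow> x \<lhd> c"
  unfolding mem_def using M.less_le_trans by (metis le_pr1)

lemma fset_eq: "fset b \<Longrightarrow> fset c \<Longrightarrow> (\<And>x. mem x b \<longleftrightarrow> mem x c) \<Longrightarrow> b = c"
  unfolding fset_def using lt_total by blast

lemma ex_fset:
  assumes P: "A0 (\<lambda>v. P (v 0))" and bound: "\<And>x. P x \<Longrightarrow> x \<lhd> k"
  obtains c where "fset c" "\<And>x. mem x c \<longleftrightarrow> P x"
proof -
  obtain c0 where "\<forall>x. mem x c0 \<longleftrightarrow> P x" using ex_code[OF P, of k] bound by blast
  then have "\<exists>c. (\<forall>x. mem x c \<longleftrightarrow> P x) \<and> (\<forall>b. b \<lhd> c \<longrightarrow> \<not> (\<forall>x. mem x b \<longleftrightarrow> P x))"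
    by (intro A0_least) (intro ar_rules A0_rel1[OF P])
  then show thesis using that unfolding fset_def by (metis (no_types))
qed

text \<open>Collection for definable partial functions: the bound is enlarged by one value at a
  time.\<close>

lemma image_bound:
  assumes R: "A0 (\<lambda>v. R (v 0) (v (Suc 0)))" and fn: "\<And>x y z. x \<lhd> a \<Longrightarrow> R x y \<Longrightarrow> R x z \<Longrightarrow> y = z"
  shows "\<exists>b. \<forall>x y. x \<lhd> a \<longrightarrow> R x y \<longrightarrow> y \<lhd> b"
proof -
  have "k \<unlhd> a \<longrightarrow> (\<exists>b. \<forall>x y. x \<lhd> k \<longrightarrow> R x y \<longrightarrow> y \<lhd> b)" for k
  proof (rule A0_induct[where P = "\<lambda>k. k \<unlhd> a \<longrightarrow> (\<exists>b. \<forall>x y. x \<lhd> k \<longrightarrow> R x y \<longrightarrow> y \<lhd> b)"])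
    show "A0 (\<lambda>v. v 0 \<unlhd> a \<longrightarrow> (\<exists>b. \<forall>x y. x \<lhd> v 0 \<longrightarrow> R x y \<longrightarrow> y \<lhd> b))"
      by (intro ar_rules A0_rel2[OF R])
    fix n assume IH: "n \<unlhd> a \<longrightarrow> (\<exists>b. \<forall>x y. x \<lhd> n \<longrightarrow> R x y \<longrightarrow> y \<lhd> b)"
    show "n \<oplus> \<one> \<unlhd> a \<longrightarrow> (\<exists>b. \<forall>x y. x \<lhd> n \<oplus> \<one> \<longrightarrow> R x y \<longrightarrow> y \<lhd> b)"
    proof
      assume "n \<oplus> \<one> \<unlhd> a"
      then have na: "n \<lhd> a" by simp
      then obtain b where b: "\<And>x y. x \<lhd> n \<Longrightarrow> R x y \<Longrightarrow> y \<lhd> b" using IH le_def by blast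
      obtain c where c: "\<And>y. R n y \<Longrightarrow> y = c" using fn[OF na] by blast
      have "b \<unlhd> b \<oplus> c \<oplus> \<one>" "c \<lhd> b \<oplus> c \<oplus> \<one>" using le_plus1[of b "c \<oplus> \<one>"] by (simp_all add: plus_assoc'[symmetric])
      then have "y \<lhd> b \<oplus> c \<oplus> \<one>" if "x \<lhd> n \<oplus> \<one>" "R x y" for x y
      proof (cases "x = n")
        case True
        then show ?thesis using c that(2) \<open>c \<lhd> b \<oplus> c \<oplus> \<one>\<close> by simp
      next
        case False
        then have "y \<lhd> b" using b that lt_suc by blast
        then show ?thesis using \<open>b \<unlhd> b \<oplus> c \<oplus> \<one>\<close> by (rule M.less_le_trans)
      qed
      then show "\<exists>b. \<forall>x y. x \<lhd> n \<oplus> \<one> \<longrightarrow> R x y \<longrightarrow> y \<lhd> b" by blast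
    qed
  qed (simp add: not_lt_zero)
  then show ?thesis by auto
qed

lemma ex_image:
  assumes R: "A0 (\<lambda>v. R (v 0) (v (Suc 0)))" and fn: "\<And>x y z. mem x a \<Longrightarrow> R x y \<Longrightarrow> R x z \<Longrightarrow> y = z"
  obtains b where "fset b" "\<And>y. mem y b \<longleftrightarrow> (\<exists>x. mem x a \<and> R x y)"
proof -
  have "\<exists>b. \<forall>x y. x \<lhd> a \<longrightarrow> mem x a \<and> R x y \<longrightarrow> y \<lhd> b"
  proof (rule image_bound)
    show "A0 (\<lambda>v. mem (v 0) a \<and> R (v 0) (v (Suc 0)))" by (intro ar_rules R)
  qed (use fn in blast)
  then obtain b where "\<And>y. (\<exists>x. mem x a \<and> R x y) \<Longrightarrow> y \<lhd> b" using mem_lt by blast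
  moreover have "A0 (\<lambda>v. \<exists>x. mem x a \<and> R x (v 0))" by (intro ar_rules A0_rel2[OF R])
  ultimately show thesis
    using ex_fset[of "\<lambda>y. \<exists>x. mem x a \<and> R x y" b thesis] that by blast
qed

text \<open>Course-of-values recursion. The hypothesis \<open>bound\<close> leaves only finitely
  many candidates up to each rank, so a number can code the solution below a given rank
  (\<open>appr\<close>). Such approximations agree where both are defined, and the solution is the
  arithmetical set of all members of approximations. Definability of \<open>\<Phi>\<close> is only
  asked for coded finite sets in its second argument.\<close>

lemma recursion:
  assumes rank: "A0 (\<lambda>v. v 0 = rank (v (Suc 0)))"
    and \<Phi>: "A0 (\<lambda>v. \<Phi> (v 0) {y. mem y (v (Suc 0)) \<and> rank y \<lhd> rank (v 0)})"
    and bound: "\<And>r. \<exists>b. \<forall>z. rank z \<unlhd> r \<longrightarrow> (\<exists>X. \<Phi> z X) \<longrightarrow> z \<lhd> b"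
  shows "\<exists>D\<in>\<S>. \<forall>x. x \<in> D \<longleftrightarrow> \<Phi> x {y \<in> D. rank y \<lhd> rank x}"
proof -
  define below where "below c x = {y. mem y c \<and> rank y \<lhd> rank x}" for c x
  define appr where "appr r c \<longleftrightarrow> (\<forall>x. mem x c \<longleftrightarrow> rank x \<lhd> r \<and> \<Phi> x (below c x))" for r c
  have [ar_rules]: "af f \<Longrightarrow> af (\<lambda>v. rank (f v))" for f using af_fun1[OF rank] .
  have \<Phi>' [ar_rules]: "af f \<Longrightarrow> af g \<Longrightarrow> A0 (\<lambda>v. \<Phi> (f v) (below (g v) (f v)))" for f g
    unfolding below_def using A0_rel2[OF \<Phi>] .
  have appr_A0 [ar_rules]: "af f \<Longrightarrow> af g \<Longrightarrow> A0 (\<lambda>v. appr (f v) (g v))" for f g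
    by (erule (1) A0_rel2[rotated]) (unfold appr_def, intro ar_rules)
  have ex: "\<exists>c. appr r c" for r
  proof (rule A0_induct[where P = "\<lambda>r. \<exists>c. appr r c"])
    show "A0 (\<lambda>v. \<exists>c. appr (v 0) c)" by (intro ar_rules)
    show "\<exists>c. appr \<zero> c"
      unfolding appr_def using ex_code[of "\<lambda>_. False" \<zero>] not_lt_zero by (simp add: A0_bool)
    fix r assume "\<exists>c. appr r c"
    then obtain c where c: "appr r c" by blast
    obtain b where b: "\<And>z X. rank z \<unlhd> r \<Longrightarrow> \<Phi> z X \<Longrightarrow> z \<lhd> b" using bound by blast
    have "A0 (\<lambda>v. rank (v 0) \<unlhd> r \<and> \<Phi> (v 0) (below c (v 0)))" by (intro ar_rules)
    then obtain c' where c': "\<And>x. mem x c' \<longleftrightarrow> x \<lhd> b \<and> rank x \<unlhd> r \<and> \<Phi> x (below c x)"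
      using ex_code[of "\<lambda>x. rank x \<unlhd> r \<and> \<Phi> x (below c x)" b] by blast
    have "below c' x = below c x" if "rank x \<unlhd> r" for x
    proof -
      have "mem y c' \<longleftrightarrow> mem y c" if "rank y \<lhd> r" for y
        using that c c' b unfolding appr_def le_def by blast
      then show ?thesis unfolding below_def using \<open>rank x \<unlhd> r\<close> M.less_le_trans by blast
    qed
    then have "appr (r \<oplus> \<one>) c'"
      unfolding appr_def c' using b by auto
    then show "\<exists>c. appr (r \<oplus> \<one>) c" by blast
  qed
  have unique: "\<forall>x. rank x = s \<longrightarrow> s \<lhd> r \<longrightarrow> s \<lhd> r' \<longrightarrow> (mem x c \<longleftrightarrow> mem x c')"
    if "appr r c" "appr r' c'" for r r' c c' s
  proof (rule A0_less_induct[where P = "\<lambda>s. \<forall>x. rank x = s \<longrightarrow> s \<lhd> r \<longrightarrow> s \<lhd> r' \<longrightarrow> (mem x c \<longleftrightarrow> mem x c')"])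
    show "A0 (\<lambda>v. \<forall>x. rank x = v 0 \<longrightarrow> v 0 \<lhd> r \<longrightarrow> v 0 \<lhd> r' \<longrightarrow> (mem x c \<longleftrightarrow> mem x c'))"
      by (intro ar_rules)
    fix s assume IH: "\<And>t. t \<lhd> s \<Longrightarrow> \<forall>x. rank x = t \<longrightarrow> t \<lhd> r \<longrightarrow> t \<lhd> r' \<longrightarrow> (mem x c \<longleftrightarrow> mem x c')"
    show "\<forall>x. rank x = s \<longrightarrow> s \<lhd> r \<longrightarrow> s \<lhd> r' \<longrightarrow> (mem x c \<longleftrightarrow> mem x c')"
    proof (intro allI impI)
      fix x assume x: "rank x = s" "s \<lhd> r" "s \<lhd> r'"
      have "below c x = below c' x" unfolding below_def using x IH lt_trans by blast
      then show "mem x c \<longleftrightarrow> mem x c'" using that x unfolding appr_def by metis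
    qed
  qed
  define D where "D = {x. \<exists>c. appr (rank x \<oplus> \<one>) c \<and> mem x c}"
  have "D \<in> \<S>" unfolding D_def by (rule A0_CA) (intro ar_rules)
  moreover have "x \<in> D \<longleftrightarrow> \<Phi> x {y \<in> D. rank y \<lhd> rank x}" for x
  proof -
    obtain c where c: "appr (rank x \<oplus> \<one>) c" using ex by blast
    have D: "y \<in> D \<longleftrightarrow> mem y c" if "rank y \<unlhd> rank x" for y
      unfolding D_def mem_Collect_eq using ex[of "rank y \<oplus> \<one>"] unique[OF _ c] that by auto
    then have "{y \<in> D. rank y \<lhd> rank x} = below c x" unfolding below_def le_def by blast
    moreover have "mem x c \<longleftrightarrow> \<Phi> x (below c x)" using c unfolding appr_def by simp
    ultimately show ?thesis using D by simp
  qed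
  ultimately show ?thesis by blast
qed

end

section \<open>Enumerations of finite linear orders\<close>

context model
begin

definition ar2 :: "('a \<Rightarrow> 'a \<Rightarrow> bool) \<Rightarrow> bool" where
  "ar2 R \<longleftrightarrow> A0 (\<lambda>v. R (v 0) (v (Suc 0)))"

lemma ar2D: "ar2 R \<Longrightarrow> af f \<Longrightarrow> af g \<Longrightarrow> A0 (\<lambda>v. R (f v) (g v))"
  unfolding ar2_def by (rule A0_rel2)

text \<open>Unlike in \<open>lin\<close>, the relation may also hold outside of \<open>P\<close>, so
  that the property passes to subsets without restricting \<open>R\<close>.\<close>

definition linon :: "('a \<Rightarrow> 'a \<Rightarrow> bool) \<Rightarrow> ('a \<Rightarrow> bool) \<Rightarrow> bool" where
  "linon R P \<longleftrightarrow> (\<forall>x. P x \<longrightarrow> \<not> R x x) \<and>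
    (\<forall>x y z. P x \<longrightarrow> P y \<longrightarrow> P z \<longrightarrow> R x y \<longrightarrow> R y z \<longrightarrow> R x z) \<and>
    (\<forall>x y. P x \<longrightarrow> P y \<longrightarrow> R x y \<or> x = y \<or> R y x)"

lemma linonD:
  assumes "linon R P"
  shows "P x \<Longrightarrow> \<not> R x x" "P x \<Longrightarrow> P y \<Longrightarrow> P z \<Longrightarrow> R x y \<Longrightarrow> R y z \<Longrightarrow> R x z"
    "P x \<Longrightarrow> P y \<Longrightarrow> R x y \<or> x = y \<or> R y x" "P x \<Longrightarrow> P y \<Longrightarrow> R x y \<Longrightarrow> \<not> R y x"
  using assms unfolding linon_def by blast+

lemma linon_mono: "linon R P \<Longrightarrow> (\<And>x. Q x \<Longrightarrow> P x) \<Longrightarrow> linon R Q"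
  unfolding linon_def by (elim conjE, intro conjI allI impI) metis+

lemma linon_lt: "linon (\<lhd>) P"
  unfolding linon_def
  by (intro conjI allI impI) (rule lt_irrefl, erule (1) lt_trans, rule lt_total)

lemma A0_mor [ar_rules]: "A0 (\<lambda>v. mor (v f) (v n) (v l))"
  unfolding mor_def ffun_def by (intro ar_rules)

lemma A0_fcard [ar_rules]: "A0 (\<lambda>v. fcard (v a) (v n))"
  unfolding fcard_def ffun_def by (intro ar_rules)

lemma A0_funion [ar_rules]: "A0 (\<lambda>v. funion (v c) (v a) (v b))"
  unfolding funion_def by (intro ar_rules)

lemma A0_enm:
  assumes "A0 (\<lambda>v. R (v 0) (v (Suc 0)) (v (Suc (Suc 0))))"
  shows "A0 (\<lambda>v. enm (v f) (v n) (v a) (R (v d)))"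
  unfolding enm_def ffun_def by (intro ar_rules A0_rel3[OF assms])

lemma A0_inc:
  assumes "A0 (\<lambda>v. R (v 0) (v (Suc 0)) (v (Suc (Suc 0))))"
  shows "A0 (\<lambda>v. inc (v g) (v p) (v r) (v a) (v c) (R (v d)))"
  unfolding inc_def by (intro ar_rules A0_enm[OF assms])

lemma ar2_rel3: "ar2 R \<Longrightarrow> A0 (\<lambda>v. (\<lambda>_. R) (v 0) (v (Suc 0)) (v (Suc (Suc 0))))"
  by (intro ar2D ar_rules)

lemma ffunI:
  assumes "fset f" "\<And>z. mem z f \<longleftrightarrow> (\<exists>i x. z = pr i x \<and> i \<lhd> n \<and> G i x)"
    "\<And>i. i \<lhd> n \<Longrightarrow> \<exists>!x. G i x" "\<And>i x. i \<lhd> n \<Longrightarrow> G i x \<Longrightarrow> B x"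
  shows "ffun f n B"
  unfolding ffun_def using assms(1,3,4) by (auto simp: assms(2))

lemma ex_graph:
  assumes G: "ar2 G" and fn: "\<And>i. i \<lhd> n \<Longrightarrow> \<exists>!x. G i x"
  obtains f where "fset f" "\<And>z. mem z f \<longleftrightarrow> (\<exists>i x. z = pr i x \<and> i \<lhd> n \<and> G i x)"
proof -
  have "A0 (\<lambda>v. v 0 \<lhd> n)" by (intro ar_rules)
  then obtain d where d: "\<And>i. mem i d \<longleftrightarrow> i \<lhd> n" using ex_code[of "\<lambda>i. i \<lhd> n" n] by blast
  have "A0 (\<lambda>v. \<exists>x. v (Suc 0) = pr (v 0) x \<and> G (v 0) x)" by (intro ar_rules ar2D[OF G])
  then show thesis
  proof (rule ex_image[of "\<lambda>i z. \<exists>x. z = pr i x \<and> G i x" d])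
    fix i y z assume "mem i d" "\<exists>x. y = pr i x \<and> G i x" "\<exists>x. z = pr i x \<and> G i x"
    then show "y = z" using fn d by blast
  next
    fix f assume "fset f" "\<And>z. mem z f \<longleftrightarrow> (\<exists>i. mem i d \<and> (\<exists>x. z = pr i x \<and> G i x))"
    then show thesis using d by (intro that) auto
  qed
qed

lemma ffunD:
  assumes "ffun f n B"
  shows "fset f" "mem (pr i x) f \<Longrightarrow> i \<lhd> n" "mem (pr i x) f \<Longrightarrow> B x"
    "i \<lhd> n \<Longrightarrow> \<exists>x. mem (pr i x) f" "mem (pr i x) f \<Longrightarrow> mem (pr i y) f \<Longrightarrow> x = y"
proof -
  show "fset f" using assms unfolding ffun_def by blast
  have *: "i \<lhd> n \<and> B x" if "mem (pr i x) f" for i x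
    using assms that unfolding ffun_def by fastforce
  show "mem (pr i x) f \<Longrightarrow> i \<lhd> n" "mem (pr i x) f \<Longrightarrow> B x" using * by auto
  show "i \<lhd> n \<Longrightarrow> \<exists>x. mem (pr i x) f" using assms unfolding ffun_def by blast
  show "mem (pr i x) f \<Longrightarrow> mem (pr i y) f \<Longrightarrow> x = y" using assms * unfolding ffun_def by blast
qed

lemma ffun_eq:
  assumes "ffun f n B" "ffun f' n B'" "\<And>i x. mem (pr i x) f \<Longrightarrow> mem (pr i x) f'"
  shows "f = f'"
proof (rule fset_eq)
  fix z show "mem z f \<longleftrightarrow> mem z f'"
  proof
    assume "mem z f" then show "mem z f'" using assms(1,3) unfolding ffun_def by blast
  next
    assume z: "mem z f'"
    then obtain i x where i: "z = pr i x" "i \<lhd> n" using assms(2) unfolding ffun_def by blast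
    then show "mem z f" using z assms ffunD by metis
  qed
qed (use assms in \<open>auto simp: ffun_def\<close>)

section \<open>Existence and uniqueness of increasing enumerations\<close>

lemma enmD:
  assumes "enm f n a R"
  shows "ffun f n (\<lambda>x. mem x a)" "mem x a \<Longrightarrow> \<exists>i. mem (pr i x) f"
    "mem (pr i x) f \<Longrightarrow> mem (pr j y) f \<Longrightarrow> i \<lhd> j \<Longrightarrow> R x y"
  using assms unfolding enm_def by blast+

lemma enm_inj:
  assumes "enm f n a R" "linon R (\<lambda>x. mem x a)" "mem (pr i x) f" "mem (pr j x) f"
  shows "i = j"
  using assms enmD ffunD(3)[OF enmD(1)] linonD(1)[OF assms(2)] lt_total by metis

lemma enm_reflect:
  assumes "enm f n a R" "linon R (\<lambda>x. mem x a)" "mem (pr i x) f" "mem (pr j y) f" "R x y"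
  shows "i \<lhd> j"
proof -
  have xy: "mem x a" "mem y a" using ffunD(3)[OF enmD(1)[OF assms(1)]] assms(3,4) by auto
  have "i \<noteq> j" using assms ffunD(5)[OF enmD(1)[OF assms(1)]] linonD(1)[OF assms(2)] xy by metis
  moreover have "\<not> j \<lhd> i" using enmD(3)[OF assms(1,4,3)] linonD(4)[OF assms(2)] xy assms(5) by blast
  ultimately show ?thesis using lt_total by blast
qed

lemma enm_fcard: "enm f n a R \<Longrightarrow> linon R (\<lambda>x. mem x a) \<Longrightarrow> fcard a n"
  unfolding fcard_def using enm_inj enmD by metis

text \<open>The new element goes to the first position \<open>p\<close> whose entry exceeds it, or
  to the end if there is none; entries from \<open>p\<close> on move up by one.\<close>

lemma enm_insert:
  assumes f: "enm f n a R" and R: "ar2 R" and x: "\<not> mem x a"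
    and b: "\<And>y. mem y b \<longleftrightarrow> mem y a \<or> y = x" and lin: "linon R (\<lambda>x. mem x b)"
  shows "\<exists>f'. enm f' (n \<oplus> \<one>) b R"
proof -
  note ff = ffunD[OF enmD(1)[OF f]]
  have lina: "linon R (\<lambda>x. mem x a)" by (rule linon_mono[OF lin]) (simp add: b)
  have "\<exists>p. (p = n \<or> (\<exists>y. mem (pr p y) f \<and> R x y)) \<and> (\<forall>i. i \<lhd> p \<longrightarrow> \<not> (i = n \<or> (\<exists>y. mem (pr i y) f \<and> R x y)))"
    by (rule A0_least[of _ n]) (intro ar_rules ar2D[OF R], simp)
  then obtain p where p: "p = n \<or> (\<exists>y. mem (pr p y) f \<and> R x y)"
    "\<And>i y. i \<lhd> p \<Longrightarrow> mem (pr i y) f \<Longrightarrow> \<not> R x y" "\<not> n \<lhd> p" by blast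
  have pn: "p \<unlhd> n" using p(3) M.not_less by blast
  have less: "R y x" if "i \<lhd> p" "mem (pr i y) f" for i y
    using p(2)[OF that] that(2) ff(3) x b linonD(3)[OF lin] by metis
  have greater: "R x y" if iy: "p \<unlhd> i" "mem (pr i y) f" for i y
  proof -
    obtain y0 where y0: "mem (pr p y0) f" "R x y0"
      using iy ff(2) p(1) M.not_less by metis
    show ?thesis
    proof (cases "p = i")
      case True
      then show ?thesis using y0 iy ff(5) by metis
    next
      case False
      then have "p \<lhd> i" using iy(1) unfolding le_def by blast
      then have "R y0 y" using enmD(3)[OF f y0(1) iy(2)] by blast
      then show ?thesis using y0 iy(2) ff(3) b linonD(2)[OF lin] by metis
    qed
  qed
  define G where "G i y \<longleftrightarrow> (i \<lhd> p \<and> mem (pr i y) f) \<or> (i = p \<and> y = x) \<or>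
    (\<exists>j. i = j \<oplus> \<one> \<and> p \<unlhd> j \<and> mem (pr j y) f)" for i y
  have G: "ar2 G" unfolding G_def ar2_def by (intro ar_rules)
  have Gmem: "mem y b" if "G i y" for i y using that ff(3) b unfolding G_def by blast
  have G1: "\<exists>!y. G i y" if "i \<lhd> n \<oplus> \<one>" for i
  proof -
    have above: "p \<lhd> i" if "i = j \<oplus> \<one>" "p \<unlhd> j" for j using that by simp
    have excl: "\<not> (i \<lhd> p \<and> i = p)" "\<not> (i \<lhd> p \<and> p \<unlhd> j \<and> i = j \<oplus> \<one>)" "\<not> (i = p \<and> p \<unlhd> j \<and> i = j \<oplus> \<one>)" for j
      using lt_irrefl above lt_trans by blast+
    consider "i \<lhd> p" | "i = p" | j where "i = j \<oplus> \<one>" "p \<unlhd> j"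
      using lt_total[of i p] zero_or_suc[of i] not_lt_zero[of p] by auto
    then show ?thesis
    proof cases
      case 1
      then have "i \<lhd> n" using pn by (rule M.less_le_trans)
      then show ?thesis unfolding G_def using 1 excl ff(4,5) by blast
    next
      case 2
      then show ?thesis unfolding G_def using excl by blast
    next
      case 3
      then have "j \<lhd> n" using that by simp
      then show ?thesis unfolding G_def using 3 excl ff(4,5) suc_inject by metis
    qed
  qed
  obtain f' where f': "fset f'" "\<And>z. mem z f' \<longleftrightarrow> (\<exists>i x. z = pr i x \<and> i \<lhd> n \<oplus> \<one> \<and> G i x)"
    using ex_graph[OF G G1] by blast
  have ffun: "ffun f' (n \<oplus> \<one>) (\<lambda>x. mem x b)" using f' G1 Gmem by (rule ffunI)
  have mem_f': "mem (pr i y) f' \<longleftrightarrow> i \<lhd> n \<oplus> \<one> \<and> G i y" for i y by (simp add: f'(2) del: lt_suc_iff)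
  have onto: "\<exists>i. mem (pr i y) f'" if y: "mem y b" for y
  proof (cases "y = x")
    case True
    then have "G p y" unfolding G_def by blast
    then show ?thesis using pn mem_f' by auto
  next
    case False
    then obtain i where i: "mem (pr i y) f" using y b enmD(2)[OF f] by blast
    then have "i \<lhd> n" using ff(2) by blast
    then show ?thesis using i mem_f' unfolding G_def
      by (metis M.not_less lt_suc suc_lt_suc)
  qed
  have mono: "R y z" if ij: "mem (pr i y) f'" "mem (pr j z) f'" "i \<lhd> j" for i j y z
  proof -
    have "G i y" "G j z" using ij mem_f' by auto
    then consider "i \<lhd> p" "mem (pr i y) f" "j \<lhd> p" "mem (pr j z) f"
      | "i \<lhd> p" "mem (pr i y) f" "z = x"
      | k where "i \<lhd> p" "mem (pr i y) f" "j = k \<oplus> \<one>" "p \<unlhd> k" "mem (pr k z) f"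
      | k where "y = x" "p \<unlhd> k" "mem (pr k z) f"
      | k l where "i = k \<oplus> \<one>" "j = l \<oplus> \<one>" "mem (pr k y) f" "mem (pr l z) f"
      | "i = p" "j \<lhd> p" | "i = p" "j = p" | k where "i = k \<oplus> \<one>" "p \<unlhd> k" "j \<unlhd> p"
      unfolding G_def le_def by blast
    then show ?thesis
    proof cases
      case 3
      then have "R y x" "R x z" using less greater by blast+
      then show ?thesis using linonD(2)[OF lin] b 3 ff(3) by metis
    next
      case 8
      then have "i \<lhd> p" using ij(3) by (meson M.less_le_trans)
      moreover have "p \<lhd> i" using 8 by simp
      ultimately show ?thesis using lt_trans lt_irrefl by blast
    next
      case 1
      then show ?thesis using enmD(3)[OF f _ _ ij(3)] by blast
    next
      case 2
      then show ?thesis using less by blast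
    next
      case 4
      then show ?thesis using greater by blast
    next
      case 5
      then show ?thesis using enmD(3)[OF f, of k y l z] ij(3) by simp
    next
      case 6
      then show ?thesis using ij(3) lt_trans lt_irrefl by blast
    next
      case 7
      then show ?thesis using ij(3) lt_irrefl by blast
    qed
  qed
  have "enm f' (n \<oplus> \<one>) b R" unfolding enm_def using ffun onto mono by blast
  then show ?thesis by blast
qed

lemma enm_empty: "(\<And>x. \<not> mem x a) \<Longrightarrow> \<exists>f. enm f \<zero> a R"
proof -
  assume a: "\<And>x. \<not> mem x a"
  have "A0 (\<lambda>v. False)" by (intro ar_rules)
  then obtain f where "fset f" "\<And>x. \<not> mem x f" using ex_fset[of "\<lambda>_. False" \<zero>] by auto
  then show ?thesis unfolding enm_def ffun_def by (intro exI[of _ f]) (simp add: a not_lt_zero)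
qed

lemma fset_remove: obtains b where "fset b" "\<And>y. mem y b \<longleftrightarrow> mem y a \<and> y \<noteq> x"
proof -
  have "A0 (\<lambda>v. mem (v 0) a \<and> v 0 \<noteq> x)" by (intro ar_rules)
  then show thesis using ex_fset[of "\<lambda>y. mem y a \<and> y \<noteq> x" a] mem_lt that by blast
qed

text \<open>By induction on the cardinality: the last value of the given bijection is removed, the
  rest is enumerated in increasing order, and the value is inserted again.\<close>

lemma enm_ex:
  assumes R: "ar2 R" and lin: "linon R (\<lambda>x. mem x a)" and card: "fcard a n"
  shows "\<exists>f. enm f n a R"
proof -
  have "\<forall>a. fcard a n \<longrightarrow> linon R (\<lambda>x. mem x a) \<longrightarrow> (\<exists>f. enm f n a R)"
  proof (rule A0_induct[where P = "\<lambda>n. \<forall>a. fcard a n \<longrightarrow> linon R (\<lambda>x. mem x a) \<longrightarrow> (\<exists>f. enm f n a R)"])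
    show "A0 (\<lambda>v. \<forall>a. fcard a (v 0) \<longrightarrow> linon R (\<lambda>x. mem x a) \<longrightarrow> (\<exists>f. enm f (v 0) a R))"
      unfolding linon_def by (intro ar_rules ar2D[OF R] A0_enm[OF ar2_rel3[OF R]])
    show "\<forall>a. fcard a \<zero> \<longrightarrow> linon R (\<lambda>x. mem x a) \<longrightarrow> (\<exists>f. enm f \<zero> a R)"
      unfolding fcard_def using enm_empty ffunD(2) not_lt_zero by metis
    fix n assume IH: "\<forall>a. fcard a n \<longrightarrow> linon R (\<lambda>x. mem x a) \<longrightarrow> (\<exists>f. enm f n a R)"
    show "\<forall>a. fcard a (n \<oplus> \<one>) \<longrightarrow> linon R (\<lambda>x. mem x a) \<longrightarrow> (\<exists>f. enm f (n \<oplus> \<one>) a R)"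
    proof (intro allI impI)
      fix a assume "fcard a (n \<oplus> \<one>)" and lin: "linon R (\<lambda>x. mem x a)"
      then obtain f where f: "ffun f (n \<oplus> \<one>) (\<lambda>x. mem x a)" "\<And>x. mem x a \<Longrightarrow> \<exists>!i. mem (pr i x) f"
        unfolding fcard_def by blast
      obtain x where x: "mem (pr n x) f" using ffunD(4)[OF f(1)] by auto
      obtain b where b: "fset b" "\<And>y. mem y b \<longleftrightarrow> mem y a \<and> y \<noteq> x" using fset_remove[of a x] by blast
      have "ar2 (\<lambda>i y. mem (pr i y) f)" unfolding ar2_def by (intro ar_rules)
      moreover have f1: "\<exists>!y. mem (pr i y) f" if "i \<lhd> n" for i
        using ffunD(4,5)[OF f(1)] that by (metis lt_suc)
      ultimately obtain g where g: "fset g" "\<And>z. mem z g \<longleftrightarrow> (\<exists>i x. z = pr i x \<and> i \<lhd> n \<and> mem (pr i x) f)"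
        using ex_graph[of "\<lambda>i y. mem (pr i y) f" n] by blast
      have xa: "mem x a" using x ffunD(3)[OF f(1)] by blast
      have "ffun g n (\<lambda>x. mem x b)"
      proof (rule ffunI[OF g f1])
        fix i y assume "i \<lhd> n" "mem (pr i y) f"
        then show "mem y b" using b(2) f(2)[OF xa] x ffunD(3)[OF f(1)] lt_irrefl by blast
      qed
      moreover have "\<exists>!i. mem (pr i y) g" if "mem y b" for y
      proof -
        have y: "mem y a" "y \<noteq> x" using that b by auto
        then obtain i where i: "mem (pr i y) f" using f(2) by blast
        then have "i \<lhd> n" using x y ffunD(2,5)[OF f(1)] lt_suc by metis
        then show ?thesis using i f(2)[OF y(1)] g(2) by auto
      qed
      ultimately have "fcard b n" unfolding fcard_def by (intro exI conjI allI impI)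
      moreover have "linon R (\<lambda>x. mem x b)" by (rule linon_mono[OF lin]) (simp add: b)
      ultimately obtain h where "enm h n b R" using IH by blast
      then show "\<exists>f. enm f (n \<oplus> \<one>) a R"
        using R _ _ lin by (rule enm_insert[of _ _ _ _ x]) (use b xa in auto)
    qed
  qed
  then show ?thesis using lin card by blast
qed

text \<open>The elements below \<open>k\<close> are counted by induction on \<open>k\<close>. At
  \<open>k = a\<close> all of them are reached, since elements are smaller than the code.\<close>

lemma fcard_ex: "\<exists>n. fcard a n"
proof -
  have R: "ar2 (\<lhd>)" unfolding ar2_def by (intro ar_rules)
  have "\<exists>b. (\<forall>x. mem x b \<longleftrightarrow> x \<lhd> k \<and> mem x a) \<and> (\<exists>n f. enm f n b (\<lhd>))" for k
  proof (rule A0_induct[where P = "\<lambda>k. \<exists>b. (\<forall>x. mem x b \<longleftrightarrow> x \<lhd> k \<and> mem x a) \<and> (\<exists>n f. enm f n b (\<lhd>))"])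
    show "A0 (\<lambda>v. \<exists>b. (\<forall>x. mem x b \<longleftrightarrow> x \<lhd> v 0 \<and> mem x a) \<and> (\<exists>n f. enm f n b (\<lhd>)))"
      by (intro ar_rules A0_enm[OF ar2_rel3[OF R]])
    obtain b where "\<And>x. mem x b \<longleftrightarrow> x \<lhd> \<zero> \<and> False" using ex_code[of "\<lambda>_. False" \<zero>] A0_bool by auto
    then show "\<exists>b. (\<forall>x. mem x b \<longleftrightarrow> x \<lhd> \<zero> \<and> mem x a) \<and> (\<exists>n f. enm f n b (\<lhd>))"
      using not_lt_zero enm_empty by metis
    fix k assume "\<exists>b. (\<forall>x. mem x b \<longleftrightarrow> x \<lhd> k \<and> mem x a) \<and> (\<exists>n f. enm f n b (\<lhd>))"
    then obtain b n f where b: "\<And>x. mem x b \<longleftrightarrow> x \<lhd> k \<and> mem x a" and f: "enm f n b (\<lhd>)" by blast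
    show "\<exists>b. (\<forall>x. mem x b \<longleftrightarrow> x \<lhd> k \<oplus> \<one> \<and> mem x a) \<and> (\<exists>n f. enm f n b (\<lhd>))"
    proof (cases "mem k a")
      case True
      have "A0 (\<lambda>v. mem (v 0) a)" by (intro ar_rules)
      then obtain c where c: "\<And>x. mem x c \<longleftrightarrow> x \<lhd> k \<oplus> \<one> \<and> mem x a"
        using ex_code[of "\<lambda>x. mem x a" "k \<oplus> \<one>"] by blast
      then have "\<exists>f. enm f (n \<oplus> \<one>) c (\<lhd>)"
        using True b lt_irrefl by (intro enm_insert[OF f R _ _ linon_lt, of k]) (auto simp: lt_suc simp del: lt_suc_iff)
      then show ?thesis using c by blast
    next
      case False
      then have "x \<lhd> k \<oplus> \<one> \<and> mem x a \<longleftrightarrow> mem x b" for x using b lt_suc by blast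
      then show ?thesis using f by blast
    qed
  qed
  then obtain b n f where b: "\<And>x. mem x b \<longleftrightarrow> x \<lhd> a \<and> mem x a" and f: "enm f n b (\<lhd>)" by blast
  have "mem x b \<longleftrightarrow> mem x a" for x using b mem_lt by blast
  then have "fcard a n" using enm_fcard[OF f linon_lt] unfolding fcard_def by auto
  then show ?thesis by blast
qed

text \<open>Induction on the position. If the entry \<open>x\<close> of \<open>f\<close> at
  \<open>i\<close> came earlier in \<open>f'\<close>, it would by induction occur twice in
  \<open>f\<close>. If it came later, the entry of \<open>f'\<close> at \<open>i\<close> would be
  smaller than \<open>x\<close>, hence come earlier in \<open>f\<close> and occur twice in
  \<open>f'\<close>.\<close>

lemma enm_initial:
  assumes f: "enm f n a R" and f': "enm f' n' a R" and lin: "linon R (\<lambda>x. mem x a)"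
  shows "i \<lhd> n \<longrightarrow> (\<exists>x. mem (pr i x) f \<and> mem (pr i x) f')"
proof (rule A0_less_induct[where P = "\<lambda>i. i \<lhd> n \<longrightarrow> (\<exists>x. mem (pr i x) f \<and> mem (pr i x) f')"])
  show "A0 (\<lambda>v. v 0 \<lhd> n \<longrightarrow> (\<exists>x. mem (pr (v 0) x) f \<and> mem (pr (v 0) x) f'))" by (intro ar_rules)
  fix i assume IH: "\<And>j. j \<lhd> i \<Longrightarrow> j \<lhd> n \<longrightarrow> (\<exists>x. mem (pr j x) f \<and> mem (pr j x) f')"
  note ff = ffunD[OF enmD(1)[OF f]] and ff' = ffunD[OF enmD(1)[OF f']]
  show "i \<lhd> n \<longrightarrow> (\<exists>x. mem (pr i x) f \<and> mem (pr i x) f')"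
  proof
    assume i: "i \<lhd> n"
    then obtain x where x: "mem (pr i x) f" using ff(4) by blast
    then obtain k where k: "mem (pr k x) f'" using enmD(2)[OF f'] ff(3) by blast
    have "\<not> k \<lhd> i"
    proof
      assume "k \<lhd> i"
      then obtain y where "mem (pr k y) f" "mem (pr k y) f'" using IH i lt_trans by blast
      then have "mem (pr k x) f" using k ff'(5) by blast
      then show False using enm_inj[OF f lin x] \<open>k \<lhd> i\<close> lt_irrefl by blast
    qed
    moreover have "\<not> i \<lhd> k"
    proof
      assume ik: "i \<lhd> k"
      then have "i \<lhd> n'" using ff'(2)[OF k] lt_trans by blast
      then obtain y where y: "mem (pr i y) f'" using ff'(4) by blast
      then have "R y x" using enmD(3)[OF f' _ k ik] by blast
      obtain m where m: "mem (pr m y) f" using y ff'(3) enmD(2)[OF f] by blast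
      then have "m \<lhd> i" using enm_reflect[OF f lin m x \<open>R y x\<close>] by blast
      then obtain z where "mem (pr m z) f" "mem (pr m z) f'" using IH i lt_trans by blast
      then have "mem (pr m y) f'" using m ff(5) by blast
      then show False using enm_inj[OF f' lin y] \<open>m \<lhd> i\<close> lt_irrefl by blast
    qed
    ultimately show "\<exists>x. mem (pr i x) f \<and> mem (pr i x) f'" using x k lt_total by blast
  qed
qed

lemma enm_unique:
  assumes f: "enm f n a R" and f': "enm f' n' a R" and lin: "linon R (\<lambda>x. mem x a)"
  shows "n = n'" "f = f'"
proof -
  have "i \<lhd> n \<Longrightarrow> i \<lhd> n'" for i
    using enm_initial[OF f f' lin] ffunD(2)[OF enmD(1)[OF f']] by blast
  moreover have "i \<lhd> n' \<Longrightarrow> i \<lhd> n" for i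
    using enm_initial[OF f' f lin] ffunD(2)[OF enmD(1)[OF f]] by blast
  ultimately show n: "n = n'" using lt_irrefl lt_total by metis
  show "f = f'"
  proof (rule ffun_eq[OF enmD(1)[OF f] enmD(1)[OF f'[folded n]]])
    fix i x assume "mem (pr i x) f"
    then show "mem (pr i x) f'"
      using enm_initial[OF f f' lin] ffunD(2,5)[OF enmD(1)[OF f]] by metis
  qed
qed

text \<open>An internal pigeonhole principle: both cardinalities are realized by enumerations that
  increase with respect to \<open>\<lhd>\<close>, and these are unique.\<close>

lemma fcard_unique: assumes "fcard a n" "fcard a n'" shows "n = n'"
proof -
  have "ar2 (\<lhd>)" unfolding ar2_def by (intro ar_rules)
  then show ?thesis using enm_ex linon_lt assms enm_unique(1) by metis
qed

lemma enm_map: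
  assumes f: "enm f n a R" and \<phi>: "ar2 \<phi>"
    and fn: "\<And>x. mem x a \<Longrightarrow> \<exists>!y. \<phi> x y"
    and mono: "\<And>x x' y y'. mem x a \<Longrightarrow> mem x' a \<Longrightarrow> \<phi> x y \<Longrightarrow> \<phi> x' y' \<Longrightarrow> R x x' \<Longrightarrow> R' y y'"
    and b: "\<And>y. mem y b \<longleftrightarrow> (\<exists>x. mem x a \<and> \<phi> x y)"
  obtains g where "enm g n b R'" "\<And>i y. mem (pr i y) g \<longleftrightarrow> (\<exists>x. mem (pr i x) f \<and> \<phi> x y)"
proof -
  note ff = ffunD[OF enmD(1)[OF f]]
  define G where "G i y \<longleftrightarrow> (\<exists>x. mem (pr i x) f \<and> \<phi> x y)" for i y
  have G: "ar2 G" unfolding G_def ar2_def by (intro ar_rules ar2D[OF \<phi>])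
  have G1: "\<exists>!y. G i y" if "i \<lhd> n" for i unfolding G_def using ff fn that by metis
  obtain g where g: "fset g" "\<And>z. mem z g \<longleftrightarrow> (\<exists>i x. z = pr i x \<and> i \<lhd> n \<and> G i x)"
    using ex_graph[OF G G1] by blast
  have mem_g: "mem (pr i y) g \<longleftrightarrow> (\<exists>x. mem (pr i x) f \<and> \<phi> x y)" for i y
    using g(2) ff(2) unfolding G_def by auto
  have "ffun g n (\<lambda>x. mem x b)"
  proof (rule ffunI[OF g G1])
    fix i y assume "i \<lhd> n" "G i y"
    then show "mem y b" unfolding G_def b using ff(3) by blast
  qed
  moreover have "\<exists>i. mem (pr i y) g" if "mem y b" for y
    using that b enmD(2)[OF f] mem_g by blast
  moreover have "R' y z" if "mem (pr i y) g" "mem (pr j z) g" "i \<lhd> j" for i j y z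
    using that mem_g mono enmD(3)[OF f] ff(3) by metis
  ultimately have "enm g n b R'" unfolding enm_def by blast
  then show thesis using that mem_g by blast
qed

section \<open>Morphisms induced by inclusions\<close>

text \<open>The definition of \<open>inc\<close> only asserts that suitable enumerations exist. By
  their uniqueness any given ones may be used, and functionality turns its implication into an
  equivalence.\<close>

lemma inc_mem_iff:
  assumes g: "inc g p r a c R" and lin: "linon R (\<lambda>x. mem x c)" and ac: "\<And>x. mem x a \<Longrightarrow> mem x c"
    and f: "enm f p a R" and h: "enm h r c R"
  shows "mem (pr i j) g \<longleftrightarrow> (\<exists>x. mem (pr i x) f \<and> mem (pr j x) h)"
proof -
  have lina: "linon R (\<lambda>x. mem x a)" by (rule linon_mono[OF lin ac])
  obtain f' h' where fh: "enm f' p a R" "enm h' r c R"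
    "\<And>i j. mem (pr i j) g \<Longrightarrow> \<exists>x. mem (pr i x) f' \<and> mem (pr j x) h'"
    and mor: "mor g p r" using g unfolding inc_def by blast
  have [simp]: "f' = f" "h' = h"
    using enm_unique(2)[OF fh(1) f lina] enm_unique(2)[OF fh(2) h lin] by auto
  show ?thesis
  proof
    assume "\<exists>x. mem (pr i x) f \<and> mem (pr j x) h"
    then obtain x where x: "mem (pr i x) f" "mem (pr j x) h" by blast
    then have "i \<lhd> p" using ffunD(2)[OF enmD(1)[OF f]] by blast
    then obtain j' where j': "mem (pr i j') g" using mor ffunD(4) unfolding mor_def by blast
    then have "mem (pr j' x) h" using fh(3) x(1) ffunD(5)[OF enmD(1)[OF f]] by fastforce
    then have "j' = j" using enm_inj[OF h lin] x(2) by blast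
    then show "mem (pr i j) g" using j' by blast
  qed (use fh(3) in auto)
qed

lemma inc_ex:
  assumes R: "ar2 R" and lin: "linon R (\<lambda>x. mem x c)" and ac: "\<And>x. mem x a \<Longrightarrow> mem x c"
    and f: "enm f p a R" and h: "enm h r c R"
  shows "\<exists>g. inc g p r a c R"
proof -
  note ff = ffunD[OF enmD(1)[OF f]] and hh = ffunD[OF enmD(1)[OF h]]
  define G where "G i j \<longleftrightarrow> (\<exists>x. mem (pr i x) f \<and> mem (pr j x) h)" for i j
  have G: "ar2 G" unfolding G_def ar2_def by (intro ar_rules)
  have G1: "\<exists>!j. G i j" if i: "i \<lhd> p" for i
  proof -
    obtain x where x: "mem (pr i x) f" using ff(4) i by blast
    then obtain j where "mem (pr j x) h" using enmD(2)[OF h] ff(3) ac by blast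
    then show ?thesis unfolding G_def using x ff(5) enm_inj[OF h lin] by blast
  qed
  obtain g where g: "fset g" "\<And>z. mem z g \<longleftrightarrow> (\<exists>i x. z = pr i x \<and> i \<lhd> p \<and> G i x)"
    using ex_graph[OF G G1] by blast
  have "ffun g p (\<lambda>j. j \<lhd> r)" using g G1 by (rule ffunI) (use hh(2) in \<open>auto simp: G_def\<close>)
  moreover have "j \<lhd> j'" if "mem (pr i j) g" "mem (pr i' j') g" "i \<lhd> i'" for i i' j j'
  proof -
    have "G i j" "G i' j'" using that(1,2) by (auto simp: g(2))
    then obtain x x' where x: "mem (pr i x) f" "mem (pr j x) h" "mem (pr i' x') f" "mem (pr j' x') h"
      unfolding G_def by blast
    then have "R x x'" using enmD(3)[OF f] that(3) by blast
    then show ?thesis using enm_reflect[OF h lin] x by blast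
  qed
  ultimately have "mor g p r" unfolding mor_def by blast
  moreover have "\<exists>x. mem (pr i x) f \<and> mem (pr j x) h" if "mem (pr i j) g" for i j
    using that g(2) unfolding G_def by simp
  ultimately show ?thesis unfolding inc_def using f h by blast
qed

lemma inc_enm: "inc g p r a c R \<Longrightarrow> \<exists>f h. enm f p a R \<and> enm h r c R"
  unfolding inc_def by blast

lemma inc_mor: "inc g p r a c R \<Longrightarrow> mor g p r"
  unfolding inc_def by blast

lemma mor_eq: "mor g p r \<Longrightarrow> mor g' p r' \<Longrightarrow> (\<And>i j. mem (pr i j) g \<Longrightarrow> mem (pr i j) g') \<Longrightarrow> g = g'"
  unfolding mor_def using ffun_eq by blast

lemma inc_unique:
  assumes "inc g p r a c R" "inc g' p' r' a c R" "linon R (\<lambda>x. mem x c)" "\<And>x. mem x a \<Longrightarrow> mem x c"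
  shows "g = g'" "p = p'" "r = r'"
proof -
  obtain f h where fh: "enm f p a R" "enm h r c R" using inc_enm[OF assms(1)] by blast
  obtain f' h' where fh': "enm f' p' a R" "enm h' r' c R" using inc_enm[OF assms(2)] by blast
  have lina: "linon R (\<lambda>x. mem x a)" by (rule linon_mono[OF assms(3,4)])
  note u = enm_unique[OF fh(1) fh'(1) lina] enm_unique[OF fh(2) fh'(2) assms(3)]
  show "p = p'" "r = r'" using u by auto
  show "g = g'"
    using mor_eq[OF inc_mor[OF assms(1)] inc_mor[OF assms(2)[folded u]]]
      inc_mem_iff[OF assms(1,3,4) fh] inc_mem_iff[OF assms(2,3,4) fh'] u by simp
qed

lemma inc_comp:
  assumes R: "ar2 R" and lin: "linon R (\<lambda>x. mem x d)"
    and ac: "\<And>x. mem x a \<Longrightarrow> mem x c" and cd: "\<And>x. mem x c \<Longrightarrow> mem x d"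
    and g: "inc g p r a c R" and h: "inc h r s c d R"
  obtains k where "inc k p s a d R"
    "\<And>i j m. mem (pr i j) g \<Longrightarrow> mem (pr j m) h \<Longrightarrow> mem (pr i m) k"
proof -
  have linc: "linon R (\<lambda>x. mem x c)" by (rule linon_mono[OF lin cd])
  obtain fa fc where f: "enm fa p a R" "enm fc r c R" using inc_enm[OF g] by blast
  obtain fc' fd where f': "enm fc' r c R" "enm fd s d R" using inc_enm[OF h] by blast
  obtain k where k: "inc k p s a d R" using inc_ex[OF R lin _ f(1) f'(2)] ac cd by blast
  have "mem (pr i m) k" if ij: "mem (pr i j) g" and jm: "mem (pr j m) h" for i j m
  proof -
    obtain x where x: "mem (pr i x) fa" "mem (pr j x) fc"
      using ij inc_mem_iff[OF g linc ac f] by auto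
    obtain y where y: "mem (pr j y) fc" "mem (pr m y) fd"
      using jm inc_mem_iff[OF h lin cd f(2) f'(2)] by auto
    have "x = y" using x(2) y(1) ffunD(5)[OF enmD(1)[OF f(2)]] by blast
    then show ?thesis using x y inc_mem_iff[OF k lin _ f(1) f'(2)] ac cd by blast
  qed
  then show thesis using k that by blast
qed

text \<open>The morphism records only the positions of \<open>a\<close> within \<open>c\<close>, and
  an order preserving map does not change these.\<close>

lemma inc_map:
  assumes g: "inc g p r a c R" and ac: "\<And>x. mem x a \<Longrightarrow> mem x c" and \<phi>: "ar2 \<phi>"
    and fn: "\<And>x. mem x c \<Longrightarrow> \<exists>!y. \<phi> x y"
    and mono: "\<And>x x' y y'. mem x c \<Longrightarrow> mem x' c \<Longrightarrow> \<phi> x y \<Longrightarrow> \<phi> x' y' \<Longrightarrow> R x x' \<Longrightarrow> R' y y'"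
    and a': "\<And>y. mem y a' \<longleftrightarrow> (\<exists>x. mem x a \<and> \<phi> x y)"
    and c': "\<And>y. mem y c' \<longleftrightarrow> (\<exists>x. mem x c \<and> \<phi> x y)"
  shows "inc g p r a' c' R'"
proof -
  obtain f h where fh: "enm f p a R" "enm h r c R"
    "\<And>i j. mem (pr i j) g \<Longrightarrow> \<exists>x. mem (pr i x) f \<and> mem (pr j x) h" "mor g p r"
    using g unfolding inc_def by blast
  obtain f' where f': "enm f' p a' R'" "\<And>i y. mem (pr i y) f' \<longleftrightarrow> (\<exists>x. mem (pr i x) f \<and> \<phi> x y)"
    using enm_map[OF fh(1) \<phi> _ _ a', of R'] fn mono ac by blast
  obtain h' where h': "enm h' r c' R'" "\<And>i y. mem (pr i y) h' \<longleftrightarrow> (\<exists>x. mem (pr i x) h \<and> \<phi> x y)"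
    using enm_map[OF fh(2) \<phi> _ _ c', of R'] fn mono by blast
  have "\<exists>y. mem (pr i y) f' \<and> mem (pr j y) h'" if ij: "mem (pr i j) g" for i j
  proof -
    obtain x where x: "mem (pr i x) f" "mem (pr j x) h" using fh(3)[OF ij] by blast
    then have "mem x c" using ffunD(3)[OF enmD(1)[OF fh(2)]] by blast
    then obtain y where "\<phi> x y" using fn by blast
    then show ?thesis using x f'(2) h'(2) by blast
  qed
  then show ?thesis unfolding inc_def using fh(4) f'(1) h'(1) by blast
qed

end

section \<open>The order on pairs of finite sets and elements of a dilator\<close>

locale normal_model = model +
  fixes T :: "'a set"
  assumes T_S: "T \<in> \<S>" and T: "nprae T"
begin

section \<open>Laws of a normal prae-dilator\<close>

lemma prae: "prae T"
  using T unfolding nprae_def by blast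

lemmas prae_parts =
  prae[unfolded prae_def, THEN conjunct1]
  prae[unfolded prae_def, THEN conjunct2, THEN conjunct1]
  prae[unfolded prae_def, THEN conjunct2, THEN conjunct2, THEN conjunct1]
  prae[unfolded prae_def, THEN conjunct2, THEN conjunct2, THEN conjunct2, THEN conjunct1]
  prae[unfolded prae_def, THEN conjunct2, THEN conjunct2, THEN conjunct2, THEN conjunct2, THEN conjunct1]
  prae[unfolded prae_def, THEN conjunct2, THEN conjunct2, THEN conjunct2, THEN conjunct2, THEN conjunct2, THEN conjunct1]
  prae[unfolded prae_def, THEN conjunct2, THEN conjunct2, THEN conjunct2, THEN conjunct2, THEN conjunct2, THEN conjunct2, THEN conjunct1]
  prae[unfolded prae_def, THEN conjunct2, THEN conjunct2, THEN conjunct2, THEN conjunct2, THEN conjunct2, THEN conjunct2, THEN conjunct2, THEN conjunct1]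
  prae[unfolded prae_def, THEN conjunct2, THEN conjunct2, THEN conjunct2, THEN conjunct2, THEN conjunct2, THEN conjunct2, THEN conjunct2, THEN conjunct2, THEN conjunct1]
  prae[unfolded prae_def, THEN conjunct2, THEN conjunct2, THEN conjunct2, THEN conjunct2, THEN conjunct2, THEN conjunct2, THEN conjunct2, THEN conjunct2, THEN conjunct2]

lemmas nprae_parts =
  T[unfolded nprae_def, THEN conjunct2, THEN conjunct1]
  T[unfolded nprae_def, THEN conjunct2, THEN conjunct2, THEN conjunct1]
  T[unfolded nprae_def, THEN conjunct2, THEN conjunct2, THEN conjunct2, THEN conjunct1]
  T[unfolded nprae_def, THEN conjunct2, THEN conjunct2, THEN conjunct2, THEN conjunct2, THEN conjunct1]
  T[unfolded nprae_def, THEN conjunct2, THEN conjunct2, THEN conjunct2, THEN conjunct2, THEN conjunct2]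

lemma T_lin: "lin (Elt T n) (Below T n)"
  using prae_parts(1) by blast

lemma Below_irrefl: "\<not> Below T n s s"
  using T_lin[of n] unfolding lin_def by blast

lemma Below_trans: "Below T n s t \<Longrightarrow> Below T n t u \<Longrightarrow> Below T n s u"
  using T_lin[of n] unfolding lin_def by metis

lemma Below_total: "Elt T n s \<Longrightarrow> Elt T n t \<Longrightarrow> Below T n s t \<or> s = t \<or> Below T n t s"
  using T_lin[of n] unfolding lin_def by metis

lemma ActD: "Act T n l f s t \<Longrightarrow> mor f n l" "Act T n l f s t \<Longrightarrow> Elt T n s" "Act T n l f s t \<Longrightarrow> Elt T l t"
  using prae_parts(2) by blast+

lemma Act_ex1: "mor f n l \<Longrightarrow> Elt T n s \<Longrightarrow> \<exists>!t. Act T n l f s t"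
  using prae_parts(3) by blast

lemma Act_fun: "Act T n l f s t \<Longrightarrow> Act T n l f s t' \<Longrightarrow> t = t'"
  using Act_ex1 ActD by blast

lemma Act_mono: "Act T n l f s s' \<Longrightarrow> Act T n l f t t' \<Longrightarrow> Below T n s t \<Longrightarrow> Below T l s' t'"
  using prae_parts(4) by blast

lemma Act_comp: "mor h k l \<Longrightarrow> (\<And>i j m. mem (pr i j) f \<Longrightarrow> mem (pr j m) g \<Longrightarrow> mem (pr i m) h) \<Longrightarrow>
    Act T k n f s t \<Longrightarrow> Act T n l g t u \<Longrightarrow> Act T k l h s u"
  using prae_parts(6)[rule_format, of h k l f g n s t u] by blast

lemma Act_inj: "Act T n l f s u \<Longrightarrow> Act T n l f t u \<Longrightarrow> s = t"
  using Act_mono Below_total Below_irrefl ActD(2) by metis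

lemma Supp_ex: "Elt T n s \<Longrightarrow> \<exists>a. Supp T n s a"
  using prae_parts(8) by blast

lemma Supp_Act: "Act T n l f s t \<Longrightarrow> Supp T n s a \<Longrightarrow> Supp T l t b \<Longrightarrow>
    mem y b \<longleftrightarrow> (\<exists>x. mem x a \<and> mem (pr x y) f)"
  using prae_parts(9)[rule_format, of n l f s t a b y] by blast

lemma Mu_ex: "m \<lhd> n \<Longrightarrow> \<exists>s. Mu T n m s"
  using nprae_parts(2) by blast

lemma Mu_Elt: "Mu T n m s \<Longrightarrow> Elt T n s"
  using nprae_parts(1) by blast

lemma Mu_normal: "Mu T n m u \<Longrightarrow> Supp T n s a \<Longrightarrow> Below T n s u \<longleftrightarrow> (\<forall>x. mem x a \<longrightarrow> x \<lhd> m)"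
  using nprae_parts(5)[rule_format, of n m u s a] by blast

lemma A0_T [ar_rules]:
  "A0 (\<lambda>v. Elt T (v n) (v s))" "A0 (\<lambda>v. Below T (v n) (v s) (v t))"
  "A0 (\<lambda>v. Act T (v n) (v l) (v f) (v s) (v t))" "A0 (\<lambda>v. Supp T (v n) (v s) (v a))"
  unfolding Elt_def Below_def Act_def Supp_def by (intro ar_rules T_S)+

lemma A0_full [ar_rules]: "af f \<Longrightarrow> af g \<Longrightarrow> A0 (\<lambda>v. full T (f v) (g v))"
  by (erule (1) A0_rel2[rotated]) (unfold full_def, intro ar_rules)

lemma A0_pless:
  assumes "A0 (\<lambda>v. R (v 0) (v (Suc 0)) (v (Suc (Suc 0))))"
  shows "A0 (\<lambda>v. pless T (R (v d)) (v a) (v s) (v b) (v t))"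
  unfolding pless_def by (intro ar_rules A0_inc[OF assms])

section \<open>Evaluation of pairs over a common finite order\<close>

text \<open>This is \<open>T\<^sub>f(s) = t\<close> for \<open>f = |\<iota>|\<close>, induced by the
  inclusion of \<open>a\<close> into \<open>c\<close>: the pair
  \<open>\<langle>a, s\<rangle>\<close> evaluated in \<open>T\<close> at the cardinality of
  \<open>c\<close>.\<close>

definition val :: "('a \<Rightarrow> 'a \<Rightarrow> bool) \<Rightarrow> 'a \<Rightarrow> 'a \<Rightarrow> 'a \<Rightarrow> 'a \<Rightarrow> bool" where
  "val R c a s t \<longleftrightarrow> (\<exists>g p r. inc g p r a c R \<and> Act T p r g s t)"

lemma union_ex: "\<exists>c. funion c a b"
proof -
  have "A0 (\<lambda>v. mem (v 0) a \<or> mem (v 0) b)" by (intro ar_rules)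
  moreover have "x \<lhd> a \<oplus> b" if "mem x a \<or> mem x b" for x
    using that mem_lt M.less_le_trans[OF _ le_plus1] M.less_le_trans[OF _ le_plus2] by blast
  ultimately obtain c where "fset c" "\<And>x. mem x c \<longleftrightarrow> mem x a \<or> mem x b"
    using ex_fset[of "\<lambda>x. mem x a \<or> mem x b" "a \<oplus> b"] by blast
  then show ?thesis unfolding funion_def by blast
qed

lemma union_mem: "funion c a b \<Longrightarrow> mem x c \<longleftrightarrow> mem x a \<or> mem x b"
  unfolding funion_def by blast

context
  fixes R :: "'a \<Rightarrow> 'a \<Rightarrow> bool"
  assumes R: "ar2 R"
begin

lemma fullD: "full T a s \<Longrightarrow> fcard a p \<Longrightarrow> Elt T p s \<and> (\<exists>b. Supp T p s b \<and> (\<forall>x. mem x b \<longleftrightarrow> x \<lhd> p))"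
  unfolding full_def using fcard_unique by blast

lemma val_ex:
  assumes lin: "linon R (\<lambda>x. mem x c)" and ac: "\<And>x. mem x a \<Longrightarrow> mem x c" and s: "full T a s"
    and h: "enm h r c R"
  obtains g p t where "inc g p r a c R" "Act T p r g s t"
proof -
  obtain p where p: "fcard a p" using s unfolding full_def by blast
  then obtain f where f: "enm f p a R" using enm_ex[OF R linon_mono[OF lin ac]] by blast
  obtain g where g: "inc g p r a c R" using inc_ex[OF R lin ac f h] by blast
  then show thesis using that Act_ex1[OF inc_mor[OF g]] fullD[OF s p] by blast
qed

lemma val_fun:
  assumes lin: "linon R (\<lambda>x. mem x c)" and ac: "\<And>x. mem x a \<Longrightarrow> mem x c"
    and "val R c a s t" "val R c a s t'"
  shows "t = t'"
  using assms inc_unique[OF _ _ lin ac] Act_fun unfolding val_def by metis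

text \<open>Functoriality: the morphism induced by the inclusion of \<open>a\<close> into
  \<open>d\<close> factors through \<open>c\<close>.\<close>

lemma val_trans:
  assumes lin: "linon R (\<lambda>x. mem x d)"
    and ac: "\<And>x. mem x a \<Longrightarrow> mem x c" and cd: "\<And>x. mem x c \<Longrightarrow> mem x d"
    and "val R c a s t" "val R d a s u" "inc k r q c d R"
  shows "Act T r q k t u"
proof -
  have linc: "linon R (\<lambda>x. mem x c)" by (rule linon_mono[OF lin cd])
  obtain g p r' where g: "inc g p r' a c R" "Act T p r' g s t" using assms(4) unfolding val_def by blast
  obtain g' p' q' where g': "inc g' p' q' a d R" "Act T p' q' g' s u" using assms(5) unfolding val_def by blast
  have r: "r' = r"
    using inc_enm[OF g(1)] inc_enm[OF assms(6)] enm_unique(1)[OF _ _ linc] by blast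
  obtain l where l: "inc l p q a d R"
    "\<And>i j m. mem (pr i j) g \<Longrightarrow> mem (pr j m) k \<Longrightarrow> mem (pr i m) l"
    using inc_comp[OF R lin ac cd g(1)[unfolded r] assms(6)] by blast
  have eq: "l = g'" "p = p'" "q = q'" using inc_unique[OF l(1) g'(1) lin] ac cd by blast+
  obtain u' where u': "Act T r q k t u'"
    using Act_ex1[OF inc_mor[OF assms(6)]] ActD(3)[OF g(2)] r by blast
  have "Act T p q l s u'" by (rule Act_comp[OF inc_mor[OF l(1)] _ g(2)[unfolded r] u']) (rule l(2))
  then have "u' = u" using g'(2) Act_fun unfolding eq by blast
  then show ?thesis using u' by simp
qed

text \<open>A comparison over the union of \<open>a\<close> and \<open>b\<close> may be carried out
  over any larger set, since morphisms act as order embeddings. This puts several pairs on common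
  ground.\<close>

lemma pless_val:
  assumes lin: "linon R (\<lambda>x. mem x d)"
    and ad: "\<And>x. mem x a \<Longrightarrow> mem x d" and bd: "\<And>x. mem x b \<Longrightarrow> mem x d"
    and full: "full T a s" "full T b t"
    and val: "val R d a s u" "val R d b t w" and h: "enm h q d R"
  shows "pless T R a s b t \<longleftrightarrow> Below T q u w"
proof -
  obtain c where c: "funion c a b" using union_ex by blast
  note cm = union_mem[OF c]
  have cd: "mem x c \<Longrightarrow> mem x d" for x using cm ad bd by blast
  have linc: "linon R (\<lambda>x. mem x c)" by (rule linon_mono[OF lin cd])
  obtain r hc where hc: "enm hc r c R" using fcard_ex enm_ex[OF R linc] by blast
  obtain k where k: "inc k r q c d R" using inc_ex[OF R lin cd hc h] by blast
  obtain g p u' where g: "inc g p r a c R" "Act T p r g s u'"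
    using val_ex[OF linc _ full(1) hc] cm by blast
  obtain g2 p2 w' where g2: "inc g2 p2 r b c R" "Act T p2 r g2 t w'"
    using val_ex[OF linc _ full(2) hc] cm by blast
  have vals: "val R c a s u'" "val R c b t w'" unfolding val_def using g g2 by blast+
  have act: "Act T r q k u' u" "Act T r q k w' w"
    using val_trans[OF lin _ cd vals(1) val(1) k] val_trans[OF lin _ cd vals(2) val(2) k] cm by blast+
  have "pless T R a s b t \<longleftrightarrow> Below T r u' w'"
  proof
    assume "Below T r u' w'"
    then show "pless T R a s b t" unfolding pless_def using c g g2 by blast
  next
    assume "pless T R a s b t"
    then obtain c1 p1 q1 r1 g1 h1 u1 w1 where 1: "funion c1 a b" "inc g1 p1 r1 a c1 R" "inc h1 q1 r1 b c1 R"
       "Act T p1 r1 g1 s u1" "Act T q1 r1 h1 t w1" "Below T r1 u1 w1"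
      unfolding pless_def by blast
    have "c1 = c" using c 1(1) fset_eq[of c1 c] unfolding funion_def by blast
    then have "g1 = g \<and> p1 = p \<and> r1 = r" "h1 = g2 \<and> q1 = p2"
      using inc_unique[OF 1(2)[unfolded \<open>c1 = c\<close>] g(1) linc] inc_unique[OF 1(3)[unfolded \<open>c1 = c\<close>] g2(1) linc] cm
      by blast+
    then show "Below T r u' w'" using 1 g g2 Act_fun by metis
  qed
  also have "\<dots> \<longleftrightarrow> Below T q u w"
    using Act_mono[OF act(1,2)] Act_mono[OF act(2,1)] Below_total[of r u' w'] ActD(2)[OF act(1)] ActD(2)[OF act(2)]
      Act_fun[OF act(1)] act Below_irrefl Below_trans by metis
  finally show ?thesis .
qed

text \<open>By naturality of supports and fullness of \<open>s\<close>, the support of the value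
  consists of the positions of the elements of \<open>a\<close> in \<open>c\<close>. Thus the value
  remembers \<open>a\<close>.\<close>

lemma val_supp:
  assumes lin: "linon R (\<lambda>x. mem x c)" and ac: "\<And>x. mem x a \<Longrightarrow> mem x c" and full: "full T a s"
    and val: "val R c a s t" and h: "enm h r c R" and S: "Supp T r t S"
  shows "mem j S \<longleftrightarrow> (\<exists>x. mem x a \<and> mem (pr j x) h)"
proof -
  obtain g p r' where g: "inc g p r' a c R" "Act T p r' g s t" using val unfolding val_def by blast
  obtain f h' where f: "enm f p a R" "enm h' r' c R" using inc_enm[OF g(1)] by blast
  have [simp]: "r' = r" using enm_unique(1)[OF f(2) h lin] .
  have p: "fcard a p" by (rule enm_fcard[OF f(1) linon_mono[OF lin ac]])
  obtain b where b: "Supp T p s b" "\<And>x. mem x b \<longleftrightarrow> x \<lhd> p" using fullD[OF full p] by blast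
  have "mem j S \<longleftrightarrow> (\<exists>i. i \<lhd> p \<and> mem (pr i j) g)"
    using Supp_Act[OF g(2) b(1)] S b(2) by simp
  also have "\<dots> \<longleftrightarrow> (\<exists>i. i \<lhd> p \<and> (\<exists>x. mem (pr i x) f \<and> mem (pr j x) h))"
    using inc_mem_iff[OF g(1) lin ac f(1)] h by simp
  also have "\<dots> \<longleftrightarrow> (\<exists>x. mem x a \<and> mem (pr j x) h)"
    using enmD(2)[OF f(1)] ffunD(2,3)[OF enmD(1)[OF f(1)]] by blast
  finally show ?thesis .
qed

lemma vals_ex:
  assumes lin: "linon R (\<lambda>x. mem x a \<or> mem x b)" and full: "full T a s" "full T b t"
  obtains c h r u w where "linon R (\<lambda>x. mem x c)" "\<And>x. mem x c \<longleftrightarrow> mem x a \<or> mem x b"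
    "enm h r c R" "val R c a s u" "val R c b t w" "Elt T r u" "Elt T r w"
    "pless T R a s b t \<longleftrightarrow> Below T r u w" "pless T R b t a s \<longleftrightarrow> Below T r w u"
proof -
  obtain c where c: "funion c a b" using union_ex by blast
  note cm = union_mem[OF c]
  have linc: "linon R (\<lambda>x. mem x c)" using lin cm by simp
  have ac: "\<And>x. mem x a \<Longrightarrow> mem x c" and bc: "\<And>x. mem x b \<Longrightarrow> mem x c" using cm by auto
  obtain r h where h: "enm h r c R" using fcard_ex enm_ex[OF R linc] by blast
  obtain g p u where g: "inc g p r a c R" "Act T p r g s u"
    by (rule val_ex[OF linc ac full(1) h])
  obtain g2 p2 w where g2: "inc g2 p2 r b c R" "Act T p2 r g2 t w"
    by (rule val_ex[OF linc bc full(2) h])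
  have vals: "val R c a s u" "val R c b t w" unfolding val_def using g g2 by blast+
  show thesis
    by (rule that[OF linc cm h vals ActD(3)[OF g(2)] ActD(3)[OF g2(2)]
      pless_val[OF linc ac bc full vals h] pless_val[OF linc bc ac full(2,1) vals(2,1) h]])
qed

lemma pless_irrefl:
  assumes "linon R (\<lambda>x. mem x a)" "full T a s" shows "\<not> pless T R a s a s"
proof -
  have lin: "linon R (\<lambda>x. mem x a \<or> mem x a)" using assms(1) by simp
  obtain c h r u w where linc: "linon R (\<lambda>x. mem x c)" and cm: "\<And>x. mem x c \<longleftrightarrow> mem x a \<or> mem x a"
    and h: "enm h r c R" and v: "val R c a s u" "val R c a s w" and E: "Elt T r u" "Elt T r w"
    and p: "pless T R a s a s \<longleftrightarrow> Below T r u w" "pless T R a s a s \<longleftrightarrow> Below T r w u"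
    by (rule vals_ex[OF lin assms(2,2)]) (rule that)
  have ac: "\<And>x. mem x a \<Longrightarrow> mem x c" using cm by auto
  have "u = w" by (rule val_fun[OF linc ac v])
  then show ?thesis using p(1) Below_irrefl by blast
qed

lemma pless_trans:
  assumes lin: "linon R (\<lambda>x. mem x a \<or> mem x b \<or> mem x c)"
    and full: "full T a s" "full T b t" "full T c u"
    and less: "pless T R a s b t" "pless T R b t c u"
  shows "pless T R a s c u"
proof -
  obtain d where d: "funion d a b" using union_ex by blast
  obtain e where e: "funion e d c" using union_ex by blast
  have em: "mem x e \<longleftrightarrow> mem x a \<or> mem x b \<or> mem x c" for x
    using union_mem[OF d] union_mem[OF e] by blast
  have line: "linon R (\<lambda>x. mem x e)" using lin em by simp
  have ae: "\<And>x. mem x a \<Longrightarrow> mem x e" and be: "\<And>x. mem x b \<Longrightarrow> mem x e"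
    and ce: "\<And>x. mem x c \<Longrightarrow> mem x e" using em by auto
  obtain r h where h: "enm h r e R" using fcard_ex enm_ex[OF R line] by blast
  obtain g p s' where g: "inc g p r a e R" "Act T p r g s s'" by (rule val_ex[OF line ae full(1) h])
  obtain g2 p2 t' where g2: "inc g2 p2 r b e R" "Act T p2 r g2 t t'" by (rule val_ex[OF line be full(2) h])
  obtain g3 p3 u' where g3: "inc g3 p3 r c e R" "Act T p3 r g3 u u'" by (rule val_ex[OF line ce full(3) h])
  have v: "val R e a s s'" "val R e b t t'" "val R e c u u'" unfolding val_def using g g2 g3 by blast+
  show ?thesis
    using less Below_trans pless_val[OF line ae be full(1,2) v(1,2) h]
      pless_val[OF line be ce full(2,3) v(2,3) h] pless_val[OF line ae ce full(1,3) v(1,3) h] by blast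
qed

text \<open>If the values coincide, so do their supports, hence \<open>a = b\<close>; then
  \<open>s = t\<close> because the action of a morphism is injective.\<close>

lemma pless_total:
  assumes lin: "linon R (\<lambda>x. mem x a \<or> mem x b)" and full: "full T a s" "full T b t"
    and fs: "fset a" "fset b"
  shows "pless T R a s b t \<or> (a = b \<and> s = t) \<or> pless T R b t a s"
proof -
  obtain c h r u w where linc: "linon R (\<lambda>x. mem x c)" and cm: "\<And>x. mem x c \<longleftrightarrow> mem x a \<or> mem x b"
    and h: "enm h r c R" and v: "val R c a s u" "val R c b t w" and E: "Elt T r u" "Elt T r w"
    and p: "pless T R a s b t \<longleftrightarrow> Below T r u w" "pless T R b t a s \<longleftrightarrow> Below T r w u"
    by (rule vals_ex[OF lin full]) (rule that)
  have ac: "\<And>x. mem x a \<Longrightarrow> mem x c" and bc: "\<And>x. mem x b \<Longrightarrow> mem x c" using cm by auto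
  have "a = b \<and> s = t" if uw: "u = w"
  proof -
    obtain S where S: "Supp T r u S" using Supp_ex E by blast
    have eq: "(\<exists>x. mem x a \<and> mem (pr j x) h) \<longleftrightarrow> (\<exists>x. mem x b \<and> mem (pr j x) h)" for j
      using val_supp[OF linc ac full(1) v(1) h S] val_supp[OF linc bc full(2) v(2) h S[unfolded uw]] by blast
    have hf: "mem (pr j x) h \<Longrightarrow> mem (pr j y) h \<Longrightarrow> x = y" for j x y
      using ffunD(5)[OF enmD(1)[OF h]] by blast
    have "mem x a \<longleftrightarrow> mem x b" for x
      using eq enmD(2)[OF h] hf ac bc by metis
    then have ab: "a = b" using fset_eq fs by blast
    obtain g p r1 where g: "inc g p r1 a c R" "Act T p r1 g s u" using v(1) unfolding val_def by blast
    obtain g' p' r2 where g': "inc g' p' r2 a c R" "Act T p' r2 g' t u"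
      using v(2) unfolding val_def ab uw by blast
    have "s = t" using inc_unique[OF g(1) g'(1) linc ac] g(2) g'(2) Act_inj by metis
    then show ?thesis using ab by blast
  qed
  then show ?thesis using Below_total[OF E] p by blast
qed

text \<open>Normality of \<open>T\<close> with positions translated back into elements:
  \<open>m\<close> is the value of \<open>\<mu>\<close> at the position of \<open>q\<close>.\<close>

lemma below_mu_iff:
  assumes lin: "linon R (\<lambda>x. mem x c)" and ac: "\<And>x. mem x a \<Longrightarrow> mem x c" and full: "full T a s"
    and v: "val R c a s u" "Elt T r u" and h: "enm h r c R" and q: "mem (pr j q) h" and m: "Mu T r j m"
  shows "Below T r u m \<longleftrightarrow> (\<forall>x. mem x a \<longrightarrow> R x q)"
proof -
  obtain S where S: "Supp T r u S" using Supp_ex v by blast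
  have "Below T r u m \<longleftrightarrow> (\<forall>i x. mem x a \<and> mem (pr i x) h \<longrightarrow> i \<lhd> j)"
    using Mu_normal[OF m S] val_supp[OF lin ac full v(1) h S] by blast
  also have "\<dots> \<longleftrightarrow> (\<forall>x. mem x a \<longrightarrow> R x q)"
    using enmD(2,3)[OF h] enm_reflect[OF h lin] q ac by metis
  finally show ?thesis .
qed

text \<open>If all of \<open>b\<close> were below \<open>q\<close>, normality would put the value of
  the second pair, and with it that of the first, below \<open>\<mu>\<close> at the position of
  \<open>q\<close>. Then \<open>q\<close>, as an element of \<open>a\<close>, would be below
  itself.\<close>

lemma pless_cofinal:
  assumes lin: "linon R (\<lambda>x. mem x a \<or> mem x b)" and full: "full T a s" "full T b t"
    and less: "pless T R a s b t" and q: "mem q a"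
  shows "\<exists>r. mem r b \<and> (R q r \<or> q = r)"
proof (rule ccontr)
  assume "\<not> ?thesis"
  then have bq: "R x q" if "mem x b" for x using linonD(3)[OF lin] that q by blast
  obtain c h r u w where linc: "linon R (\<lambda>x. mem x c)" and cm: "\<And>x. mem x c \<longleftrightarrow> mem x a \<or> mem x b"
    and h: "enm h r c R" and v: "val R c a s u" "val R c b t w" and E: "Elt T r u" "Elt T r w"
    and p: "pless T R a s b t \<longleftrightarrow> Below T r u w" "pless T R b t a s \<longleftrightarrow> Below T r w u"
    by (rule vals_ex[OF lin full]) (rule that)
  have ac: "\<And>x. mem x a \<Longrightarrow> mem x c" and bc: "\<And>x. mem x b \<Longrightarrow> mem x c" using cm by auto
  obtain j where j: "mem (pr j q) h" using enmD(2)[OF h] ac q by blast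
  obtain m where m: "Mu T r j m" using Mu_ex ffunD(2)[OF enmD(1)[OF h] j] by blast
  have "Below T r w m" using below_mu_iff[OF linc bc full(2) v(2) E(2) h j m] bq by blast
  then have "Below T r u m" using less p Below_trans by blast
  then have "R q q" using below_mu_iff[OF linc ac full(1) v(1) E(1) h j m] q by blast
  then show False using linonD(1)[OF lin] q by blast
qed

text \<open>The value of \<open>\<mu>\<close> at the position of \<open>q\<close> separates the two
  pairs.\<close>

lemma pless_dominated:
  assumes lin: "linon R (\<lambda>x. mem x a \<or> mem x b)" and full: "full T a s" "full T b t"
    and q: "mem q b" and less: "\<And>x. mem x a \<Longrightarrow> R x q"
  shows "pless T R a s b t"
proof -
  obtain c h r u w where linc: "linon R (\<lambda>x. mem x c)" and cm: "\<And>x. mem x c \<longleftrightarrow> mem x a \<or> mem x b"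
    and h: "enm h r c R" and v: "val R c a s u" "val R c b t w" and E: "Elt T r u" "Elt T r w"
    and p: "pless T R a s b t \<longleftrightarrow> Below T r u w" "pless T R b t a s \<longleftrightarrow> Below T r w u"
    by (rule vals_ex[OF lin full]) (rule that)
  have ac: "\<And>x. mem x a \<Longrightarrow> mem x c" and bc: "\<And>x. mem x b \<Longrightarrow> mem x c" using cm by auto
  obtain j where j: "mem (pr j q) h" using enmD(2)[OF h] bc q by blast
  obtain m where m: "Mu T r j m" using Mu_ex ffunD(2)[OF enmD(1)[OF h] j] by blast
  have um: "Below T r u m" using below_mu_iff[OF linc ac full(1) v(1) E(1) h j m] less by blast
  have "\<not> Below T r w m"
    using below_mu_iff[OF linc bc full(2) v(2) E(2) h j m] q linonD(1)[OF lin] by blast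
  then have "m = w \<or> Below T r m w" using Below_total[OF E(2) Mu_Elt[OF m]] by blast
  then show ?thesis using um p(1) Below_trans by blast
qed

lemma pless_map:
  assumes \<phi>: "ar2 \<phi>" and less: "pless T R a s b t"
    and fn: "\<And>x. mem x a \<or> mem x b \<Longrightarrow> \<exists>!y. \<phi> x y"
    and mono: "\<And>x x' y y'. mem x a \<or> mem x b \<Longrightarrow> mem x' a \<or> mem x' b \<Longrightarrow> \<phi> x y \<Longrightarrow> \<phi> x' y' \<Longrightarrow>
      R x x' \<Longrightarrow> R' y y'"
    and a': "\<And>y. mem y a' \<longleftrightarrow> (\<exists>x. mem x a \<and> \<phi> x y)"
    and b': "\<And>y. mem y b' \<longleftrightarrow> (\<exists>x. mem x b \<and> \<phi> x y)"
  shows "pless T R' a' s b' t"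
proof -
  obtain c p q r g h u w where c: "funion c a b" and inc: "inc g p r a c R" "inc h q r b c R"
       and *: "Act T p r g s u" "Act T q r h t w" "Below T r u w"
      using less unfolding pless_def by blast
  note cm = union_mem[OF c]
  obtain c' where c': "fset c'" "\<And>y. mem y c' \<longleftrightarrow> (\<exists>x. mem x c \<and> \<phi> x y)"
    using ex_image[OF \<phi>[unfolded ar2_def], of c] fn cm by metis
  have "inc g p r a' c' R'"
    by (rule inc_map[OF inc(1) _ \<phi> _ _ a' c'(2)]) (use cm fn mono in blast)+
  moreover have "inc h q r b' c' R'"
    by (rule inc_map[OF inc(2) _ \<phi> _ _ b' c'(2)]) (use cm fn mono in blast)+
  moreover have "funion c' a' b'" unfolding funion_def using c' a' b' cm by blast
  ultimately show ?thesis unfolding pless_def using * by blast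
qed

text \<open>The case of the identity map. It permits to exchange the full order of terms for an
  approximation that agrees with it on the arguments.\<close>

lemma pless_cong:
  assumes "\<And>x y. mem x a \<or> mem x b \<Longrightarrow> mem y a \<or> mem y b \<Longrightarrow> R x y \<Longrightarrow> R' x y"
    and "pless T R a s b t"
  shows "pless T R' a s b t"
proof (rule pless_map[where \<phi> = "(=)"])
  show "ar2 (=)" unfolding ar2_def by (intro ar_rules)
qed (use assms in auto)

end

end

section \<open>The term system\<close>

text \<open>
  The terms of \<open>\<partial>T\<close> are considered with arbitrary indices: \<open>over X\<close> is \<open>\<partial>T\<close> for the indices in
  \<open>X\<close>, and \<open>Bel R\<close> is its order when the indices are ordered by \<open>R\<close>. The clauses that compare
  \<open>\<mu>\<^sub>m\<close> with \<open>\<xi>\<langle>b, \<tau>\<rangle>\<close> are replaced by conditions on the support, which avoids recursive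
  calls; the remaining recursion is on the maximum \<open>rk\<close> of the two codes.
\<close>

context normal_model
begin

lemma one_neq_zero: "\<one> \<noteq> \<zero>"
  using M.zero_neq_one by simp

lemma term_simps [simp]:
  "mt m = mt k \<longleftrightarrow> m = k" "xt a s = xt b t \<longleftrightarrow> a = b \<and> s = t" "mt m \<noteq> xt a s" "xt a s \<noteq> mt m"
  using one_neq_zero by (auto simp: mt_def xt_def)

lemma mem_lt_xt: "mem t a \<Longrightarrow> t \<lhd> xt a s"
  unfolding xt_def using mem_lt M.less_le_trans[OF _ M.order.trans[OF le_pr1 le_pr2]] by blast

lemma af_terms [ar_rules]:
  "af f \<Longrightarrow> af (\<lambda>v. mt (f v))" "af f \<Longrightarrow> af g \<Longrightarrow> af (\<lambda>v. xt (f v) (g v))"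
  unfolding mt_def xt_def by (intro ar_rules; assumption)+

lemma recursion_id:
  assumes "A0 (\<lambda>v. \<Phi> (v 0) {y. mem y (v (Suc 0)) \<and> y \<lhd> v 0})"
  shows "\<exists>D\<in>\<S>. \<forall>x. x \<in> D \<longleftrightarrow> \<Phi> x {y \<in> D. y \<lhd> x}"
proof (rule recursion[where rank = "\<lambda>x. x"])
  show "A0 (\<lambda>v. v 0 = v (Suc 0))" by (intro ar_rules)
  show "\<exists>b. \<forall>z. z \<unlhd> r \<longrightarrow> (\<exists>X. \<Phi> z X) \<longrightarrow> z \<lhd> b" for r by (rule exI[of _ "r \<oplus> \<one>"]) simp
qed (use assms in simp)

lemma A0_Mu10 [ar_rules]: "af f \<Longrightarrow> A0 (\<lambda>v. Mu T \<one> \<zero> (f v))"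
  unfolding Mu_def by (intro ar_rules T_S)

section \<open>Terms, indices and renaming\<close>

text \<open>The set \<open>X\<close> stands for the terms of smaller code. The index
  \<open>m\<close> of the excluded terms is unrestricted, since a bound on the indices is only
  imposed later by \<open>over\<close>.\<close>

definition Wf_step :: "'a \<Rightarrow> 'a set \<Rightarrow> bool" where
  "Wf_step z X \<longleftrightarrow> (\<exists>m. z = mt m) \<or> (\<exists>a r. z = xt a r \<and> fset a \<and> (\<forall>t. mem t a \<longrightarrow> t \<in> X) \<and>
     full T a r \<and> \<not> ((\<exists>m. \<forall>t. mem t a \<longleftrightarrow> t = mt m) \<and> Mu T \<one> \<zero> r))"

definition Wf_graph :: "'a set" where
  "Wf_graph = (SOME D. D \<in> \<S> \<and> (\<forall>x. x \<in> D \<longleftrightarrow> Wf_step x {y \<in> D. y \<lhd> x}))"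

definition Wf :: "'a \<Rightarrow> bool" where
  "Wf s \<longleftrightarrow> s \<in> Wf_graph"

lemma Wf_graph: "Wf_graph \<in> \<S>" "x \<in> Wf_graph \<longleftrightarrow> Wf_step x {y \<in> Wf_graph. y \<lhd> x}"
proof -
  have "A0 (\<lambda>v. Wf_step (v 0) {y. mem y (v (Suc 0)) \<and> y \<lhd> v 0})"
    unfolding Wf_step_def mem_Collect_eq by (intro ar_rules)
  from someI_ex[OF recursion_id[OF this, unfolded Bex_def], folded Wf_graph_def]
  show "Wf_graph \<in> \<S>" "x \<in> Wf_graph \<longleftrightarrow> Wf_step x {y \<in> Wf_graph. y \<lhd> x}" by blast+
qed

lemma A0_Wf [ar_rules]: "af f \<Longrightarrow> A0 (\<lambda>v. Wf (f v))"
  unfolding Wf_def by (intro ar_rules Wf_graph(1))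

lemma Wf_iff: "Wf z \<longleftrightarrow> Wf_step z {y. Wf y \<and> y \<lhd> z}"
  unfolding Wf_def by (rule Wf_graph(2))

lemma Wf_mt [simp]: "Wf (mt m)"
  unfolding Wf_iff[of "mt m"] Wf_step_def by blast

lemma Wf_xt: "Wf (xt a r) \<longleftrightarrow> fset a \<and> (\<forall>t. mem t a \<longrightarrow> Wf t) \<and> full T a r \<and>
    \<not> ((\<exists>m. \<forall>t. mem t a \<longleftrightarrow> t = mt m) \<and> Mu T \<one> \<zero> r)"
proof -
  have "Wf (xt a r) \<longleftrightarrow> Wf_step (xt a r) {y. Wf y \<and> y \<lhd> xt a r}" by (rule Wf_iff)
  also have "\<dots> \<longleftrightarrow> fset a \<and> (\<forall>t. mem t a \<longrightarrow> Wf t) \<and> full T a r \<and>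
    \<not> ((\<exists>m. \<forall>t. mem t a \<longleftrightarrow> t = mt m) \<and> Mu T \<one> \<zero> r)"
    unfolding Wf_step_def using mem_lt_xt by simp
  finally show ?thesis .
qed

lemma Wf_cases:
  assumes "Wf s"
  obtains m where "s = mt m" | a u where "s = xt a u" "fset a" "full T a u"
proof -
  have "Wf_step s {y. Wf y \<and> y \<lhd> s}" using Wf_iff assms by blast
  then show thesis unfolding Wf_step_def using that by blast
qed

text \<open>The relation that the index \<open>x\<close> occurs in the term \<open>s\<close>. The
  support as a finite set is recovered in \<open>Sp_code\<close>.\<close>

definition Sp_step :: "'a \<Rightarrow> 'a set \<Rightarrow> bool" where
  "Sp_step z X \<longleftrightarrow> (\<exists>s x. z = pr s x \<and>
     (s = mt x \<or> (\<exists>a u. s = xt a u \<and> (\<exists>t. mem t a \<and> pr t x \<in> X))))"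

definition Sp_graph :: "'a set" where
  "Sp_graph = (SOME D. D \<in> \<S> \<and> (\<forall>x. x \<in> D \<longleftrightarrow> Sp_step x {y \<in> D. y \<lhd> x}))"

definition Sp :: "'a \<Rightarrow> 'a \<Rightarrow> bool" where
  "Sp s x \<longleftrightarrow> pr s x \<in> Sp_graph"

lemma Sp_graph: "Sp_graph \<in> \<S>" "z \<in> Sp_graph \<longleftrightarrow> Sp_step z {y \<in> Sp_graph. y \<lhd> z}"
proof -
  have "A0 (\<lambda>v. Sp_step (v 0) {y. mem y (v (Suc 0)) \<and> y \<lhd> v 0})"
    unfolding Sp_step_def mem_Collect_eq by (intro ar_rules)
  from someI_ex[OF recursion_id[OF this, unfolded Bex_def], folded Sp_graph_def]
  show "Sp_graph \<in> \<S>" "z \<in> Sp_graph \<longleftrightarrow> Sp_step z {y \<in> Sp_graph. y \<lhd> z}" by blast+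
qed

lemma A0_Sp [ar_rules]: "af f \<Longrightarrow> af g \<Longrightarrow> A0 (\<lambda>v. Sp (f v) (g v))"
  unfolding Sp_def by (intro ar_rules Sp_graph(1))

lemma Sp_simps [simp]:
  "Sp (mt m) x \<longleftrightarrow> x = m" "Sp (xt a u) x \<longleftrightarrow> (\<exists>t. mem t a \<and> Sp t x)"
proof -
  have *: "Sp s x \<longleftrightarrow> Sp_step (pr s x) {y \<in> Sp_graph. y \<lhd> pr s x}" for s x
    unfolding Sp_def by (rule Sp_graph(2))
  show "Sp (mt m) x \<longleftrightarrow> x = m" unfolding * Sp_step_def by auto
  have "pr t x \<lhd> pr (xt a u) x" if "mem t a" for t
    by (rule pr_mono1[OF mem_lt_xt[OF that]]) simp
  then show "Sp (xt a u) x \<longleftrightarrow> (\<exists>t. mem t a \<and> Sp t x)"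
    unfolding *[of "xt a u"] Sp_step_def by (auto simp: Sp_def)
qed

lemma term_induct:
  assumes P: "A0 (\<lambda>v. P (v 0))" and mt: "\<And>m. P (mt m)"
    and xt: "\<And>a u. Wf (xt a u) \<Longrightarrow> (\<And>t. mem t a \<Longrightarrow> Wf t \<Longrightarrow> P t) \<Longrightarrow> P (xt a u)"
    and s: "Wf s"
  shows "P s"
proof -
  have "Wf s \<longrightarrow> P s"
  proof (rule A0_less_induct[where P = "\<lambda>s. Wf s \<longrightarrow> P s"])
    show "A0 (\<lambda>v. Wf (v 0) \<longrightarrow> P (v 0))" by (intro ar_rules P)
    fix s assume IH: "\<And>y. y \<lhd> s \<Longrightarrow> Wf y \<longrightarrow> P y"
    show "Wf s \<longrightarrow> P s"
    proof
      assume s: "Wf s"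
      then show "P s"
      proof (cases rule: Wf_cases)
        case (2 a u)
        then show ?thesis using IH xt s mem_lt_xt by blast
      qed (simp add: mt)
    qed
  qed
  then show ?thesis using s by blast
qed

lemma Sp_le: "Wf s \<Longrightarrow> Sp s x \<Longrightarrow> x \<unlhd> s"
proof -
  assume "Wf s" "Sp s x"
  moreover have "\<forall>x. Sp s x \<longrightarrow> x \<unlhd> s"
  proof (rule term_induct[OF _ _ _ \<open>Wf s\<close>, where P = "\<lambda>s. \<forall>x. Sp s x \<longrightarrow> x \<unlhd> s"])
    show "A0 (\<lambda>v. \<forall>x. Sp (v 0) x \<longrightarrow> x \<unlhd> v 0)" by (intro ar_rules)
    have "m \<unlhd> mt m" for m by (simp add: mt_def)
    then show "\<forall>x. Sp (mt m) x \<longrightarrow> x \<unlhd> mt m" for m by simp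
    show "\<forall>x. Sp (xt a u) x \<longrightarrow> x \<unlhd> xt a u"
      if "Wf (xt a u)" "\<And>t. mem t a \<Longrightarrow> Wf t \<Longrightarrow> \<forall>x. Sp t x \<longrightarrow> x \<unlhd> t" for a u
      using that mem_lt_xt[of _ a u] unfolding Wf_xt Sp_simps
      by (meson M.le_less_trans M.less_imp_le)
  qed
  ultimately show ?thesis by blast
qed

lemma Sp_code: assumes "Wf s" obtains c where "fset c" "\<And>x. mem x c \<longleftrightarrow> Sp s x"
proof -
  have "A0 (\<lambda>v. Sp s (v 0))" by (intro ar_rules)
  then show thesis
    by (rule ex_fset[of "Sp s" "s \<oplus> \<one>"]) (use Sp_le[OF assms] that in auto)
qed

text \<open>That \<open>b\<close> is the image of \<open>a\<close> is expressed by two inclusions.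
  In this way each recursive call concerns an element of \<open>a\<close> and an element of
  \<open>b\<close>, hence a smaller code; the equation for the image would quantify over values of
  unknown size.\<close>

definition Ac_step :: "'a \<Rightarrow> 'a set \<Rightarrow> bool" where
  "Ac_step z X \<longleftrightarrow> (\<exists>f s t. z = pr f (pr s t) \<and>
     ((\<exists>m k. s = mt m \<and> mem (pr m k) f \<and> t = mt k) \<or>
      (\<exists>a b u. s = xt a u \<and> t = xt b u \<and> fset b \<and>
        (\<forall>y. mem y b \<longrightarrow> (\<exists>x. mem x a \<and> pr f (pr x y) \<in> X)) \<and>
        (\<forall>x. mem x a \<longrightarrow> (\<exists>y. mem y b \<and> pr f (pr x y) \<in> X)))))"

definition Ac_graph :: "'a set" where
  "Ac_graph = (SOME D. D \<in> \<S> \<and> (\<forall>x. x \<in> D \<longleftrightarrow> Ac_step x {y \<in> D. y \<lhd> x}))"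

definition Ac :: "'a \<Rightarrow> 'a \<Rightarrow> 'a \<Rightarrow> bool" where
  "Ac f s t \<longleftrightarrow> pr f (pr s t) \<in> Ac_graph"

lemma Ac_graph: "Ac_graph \<in> \<S>" "z \<in> Ac_graph \<longleftrightarrow> Ac_step z {y \<in> Ac_graph. y \<lhd> z}"
proof -
  have "A0 (\<lambda>v. Ac_step (v 0) {y. mem y (v (Suc 0)) \<and> y \<lhd> v 0})"
    unfolding Ac_step_def mem_Collect_eq by (intro ar_rules)
  from someI_ex[OF recursion_id[OF this, unfolded Bex_def], folded Ac_graph_def]
  show "Ac_graph \<in> \<S>" "z \<in> Ac_graph \<longleftrightarrow> Ac_step z {y \<in> Ac_graph. y \<lhd> z}" by blast+
qed

lemma A0_Ac [ar_rules]: "af h \<Longrightarrow> af f \<Longrightarrow> af g \<Longrightarrow> A0 (\<lambda>v. Ac (h v) (f v) (g v))"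
  unfolding Ac_def by (intro ar_rules Ac_graph(1))

lemma Ac_iff: "Ac f s t \<longleftrightarrow> (\<exists>m k. s = mt m \<and> mem (pr m k) f \<and> t = mt k) \<or>
      (\<exists>a b u. s = xt a u \<and> t = xt b u \<and> fset b \<and>
        (\<forall>y. mem y b \<longrightarrow> (\<exists>x. mem x a \<and> Ac f x y)) \<and>
        (\<forall>x. mem x a \<longrightarrow> (\<exists>y. mem y b \<and> Ac f x y)))"
proof -
  let ?D = Ac_graph
  have less: "pr f (pr x y) \<lhd> pr f (pr (xt a u) (xt b u))" if "mem x a" "mem y b" for x y a b u
    by (intro pr_mono pr_mono1 M.order.refl mem_lt_xt[OF that(1)] M.less_imp_le[OF mem_lt_xt[OF that(2)]])
  have "Ac f s t \<longleftrightarrow> Ac_step (pr f (pr s t)) {y \<in> ?D. y \<lhd> pr f (pr s t)}"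
    unfolding Ac_def by (rule Ac_graph(2))
  also have "\<dots> \<longleftrightarrow> (\<exists>m k. s = mt m \<and> mem (pr m k) f \<and> t = mt k) \<or>
      (\<exists>a b u. s = xt a u \<and> t = xt b u \<and> fset b \<and>
        (\<forall>y. mem y b \<longrightarrow> (\<exists>x. mem x a \<and> pr f (pr x y) \<in> ?D \<and> pr f (pr x y) \<lhd> pr f (pr s t))) \<and>
        (\<forall>x. mem x a \<longrightarrow> (\<exists>y. mem y b \<and> pr f (pr x y) \<in> ?D \<and> pr f (pr x y) \<lhd> pr f (pr s t))))"
    unfolding Ac_step_def by simp
  also have "\<dots> \<longleftrightarrow> (\<exists>m k. s = mt m \<and> mem (pr m k) f \<and> t = mt k) \<or>
      (\<exists>a b u. s = xt a u \<and> t = xt b u \<and> fset b \<and>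
        (\<forall>y. mem y b \<longrightarrow> (\<exists>x. mem x a \<and> pr f (pr x y) \<in> ?D)) \<and>
        (\<forall>x. mem x a \<longrightarrow> (\<exists>y. mem y b \<and> pr f (pr x y) \<in> ?D)))"
    by (intro disj_cong refl iff_exI conj_cong) (auto simp: less cong: conj_cong)
  finally show ?thesis unfolding Ac_def[symmetric] .
qed

lemma Ac_mt [simp]: "Ac f (mt m) t \<longleftrightarrow> (\<exists>k. mem (pr m k) f \<and> t = mt k)"
  by (subst Ac_iff) auto

lemma Ac_to_mt: "Ac f s (mt k) \<longleftrightarrow> (\<exists>m. mem (pr m k) f \<and> s = mt m)"
  by (subst Ac_iff) auto

lemma Ac_xt: "Ac f (xt a u) t \<longleftrightarrow> (\<exists>b. t = xt b u \<and> fset b \<and>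
    (\<forall>y. mem y b \<longrightarrow> (\<exists>x. mem x a \<and> Ac f x y)) \<and> (\<forall>x. mem x a \<longrightarrow> (\<exists>y. mem y b \<and> Ac f x y)))"
  by (subst Ac_iff) auto

section \<open>The order of terms\<close>

definition rk :: "'a \<Rightarrow> 'a" where
  "rk z = (if p1 z \<lhd> p2 z then p2 z else p1 z)"

definition Bel_step :: "('a \<Rightarrow> 'a \<Rightarrow> bool) \<Rightarrow> 'a \<Rightarrow> 'a set \<Rightarrow> bool" where
  "Bel_step R z X \<longleftrightarrow> (\<exists>s t. z = pr s t \<and> Wf s \<and> Wf t \<and>
     ((\<exists>m k. s = mt m \<and> t = mt k \<and> R m k) \<or>
      (\<exists>m b v. s = mt m \<and> t = xt b v \<and> (\<exists>k. Sp t k \<and> (R m k \<or> m = k))) \<or>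
      (\<exists>a u k. s = xt a u \<and> t = mt k \<and> (\<forall>j. Sp s j \<longrightarrow> R j k)) \<or>
      (\<exists>a u b v. s = xt a u \<and> t = xt b v \<and>
         linon (\<lambda>x y. pr x y \<in> X) (\<lambda>x. mem x a \<or> mem x b) \<and>
         pless T (\<lambda>x y. pr x y \<in> X) a u b v)))"

definition Bel_graph :: "('a \<Rightarrow> 'a \<Rightarrow> bool) \<Rightarrow> 'a set" where
  "Bel_graph R = (SOME D. D \<in> \<S> \<and> (\<forall>x. x \<in> D \<longleftrightarrow> Bel_step R x {y \<in> D. rk y \<lhd> rk x}))"

definition Bel :: "('a \<Rightarrow> 'a \<Rightarrow> bool) \<Rightarrow> 'a \<Rightarrow> 'a \<Rightarrow> bool" where
  "Bel R s t \<longleftrightarrow> pr s t \<in> Bel_graph R"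

lemma af_rk [ar_rules]: "af f \<Longrightarrow> af (\<lambda>v. rk (f v))"
proof (rule af_fun1[of rk])
  have "x = rk z \<longleftrightarrow> (p1 z \<lhd> p2 z \<and> x = p2 z) \<or> (\<not> p1 z \<lhd> p2 z \<and> x = p1 z)" for x z
    by (auto simp: rk_def)
  then show "A0 (\<lambda>v. v 0 = rk (v (Suc 0)))" by (simp only:) (intro ar_rules)
qed

lemma le_rk: "s \<unlhd> rk (pr s t)" "t \<unlhd> rk (pr s t)"
  by (auto simp: rk_def M.not_less le_def)

lemma linon_cong:
  assumes "linon Q P" "\<And>x y. P x \<Longrightarrow> P y \<Longrightarrow> Q x y \<longleftrightarrow> Q' x y" shows "linon Q' P"
  using assms(1) unfolding linon_def by (elim conjE, intro conjI allI impI) (metis assms(2))+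

lemma rk_less:
  assumes "mem x a \<or> mem x b" "mem y a \<or> mem y b"
  shows "rk (pr x y) \<lhd> rk (pr (xt a u) (xt b v))"
proof -
  have "z \<lhd> rk (pr (xt a u) (xt b v))" if "mem z a \<or> mem z b" for z
    using that M.less_le_trans[OF mem_lt_xt le_rk(1)] M.less_le_trans[OF mem_lt_xt le_rk(2)] by blast
  then show ?thesis using assms by (simp add: rk_def)
qed

context
  fixes R :: "'a \<Rightarrow> 'a \<Rightarrow> bool"
  assumes R: "ar2 R"
begin

lemma Bel_graph: "Bel_graph R \<in> \<S>" "z \<in> Bel_graph R \<longleftrightarrow> Bel_step R z {y \<in> Bel_graph R. rk y \<lhd> rk z}"
proof -
  \<comment> \<open>The finite approximation and the bound on the rank are packed into one number
    \<open>d\<close>, because definability of \<open>pless\<close> is stated for relations with a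
    single parameter.\<close>
  define Q where "Q d x y \<longleftrightarrow> mem (pr x y) (p1 d) \<and> rk (pr x y) \<lhd> p2 d" for d x y
  have Q: "A0 (\<lambda>v. Q (v 0) (v (Suc 0)) (v (Suc (Suc 0))))" unfolding Q_def by (intro ar_rules)
  have pl: "A0 (\<lambda>v. pless T (Q (v 0)) (v (Suc 0)) (v (Suc (Suc 0))) (v (Suc (Suc (Suc 0)))) (v (Suc (Suc (Suc (Suc 0))))))"
    by (rule A0_pless[OF Q])
  have "\<exists>D\<in>\<S>. \<forall>z. z \<in> D \<longleftrightarrow> Bel_step R z {y \<in> D. rk y \<lhd> rk z}"
  proof (rule recursion)
    show "A0 (\<lambda>v. v 0 = rk (v (Suc 0)))" by (intro ar_rules)
    have eq: "(\<lambda>x y. pr x y \<in> {y. mem y c \<and> rk y \<lhd> rk z}) = Q (pr c (rk z))" for c z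
      by (intro ext) (simp add: Q_def)
    show "A0 (\<lambda>v. Bel_step R (v 0) {y. mem y (v (Suc 0)) \<and> rk y \<lhd> rk (v 0)})"
      unfolding Bel_step_def eq linon_def
      by (intro ar_rules ar2D[OF R] A0_rel5[OF pl] A0_rel3[OF Q])
    fix r
    have "z \<lhd> pr (r \<oplus> \<one>) (r \<oplus> \<one>)" if h: "rk z \<unlhd> r" "Bel_step R z X" for z X
    proof -
      obtain s t where z: "z = pr s t" using h(2) unfolding Bel_step_def by blast
      have "s \<unlhd> r" "t \<unlhd> r"
        using h(1) le_rk M.order.trans unfolding z by blast+
      then show ?thesis unfolding z by (intro pr_mono) (simp_all add: M.less_imp_le)
    qed
    then show "\<exists>b. \<forall>z. rk z \<unlhd> r \<longrightarrow> (\<exists>X. Bel_step R z X) \<longrightarrow> z \<lhd> b" by blast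
  qed
  from someI_ex[OF this[unfolded Bex_def], folded Bel_graph_def]
  show "Bel_graph R \<in> \<S>" "z \<in> Bel_graph R \<longleftrightarrow> Bel_step R z {y \<in> Bel_graph R. rk y \<lhd> rk z}" by blast+
qed

lemma Bel_ar2: "ar2 (Bel R)"
  unfolding ar2_def Bel_def by (intro ar_rules Bel_graph(1))

lemma Bel_iff: "Bel R s t \<longleftrightarrow> Wf s \<and> Wf t \<and>
     ((\<exists>m k. s = mt m \<and> t = mt k \<and> R m k) \<or>
      (\<exists>m b v. s = mt m \<and> t = xt b v \<and> (\<exists>k. Sp t k \<and> (R m k \<or> m = k))) \<or>
      (\<exists>a u k. s = xt a u \<and> t = mt k \<and> (\<forall>j. Sp s j \<longrightarrow> R j k)) \<or>
      (\<exists>a u b v. s = xt a u \<and> t = xt b v \<and>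
         linon (Bel R) (\<lambda>x. mem x a \<or> mem x b) \<and> pless T (Bel R) a u b v))"
proof -
  define D where "D = Bel_graph R"
  have D: "D \<in> \<S>" "\<And>s t. Bel R s t \<longleftrightarrow> pr s t \<in> D"
    "\<And>z. z \<in> D \<longleftrightarrow> Bel_step R z {y \<in> D. rk y \<lhd> rk z}"
    unfolding D_def Bel_def by (rule Bel_graph(1), rule refl, rule Bel_graph(2))
  define Q where "Q z x y \<longleftrightarrow> pr x y \<in> D \<and> rk (pr x y) \<lhd> rk z" for z x y
  have Q: "ar2 (Q z)" for z unfolding ar2_def Q_def by (intro ar_rules D(1))
  have eq: "linon (Q (pr s t)) (\<lambda>x. mem x a \<or> mem x b) \<and> pless T (Q (pr s t)) a u b v \<longleftrightarrow>
      linon (Bel R) (\<lambda>x. mem x a \<or> mem x b) \<and> pless T (Bel R) a u b v"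
    if st: "s = xt a u" "t = xt b v" for a u b v
  proof -
    \<comment> \<open>Arguments have smaller rank than the terms, so on them the truncated relation
      is the full one; \<open>linon\<close> and \<open>pless\<close> see nothing else.\<close>
    have QB: "Q (pr s t) x y \<longleftrightarrow> Bel R x y" if "mem x a \<or> mem x b" "mem y a \<or> mem y b" for x y
      unfolding Q_def D(2) st by (simp only: rk_less[OF that] simp_thms)
    have "linon (Q (pr s t)) (\<lambda>x. mem x a \<or> mem x b) \<longleftrightarrow> linon (Bel R) (\<lambda>x. mem x a \<or> mem x b)"
    proof
      show "linon (Bel R) (\<lambda>x. mem x a \<or> mem x b)" if "linon (Q (pr s t)) (\<lambda>x. mem x a \<or> mem x b)"
        by (rule linon_cong[OF that]) (rule QB)
      show "linon (Q (pr s t)) (\<lambda>x. mem x a \<or> mem x b)" if "linon (Bel R) (\<lambda>x. mem x a \<or> mem x b)"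
        by (rule linon_cong[OF that]) (rule QB[symmetric])
    qed
    moreover have "pless T (Q (pr s t)) a u b v \<longleftrightarrow> pless T (Bel R) a u b v"
    proof
      show "pless T (Bel R) a u b v" if "pless T (Q (pr s t)) a u b v"
        by (rule pless_cong[OF Q _ that]) (simp add: QB)
      show "pless T (Q (pr s t)) a u b v" if "pless T (Bel R) a u b v"
        by (rule pless_cong[OF Bel_ar2 _ that]) (simp add: QB)
    qed
    ultimately show ?thesis by simp
  qed
  have "Bel R s t \<longleftrightarrow> Bel_step R (pr s t) {y \<in> D. rk y \<lhd> rk (pr s t)}" unfolding D(2) by (rule D(3))
  also have "\<dots> \<longleftrightarrow> Wf s \<and> Wf t \<and>
     ((\<exists>m k. s = mt m \<and> t = mt k \<and> R m k) \<or>
      (\<exists>m b v. s = mt m \<and> t = xt b v \<and> (\<exists>k. Sp t k \<and> (R m k \<or> m = k))) \<or>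
      (\<exists>a u k. s = xt a u \<and> t = mt k \<and> (\<forall>j. Sp s j \<longrightarrow> R j k)) \<or>
      (\<exists>a u b v. s = xt a u \<and> t = xt b v \<and>
         linon (Q (pr s t)) (\<lambda>x. mem x a \<or> mem x b) \<and> pless T (Q (pr s t)) a u b v))"
    unfolding Bel_step_def Q_def by simp
  finally show ?thesis using eq by (simp only: cong: conj_cong)
qed

lemma Bel_Wf: "Bel R s t \<Longrightarrow> Wf s \<and> Wf t"
  by (subst (asm) Bel_iff) blast

lemma Bel_mt_mt [simp]: "Bel R (mt m) (mt k) \<longleftrightarrow> R m k"
  by (subst Bel_iff) simp

lemma Bel_mt_xt: "Bel R (mt m) (xt b v) \<longleftrightarrow> Wf (xt b v) \<and> (\<exists>k. Sp (xt b v) k \<and> (R m k \<or> m = k))"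
  by (subst Bel_iff) simp

lemma Bel_xt_xt: "Bel R (xt a u) (xt b v) \<longleftrightarrow> Wf (xt a u) \<and> Wf (xt b v) \<and>
    linon (Bel R) (\<lambda>x. mem x a \<or> mem x b) \<and> pless T (Bel R) a u b v"
  by (subst Bel_iff) simp

text \<open>Covers both kinds of terms by one condition, since the only index of \<open>mt m\<close>
  is \<open>m\<close>.\<close>

lemma Bel_to_mt: "Bel R s (mt k) \<longleftrightarrow> Wf s \<and> (\<forall>j. Sp s j \<longrightarrow> R j k)"
proof -
  have "Bel R s (mt k) \<longleftrightarrow> Wf s \<and> (\<forall>j. Sp s j \<longrightarrow> R j k)" if "Wf s"
    using that by (cases rule: Wf_cases; subst Bel_iff) auto
  then show ?thesis using Bel_Wf by blast
qed

lemma Bel_from_mt: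
  assumes "Wf t" "\<not> R m m"
  shows "Bel R (mt m) t \<longleftrightarrow> t \<noteq> mt m \<and> (\<exists>k. Sp t k \<and> (R m k \<or> m = k))"
  using assms(1)
proof (cases rule: Wf_cases)
  case (2 a u)
  then show ?thesis using assms(1) Bel_mt_xt by simp
qed (use assms(2) in auto)

end

definition over :: "('a \<Rightarrow> bool) \<Rightarrow> 'a \<Rightarrow> bool" where
  "over X s \<longleftrightarrow> Wf s \<and> (\<forall>j. Sp s j \<longrightarrow> X j)"

lemma over_mt [simp]: "over X (mt m) \<longleftrightarrow> X m"
  by (simp add: over_def)

lemma over_xt: "over X (xt a u) \<longleftrightarrow> Wf (xt a u) \<and> (\<forall>t. mem t a \<longrightarrow> over X t)"
  unfolding over_def by (auto simp: Wf_xt)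

lemma over_Wf: "over X s \<Longrightarrow> Wf s"
  by (simp add: over_def)

lemma A0_over: "A0 (\<lambda>v. X (v 0)) \<Longrightarrow> af f \<Longrightarrow> A0 (\<lambda>v. over X (f v))"
proof -
  assume X: "A0 (\<lambda>v. X (v 0))" and f: "af f"
  have "A0 (\<lambda>v. over X (v 0))" unfolding over_def by (intro ar_rules A0_rel1[OF X])
  then show ?thesis using f by (rule A0_rel1)
qed

end

section \<open>Linearity and functoriality of the term system\<close>

context normal_model
begin

lemma over_cases:
  assumes "over X s"
  obtains m where "s = mt m" "X m"
  | a u where "s = xt a u" "Wf (xt a u)" "fset a" "full T a u" "\<And>t. mem t a \<Longrightarrow> over X t"
proof -
  have s: "Wf s" using assms by (rule over_Wf)
  then show thesis
  proof (cases rule: Wf_cases)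
    case (1 m)
    then show ?thesis using assms that(1) by simp
  next
    case (2 a u)
    then show ?thesis using assms s that(2) over_xt by blast
  qed
qed

lemma over_mem: "over X (xt a u) \<Longrightarrow> mem t a \<Longrightarrow> over X t"
  by (simp add: over_xt)

section \<open>Linearity and domination of supports\<close>

context
  fixes R :: "'a \<Rightarrow> 'a \<Rightarrow> bool" and X :: "'a \<Rightarrow> bool"
  assumes R: "ar2 R" and X: "A0 (\<lambda>v. X (v 0))" and lin: "linon R X"
begin

definition cofinal :: "'a \<Rightarrow> 'a \<Rightarrow> bool" where
  "cofinal s t \<longleftrightarrow> (\<forall>j. Sp s j \<longrightarrow> (\<exists>k. Sp t k \<and> (R j k \<or> j = k)))"

lemma over_Sp: "over X s \<Longrightarrow> Sp s j \<Longrightarrow> X j"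
  by (simp add: over_def)

text \<open>The induction step that admits codes equal to \<open>N\<close>. Domination comes first:
  for two \<open>\<xi>\<close>-terms it passes through \<open>pless_cofinal\<close> to the
  arguments, which have smaller codes. It is then available in the proof of transitivity.\<close>

lemma Bel_step_aux:
  assumes IHlin: "linon (Bel R) (\<lambda>s. over X s \<and> s \<lhd> N)"
    and IHcof: "\<And>s t. over X s \<Longrightarrow> s \<lhd> N \<Longrightarrow> over X t \<Longrightarrow> t \<lhd> N \<Longrightarrow> Bel R s t \<Longrightarrow> cofinal s t"
  shows "linon (Bel R) (\<lambda>s. over X s \<and> s \<unlhd> N)"
    and "\<And>s t. over X s \<Longrightarrow> s \<unlhd> N \<Longrightarrow> over X t \<Longrightarrow> t \<unlhd> N \<Longrightarrow> Bel R s t \<Longrightarrow> cofinal s t"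
proof -
  note B = Bel_to_mt[OF R] Bel_mt_xt[OF R] Bel_xt_xt[OF R] Bel_mt_mt[OF R]
  have small: "over X q" "q \<lhd> N" if "over X (xt a u)" "xt a u \<unlhd> N" "mem q a" for q a u
    using over_mem[OF that(1,3)] M.less_le_trans[OF mem_lt_xt[OF that(3)] that(2)] by auto
  have irreflX: "\<not> R j j" if "X j" for j using linonD(1)[OF lin] that by blast
  have transX: "R i k" if "X i" "X j" "X k" "R i j" "R j k" for i j k
    using linonD(2)[OF lin] that by blast
  show cof: "cofinal s t" if s: "over X s" "s \<unlhd> N" and t: "over X t" "t \<unlhd> N" and st: "Bel R s t" for s t
    using s(1)
  proof (cases rule: over_cases)
    case (1 m)
    show ?thesis using t(1)
    proof (cases rule: over_cases)
      case (1 k)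
      then show ?thesis using st \<open>s = mt m\<close> unfolding cofinal_def by (simp add: B(4))
    next
      case (2 b v)
      then show ?thesis using st \<open>s = mt m\<close> B(2) unfolding cofinal_def by simp
    qed
  next
    case s': (2 a u)
    show ?thesis using t(1)
    proof (cases rule: over_cases)
      case (1 k)
      then show ?thesis using st B(1) unfolding cofinal_def by simp
    next
      case (2 b v)
      have "linon (Bel R) (\<lambda>x. mem x a \<or> mem x b)" "pless T (Bel R) a u b v"
        using st B(3) unfolding s' 2 by blast+
      note pc = pless_cofinal[OF Bel_ar2[OF R] this(1) s'(4) 2(4) this(2)]
      have c: "cofinal q r" if q: "mem q a" and r: "mem r b" and qr: "Bel R q r" for q r
        using IHcof[OF small[OF s[unfolded s'(1)] q] small[OF t[unfolded 2(1)] r] qr] .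
      show ?thesis
        unfolding s'(1) 2(1) cofinal_def
      proof (intro allI impI)
        fix j assume "Sp (xt a u) j"
        then obtain q where q: "mem q a" "Sp q j" by auto
        then obtain r where r: "mem r b" "Bel R q r \<or> q = r" using pc by blast
        then have "\<exists>k. Sp r k \<and> (R j k \<or> j = k)" using c[OF q(1) r(1)] q(2) unfolding cofinal_def by blast
        then show "\<exists>k. Sp (xt b v) k \<and> (R j k \<or> j = k)" using r(1) by auto
      qed
    qed
  qed
  have linab: "linon (Bel R) (\<lambda>x. mem x a \<or> mem x b)"
    if "over X (xt a u)" "xt a u \<unlhd> N" "over X (xt b v)" "xt b v \<unlhd> N" for a u b v
    by (rule linon_mono[OF IHlin]) (use small that in blast)
  show "linon (Bel R) (\<lambda>s. over X s \<and> s \<unlhd> N)"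
    unfolding linon_def
  proof (intro conjI allI impI)
    fix s assume s: "over X s \<and> s \<unlhd> N"
    then have "over X s" by blast
    then show "\<not> Bel R s s"
    proof (cases rule: over_cases)
      case (1 m)
      then show ?thesis using irreflX by (simp add: B(4))
    next
      case (2 a u)
      have "linon (Bel R) (\<lambda>x. mem x a)" by (rule linon_mono[OF IHlin]) (use small s 2(1) in blast)
      then show ?thesis using pless_irrefl[OF Bel_ar2[OF R]] 2(4) B(3) unfolding 2(1) by blast
    qed
  next
    fix s t assume s: "over X s \<and> s \<unlhd> N" and t: "over X t \<and> t \<unlhd> N"
    have mx: "Bel R (mt m) (xt b v) \<or> Bel R (xt b v) (mt m)" if "X m" "over X (xt b v)" for m b v
      using linonD(3)[OF lin] that over_Sp[OF that(2)] over_Wf[OF that(2)] unfolding B(1,2) by blast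
    show "Bel R s t \<or> s = t \<or> Bel R t s"
      using conjunct1[OF s]
    proof (cases rule: over_cases)
      case s1: (1 m)
      show ?thesis using conjunct1[OF t]
      proof (cases rule: over_cases)
        case (1 k)
        then show ?thesis using s1 linonD(3)[OF lin] by (simp add: B(4))
      next
        case (2 b v)
        then show ?thesis using mx s1 t by blast
      qed
    next
      case s2: (2 a u)
      show ?thesis using conjunct1[OF t]
      proof (cases rule: over_cases)
        case (1 k)
        then show ?thesis using mx s2 s by blast
      next
        case (2 b v)
        have l: "linon (Bel R) (\<lambda>x. mem x a \<or> mem x b)" "linon (Bel R) (\<lambda>x. mem x b \<or> mem x a)"
          using linab[of a u b v] linab[of b v a u] s t s2(1) 2(1) by auto
        show ?thesis
          using pless_total[OF Bel_ar2[OF R] l(1) s2(4) 2(4) s2(3) 2(3)] l s2(2) 2(2)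
          unfolding s2(1) 2(1) B(3) by auto
      qed
    qed
  next
    fix s t u assume s: "over X s \<and> s \<unlhd> N" and t: "over X t \<and> t \<unlhd> N" and u: "over X u \<and> u \<unlhd> N"
      and st: "Bel R s t" and tu: "Bel R t u"
    have cst: "cofinal s t" and ctu: "cofinal t u" using cof s t u st tu by blast+
    have Xs: "X j" if "Sp s j \<or> Sp t j \<or> Sp u j" for j using that over_Sp s t u by blast
    show "Bel R s u"
    proof (cases "\<exists>k. u = mt k")
      case True
      then obtain k where k: "u = mt k" "X k" using u by auto
      then have "R j k" if "Sp t j" for j using tu that B(1) by blast
      then have "R j k" if "Sp s j" for j
        using cst that transX[of j _ k] Xs k(2) unfolding cofinal_def by metis
      then show ?thesis unfolding k(1) B(1) using over_Wf s by blast
    next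
      case False
      then obtain c w where uc: "u = xt c w" "Wf (xt c w)" "full T c w" using u
        by (metis over_cases)
      show ?thesis using conjunct1[OF s]
      proof (cases rule: over_cases)
        case (1 m)
        have "\<exists>j. Sp t j \<and> (R m j \<or> m = j)" using cst unfolding 1(1) cofinal_def by simp
        then obtain j where j: "Sp t j" "R m j \<or> m = j" by blast
        then obtain k where k: "Sp u k" "R j k \<or> j = k" using ctu unfolding cofinal_def by blast
        have "R m k \<or> m = k" using j k transX[of m j k] Xs 1(2) by blast
        then show ?thesis using k(1) uc(2) unfolding 1(1) uc(1) B(2) by blast
      next
        case s2: (2 a v)
        have lac: "linon (Bel R) (\<lambda>x. mem x a \<or> mem x c)" using linab s u s2(1) uc(1) by blast
        show ?thesis using conjunct1[OF t]
        proof (cases rule: over_cases)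
          case t1: (1 k)
          have sk: "R j k" if "Sp s j" for j using st that unfolding t1(1) B(1) by blast
          obtain k' where k': "Sp u k'" "R k k' \<or> k = k'" using tu ctu unfolding t1(1) cofinal_def by auto
          then obtain r where r: "mem r c" "Sp r k'" unfolding uc(1) by auto
          have rX: "over X r" "r \<lhd> N" using small r(1) u uc(1) by blast+
          \<comment> \<open>All indices of \<open>q\<close> lie below the index \<open>k'\<close> of
            \<open>r\<close>, so \<open>q\<close> and \<open>r\<close> differ. If \<open>r\<close>
            were below \<open>q\<close>, domination would give an index of \<open>q\<close> that is
            not below \<open>k'\<close>. Hence \<open>r\<close> exceeds all of \<open>a\<close>, and
            normality decides the comparison.\<close>
          have "Bel R q r" if q: "mem q a" for q
          proof -
            have qX: "over X q" "q \<lhd> N" using small q s s2(1) by blast+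
            have qk: "R j k'" if "Sp q j" for j
            proof -
              have "Sp s j" using that q unfolding s2(1) by auto
              then show ?thesis using sk k' transX[of j k k'] Xs t1(2) by blast
            qed
            have k'X: "X k'" using k'(1) Xs by blast
            have "q \<noteq> r" using qk r(2) irreflX[OF k'X] by blast
            moreover have "\<not> Bel R r q"
            proof
              assume "Bel R r q"
              then have "cofinal r q" using IHcof rX qX by blast
              then obtain j where "Sp q j" "R k' j \<or> k' = j" using r(2) unfolding cofinal_def by blast
              then show False using qk[of j] transX[of k' j k'] irreflX[OF k'X] k'X over_Sp[OF qX(1)] by blast
            qed
            ultimately show ?thesis using linonD(3)[OF IHlin, of q r] qX rX by blast
          qed
          then have "pless T (Bel R) a v c w"
            using pless_dominated[OF Bel_ar2[OF R] lac s2(4) uc(3) r(1)] by blast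
          then show ?thesis unfolding s2(1) uc(1) B(3) using s2(2) uc(2) lac by blast
        next
          case t2: (2 b z)
          have "linon (Bel R) (\<lambda>x. mem x a \<or> mem x b \<or> mem x c)"
            by (rule linon_mono[OF IHlin]) (use small s t u s2(1) t2(1) uc(1) in blast)
          then have "pless T (Bel R) a v c w"
            using pless_trans[OF Bel_ar2[OF R] _ s2(4) t2(4) uc(3)] st tu
            unfolding s2(1) t2(1) uc(1) B(3) by blast
          then show ?thesis unfolding s2(1) uc(1) B(3) using s2(2) uc(2) lac by blast
        qed
      qed
    qed
  qed
qed

lemma Bel_all:
  "linon (Bel R) (\<lambda>s. over X s \<and> s \<lhd> N) \<and>
    (\<forall>s t. over X s \<longrightarrow> s \<lhd> N \<longrightarrow> over X t \<longrightarrow> t \<lhd> N \<longrightarrow> Bel R s t \<longrightarrow> cofinal s t)"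
proof (rule A0_induct[where P = "\<lambda>N. linon (Bel R) (\<lambda>s. over X s \<and> s \<lhd> N) \<and>
    (\<forall>s t. over X s \<longrightarrow> s \<lhd> N \<longrightarrow> over X t \<longrightarrow> t \<lhd> N \<longrightarrow> Bel R s t \<longrightarrow> cofinal s t)"])
  show "A0 (\<lambda>v. linon (Bel R) (\<lambda>s. over X s \<and> s \<lhd> v 0) \<and>
    (\<forall>s t. over X s \<longrightarrow> s \<lhd> v 0 \<longrightarrow> over X t \<longrightarrow> t \<lhd> v 0 \<longrightarrow> Bel R s t \<longrightarrow> cofinal s t))"
    unfolding linon_def cofinal_def by (intro ar_rules A0_over[OF X] ar2D[OF Bel_ar2[OF R]] ar2D[OF R])
  show "linon (Bel R) (\<lambda>s. over X s \<and> s \<lhd> \<zero>) \<and>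
    (\<forall>s t. over X s \<longrightarrow> s \<lhd> \<zero> \<longrightarrow> over X t \<longrightarrow> t \<lhd> \<zero> \<longrightarrow> Bel R s t \<longrightarrow> cofinal s t)"
    unfolding linon_def using not_lt_zero by simp
  fix N assume IH: "linon (Bel R) (\<lambda>s. over X s \<and> s \<lhd> N) \<and>
    (\<forall>s t. over X s \<longrightarrow> s \<lhd> N \<longrightarrow> over X t \<longrightarrow> t \<lhd> N \<longrightarrow> Bel R s t \<longrightarrow> cofinal s t)"
  then have "linon (Bel R) (\<lambda>s. over X s \<and> s \<lhd> N)"
    "\<And>s t. over X s \<Longrightarrow> s \<lhd> N \<Longrightarrow> over X t \<Longrightarrow> t \<lhd> N \<Longrightarrow> Bel R s t \<Longrightarrow> cofinal s t" by blast+
  from Bel_step_aux[OF this]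
  show "linon (Bel R) (\<lambda>s. over X s \<and> s \<lhd> N \<oplus> \<one>) \<and>
    (\<forall>s t. over X s \<longrightarrow> s \<lhd> N \<oplus> \<one> \<longrightarrow> over X t \<longrightarrow> t \<lhd> N \<oplus> \<one> \<longrightarrow> Bel R s t \<longrightarrow> cofinal s t)"
    unfolding lt_suc_iff by blast
qed

lemma Bel_linon: "linon (Bel R) (over X)"
proof -
  have N: "linon (Bel R) (\<lambda>s. over X s \<and> s \<lhd> N)" for N using Bel_all by blast
  have bound: "x \<lhd> x \<oplus> y \<oplus> z \<oplus> \<one>" "y \<lhd> x \<oplus> y \<oplus> z \<oplus> \<one>" "z \<lhd> x \<oplus> y \<oplus> z \<oplus> \<one>" for x y z
    using M.order.trans[OF le_plus1 le_plus1, of x y z] M.order.trans[OF le_plus2 le_plus1, of y x z] by auto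
  have in_N: "over X w \<and> w \<lhd> N" if "over X w" "w \<lhd> N" for w N using that ..
  show ?thesis
    unfolding linon_def
  proof (intro conjI allI impI)
    fix x y z assume x: "over X x"
    show "\<not> Bel R x x" by (rule linonD(1)[OF N in_N[OF x bound(1)]])
    assume y: "over X y"
    show "Bel R x y \<or> x = y \<or> Bel R y x"
      by (rule linonD(3)[OF N in_N[OF x bound(1)] in_N[OF y bound(2)]])
    assume z: "over X z" and "Bel R x y" "Bel R y z"
    then show "Bel R x z"
      by (intro linonD(2)[OF N in_N[OF x bound(1)] in_N[OF y bound(2)] in_N[OF z bound(3)]])
  qed
qed

end

section \<open>Renaming of indices along embeddings\<close>

text \<open>As \<open>f\<close> is a coded finite graph, this forces \<open>X\<close> to be bounded;
  only pairs with first component in \<open>X\<close> count.\<close>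

definition emb :: "'a \<Rightarrow> ('a \<Rightarrow> bool) \<Rightarrow> ('a \<Rightarrow> 'a \<Rightarrow> bool) \<Rightarrow> ('a \<Rightarrow> bool) \<Rightarrow> ('a \<Rightarrow> 'a \<Rightarrow> bool) \<Rightarrow> bool" where
  "emb f X R X' R' \<longleftrightarrow> (\<forall>j. X j \<longrightarrow> (\<exists>!k. mem (pr j k) f)) \<and> (\<forall>j k. X j \<longrightarrow> mem (pr j k) f \<longrightarrow> X' k) \<and>
    (\<forall>j k j' k'. X j \<longrightarrow> X j' \<longrightarrow> mem (pr j k) f \<longrightarrow> mem (pr j' k') f \<longrightarrow> R j j' \<longrightarrow> R' k k')"

lemma Ac_ex1:
  assumes f: "\<And>j. X j \<Longrightarrow> \<exists>!k. mem (pr j k) f" and s: "over X s" and X: "A0 (\<lambda>v. X (v 0))"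
  shows "\<exists>!t. Ac f s t"
proof -
  have "over X s \<longrightarrow> (\<exists>!t. Ac f s t)"
  proof (rule term_induct[OF _ _ _ over_Wf[OF s], where P = "\<lambda>s. over X s \<longrightarrow> (\<exists>!t. Ac f s t)"])
    show "A0 (\<lambda>v. over X (v 0) \<longrightarrow> (\<exists>!t. Ac f (v 0) t))" by (intro ar_rules A0_over[OF X])
    show "over X (mt m) \<longrightarrow> (\<exists>!t. Ac f (mt m) t)" for m
      unfolding over_mt Ac_mt using f by blast
    fix a u assume a: "Wf (xt a u)" and IH: "\<And>t. mem t a \<Longrightarrow> Wf t \<Longrightarrow> over X t \<longrightarrow> (\<exists>!y. Ac f t y)"
    show "over X (xt a u) \<longrightarrow> (\<exists>!t. Ac f (xt a u) t)"
    proof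
      assume "over X (xt a u)"
      then have 1: "\<exists>!y. Ac f t y" if "mem t a" for t using IH that over_xt over_Wf by blast
      have "A0 (\<lambda>v. Ac f (v 0) (v (Suc 0)))" by (intro ar_rules)
      then obtain b where b: "fset b" "\<And>y. mem y b \<longleftrightarrow> (\<exists>x. mem x a \<and> Ac f x y)"
        using 1 by (rule_tac ex_image[of "Ac f" a]) blast+
      have "\<exists>y. mem y b \<and> Ac f x y" if x: "mem x a" for x
      proof -
        obtain y where "Ac f x y" using 1[OF x] by blast
        then show ?thesis using b(2) x by blast
      qed
      then have "Ac f (xt a u) (xt b u)" unfolding Ac_xt using b by simp
      moreover have "t = xt b u" if t: "Ac f (xt a u) t" for t
      proof -
        obtain c where c: "t = xt c u" "fset c" "\<And>y. mem y c \<Longrightarrow> \<exists>x. mem x a \<and> Ac f x y"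
          "\<And>x. mem x a \<Longrightarrow> \<exists>y. mem y c \<and> Ac f x y"
          using t unfolding Ac_xt by blast
        have "mem y b \<longleftrightarrow> mem y c" for y using b(2) c(3,4) 1 by metis
        then show ?thesis using c(1,2) b(1) fset_eq by blast
      qed
      ultimately show "\<exists>!t. Ac f (xt a u) t" by blast
    qed
  qed
  then show ?thesis using s by blast
qed

lemma Ac_Sp:
  assumes "Wf s" "Ac f s t"
  shows "Sp t k \<Longrightarrow> \<exists>j. Sp s j \<and> mem (pr j k) f" "Sp s j \<Longrightarrow> \<exists>k. Sp t k \<and> mem (pr j k) f"
proof -
  have *: "\<forall>t. Ac f s t \<longrightarrow> (\<forall>k. Sp t k \<longrightarrow> (\<exists>j. Sp s j \<and> mem (pr j k) f)) \<and>
      (\<forall>j. Sp s j \<longrightarrow> (\<exists>k. Sp t k \<and> mem (pr j k) f))"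
  proof (rule term_induct[OF _ _ _ assms(1), where P = "\<lambda>s. \<forall>t. Ac f s t \<longrightarrow>
      (\<forall>k. Sp t k \<longrightarrow> (\<exists>j. Sp s j \<and> mem (pr j k) f)) \<and> (\<forall>j. Sp s j \<longrightarrow> (\<exists>k. Sp t k \<and> mem (pr j k) f))"])
    show "A0 (\<lambda>v. \<forall>t. Ac f (v 0) t \<longrightarrow> (\<forall>k. Sp t k \<longrightarrow> (\<exists>j. Sp (v 0) j \<and> mem (pr j k) f)) \<and>
        (\<forall>j. Sp (v 0) j \<longrightarrow> (\<exists>k. Sp t k \<and> mem (pr j k) f)))" by (intro ar_rules)
    show "\<forall>t. Ac f (mt m) t \<longrightarrow> (\<forall>k. Sp t k \<longrightarrow> (\<exists>j. Sp (mt m) j \<and> mem (pr j k) f)) \<and>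
        (\<forall>j. Sp (mt m) j \<longrightarrow> (\<exists>k. Sp t k \<and> mem (pr j k) f))" for m by auto
    fix a u assume a: "Wf (xt a u)" and IH: "\<And>s. mem s a \<Longrightarrow> Wf s \<Longrightarrow>
      \<forall>t. Ac f s t \<longrightarrow> (\<forall>k. Sp t k \<longrightarrow> (\<exists>j. Sp s j \<and> mem (pr j k) f)) \<and>
        (\<forall>j. Sp s j \<longrightarrow> (\<exists>k. Sp t k \<and> mem (pr j k) f))"
    then have IH': "\<And>s t. mem s a \<Longrightarrow> Ac f s t \<Longrightarrow> (\<forall>k. Sp t k \<longrightarrow> (\<exists>j. Sp s j \<and> mem (pr j k) f)) \<and>
        (\<forall>j. Sp s j \<longrightarrow> (\<exists>k. Sp t k \<and> mem (pr j k) f))" unfolding Wf_xt by blast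
    show "\<forall>t. Ac f (xt a u) t \<longrightarrow> (\<forall>k. Sp t k \<longrightarrow> (\<exists>j. Sp (xt a u) j \<and> mem (pr j k) f)) \<and>
        (\<forall>j. Sp (xt a u) j \<longrightarrow> (\<exists>k. Sp t k \<and> mem (pr j k) f))"
    proof (intro allI impI)
      fix t assume "Ac f (xt a u) t"
      then obtain b where b: "t = xt b u" "\<And>y. mem y b \<Longrightarrow> \<exists>x. mem x a \<and> Ac f x y"
          "\<And>x. mem x a \<Longrightarrow> \<exists>y. mem y b \<and> Ac f x y"
        unfolding Ac_xt by blast
      show "(\<forall>k. Sp t k \<longrightarrow> (\<exists>j. Sp (xt a u) j \<and> mem (pr j k) f)) \<and>
        (\<forall>j. Sp (xt a u) j \<longrightarrow> (\<exists>k. Sp t k \<and> mem (pr j k) f))"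
        unfolding b(1) Sp_simps using b(2,3) IH' by meson
    qed
  qed
  show "Sp t k \<Longrightarrow> \<exists>j. Sp s j \<and> mem (pr j k) f" "Sp s j \<Longrightarrow> \<exists>k. Sp t k \<and> mem (pr j k) f"
    using * assms(2) by blast+
qed

lemma Ac_comp:
  assumes s: "Wf s" "Ac f s t" "Ac g t r"
    and h: "\<And>i j m. Sp s i \<Longrightarrow> mem (pr i j) f \<Longrightarrow> mem (pr j m) g \<Longrightarrow> mem (pr i m) h"
  shows "Ac h s r"
proof -
  have "(\<forall>i j m. Sp s i \<longrightarrow> mem (pr i j) f \<longrightarrow> mem (pr j m) g \<longrightarrow> mem (pr i m) h) \<longrightarrow>
    (\<forall>t r. Ac f s t \<longrightarrow> Ac g t r \<longrightarrow> Ac h s r)"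
  proof (rule term_induct[OF _ _ _ s(1), where P = "\<lambda>s.
      (\<forall>i j m. Sp s i \<longrightarrow> mem (pr i j) f \<longrightarrow> mem (pr j m) g \<longrightarrow> mem (pr i m) h) \<longrightarrow>
      (\<forall>t r. Ac f s t \<longrightarrow> Ac g t r \<longrightarrow> Ac h s r)"])
    show "A0 (\<lambda>v. (\<forall>i j m. Sp (v 0) i \<longrightarrow> mem (pr i j) f \<longrightarrow> mem (pr j m) g \<longrightarrow> mem (pr i m) h) \<longrightarrow>
      (\<forall>t r. Ac f (v 0) t \<longrightarrow> Ac g t r \<longrightarrow> Ac h (v 0) r))" by (intro ar_rules)
    fix a u assume a: "Wf (xt a u)" and IH: "\<And>s. mem s a \<Longrightarrow> Wf s \<Longrightarrow>
      (\<forall>i j m. Sp s i \<longrightarrow> mem (pr i j) f \<longrightarrow> mem (pr j m) g \<longrightarrow> mem (pr i m) h) \<longrightarrow>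
      (\<forall>t r. Ac f s t \<longrightarrow> Ac g t r \<longrightarrow> Ac h s r)"
    show "(\<forall>i j m. Sp (xt a u) i \<longrightarrow> mem (pr i j) f \<longrightarrow> mem (pr j m) g \<longrightarrow> mem (pr i m) h) \<longrightarrow>
      (\<forall>t r. Ac f (xt a u) t \<longrightarrow> Ac g t r \<longrightarrow> Ac h (xt a u) r)"
    proof (intro allI impI)
      fix t r assume hh: "\<forall>i j m. Sp (xt a u) i \<longrightarrow> mem (pr i j) f \<longrightarrow> mem (pr j m) g \<longrightarrow> mem (pr i m) h"
        and t: "Ac f (xt a u) t" and r: "Ac g t r"
      have IH': "Ac h x z" if "mem x a" "Ac f x y" "Ac g y z" for x y z
        using IH[OF that(1)] a hh that unfolding Wf_xt Sp_simps by blast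
      obtain b where b: "t = xt b u" "\<And>y. mem y b \<Longrightarrow> \<exists>x. mem x a \<and> Ac f x y"
          "\<And>x. mem x a \<Longrightarrow> \<exists>y. mem y b \<and> Ac f x y" using t unfolding Ac_xt by blast
      obtain c where c: "r = xt c u" "fset c" "\<And>y. mem y c \<Longrightarrow> \<exists>x. mem x b \<and> Ac g x y"
          "\<And>x. mem x b \<Longrightarrow> \<exists>y. mem y c \<and> Ac g x y" using r unfolding b(1) Ac_xt by blast
      show "Ac h (xt a u) r" unfolding c(1) Ac_xt using b(2,3) c(2-4) IH' by (auto; meson)
    qed
  qed auto
  then show ?thesis using s h by blast
qed

lemma Ac_id: assumes "Wf s" "\<And>j. Sp s j \<Longrightarrow> mem (pr j j) f" shows "Ac f s s"
proof -
  have "(\<forall>j. Sp s j \<longrightarrow> mem (pr j j) f) \<longrightarrow> Ac f s s"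
  proof (rule term_induct[OF _ _ _ assms(1), where P = "\<lambda>s. (\<forall>j. Sp s j \<longrightarrow> mem (pr j j) f) \<longrightarrow> Ac f s s"])
    show "A0 (\<lambda>v. (\<forall>j. Sp (v 0) j \<longrightarrow> mem (pr j j) f) \<longrightarrow> Ac f (v 0) (v 0))" by (intro ar_rules)
    fix a u assume a: "Wf (xt a u)"
      and IH: "\<And>t. mem t a \<Longrightarrow> Wf t \<Longrightarrow> (\<forall>j. Sp t j \<longrightarrow> mem (pr j j) f) \<longrightarrow> Ac f t t"
    then show "(\<forall>j. Sp (xt a u) j \<longrightarrow> mem (pr j j) f) \<longrightarrow> Ac f (xt a u) (xt a u)"
      unfolding Ac_xt Wf_xt Sp_simps by blast
  qed simp
  then show ?thesis using assms(2) by blast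
qed

text \<open>Fullness depends on the set only through its cardinality, and an order preserving map
  carries an increasing enumeration of \<open>a\<close> to one of \<open>b\<close>.\<close>

lemma full_map:
  assumes full: "full T a u" and R: "ar2 R" and lin: "linon R (\<lambda>x. mem x a)"
    and lin': "linon R' (\<lambda>y. mem y b)" and \<phi>: "ar2 \<phi>" "\<And>x. mem x a \<Longrightarrow> \<exists>!y. \<phi> x y"
      "\<And>x x' y y'. mem x a \<Longrightarrow> mem x' a \<Longrightarrow> \<phi> x y \<Longrightarrow> \<phi> x' y' \<Longrightarrow> R x x' \<Longrightarrow> R' y y'"
      "\<And>y. mem y b \<longleftrightarrow> (\<exists>x. mem x a \<and> \<phi> x y)"
  shows "full T b u"
proof -
  obtain n where n: "fcard a n" using full unfolding full_def by blast
  obtain f where f: "enm f n a R" using enm_ex[OF R lin n] by blast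
  have "\<exists>g. enm g n b R'"
  proof (rule enm_map[of f n a R \<phi> R' b])
    show "\<And>x x' y y'. mem x a \<Longrightarrow> mem x' a \<Longrightarrow> \<phi> x y \<Longrightarrow> \<phi> x' y' \<Longrightarrow> R x x' \<Longrightarrow> R' y y'"
      by (rule \<phi>(3))
  qed (use f \<phi> in blast)+
  then obtain g where g: "enm g n b R'" by blast
  have "fcard b n" by (rule enm_fcard[OF g lin'])
  then show ?thesis using fullD[OF R full n] unfolding full_def by blast
qed

context
  fixes R R' :: "'a \<Rightarrow> 'a \<Rightarrow> bool" and X X' :: "'a \<Rightarrow> bool" and f :: 'a
  assumes R: "ar2 R" and X: "A0 (\<lambda>v. X (v 0))" and lin: "linon R X"
    and R': "ar2 R'" and X': "A0 (\<lambda>v. X' (v 0))" and lin': "linon R' X'"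
    and emb: "emb f X R X' R'"
begin

lemma emb_ex1: "X j \<Longrightarrow> \<exists>!k. mem (pr j k) f"
  using emb unfolding emb_def by blast

lemma emb_mono: "X j \<Longrightarrow> X j' \<Longrightarrow> mem (pr j k) f \<Longrightarrow> mem (pr j' k') f \<Longrightarrow> R j j' \<Longrightarrow> R' k k'"
  using emb unfolding emb_def by blast

lemma emb_to: "X j \<Longrightarrow> mem (pr j k) f \<Longrightarrow> X' k"
  using emb unfolding emb_def by blast

lemma emb_inj: assumes "X i" "X j" "mem (pr i k) f" "mem (pr j k) f" shows "i = j"
  using assms linonD(3)[OF lin assms(1,2)] emb_mono[of i j k k] emb_mono[of j i k k]
    linonD(1)[OF lin' emb_to[OF assms(1,3)]] by blast

text \<open>Well-formedness of the image and monotonicity are proved together: the image of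
  \<open>a\<close> must keep the cardinality of \<open>a\<close>, which follows from monotonicity on
  the arguments.\<close>

lemma Ac_mono_aux:
  assumes IH: "\<And>s s' t t'. over X s \<Longrightarrow> s \<lhd> N \<Longrightarrow> over X s' \<Longrightarrow> s' \<lhd> N \<Longrightarrow> Ac f s t \<Longrightarrow> Ac f s' t' \<Longrightarrow>
      over X' t \<and> (Bel R s s' \<longrightarrow> Bel R' t t')"
    and s: "over X s" "s \<unlhd> N" and s': "over X s'" "s' \<unlhd> N" and t: "Ac f s t" and t': "Ac f s' t'"
  shows "over X' t \<and> (Bel R s s' \<longrightarrow> Bel R' t t')"
proof -
  note B = Bel_to_mt Bel_mt_xt Bel_xt_xt Bel_mt_mt
  note BR = Bel_ar2[OF R] Bel_ar2[OF R']
  have linB: "linon (Bel R) (over X)" by (rule Bel_linon[OF R X lin])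
  have linB': "linon (Bel R') (over X')" by (rule Bel_linon[OF R' X' lin'])
  have small: "over X q" "q \<lhd> N" if "over X (xt a u)" "xt a u \<unlhd> N" "mem q a" for q a u
    using over_mem[OF that(1,3)] M.less_le_trans[OF mem_lt_xt[OF that(3)] that(2)] by auto
  have phi: "ar2 (Ac f)" unfolding ar2_def by (intro ar_rules)
  have overt: "over X' t" if s: "over X s" "s \<unlhd> N" and t: "Ac f s t" for s t
    using s(1)
  proof (cases rule: over_cases)
    case (1 m)
    then show ?thesis using t emb_to by auto
  next
    case (2 a u)
    obtain b where b: "t = xt b u" "fset b" "\<And>y. mem y b \<Longrightarrow> \<exists>x. mem x a \<and> Ac f x y"
      "\<And>x. mem x a \<Longrightarrow> \<exists>y. mem y b \<and> Ac f x y" using t unfolding 2(1) Ac_xt by blast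
    have sm: "over X q \<and> q \<lhd> N" if "mem q a" for q using small s 2(1) that by blast
    have Ac1: "\<exists>!y. Ac f q y" if "mem q a" for q using Ac_ex1[OF emb_ex1 _ X] sm[OF that] by blast
    have bm: "mem y b \<longleftrightarrow> (\<exists>x. mem x a \<and> Ac f x y)" for y using b(3,4) Ac1 by metis
    have ob: "over X' y" if "mem y b" for y using bm that IH sm by blast
    have full: "full T b u"
    proof (rule full_map[OF 2(4) BR(1) _ _ phi Ac1 _ bm])
      show "linon (Bel R) (\<lambda>x. mem x a)" by (rule linon_mono[OF linB 2(5)])
      show "linon (Bel R') (\<lambda>x. mem x b)" by (rule linon_mono[OF linB' ob])
    qed (use IH sm in blast)+
    \<comment> \<open>The excluded terms do not arise: if the image of \<open>a\<close> is a single
      \<open>\<mu>\<close>-term, then so is \<open>a\<close>, because only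
      \<open>\<mu>\<close>-terms are renamed to such terms and \<open>f\<close> is injective on
      \<open>X\<close>.\<close>
    have "\<not> ((\<exists>m. \<forall>y. mem y b \<longleftrightarrow> y = mt m) \<and> Mu T \<one> \<zero> u)"
    proof
      assume *: "(\<exists>m. \<forall>y. mem y b \<longleftrightarrow> y = mt m) \<and> Mu T \<one> \<zero> u"
      then obtain m where m: "\<And>y. mem y b \<longleftrightarrow> y = mt m" by blast
      then obtain x where x: "mem x a" "Ac f x (mt m)" using bm by blast
      then obtain j where j: "x = mt j" "mem (pr j m) f" unfolding Ac_to_mt by blast
      have "y = mt j" if y: "mem y a" for y
      proof -
        have "Ac f y (mt m)" using b(4)[OF y] by (simp add: m)
        then obtain i where i: "y = mt i" "mem (pr i m) f" unfolding Ac_to_mt by blast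
        then show ?thesis using emb_inj[of i j m] j x(1) y 2(5) by force
      qed
      then have "\<forall>y. mem y a \<longleftrightarrow> y = mt j" using x(1) j(1) by blast
      then show False using 2(2) * unfolding Wf_xt by blast
    qed
    then show ?thesis unfolding b(1) over_xt Wf_xt using b(2) full ob over_Wf by blast
  qed
  have SpR: "\<exists>k. Sp t k \<and> mem (pr j k) f" if "over X s" "Ac f s t" "Sp s j" for s t j
    using Ac_Sp(2)[OF over_Wf] that by blast
  have "Bel R' t t'" if less: "Bel R s s'"
    using s'(1)
  proof (cases rule: over_cases)
    case (1 m)
    then obtain k where k: "t' = mt k" "mem (pr m k) f" using t' by auto
    have "R' i k" if i: "Sp t i" for i
    proof -
      obtain j where j: "Sp s j" "mem (pr j i) f" using Ac_Sp(1)[OF over_Wf[OF s(1)] t i] by blast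
      then have "R j m" using less unfolding 1(1) B(1)[OF R] by blast
      then show ?thesis using emb_mono[of j m i k] j k(2) 1(2) over_Sp[OF R X lin s(1)] by blast
    qed
    then show ?thesis unfolding k(1) B(1)[OF R'] using overt[OF s t] over_Wf by blast
  next
    case s2: (2 b v)
    obtain b' where b': "t' = xt b' v" "fset b'" "\<And>y. mem y b' \<Longrightarrow> \<exists>x. mem x b \<and> Ac f x y"
      "\<And>x. mem x b \<Longrightarrow> \<exists>y. mem y b' \<and> Ac f x y" using t' unfolding s2(1) Ac_xt by blast
    have ot': "over X' t'" by (rule overt[OF s' t'])
    show ?thesis using s(1)
    proof (cases rule: over_cases)
      case (1 m)
      then obtain k where k: "t = mt k" "mem (pr m k) f" using t by auto
      obtain j where j: "Sp s' j" "R m j \<or> m = j" using less unfolding 1(1) s2(1) B(2)[OF R] by blast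
      obtain i where i: "Sp t' i" "mem (pr j i) f" using SpR[OF s'(1) t' j(1)] by blast
      have Xj: "X j" by (rule over_Sp[OF R X lin s'(1) j(1)])
      have "R' k i \<or> k = i"
        using j(2) emb_mono[OF 1(2) Xj k(2) i(2)] emb_ex1[OF 1(2)] k(2) i(2) by blast
      then show ?thesis unfolding k(1) b'(1) B(2)[OF R'] using i(1) over_Wf[OF ot'] b'(1) by blast
    next
      case (2 a u)
      obtain a' where a': "t = xt a' u" "fset a'" "\<And>y. mem y a' \<Longrightarrow> \<exists>x. mem x a \<and> Ac f x y"
        "\<And>x. mem x a \<Longrightarrow> \<exists>y. mem y a' \<and> Ac f x y" using t unfolding 2(1) Ac_xt by blast
      have ot: "over X' t" by (rule overt[OF s t])
      have sm: "over X q \<and> q \<lhd> N" if "mem q a \<or> mem q b" for q using small s s' 2(1) s2(1) that by blast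
      have Ac1: "\<exists>!y. Ac f q y" if "mem q a \<or> mem q b" for q
        using Ac_ex1[OF emb_ex1 _ X] sm[OF that] by blast
      have am: "mem y a' \<longleftrightarrow> (\<exists>x. mem x a \<and> Ac f x y)" for y using a'(3,4) Ac1 by metis
      have bm: "mem y b' \<longleftrightarrow> (\<exists>x. mem x b \<and> Ac f x y)" for y using b'(3,4) Ac1 by metis
      have "pless T (Bel R') a' u b' v"
      proof (rule pless_map[OF BR(1) phi _ Ac1 _ am bm])
        show "pless T (Bel R) a u b v" using less unfolding 2(1) s2(1) B(3)[OF R] by blast
      qed (use IH sm in blast)+
      moreover have "linon (Bel R') (\<lambda>x. mem x a' \<or> mem x b')"
        by (rule linon_mono[OF linB']) (use ot ot' over_mem a'(1) b'(1) in blast)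
      ultimately show ?thesis
        unfolding a'(1) b'(1) B(3)[OF R'] using over_Wf ot ot' a'(1) b'(1) by blast
    qed
  qed
  then show ?thesis using overt[OF s t] by blast
qed

lemma Ac_over_mono:
  assumes s: "over X s" "over X s'" "Ac f s t" "Ac f s' t'"
  shows "over X' t" "Bel R s s' \<Longrightarrow> Bel R' t t'"
proof -
  have "\<forall>s s' t t'. over X s \<longrightarrow> s \<lhd> N \<longrightarrow> over X s' \<longrightarrow> s' \<lhd> N \<longrightarrow> Ac f s t \<longrightarrow> Ac f s' t' \<longrightarrow>
      over X' t \<and> (Bel R s s' \<longrightarrow> Bel R' t t')" for N
  proof (rule A0_induct[where P = "\<lambda>N. \<forall>s s' t t'. over X s \<longrightarrow> s \<lhd> N \<longrightarrow> over X s' \<longrightarrow> s' \<lhd> N \<longrightarrow>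
      Ac f s t \<longrightarrow> Ac f s' t' \<longrightarrow> over X' t \<and> (Bel R s s' \<longrightarrow> Bel R' t t')"])
    show "A0 (\<lambda>v. \<forall>s s' t t'. over X s \<longrightarrow> s \<lhd> v 0 \<longrightarrow> over X s' \<longrightarrow> s' \<lhd> v 0 \<longrightarrow>
      Ac f s t \<longrightarrow> Ac f s' t' \<longrightarrow> over X' t \<and> (Bel R s s' \<longrightarrow> Bel R' t t'))"
      by (intro ar_rules A0_over[OF X] A0_over[OF X'] ar2D[OF Bel_ar2[OF R]] ar2D[OF Bel_ar2[OF R']])
    fix N assume IH: "\<forall>s s' t t'. over X s \<longrightarrow> s \<lhd> N \<longrightarrow> over X s' \<longrightarrow> s' \<lhd> N \<longrightarrow>
      Ac f s t \<longrightarrow> Ac f s' t' \<longrightarrow> over X' t \<and> (Bel R s s' \<longrightarrow> Bel R' t t')"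
    show "\<forall>s s' t t'. over X s \<longrightarrow> s \<lhd> N \<oplus> \<one> \<longrightarrow> over X s' \<longrightarrow> s' \<lhd> N \<oplus> \<one> \<longrightarrow>
      Ac f s t \<longrightarrow> Ac f s' t' \<longrightarrow> over X' t \<and> (Bel R s s' \<longrightarrow> Bel R' t t')"
      unfolding lt_suc_iff
      by (intro allI impI; rule Ac_mono_aux) (use IH in blast)+
  qed (simp add: not_lt_zero)
  note N = this[rule_format, of s "s \<oplus> s' \<oplus> \<one>" s' t t']
  have "s \<lhd> s \<oplus> s' \<oplus> \<one>" "s' \<lhd> s \<oplus> s' \<oplus> \<one>" by auto
  then show "over X' t" "Bel R s s' \<Longrightarrow> Bel R' t t'" using N s by blast+
qed

lemma Ac_inj: assumes "over X s" "over X s'" "Ac f s t" "Ac f s' t" shows "s = s'"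
  using linonD(3)[OF Bel_linon[OF R X lin] assms(1,2)] Ac_over_mono(2)[OF assms]
    Ac_over_mono(2)[OF assms(2,1,4,3)] linonD(1)[OF Bel_linon[OF R' X' lin'] Ac_over_mono(1)[OF assms]] by blast

lemma Ac_reflect: "over X s \<Longrightarrow> over X s' \<Longrightarrow> Ac f s t \<Longrightarrow> Ac f s' t' \<Longrightarrow> Bel R' t t' \<Longrightarrow> Bel R s s'"
  using linonD(3)[OF Bel_linon[OF R X lin], of s s'] Ac_over_mono[of s s' t t'] Ac_over_mono[of s' s t' t]
    linonD(1,4)[OF Bel_linon[OF R' X' lin']] Ac_ex1[OF emb_ex1 _ X, of s] by metis

text \<open>Behind the support condition for prae-dilators. The preimage of the arguments exists as
  a finite set because \<open>Ac_inj\<close> makes the inverse \<open>\<psi>\<close> of the renaming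
  functional.\<close>

lemma Ac_preimage:
  assumes t: "over X' t" and range: "\<And>k. Sp t k \<Longrightarrow> \<exists>j. X j \<and> mem (pr j k) f"
  shows "\<exists>s. over X s \<and> Ac f s t"
proof -
  have "over X' t \<longrightarrow> (\<forall>k. Sp t k \<longrightarrow> (\<exists>j. X j \<and> mem (pr j k) f)) \<longrightarrow> (\<exists>s. over X s \<and> Ac f s t)"
  proof (rule term_induct[OF _ _ _ over_Wf[OF t], where P = "\<lambda>t. over X' t \<longrightarrow>
      (\<forall>k. Sp t k \<longrightarrow> (\<exists>j. X j \<and> mem (pr j k) f)) \<longrightarrow> (\<exists>s. over X s \<and> Ac f s t)"])
    show "A0 (\<lambda>v. over X' (v 0) \<longrightarrow> (\<forall>k. Sp (v 0) k \<longrightarrow> (\<exists>j. X j \<and> mem (pr j k) f)) \<longrightarrow>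
      (\<exists>s. over X s \<and> Ac f s (v 0)))"
      by (intro ar_rules A0_over[OF X] A0_over[OF X'] A0_rel1[OF X])
    show "over X' (mt m) \<longrightarrow> (\<forall>k. Sp (mt m) k \<longrightarrow> (\<exists>j. X j \<and> mem (pr j k) f)) \<longrightarrow>
      (\<exists>s. over X s \<and> Ac f s (mt m))" for m
      unfolding Ac_to_mt by (metis Sp_simps(1) over_mt)
    fix b u assume b: "Wf (xt b u)" and IH: "\<And>t. mem t b \<Longrightarrow> Wf t \<Longrightarrow> over X' t \<longrightarrow>
      (\<forall>k. Sp t k \<longrightarrow> (\<exists>j. X j \<and> mem (pr j k) f)) \<longrightarrow> (\<exists>s. over X s \<and> Ac f s t)"
    show "over X' (xt b u) \<longrightarrow> (\<forall>k. Sp (xt b u) k \<longrightarrow> (\<exists>j. X j \<and> mem (pr j k) f)) \<longrightarrow>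
      (\<exists>s. over X s \<and> Ac f s (xt b u))"
    proof (intro impI)
      assume ob: "over X' (xt b u)" and r: "\<forall>k. Sp (xt b u) k \<longrightarrow> (\<exists>j. X j \<and> mem (pr j k) f)"
      define \<psi> where "\<psi> y x \<longleftrightarrow> over X x \<and> Ac f x y" for y x
      have psi: "ar2 \<psi>" unfolding \<psi>_def ar2_def by (intro ar_rules A0_over[OF X])
      have ex1: "\<exists>!x. \<psi> y x" if y: "mem y b" for y
      proof -
        have "\<exists>s. over X s \<and> Ac f s y"
          using IH[OF y] b ob r y unfolding Wf_xt over_xt Sp_simps by blast
        then show ?thesis unfolding \<psi>_def using Ac_inj by blast
      qed
      obtain a where a: "fset a" "\<And>x. mem x a \<longleftrightarrow> (\<exists>y. mem y b \<and> \<psi> y x)"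
      proof (rule ex_image[of \<psi> b])
        show "A0 (\<lambda>v. \<psi> (v 0) (v (Suc 0)))" using psi unfolding ar2_def .
      qed (use ex1 in blast)+
      have oy: "over X' y" if "mem y b" for y using ob that over_mem by blast
      have ox: "over X x" if "mem x a" for x using a(2) that unfolding \<psi>_def by blast
      have Ac: "Ac f (xt a u) (xt b u)"
        unfolding Ac_xt
      proof (rule exI[of _ b], intro conjI allI impI)
        show "fset b" using b unfolding Wf_xt by blast
        show "\<exists>x. mem x a \<and> Ac f x y" if y: "mem y b" for y
        proof -
          obtain x where "\<psi> y x" using ex1[OF y] by blast
          then show ?thesis using a(2) y unfolding \<psi>_def by blast
        qed
        show "\<exists>y. mem y b \<and> Ac f x y" if "mem x a" for x
          using that a(2) unfolding \<psi>_def by blast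
      qed rule
      have "full T a u"
      proof (rule full_map[OF _ Bel_ar2[OF R'] _ _ psi ex1 _ a(2)])
        show "full T b u" using b unfolding Wf_xt by blast
        show "linon (Bel R') (\<lambda>x. mem x b)" by (rule linon_mono[OF Bel_linon[OF R' X' lin'] oy])
        show "linon (Bel R) (\<lambda>x. mem x a)" by (rule linon_mono[OF Bel_linon[OF R X lin] ox])
      qed (auto simp: \<psi>_def intro: Ac_reflect)
      moreover have "\<not> ((\<exists>m. \<forall>t. mem t a \<longleftrightarrow> t = mt m) \<and> Mu T \<one> \<zero> u)"
      proof
        assume *: "(\<exists>m. \<forall>t. mem t a \<longleftrightarrow> t = mt m) \<and> Mu T \<one> \<zero> u"
        then obtain m where m: "\<And>x. mem x a \<longleftrightarrow> x = mt m" by blast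
        then obtain y where y: "mem y b" "\<psi> y (mt m)" using a(2) by blast
        then obtain k where k: "y = mt k" "mem (pr m k) f" unfolding \<psi>_def by auto
        have "z = y" if z: "mem z b" for z
        proof -
          obtain x where x: "\<psi> z x" using ex1[OF z] by blast
          then have "mem x a" using a(2) z by blast
          then have "x = mt m" by (simp add: m)
          then have "Ac f (mt m) z" using x unfolding \<psi>_def by simp
          moreover have "over X (mt m)" by (rule ox) (simp add: m)
          then have "\<exists>!z. Ac f (mt m) z" by (intro Ac_ex1[OF emb_ex1 _ X])
          ultimately show ?thesis using y(2) unfolding \<psi>_def by blast
        qed
        then have "\<forall>z. mem z b \<longleftrightarrow> z = mt k" using y(1) k(1) by blast
        then show False using b * unfolding Wf_xt by blast
      qed
      ultimately have "over X (xt a u)"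
        unfolding over_xt Wf_xt using a(1) ox over_Wf by blast
      then show "\<exists>s. over X s \<and> Ac f s (xt b u)" using Ac by blast
    qed
  qed
  then show ?thesis using t range by blast
qed

end

end

section \<open>The derivative\<close>

lemma (in model) lin_linon: "lin P (\<lambda>x y. P x \<and> P y \<and> R x y) \<longleftrightarrow> linon R P"
  unfolding lin_def linon_def by (rule iffI; elim conjE; intro conjI allI impI) metis+

context normal_model
begin

section \<open>The orders at natural numbers\<close>

lemma ar2_lt: "ar2 (\<lhd>)"
  unfolding ar2_def by (intro ar_rules)

lemma A0_below: "A0 (\<lambda>v. v 0 \<lhd> n)"
  by (intro ar_rules)

text \<open>The field of \<open>\<partial>T\<^sub>n\<close>, as the terms of the general system with
  indices below \<open>n\<close>; \<open>BE n\<close> is its order.\<close>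

definition E :: "'a \<Rightarrow> 'a \<Rightarrow> bool" where
  "E n s \<longleftrightarrow> over (\<lambda>j. j \<lhd> n) s"

definition BE :: "'a \<Rightarrow> 'a \<Rightarrow> 'a \<Rightarrow> bool" where
  "BE n s t \<longleftrightarrow> E n s \<and> E n t \<and> Bel (\<lhd>) s t"

lemma A0_E [ar_rules]: "af f \<Longrightarrow> af g \<Longrightarrow> A0 (\<lambda>v. E (f v) (g v))"
  by (erule (1) A0_rel2[rotated]) (unfold E_def over_def, intro ar_rules)

lemma ar2_BE: "ar2 (BE n)"
  unfolding BE_def ar2_def by (intro ar_rules ar2D[OF Bel_ar2[OF ar2_lt]])

lemma A0_BE [ar_rules]: "A0 (\<lambda>v. BE (v i) (v j) (v k))"
  unfolding BE_def by (intro ar_rules ar2D[OF Bel_ar2[OF ar2_lt]])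

lemma E_mt [simp]: "E n (mt m) \<longleftrightarrow> m \<lhd> n"
  by (simp add: E_def)

lemma E_xt: "E n (xt a r) \<longleftrightarrow> fset a \<and> (\<forall>t. mem t a \<longrightarrow> E n t) \<and> full T a r \<and>
    \<not> ((\<exists>m. m \<lhd> n \<and> (\<forall>t. mem t a \<longleftrightarrow> t = mt m)) \<and> Mu T \<one> \<zero> r)"
proof -
  have "m \<lhd> n" if "\<forall>t. mem t a \<longrightarrow> E n t" "\<forall>t. mem t a \<longleftrightarrow> t = mt m" for m
    using that by auto
  moreover have "Wf t" if "E n t" for t using that over_Wf unfolding E_def by blast
  ultimately show ?thesis unfolding E_def over_xt Wf_xt by blast
qed

lemma E_cases: assumes "E n s" obtains m where "s = mt m" "m \<lhd> n" | a u where "s = xt a u"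
  using assms over_cases[of "\<lambda>j. j \<lhd> n" s] unfolding E_def by metis

lemma E_Wf: "E n s \<Longrightarrow> Wf s"
  unfolding E_def by (rule over_Wf)

lemma E_Sp: "E n s \<Longrightarrow> Sp s j \<Longrightarrow> j \<lhd> n"
  unfolding E_def over_def by blast

lemma E_mem: "E n (xt a u) \<Longrightarrow> mem t a \<Longrightarrow> E n t"
  unfolding E_xt by blast

lemma Bel_linon_E: "linon (Bel (\<lhd>)) (E n)"
  using Bel_linon[OF ar2_lt A0_below linon_lt] unfolding E_def .

lemma BE_linon: "linon (BE n) (E n)"
  by (rule linon_cong[OF Bel_linon_E]) (simp add: BE_def)

lemma E_eq: "E n s \<longleftrightarrow> (\<exists>m. m \<lhd> n \<and> s = mt m) \<or>
     (\<exists>a r. s = xt a r \<and> fset a \<and> (\<forall>t. mem t a \<longrightarrow> E n t) \<and> full T a r \<and>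
        \<not> ((\<exists>m. m \<lhd> n \<and> (\<forall>t. mem t a \<longleftrightarrow> t = mt m)) \<and> Mu T \<one> \<zero> r))"
proof
  assume s: "E n s"
  then show "(\<exists>m. m \<lhd> n \<and> s = mt m) \<or>
     (\<exists>a r. s = xt a r \<and> fset a \<and> (\<forall>t. mem t a \<longrightarrow> E n t) \<and> full T a r \<and>
        \<not> ((\<exists>m. m \<lhd> n \<and> (\<forall>t. mem t a \<longleftrightarrow> t = mt m)) \<and> Mu T \<one> \<zero> r))"
  proof (cases rule: E_cases)
    case (2 a u)
    show ?thesis using s unfolding 2 E_xt by blast
  qed blast
next
  assume "(\<exists>m. m \<lhd> n \<and> s = mt m) \<or>
     (\<exists>a r. s = xt a r \<and> fset a \<and> (\<forall>t. mem t a \<longrightarrow> E n t) \<and> full T a r \<and>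
        \<not> ((\<exists>m. m \<lhd> n \<and> (\<forall>t. mem t a \<longleftrightarrow> t = mt m)) \<and> Mu T \<one> \<zero> r))"
  then show "E n s"
  proof (elim disjE exE conjE)
    fix m assume "m \<lhd> n" "s = mt m" then show "E n s" by simp
  next
    fix a r assume s: "s = xt a r" and "fset a" "\<forall>t. mem t a \<longrightarrow> E n t" "full T a r"
      "\<not> ((\<exists>m. m \<lhd> n \<and> (\<forall>t. mem t a \<longleftrightarrow> t = mt m)) \<and> Mu T \<one> \<zero> r)"
    then show "E n s" unfolding s E_xt by blast
  qed
qed

text \<open>The derivative is specified by recursive equations. This lemma and its analogues for
  order, action and support identify every solution in the model with the construction given
  above.\<close>

lemma E_unique:
  assumes P: "A0 (\<lambda>v. P (v 0))"
    and eq: "\<And>s. P s \<longleftrightarrow> (\<exists>m. m \<lhd> n \<and> s = mt m) \<or>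
     (\<exists>a r. s = xt a r \<and> fset a \<and> (\<forall>t. mem t a \<longrightarrow> P t) \<and> full T a r \<and>
        \<not> ((\<exists>m. m \<lhd> n \<and> (\<forall>t. mem t a \<longleftrightarrow> t = mt m)) \<and> Mu T \<one> \<zero> r))"
  shows "P s \<longleftrightarrow> E n s"
proof (rule A0_less_induct[where P = "\<lambda>s. P s \<longleftrightarrow> E n s"])
  show "A0 (\<lambda>v. P (v 0) \<longleftrightarrow> E n (v 0))" by (intro ar_rules P)
  fix s assume IH: "\<And>y. y \<lhd> s \<Longrightarrow> P y \<longleftrightarrow> E n y"
  have "(\<forall>t. mem t a \<longrightarrow> P t) \<longleftrightarrow> (\<forall>t. mem t a \<longrightarrow> E n t)" if "s = xt a r" for a r
    using IH mem_lt_xt that by blast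
  then show "P s \<longleftrightarrow> E n s" unfolding eq[of s] E_eq[of n s]
    by (intro disj_cong refl iff_exI conj_cong) auto
qed

section \<open>Order, action and support as unique solutions\<close>

text \<open>The operator whose fixed point is the order, isolated so that existence and uniqueness
  of the fixed point can be treated separately.\<close>

definition below_rhs :: "'a \<Rightarrow> ('a \<Rightarrow> 'a \<Rightarrow> bool) \<Rightarrow> 'a \<Rightarrow> 'a \<Rightarrow> bool" where
  "below_rhs n P s t \<longleftrightarrow> E n s \<and> E n t \<and>
     ((\<exists>m k. s = mt m \<and> t = mt k \<and> m \<lhd> k) \<or>
      (\<exists>m b u. s = mt m \<and> t = xt b u \<and> (\<exists>r. mem r b \<and> (P s r \<or> s = r))) \<or>
      (\<exists>a u k. s = xt a u \<and> t = mt k \<and> (\<forall>r. mem r a \<longrightarrow> P r t)) \<or>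
      (\<exists>a u b v. s = xt a u \<and> t = xt b v \<and>
         lin (\<lambda>x. mem x a \<or> mem x b)
           (\<lambda>x y. (mem x a \<or> mem x b) \<and> (mem y a \<or> mem y b) \<and> P x y) \<and>
         pless T P a u b v))"

lemma below_rhs_simps:
  "below_rhs n P (mt m) (mt k) \<longleftrightarrow> m \<lhd> n \<and> k \<lhd> n \<and> m \<lhd> k"
  "below_rhs n P (mt m) (xt b u) \<longleftrightarrow> m \<lhd> n \<and> E n (xt b u) \<and> (\<exists>r. mem r b \<and> (P (mt m) r \<or> mt m = r))"
  "below_rhs n P (xt a u) (mt k) \<longleftrightarrow> E n (xt a u) \<and> k \<lhd> n \<and> (\<forall>r. mem r a \<longrightarrow> P r (mt k))"
  "below_rhs n P (xt a u) (xt b v) \<longleftrightarrow> E n (xt a u) \<and> E n (xt b v) \<and>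
     linon P (\<lambda>x. mem x a \<or> mem x b) \<and> pless T P a u b v"
  unfolding below_rhs_def by (simp_all add: lin_linon)

lemma pless_BE:
  assumes "E n (xt a u)" "E n (xt b v)"
  shows "pless T (BE n) a u b v \<longleftrightarrow> pless T (Bel (\<lhd>)) a u b v"
proof
  have mem: "E n x" if "mem x a \<or> mem x b" for x using that assms E_mem by blast
  show "pless T (Bel (\<lhd>)) a u b v" if "pless T (BE n) a u b v"
    by (rule pless_cong[OF ar2_BE _ that]) (simp add: BE_def)
  show "pless T (BE n) a u b v" if "pless T (Bel (\<lhd>)) a u b v"
    by (rule pless_cong[OF Bel_ar2[OF ar2_lt] _ that]) (simp add: BE_def mem)
qed

lemma BE_xt_xt: "BE n (xt a u) (xt b v) \<longleftrightarrow> E n (xt a u) \<and> E n (xt b v) \<and>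
     linon (BE n) (\<lambda>x. mem x a \<or> mem x b) \<and> pless T (BE n) a u b v"
proof (cases "E n (xt a u) \<and> E n (xt b v)")
  case True
  then have mem: "E n x" if "mem x a \<or> mem x b" for x using that E_mem by blast
  have "linon (BE n) (\<lambda>x. mem x a \<or> mem x b)" "linon (Bel (\<lhd>)) (\<lambda>x. mem x a \<or> mem x b)"
    by (rule linon_mono[OF BE_linon mem], assumption, rule linon_mono[OF Bel_linon_E mem])
  then show ?thesis unfolding BE_def[of n "xt a u" "xt b v"] Bel_xt_xt[OF ar2_lt]
    using True pless_BE[of n a u b v] E_Wf by blast
qed (unfold BE_def[of n "xt a u" "xt b v"], blast)

lemma BE_from_mt:
  assumes "E n t" "m \<lhd> n" shows "BE n (mt m) t \<or> mt m = t \<longleftrightarrow> (\<exists>k. Sp t k \<and> (m \<lhd> k \<or> m = k))"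
  unfolding BE_def Bel_from_mt[OF ar2_lt E_Wf[OF assms(1)] lt_irrefl] using assms by auto

lemma BE_to_mt: "BE n s (mt k) \<longleftrightarrow> E n s \<and> k \<lhd> n \<and> (\<forall>j. Sp s j \<longrightarrow> j \<lhd> k)"
  unfolding BE_def Bel_to_mt[OF ar2_lt] using E_Wf by auto

text \<open>Undoes the replacement of recursive clauses by conditions on supports: the support of
  \<open>xt b u\<close> is the union of the supports of the elements of \<open>b\<close>.\<close>

lemma BE_eq: "BE n s t \<longleftrightarrow> below_rhs n (BE n) s t"
proof (cases "E n s \<and> E n t")
  case True
  then have s: "E n s" and t: "E n t" by auto
  show ?thesis using s
  proof (cases rule: E_cases)
    case m: (1 m)
    show ?thesis using t
    proof (cases rule: E_cases)
      case (1 k)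
      then show ?thesis unfolding m(1) 1(1) below_rhs_simps BE_to_mt using m by simp
    next
      case (2 b u)
      have "BE n (mt m) (xt b u) \<longleftrightarrow> (\<exists>k. Sp (xt b u) k \<and> (m \<lhd> k \<or> m = k))"
        using BE_from_mt[OF t m(2)] unfolding 2 by simp
      also have "\<dots> \<longleftrightarrow> (\<exists>r. mem r b \<and> (\<exists>k. Sp r k \<and> (m \<lhd> k \<or> m = k)))" by auto
      also have "\<dots> \<longleftrightarrow> (\<exists>r. mem r b \<and> (BE n (mt m) r \<or> mt m = r))"
        using BE_from_mt[OF _ m(2)] E_mem t[unfolded 2] by blast
      finally show ?thesis unfolding m(1) 2 below_rhs_simps using m(2) t[unfolded 2] by blast
    qed
  next
    case a: (2 a u)
    show ?thesis using t
    proof (cases rule: E_cases)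
      case (1 k)
      show ?thesis unfolding a 1(1) below_rhs_simps BE_to_mt using s[unfolded a] E_mem 1(2) by auto
    next
      case (2 b v)
      show ?thesis unfolding a 2 below_rhs_simps by (rule BE_xt_xt)
    qed
  qed
qed (auto simp: BE_def below_rhs_def)

text \<open>A recursive call in a clause that compares \<open>mt m\<close> with a
  \<open>\<xi>\<close>-term keeps \<open>mt m\<close>, so the larger code need not decrease. Hence
  these clauses are settled beforehand, by induction on the other term, in favour of conditions on
  supports.\<close>

lemma BE_unique:
  assumes P: "ar2 P" and eq: "\<And>s t. P s t \<longleftrightarrow> below_rhs n P s t"
  shows "P s t \<longleftrightarrow> BE n s t"
proof -
  have PE: "E n s \<and> E n t" if "P s t" for s t using that unfolding eq[of s t] below_rhs_def by blast
  have from_mt: "E n t \<longrightarrow> (P (mt m) t \<or> mt m = t \<longleftrightarrow> (\<exists>k. Sp t k \<and> (m \<lhd> k \<or> m = k)))"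
    if m: "m \<lhd> n" and "Wf t" for m t
  proof (rule term_induct[OF _ _ _ \<open>Wf t\<close>, where
      P = "\<lambda>t. E n t \<longrightarrow> (P (mt m) t \<or> mt m = t \<longleftrightarrow> (\<exists>k. Sp t k \<and> (m \<lhd> k \<or> m = k)))"])
    show "A0 (\<lambda>v. E n (v 0) \<longrightarrow> (P (mt m) (v 0) \<or> mt m = v 0 \<longleftrightarrow> (\<exists>k. Sp (v 0) k \<and> (m \<lhd> k \<or> m = k))))"
      by (intro ar_rules ar2D[OF P])
    show "E n (mt k) \<longrightarrow> (P (mt m) (mt k) \<or> mt m = mt k \<longleftrightarrow> (\<exists>i. Sp (mt k) i \<and> (m \<lhd> i \<or> m = i)))" for k
      unfolding eq[of "mt m" "mt k"] below_rhs_simps using m by auto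
    fix b u assume "Wf (xt b u)" and IH: "\<And>t. mem t b \<Longrightarrow> Wf t \<Longrightarrow>
      E n t \<longrightarrow> (P (mt m) t \<or> mt m = t \<longleftrightarrow> (\<exists>k. Sp t k \<and> (m \<lhd> k \<or> m = k)))"
    show "E n (xt b u) \<longrightarrow> (P (mt m) (xt b u) \<or> mt m = xt b u \<longleftrightarrow> (\<exists>k. Sp (xt b u) k \<and> (m \<lhd> k \<or> m = k)))"
    proof
      assume b: "E n (xt b u)"
      have "P (mt m) (xt b u) \<longleftrightarrow> (\<exists>r. mem r b \<and> (P (mt m) r \<or> mt m = r))"
        unfolding eq[of "mt m" "xt b u"] below_rhs_simps using m b by blast
      also have "\<dots> \<longleftrightarrow> (\<exists>r. mem r b \<and> (\<exists>k. Sp r k \<and> (m \<lhd> k \<or> m = k)))"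
        using IH E_mem[OF b] E_Wf by blast
      finally show "P (mt m) (xt b u) \<or> mt m = xt b u \<longleftrightarrow> (\<exists>k. Sp (xt b u) k \<and> (m \<lhd> k \<or> m = k))" by auto
    qed
  qed
  have to_mt: "E n t \<longrightarrow> (P t (mt k) \<longleftrightarrow> (\<forall>j. Sp t j \<longrightarrow> j \<lhd> k))"
    if k: "k \<lhd> n" and "Wf t" for k t
  proof (rule term_induct[OF _ _ _ \<open>Wf t\<close>, where
      P = "\<lambda>t. E n t \<longrightarrow> (P t (mt k) \<longleftrightarrow> (\<forall>j. Sp t j \<longrightarrow> j \<lhd> k))"])
    show "A0 (\<lambda>v. E n (v 0) \<longrightarrow> (P (v 0) (mt k) \<longleftrightarrow> (\<forall>j. Sp (v 0) j \<longrightarrow> j \<lhd> k)))"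
      by (intro ar_rules ar2D[OF P])
    show "E n (mt m) \<longrightarrow> (P (mt m) (mt k) \<longleftrightarrow> (\<forall>j. Sp (mt m) j \<longrightarrow> j \<lhd> k))" for m
      unfolding eq[of "mt m" "mt k"] below_rhs_simps using k by auto
    fix a u assume "Wf (xt a u)" and IH: "\<And>t. mem t a \<Longrightarrow> Wf t \<Longrightarrow>
      E n t \<longrightarrow> (P t (mt k) \<longleftrightarrow> (\<forall>j. Sp t j \<longrightarrow> j \<lhd> k))"
    show "E n (xt a u) \<longrightarrow> (P (xt a u) (mt k) \<longleftrightarrow> (\<forall>j. Sp (xt a u) j \<longrightarrow> j \<lhd> k))"
    proof
      assume a: "E n (xt a u)"
      have "P (xt a u) (mt k) \<longleftrightarrow> (\<forall>r. mem r a \<longrightarrow> P r (mt k))"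
        unfolding eq[of "xt a u" "mt k"] below_rhs_simps using k a by blast
      also have "\<dots> \<longleftrightarrow> (\<forall>r. mem r a \<longrightarrow> (\<forall>j. Sp r j \<longrightarrow> j \<lhd> k))"
        using IH E_mem[OF a] E_Wf by blast
      finally show "P (xt a u) (mt k) \<longleftrightarrow> (\<forall>j. Sp (xt a u) j \<longrightarrow> j \<lhd> k)" by auto
    qed
  qed
  \<comment> \<open>Induction on a common bound of the codes; it is needed only when both terms are
    \<open>\<xi>\<close>-terms, and then both arguments of a recursive call are smaller.\<close>
  have "\<forall>s t. s \<lhd> N \<longrightarrow> t \<lhd> N \<longrightarrow> (P s t \<longleftrightarrow> BE n s t)" for N
  proof (rule A0_induct[where P = "\<lambda>N. \<forall>s t. s \<lhd> N \<longrightarrow> t \<lhd> N \<longrightarrow> (P s t \<longleftrightarrow> BE n s t)"])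
    show "A0 (\<lambda>v. \<forall>s t. s \<lhd> v 0 \<longrightarrow> t \<lhd> v 0 \<longrightarrow> (P s t \<longleftrightarrow> BE n s t))"
      by (intro ar_rules ar2D[OF P] ar2D[OF ar2_BE])
    fix N assume IH: "\<forall>s t. s \<lhd> N \<longrightarrow> t \<lhd> N \<longrightarrow> (P s t \<longleftrightarrow> BE n s t)"
    show "\<forall>s t. s \<lhd> N \<oplus> \<one> \<longrightarrow> t \<lhd> N \<oplus> \<one> \<longrightarrow> (P s t \<longleftrightarrow> BE n s t)"
      unfolding lt_suc_iff
    proof (intro allI impI)
      fix s t assume sN: "s \<unlhd> N" and tN: "t \<unlhd> N"
      show "P s t \<longleftrightarrow> BE n s t"
      proof (cases "E n s \<and> E n t")
        case True
        then have s: "E n s" and t: "E n t" by auto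
        show ?thesis using s
        proof (cases rule: E_cases)
          case m: (1 m)
          have "\<not> P (mt m) (mt m)" "\<not> BE n (mt m) (mt m)"
            unfolding eq[of "mt m" "mt m"] below_rhs_simps BE_to_mt using lt_irrefl by auto
          then show ?thesis
            unfolding m(1) using from_mt[OF m(2) E_Wf[OF t]] BE_from_mt[OF t m(2)] t by blast
        next
          case a: (2 a u)
          show ?thesis using t
          proof (cases rule: E_cases)
            case (1 k)
            show ?thesis unfolding 1(1) BE_to_mt using to_mt[OF 1(2) E_Wf[OF s]] s 1(2) by blast
          next
            case (2 b v)
            have small: "x \<lhd> N" if "mem x a \<or> mem x b" for x
              using that M.less_le_trans[OF mem_lt_xt] sN tN unfolding a 2 by blast
            have PB: "P x y \<longleftrightarrow> BE n x y" if "mem x a \<or> mem x b" "mem y a \<or> mem y b" for x y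
              using IH small that by blast
            have "linon P (\<lambda>x. mem x a \<or> mem x b) \<longleftrightarrow> linon (BE n) (\<lambda>x. mem x a \<or> mem x b)"
            proof
              show "linon (BE n) (\<lambda>x. mem x a \<or> mem x b)" if "linon P (\<lambda>x. mem x a \<or> mem x b)"
                by (rule linon_cong[OF that]) (rule PB)
              show "linon P (\<lambda>x. mem x a \<or> mem x b)" if "linon (BE n) (\<lambda>x. mem x a \<or> mem x b)"
                by (rule linon_cong[OF that]) (rule PB[symmetric])
            qed
            moreover have "pless T P a u b v \<longleftrightarrow> pless T (BE n) a u b v"
            proof
              show "pless T (BE n) a u b v" if "pless T P a u b v"
                by (rule pless_cong[OF P _ that]) (simp add: PB)
              show "pless T P a u b v" if "pless T (BE n) a u b v"
                by (rule pless_cong[OF ar2_BE _ that]) (simp add: PB)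
            qed
            ultimately show ?thesis unfolding a 2 BE_xt_xt eq[of "xt a u" "xt b v"] below_rhs_simps by blast
          qed
        qed
      next
        case False
        then show ?thesis using PE unfolding BE_def by blast
      qed
    qed
  qed (simp add: not_lt_zero)
  note N = this[rule_format, of s "s \<oplus> t \<oplus> \<one>" t]
  show ?thesis by (rule N) auto
qed

lemma mor_fun: "mor f n l \<Longrightarrow> j \<lhd> n \<Longrightarrow> \<exists>!k. mem (pr j k) f"
  unfolding mor_def ffun_def by blast

lemma mor_emb: "mor f n l \<Longrightarrow> emb f (\<lambda>j. j \<lhd> n) (\<lhd>) (\<lambda>j. j \<lhd> l) (\<lhd>)"
  unfolding emb_def
proof (intro conjI allI impI)
  assume f: "mor f n l"
  show "\<exists>!k. mem (pr j k) f" if "j \<lhd> n" for j by (rule mor_fun[OF f that])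
  show "k \<lhd> l" if "mem (pr j k) f" for j k
    using f ffunD(3)[of f n "\<lambda>x. x \<lhd> l" j k] that unfolding mor_def by blast
  show "k \<lhd> k'" if "mem (pr j k) f" "mem (pr j' k') f" "j \<lhd> j'" for j k j' k'
    using f that unfolding mor_def by blast
qed

lemma Ac_E_mono:
  assumes f: "mor f n l" and s: "E n s" "E n s'" "Ac f s t" "Ac f s' t'"
  shows "E l t" "Bel (\<lhd>) s s' \<Longrightarrow> Bel (\<lhd>) t t'"
  using Ac_over_mono[OF ar2_lt A0_below linon_lt ar2_lt A0_below linon_lt mor_emb[OF f]] s
  unfolding E_def by blast+

lemma Ac_E_preimage:
  assumes "mor f n l" "E l t" "\<And>k. Sp t k \<Longrightarrow> \<exists>j. j \<lhd> n \<and> mem (pr j k) f"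
  shows "\<exists>s. E n s \<and> Ac f s t"
  using Ac_preimage[OF ar2_lt A0_below linon_lt ar2_lt A0_below linon_lt mor_emb[OF assms(1)]] assms(2,3)
  unfolding E_def by blast

lemma Ac_ex1_E: "mor f n l \<Longrightarrow> E n s \<Longrightarrow> \<exists>!t. Ac f s t"
  unfolding E_def by (rule Ac_ex1[OF mor_fun _ A0_below])

definition act_rhs :: "'a \<Rightarrow> 'a \<Rightarrow> 'a \<Rightarrow> ('a \<Rightarrow> 'a \<Rightarrow> bool) \<Rightarrow> 'a \<Rightarrow> 'a \<Rightarrow> bool" where
  "act_rhs n l f P s t \<longleftrightarrow> mor f n l \<and> E n s \<and>
     ((\<exists>m k. s = mt m \<and> mem (pr m k) f \<and> t = mt k) \<or>
      (\<exists>a b u. s = xt a u \<and> t = xt b u \<and> fset b \<and> (\<forall>y. mem y b \<longleftrightarrow> (\<exists>x. mem x a \<and> P x y))))"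

lemma act_rhs_step:
  assumes f: "mor f n l" and s: "E n s"
    and P: "\<And>a u x y. s = xt a u \<Longrightarrow> mem x a \<Longrightarrow> P x y \<longleftrightarrow> Ac f x y"
  shows "act_rhs n l f P s t \<longleftrightarrow> Ac f s t"
  using s
proof (cases rule: E_cases)
  case (1 m)
  then show ?thesis using f unfolding act_rhs_def by simp
next
  case (2 a u)
  have ex1: "\<exists>!y. Ac f x y" if "mem x a" for x
    using Ac_ex1_E[OF f] E_mem[OF s[unfolded 2] that] by blast
  have "act_rhs n l f P s t \<longleftrightarrow>
    (\<exists>b. t = xt b u \<and> fset b \<and> (\<forall>y. mem y b \<longleftrightarrow> (\<exists>x. mem x a \<and> P x y)))"
    unfolding act_rhs_def using f s unfolding 2 by simp
  also have "\<dots> \<longleftrightarrow> (\<exists>b. t = xt b u \<and> fset b \<and> (\<forall>y. mem y b \<longleftrightarrow> (\<exists>x. mem x a \<and> Ac f x y)))"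
    using P[OF 2] by (simp cong: conj_cong)
  also have "\<dots> \<longleftrightarrow> Ac f s t"
  proof -
    \<comment> \<open>The second inclusion of \<open>Ac_xt\<close> is equivalent to the missing
      direction because each element of \<open>a\<close> has exactly one value.\<close>
    have "(\<forall>y. mem y b \<longleftrightarrow> (\<exists>x. mem x a \<and> Ac f x y)) \<longleftrightarrow>
      (\<forall>y. mem y b \<longrightarrow> (\<exists>x. mem x a \<and> Ac f x y)) \<and> (\<forall>x. mem x a \<longrightarrow> (\<exists>y. mem y b \<and> Ac f x y))" for b
      using ex1 by metis
    then show ?thesis unfolding 2 Ac_xt by simp
  qed
  finally show ?thesis .
qed

lemma act_eq:
  "mor f n l \<and> E n s \<and> Ac f s t \<longleftrightarrow> act_rhs n l f (\<lambda>s t. mor f n l \<and> E n s \<and> Ac f s t) s t"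
proof (cases "mor f n l \<and> E n s")
  case True
  then have "act_rhs n l f (\<lambda>s t. mor f n l \<and> E n s \<and> Ac f s t) s t \<longleftrightarrow> Ac f s t"
    by (intro act_rhs_step) (use E_mem in blast)+
  then show ?thesis using True by blast
qed (auto simp: act_rhs_def)

lemma act_unique:
  assumes P: "ar2 P" and eq: "\<And>s t. P s t \<longleftrightarrow> act_rhs n l f P s t"
  shows "P s t \<longleftrightarrow> mor f n l \<and> E n s \<and> Ac f s t"
proof -
  have "\<forall>t. P s t \<longleftrightarrow> mor f n l \<and> E n s \<and> Ac f s t"
  proof (rule A0_less_induct[where P = "\<lambda>s. \<forall>t. P s t \<longleftrightarrow> mor f n l \<and> E n s \<and> Ac f s t"])
    show "A0 (\<lambda>v. \<forall>t. P (v 0) t \<longleftrightarrow> mor f n l \<and> E n (v 0) \<and> Ac f (v 0) t)"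
      by (intro ar_rules ar2D[OF P])
    fix s assume IH: "\<And>y. y \<lhd> s \<Longrightarrow> \<forall>t. P y t \<longleftrightarrow> mor f n l \<and> E n y \<and> Ac f y t"
    show "\<forall>t. P s t \<longleftrightarrow> mor f n l \<and> E n s \<and> Ac f s t"
    proof (cases "mor f n l \<and> E n s")
      case True
      then have "act_rhs n l f P s t \<longleftrightarrow> Ac f s t" for t
        by (intro act_rhs_step) (use IH E_mem mem_lt_xt in blast)+
      then show ?thesis using True eq by blast
    next
      case False
      then show ?thesis using eq[of s] unfolding act_rhs_def by blast
    qed
  qed
  then show ?thesis by blast
qed

definition supp_rhs :: "'a \<Rightarrow> ('a \<Rightarrow> 'a \<Rightarrow> bool) \<Rightarrow> 'a \<Rightarrow> 'a \<Rightarrow> bool" where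
  "supp_rhs n P s c \<longleftrightarrow> E n s \<and> fset c \<and>
     ((\<exists>m. s = mt m \<and> (\<forall>x. mem x c \<longleftrightarrow> x = m)) \<or>
      (\<exists>a u. s = xt a u \<and> (\<forall>x. mem x c \<longleftrightarrow> (\<exists>t b. mem t a \<and> P t b \<and> mem x b))))"

lemma supp_rhs_step:
  assumes s: "E n s"
    and P: "\<And>a u t b. s = xt a u \<Longrightarrow> mem t a \<Longrightarrow> P t b \<longleftrightarrow> E n t \<and> fset b \<and> (\<forall>x. mem x b \<longleftrightarrow> Sp t x)"
  shows "supp_rhs n P s c \<longleftrightarrow> E n s \<and> fset c \<and> (\<forall>x. mem x c \<longleftrightarrow> Sp s x)"
  using s
proof (cases rule: E_cases)
  case (1 m)
  then show ?thesis using s unfolding supp_rhs_def by simp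
next
  case (2 a u)
  have "(\<exists>b. P t b \<and> mem x b) \<longleftrightarrow> Sp t x" if t: "mem t a" for t x
  proof -
    have "E n t" using E_mem s t unfolding 2 by blast
    moreover obtain b where "fset b" "\<And>x. mem x b \<longleftrightarrow> Sp t x"
      using Sp_code[OF E_Wf[OF \<open>E n t\<close>]] by blast
    ultimately show ?thesis unfolding P[OF 2 t] by blast
  qed
  then have "(\<exists>t b. mem t a \<and> P t b \<and> mem x b) \<longleftrightarrow> Sp s x" for x unfolding 2 by auto
  then show ?thesis unfolding supp_rhs_def using s unfolding 2 by simp
qed

lemma supp_eq: "E n s \<and> fset c \<and> (\<forall>x. mem x c \<longleftrightarrow> Sp s x) \<longleftrightarrow>
    supp_rhs n (\<lambda>s c. E n s \<and> fset c \<and> (\<forall>x. mem x c \<longleftrightarrow> Sp s x)) s c"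
proof (cases "E n s")
  case True
  show ?thesis by (rule supp_rhs_step[symmetric, OF True]) simp
qed (auto simp: supp_rhs_def)

lemma supp_unique:
  assumes P: "ar2 P" and eq: "\<And>s c. P s c \<longleftrightarrow> supp_rhs n P s c"
  shows "P s c \<longleftrightarrow> E n s \<and> fset c \<and> (\<forall>x. mem x c \<longleftrightarrow> Sp s x)"
proof -
  have "\<forall>c. P s c \<longleftrightarrow> E n s \<and> fset c \<and> (\<forall>x. mem x c \<longleftrightarrow> Sp s x)"
  proof (rule A0_less_induct[where P = "\<lambda>s. \<forall>c. P s c \<longleftrightarrow> E n s \<and> fset c \<and> (\<forall>x. mem x c \<longleftrightarrow> Sp s x)"])
    show "A0 (\<lambda>v. \<forall>c. P (v 0) c \<longleftrightarrow> E n (v 0) \<and> fset c \<and> (\<forall>x. mem x c \<longleftrightarrow> Sp (v 0) x))"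
      by (intro ar_rules ar2D[OF P])
    fix s assume IH: "\<And>y. y \<lhd> s \<Longrightarrow> \<forall>c. P y c \<longleftrightarrow> E n y \<and> fset c \<and> (\<forall>x. mem x c \<longleftrightarrow> Sp y x)"
    show "\<forall>c. P s c \<longleftrightarrow> E n s \<and> fset c \<and> (\<forall>x. mem x c \<longleftrightarrow> Sp s x)"
    proof (cases "E n s")
      case True
      show ?thesis unfolding eq[of s]
        by (intro allI supp_rhs_step[OF True]) (use IH mem_lt_xt in blast)
    next
      case False
      then show ?thesis using eq[of s] unfolding supp_rhs_def by blast
    qed
  qed
  then show ?thesis by blast
qed

section \<open>Existence of the derivative and its normality\<close>

definition is_deriv :: "'a set \<Rightarrow> bool" where
  "is_deriv D \<longleftrightarrow> (\<forall>n s. Elt D n s \<longleftrightarrow> E n s) \<and> (\<forall>n s t. Below D n s t \<longleftrightarrow> BE n s t) \<and>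
     (\<forall>n l f s t. Act D n l f s t \<longleftrightarrow> mor f n l \<and> E n s \<and> Ac f s t) \<and>
     (\<forall>n s c. Supp D n s c \<longleftrightarrow> E n s \<and> fset c \<and> (\<forall>x. mem x c \<longleftrightarrow> Sp s x)) \<and>
     (\<forall>n m s. Mu D n m s \<longleftrightarrow> m \<lhd> n \<and> s = mt m)"

lemma deriv_is_deriv:
  assumes D: "D \<in> \<S>" and deriv: "deriv T D" shows "is_deriv D"
proof -
  have Elt: "Elt D n s \<longleftrightarrow> E n s" for n s
  proof (rule E_unique)
    show "A0 (\<lambda>v. Elt D n (v 0))" unfolding Elt_def by (intro ar_rules D)
    show "Elt D n s \<longleftrightarrow> (\<exists>m. m \<lhd> n \<and> s = mt m) \<or>
     (\<exists>a r. s = xt a r \<and> fset a \<and> (\<forall>t. mem t a \<longrightarrow> Elt D n t) \<and> full T a r \<and>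
        \<not> ((\<exists>m. m \<lhd> n \<and> (\<forall>t. mem t a \<longleftrightarrow> t = mt m)) \<and> Mu T \<one> \<zero> r))" for s
      using deriv unfolding deriv_def deriv_elt_def by (elim conjE allE)
  qed
  have "Below D n s t \<longleftrightarrow> BE n s t" for n s t
  proof (rule BE_unique)
    show "ar2 (Below D n)" unfolding Below_def ar2_def by (intro ar_rules D)
    have "deriv_below T D" using deriv unfolding deriv_def by blast
    then show "Below D n s t \<longleftrightarrow> below_rhs n (Below D n) s t" for s t
      unfolding deriv_below_def below_rhs_def Elt by (elim allE)
  qed
  moreover have "Act D n l f s t \<longleftrightarrow> mor f n l \<and> E n s \<and> Ac f s t" for n l f s t
  proof (rule act_unique)
    show "ar2 (Act D n l f)" unfolding Act_def ar2_def by (intro ar_rules D)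
    have "deriv_act D" using deriv unfolding deriv_def by blast
    then show "Act D n l f s t \<longleftrightarrow> act_rhs n l f (Act D n l f) s t" for s t
      unfolding deriv_act_def act_rhs_def Elt by (elim allE)
  qed
  moreover have "Supp D n s c \<longleftrightarrow> E n s \<and> fset c \<and> (\<forall>x. mem x c \<longleftrightarrow> Sp s x)" for n s c
  proof (rule supp_unique)
    show "ar2 (Supp D n)" unfolding Supp_def ar2_def by (intro ar_rules D)
    have "deriv_supp D" using deriv unfolding deriv_def by blast
    then show "Supp D n s c \<longleftrightarrow> supp_rhs n (Supp D n) s c" for s c
      unfolding deriv_supp_def supp_rhs_def Elt by (elim allE)
  qed
  moreover have "Mu D n m s \<longleftrightarrow> m \<lhd> n \<and> s = mt m" for n m s
    using deriv unfolding deriv_def by blast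
  ultimately show ?thesis unfolding is_deriv_def using Elt by blast
qed

lemma is_deriv_deriv: "is_deriv D \<Longrightarrow> deriv T D"
proof -
  assume "is_deriv D"
  then have D: "\<And>n s. Elt D n s \<longleftrightarrow> E n s" "\<And>n s t. Below D n s t \<longleftrightarrow> BE n s t"
     "\<And>n l f s t. Act D n l f s t \<longleftrightarrow> mor f n l \<and> E n s \<and> Ac f s t"
     "\<And>n s c. Supp D n s c \<longleftrightarrow> E n s \<and> fset c \<and> (\<forall>x. mem x c \<longleftrightarrow> Sp s x)"
     "\<And>n m s. Mu D n m s \<longleftrightarrow> m \<lhd> n \<and> s = mt m" unfolding is_deriv_def by blast+
  have "deriv_elt T D" unfolding deriv_elt_def D(1) by (intro allI, rule E_eq)
  moreover have "deriv_below T D"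
  proof -
    have "Below D n = BE n" for n by (intro ext, rule D(2))
    note * = this
    show ?thesis unfolding deriv_below_def D(1) * by (intro allI, rule BE_eq[unfolded below_rhs_def])
  qed
  moreover have "deriv_act D"
  proof -
    have "Act D n l f = (\<lambda>s t. mor f n l \<and> E n s \<and> Ac f s t)" for n l f by (intro ext, rule D(3))
    note * = this
    show ?thesis unfolding deriv_act_def D(1) * by (intro allI, rule act_eq[unfolded act_rhs_def])
  qed
  moreover have "deriv_supp D"
  proof -
    have "Supp D n = (\<lambda>s c. E n s \<and> fset c \<and> (\<forall>x. mem x c \<longleftrightarrow> Sp s x))" for n by (intro ext, rule D(4))
    note * = this
    show ?thesis unfolding deriv_supp_def D(1) * by (intro allI, rule supp_eq[unfolded supp_rhs_def])
  qed
  ultimately show ?thesis unfolding deriv_def using D(5) by blast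
qed

lemma tag_simps [simp]:
  "\<one> \<noteq> \<zero>" "\<zero> \<noteq> \<one>" "x \<oplus> \<one> \<noteq> \<zero>" "\<zero> \<noteq> x \<oplus> \<one>" "x \<oplus> \<one> = \<one> \<longleftrightarrow> x = \<zero>" "\<one> = x \<oplus> \<one> \<longleftrightarrow> x = \<zero>"
  "x \<oplus> \<one> = y \<oplus> \<one> \<longleftrightarrow> x = y"
  using suc_nonzero suc_inject[of x \<zero>] suc_inject[of x y] one_neq_zero zero_plus by metis+

text \<open>All components are arithmetical, so one comprehension collects them; the tags keep the
  five sections apart.\<close>

lemma deriv_ex: "\<exists>D\<in>\<S>. deriv T D"
proof -
  define P where "P z \<longleftrightarrow> (\<exists>n s. z = pr \<zero> (pr n s) \<and> E n s) \<or>
    (\<exists>n s t. z = pr \<one> (pr n (pr s t)) \<and> BE n s t) \<or>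
    (\<exists>n l f s t. z = pr (\<one> \<oplus> \<one>) (pr n (pr l (pr f (pr s t)))) \<and> mor f n l \<and> E n s \<and> Ac f s t) \<or>
    (\<exists>n s c. z = pr (\<one> \<oplus> \<one> \<oplus> \<one>) (pr n (pr s c)) \<and> E n s \<and> fset c \<and> (\<forall>x. mem x c \<longleftrightarrow> Sp s x)) \<or>
    (\<exists>n m s. z = pr (\<one> \<oplus> \<one> \<oplus> \<one> \<oplus> \<one>) (pr n (pr m s)) \<and> m \<lhd> n \<and> s = mt m)" for z
  have "{z. P z} \<in> \<S>" unfolding P_def by (rule A0_CA) (intro ar_rules)
  moreover have "is_deriv {z. P z}"
    unfolding is_deriv_def Elt_def Below_def Act_def Supp_def Mu_def mem_Collect_eq P_def by auto
  ultimately show ?thesis using is_deriv_deriv by blast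
qed

lemma is_deriv_nprae:
  assumes "is_deriv D" shows "nprae D"
proof -
  have D: "\<And>n s. Elt D n s \<longleftrightarrow> E n s" "\<And>n s t. Below D n s t \<longleftrightarrow> BE n s t"
     "\<And>n l f s t. Act D n l f s t \<longleftrightarrow> mor f n l \<and> E n s \<and> Ac f s t"
     "\<And>n s c. Supp D n s c \<longleftrightarrow> E n s \<and> fset c \<and> (\<forall>x. mem x c \<longleftrightarrow> Sp s x)"
     "\<And>n m s. Mu D n m s \<longleftrightarrow> m \<lhd> n \<and> s = mt m" using assms unfolding is_deriv_def by blast+
  have Ac_E: "E l t" if "mor f n l" "E n s" "Ac f s t" for f n l s t
    by (rule Ac_E_mono(1)[OF that(1,2,2,3,3)])
  have 1: "lin (Elt D n) (Below D n)" for n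
  proof -
    have "Elt D n = E n" "Below D n = (\<lambda>x y. E n x \<and> E n y \<and> Bel (\<lhd>) x y)"
      using D(1,2) unfolding BE_def by blast+
    then show ?thesis using lin_linon[of "E n" "Bel (\<lhd>)"] Bel_linon_E by simp
  qed
  have 2: "Act D n l f s t \<longrightarrow> mor f n l \<and> Elt D n s \<and> Elt D l t" for n l f s t
    unfolding D using Ac_E by blast
  have 3: "mor f n l \<and> Elt D n s \<longrightarrow> (\<exists>!t. Act D n l f s t)" for n l f s
    unfolding D using Ac_ex1_E[of f n l s] by blast
  have 4: "Act D n l f s s' \<and> Act D n l f t t' \<and> Below D n s t \<longrightarrow> Below D l s' t'" for n l f s t s' t'
    unfolding D BE_def using Ac_E Ac_E_mono(2)[of f n l s t s' t'] by blast
  have 5: "mor f n n \<and> (\<forall>i. i \<lhd> n \<longrightarrow> mem (pr i i) f) \<and> Elt D n s \<longrightarrow> Act D n n f s s" for n f s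
    unfolding D using Ac_id[OF E_Wf] E_Sp by blast
  have 6: "mor h k l \<and> (\<forall>i j m. mem (pr i j) f \<and> mem (pr j m) g \<longrightarrow> mem (pr i m) h) \<and>
        Act D k n f s t \<and> Act D n l g t u \<longrightarrow> Act D k l h s u" for k n l f g h s t u
    unfolding D using Ac_comp[OF E_Wf, of k s f t g u h] by blast
  have 7: "Supp D n s a \<longrightarrow> Elt D n s \<and> fset a \<and> (\<forall>x. mem x a \<longrightarrow> x \<lhd> n)" for n s a
    unfolding D using E_Sp by blast
  have 8: "Elt D n s \<longrightarrow> (\<exists>!a. Supp D n s a)" for n s
  proof
    assume s: "Elt D n s"
    then obtain c where c: "fset c" "\<And>x. mem x c \<longleftrightarrow> Sp s x" using Sp_code E_Wf unfolding D by metis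
    show "\<exists>!a. Supp D n s a"
    proof
      show "Supp D n s c" using s c unfolding D by blast
      show "b = c" if "Supp D n s b" for b using that c fset_eq[of b c] unfolding D by blast
    qed
  qed
  have 9: "Act D n l f s t \<and> Supp D n s a \<and> Supp D l t b \<longrightarrow>
        (\<forall>y. mem y b \<longleftrightarrow> (\<exists>x. mem x a \<and> mem (pr x y) f))" for n l f s t a b
  proof (intro impI allI)
    fix y assume "Act D n l f s t \<and> Supp D n s a \<and> Supp D l t b"
    then have f: "mor f n l" and s: "E n s" "Ac f s t" and a: "\<And>x. mem x a \<longleftrightarrow> Sp s x"
      and b: "\<And>x. mem x b \<longleftrightarrow> Sp t x" unfolding D by blast+
    show "mem y b \<longleftrightarrow> (\<exists>x. mem x a \<and> mem (pr x y) f)"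
      unfolding a b
    proof
      assume "\<exists>x. Sp s x \<and> mem (pr x y) f"
      then obtain x where x: "Sp s x" "mem (pr x y) f" by blast
      then obtain k where "Sp t k" "mem (pr x k) f" using Ac_Sp(2)[OF E_Wf s(2)] s(1) by blast
      moreover have "k = y" using mor_fun[OF f E_Sp[OF s(1) x(1)]] x(2) \<open>mem (pr x k) f\<close> by blast
      ultimately show "Sp t y" by simp
    qed (use Ac_Sp(1)[OF E_Wf s(2)] s(1) in blast)
  qed
  have 10: "Supp D n s a \<longrightarrow> (\<exists>k f r. enm f k a (\<lhd>) \<and> Act D k n f r s)" for n s a
  proof
    assume "Supp D n s a"
    then have s: "E n s" and a: "\<And>x. mem x a \<longleftrightarrow> Sp s x" unfolding D by blast+
    obtain k where "fcard a k" using fcard_ex by blast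
    then obtain f where f: "enm f k a (\<lhd>)" using enm_ex[OF ar2_lt linon_lt] by blast
    note ff = ffunD[OF enmD(1)[OF f]]
    have "ffun f k (\<lambda>x. x \<lhd> n)"
      using enmD(1)[OF f] a E_Sp[OF s] unfolding ffun_def by blast
    then have mor: "mor f k n" unfolding mor_def using enmD(3)[OF f] by blast
    \<comment> \<open>All indices of \<open>s\<close> lie in the range of the enumeration of its
      support, so \<open>s\<close> arises by renaming from a term with indices below
      \<open>k\<close>.\<close>
    have "\<exists>r. E k r \<and> Ac f r s"
      by (rule Ac_E_preimage[OF mor s]) (use enmD(2)[OF f] a ff(2) in blast)
    then obtain r where "E k r" "Ac f r s" by blast
    then show "\<exists>k f r. enm f k a (\<lhd>) \<and> Act D k n f r s" unfolding D using f mor by blast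
  qed
  have prae: "prae D"
    unfolding prae_def by (intro conjI allI) (fact 1 2 3 4 5 6 7 8 9 10)+
  have "Mu D n m u \<and> Supp D n s a \<longrightarrow> (Below D n s u \<longleftrightarrow> (\<forall>x. mem x a \<longrightarrow> x \<lhd> m))" for n m u s a
    unfolding D using BE_to_mt by auto
  moreover have "Mu D n m s \<and> Mu D n m' s' \<and> m \<lhd> m' \<longrightarrow> Below D n s s'" for n m m' s s'
    unfolding D using BE_to_mt by auto
  ultimately show ?thesis unfolding nprae_def using prae unfolding D by auto
qed

end

section \<open>Well-foundedness of the derivative\<close>

context model
begin

section \<open>Accessible elements\<close>

definition acc :: "('a \<Rightarrow> 'a \<Rightarrow> bool) \<Rightarrow> 'a \<Rightarrow> bool" where
  "acc R s \<longleftrightarrow> \<not> (\<exists>F\<in>\<S>. desc R F \<and> pr \<zero> s \<in> F)"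

lemma desc_fun: "desc R F \<Longrightarrow> pr n x \<in> F \<Longrightarrow> pr n y \<in> F \<Longrightarrow> x = y"
  unfolding desc_def by blast

lemma desc_ex: "desc R F \<Longrightarrow> \<exists>x. pr n x \<in> F"
  unfolding desc_def by blast

lemma desc_step: "desc R F \<Longrightarrow> pr n x \<in> F \<Longrightarrow> pr (n \<oplus> \<one>) y \<in> F \<Longrightarrow> R y x"
  unfolding desc_def by blast

text \<open>Bar induction for a statement on accessibility. Its universal set quantifier ranges over
  the possible descending sequences, and an arithmetical relation \<open>G\<close> says which
  elements are treated at \<open>x\<close>.\<close>

lemma acc_bar_induction:
  assumes X: "X \<in> \<S>" "R \<in> \<S>" "wo (\<lambda>x. x \<in> X) (\<lambda>y x. pr y x \<in> R)"
    and B: "ar2 B" and G: "ar2 G"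
    and step: "\<And>x s. x \<in> X \<Longrightarrow> (\<And>y t. pr y x \<in> R \<Longrightarrow> G y t \<Longrightarrow> acc B t) \<Longrightarrow> G x s \<Longrightarrow> acc B s"
    and x: "x \<in> X" "G x s"
  shows "acc B s"
proof -
  obtain B' where B': "B' \<in> \<S>" "\<And>x y. pr x y \<in> B' \<longleftrightarrow> B x y"
    using A0_set2[of B] B unfolding ar2_def by blast
  obtain G' where G': "G' \<in> \<S>" "\<And>x y. pr x y \<in> G' \<longleftrightarrow> G x y"
    using A0_set2[of G] G unfolding ar2_def by blast
  \<comment> \<open>Set variables 0, 1 and 2 stand for the sequence, the relation \<open>B'\<close>
    and the family \<open>G'\<close>. At depth \<open>d\<close> the term \<open>Var d\<close> is
    number variable 0, on which the induction runs.\<close>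
  define P :: form where "P = (\<^bold>\<not> (((\<^bold>\<forall>n. \<^bold>\<exists>\<^bold>!x. \<langle>n, x\<rangle> \<^bold>\<in> param 0) \<^bold>\<and>
      (\<^bold>\<forall>n. \<^bold>\<forall>x. \<^bold>\<forall>y. \<langle>n, x\<rangle> \<^bold>\<in> param 0 \<^bold>\<and> \<langle>n \<^bold>+ \<^bold>1, y\<rangle> \<^bold>\<in> param 0 \<^bold>\<longrightarrow> \<langle>y, x\<rangle> \<^bold>\<in> param 1)) \<^bold>\<and>
      (\<^bold>\<forall>y. \<langle>\<^bold>0, y\<rangle> \<^bold>\<in> param 0 \<^bold>\<longrightarrow> \<langle>(\<lambda>d. Var d), y\<rangle> \<^bold>\<in> param 2)))"
  define V where "V = case_nat B' (\<lambda>_ :: nat. G')"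
  let ?Q = "\<lambda>z F. \<not> (desc B F \<and> (\<forall>y. pr \<zero> y \<in> F \<longrightarrow> G z y))"
  have sat: "sat (case_nat z v) (case_nat F V) (P 0 0) \<longleftrightarrow> ?Q z F" for z v F
  proof -
    have var: "den_t E (\<lambda>d. Var d) z" if "ext (0, 0, case_nat z v, case_nat F V) E" for E
      unfolding den_t_def
    proof (intro allI impI)
      fix d e w W assume "ext E (d, e, w, W)"
      from ext_trans[OF that this] have "w (0 + (d - 0)) = case_nat z v 0" unfolding ext_def by blast
      then show "tval w (Var d) = z" by simp
    qed
    have "den (0, 0, case_nat z v, case_nat F V) P
      (\<not> (((\<forall>n. \<exists>!x. pr n x \<in> case_nat F V 0) \<and>
      (\<forall>n x y. pr n x \<in> case_nat F V 0 \<and> pr (n \<oplus> \<one>) y \<in> case_nat F V 0 \<longrightarrow> pr y x \<in> case_nat F V 1)) \<and>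
      (\<forall>y. pr \<zero> y \<in> case_nat F V 0 \<longrightarrow> pr z y \<in> case_nat F V 2)))"
      unfolding P_def
      by (rule den_rules | rule den_param | rule var | assumption | rule ext_refl | erule den_mono | erule ext_extend)+
    then show ?thesis
      by (simp add: den_sat V_def B'(2) G'(2) desc_def numeral_2_eq_2)
  qed
  have P: "arithmetical (P 0 0)"
    by (simp add: P_def fall_def fex1_def fex_def fnot_def fand_def fimp_def fmem_def feq_def)
  \<comment> \<open>A sequence has exactly one first member, so universal and existential
    quantification over it agree.\<close>
  have "(\<forall>y. pr \<zero> y \<in> F \<longrightarrow> G z y) \<longleftrightarrow> (\<exists>y. pr \<zero> y \<in> F \<and> G z y)" if "desc B F" for z F
    using desc_ex[OF that, of \<zero>] desc_fun[OF that, of \<zero>] by metis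
  then have acc: "(\<forall>s. G z s \<longrightarrow> acc B s) \<longleftrightarrow> (\<forall>F\<in>\<S>. ?Q z F)" for z
    unfolding acc_def by blast
  have "\<forall>s. G x s \<longrightarrow> acc B s"
  proof (rule bar_induction[OF X P _ _ _ x(1), where P = "\<lambda>x. \<forall>s. G x s \<longrightarrow> acc B s"])
    show "range V \<subseteq> \<S>" unfolding V_def using B'(1) G'(1) by (auto split: nat.split)
    show "(\<forall>s. G z s \<longrightarrow> acc B s) \<longleftrightarrow> (\<forall>F\<in>\<S>. sat (case_nat z (\<lambda>_. \<zero>)) (case_nat F V) (P 0 0))" for z
      unfolding acc sat ..
  qed (use step in blast)
  then show ?thesis using x(2) by blast
qed

text \<open>Induction on codes for a statement that is not arithmetical: bar induction along the
  order of the numbers, with one element treated at each number.\<close>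

lemma acc_code_induction:
  assumes B: "ar2 B" and Q: "A0 (\<lambda>v. Q (v 0))"
    and step: "\<And>s. Q s \<Longrightarrow> (\<And>t. t \<lhd> s \<Longrightarrow> Q t \<Longrightarrow> acc B t) \<Longrightarrow> acc B s"
    and s: "Q s"
  shows "acc B s"
proof -
  obtain R where R: "R \<in> \<S>" "\<And>x y. pr y x \<in> R \<longleftrightarrow> y \<lhd> x" "wo (\<lambda>x. x \<in> UNIV) (\<lambda>y x. pr y x \<in> R)"
    using lt_wo by blast
  show ?thesis
  proof (rule acc_bar_induction[OF UNIV_S R(1,3) B, where G = "\<lambda>x s. x = s \<and> Q s"])
    show "ar2 (\<lambda>x s. x = s \<and> Q s)" unfolding ar2_def by (intro ar_rules A0_rel1[OF Q])
  qed (use step s R(2) in blast)+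
qed

text \<open>A tail of the sequence is a descending sequence from \<open>x\<close>.\<close>

lemma desc_not_acc:
  assumes F: "F \<in> \<S>" "desc R F" "pr n x \<in> F" shows "\<not> acc R x"
proof -
  let ?F = "{z. \<exists>k y. z = pr k y \<and> pr (n \<oplus> k) y \<in> F}"
  have "?F \<in> \<S>" by (rule A0_CA) (intro ar_rules F(1))
  moreover have "desc R ?F" using F(2) unfolding desc_def by (simp add: plus_suc)
  moreover have "pr \<zero> x \<in> ?F" using F(3) by (simp add: plus_zero)
  ultimately show ?thesis unfolding acc_def by blast
qed

lemma accI: assumes "\<And>x. R x z \<Longrightarrow> acc R x" shows "acc R z"
proof -
  have False if F: "F \<in> \<S>" "desc R F" "pr \<zero> z \<in> F" for F
  proof -
    obtain x where x: "pr (\<zero> \<oplus> \<one>) x \<in> F" using desc_ex[OF F(2)] by blast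
    then have "acc R x" using desc_step[OF F(2,3)] assms by blast
    then show False using desc_not_acc[OF F(1,2) x] by blast
  qed
  then show ?thesis unfolding acc_def by blast
qed

lemma accD: assumes "acc R z" "R x z" shows "acc R x"
proof -
  have False if F: "F \<in> \<S>" "desc R F" "pr \<zero> x \<in> F" for F
  proof -
    \<comment> \<open>The sequence with \<open>z\<close> put in front of it.\<close>
    let ?F = "{w. w = pr \<zero> z \<or> (\<exists>k y. w = pr (k \<oplus> \<one>) y \<and> pr k y \<in> F)}"
    have "?F \<in> \<S>" by (rule A0_CA) (intro ar_rules F(1))
    moreover have "desc R ?F"
      unfolding desc_def
    proof (intro conjI allI impI)
      fix n
      show "\<exists>!y. pr n y \<in> ?F"
      proof (cases "n = \<zero>")
        case True
        then show ?thesis using suc_nonzero suc_nonzero[symmetric] by auto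
      next
        case False
        then obtain m where m: "n = m \<oplus> \<one>" using lt_iff[of \<zero> n] zero_lt_iff by (auto simp: zero_plus)
        have "\<exists>!y. pr m y \<in> F" using F(2) unfolding desc_def by blast
        then show ?thesis unfolding m using suc_nonzero suc_inject by simp
      qed
      fix y y' assume "pr n y \<in> ?F \<and> pr (n \<oplus> \<one>) y' \<in> ?F"
      then have "n = \<zero> \<and> y = z \<or> (\<exists>m. n = m \<oplus> \<one> \<and> pr m y \<in> F)" "pr n y' \<in> F"
        using suc_nonzero suc_inject by auto
      then show "R y' y" using desc_step[OF F(2)] desc_fun[OF F(2,3)] assms(2) by blast
    qed
    moreover have "pr \<zero> z \<in> ?F" by simp
    ultimately show False using assms(1) unfolding acc_def by blast
  qed
  then show ?thesis unfolding acc_def by blast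
qed

lemma wfdI: assumes "\<And>x y. R x y \<Longrightarrow> acc R y" shows "wfd R"
  unfolding wfd_def
proof
  assume "\<exists>F\<in>\<S>. desc R F"
  then obtain F where F: "F \<in> \<S>" "desc R F" by blast
  obtain x y where xy: "pr \<zero> x \<in> F" "pr (\<zero> \<oplus> \<one>) y \<in> F" using desc_ex[OF F(2)] by blast
  then show False using assms[OF desc_step[OF F(2) xy]] desc_not_acc[OF F xy(1)] by blast
qed

lemma acc_mono: assumes "acc R x" "\<And>x y. R' x y \<Longrightarrow> R x y" shows "acc R' x"
proof -
  have "desc R F" if "desc R' F" for F using that assms(2) unfolding desc_def by simp
  then show ?thesis using assms(1) unfolding acc_def by blast
qed

text \<open>Functionality of \<open>\<phi>\<close> is asked only at elements with something below
  them, as is the case for all members of a descending sequence.\<close>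

lemma wfd_map:
  assumes R': "wfd R'" and \<phi>: "ar2 \<phi>"
    and fn: "\<And>x y. R x y \<Longrightarrow> \<exists>!z. \<phi> y z"
    and mono: "\<And>x y x' y'. R x y \<Longrightarrow> \<phi> x x' \<Longrightarrow> \<phi> y y' \<Longrightarrow> R' x' y'"
  shows "wfd R"
  unfolding wfd_def
proof
  assume "\<exists>F\<in>\<S>. desc R F"
  then obtain F where F: "F \<in> \<S>" "desc R F" by blast
  let ?F = "{w. \<exists>n x y. w = pr n y \<and> pr n x \<in> F \<and> \<phi> x y}"
  have "?F \<in> \<S>" by (rule A0_CA) (intro ar_rules F(1) ar2D[OF \<phi>])
  moreover have "desc R' ?F"
    unfolding desc_def
  proof (intro conjI allI impI)
    fix n
    obtain x x' where x: "pr n x \<in> F" "pr (n \<oplus> \<one>) x' \<in> F" using desc_ex[OF F(2)] by blast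
    have mem: "pr m y \<in> ?F \<longleftrightarrow> (\<exists>x. pr m x \<in> F \<and> \<phi> x y)" for m y by simp
    have eq: "pr n y \<in> ?F \<longleftrightarrow> \<phi> x y" for y unfolding mem using x(1) desc_fun[OF F(2) x(1)] by blast
    show "\<exists>!y. pr n y \<in> ?F" unfolding eq by (rule fn[OF desc_step[OF F(2) x]])
    fix y y' assume yy: "pr n y \<in> ?F \<and> pr (n \<oplus> \<one>) y' \<in> ?F"
    from conjunct1[OF yy] have y: "\<phi> x y" unfolding eq .
    from conjunct2[OF yy] have "\<exists>z. pr (n \<oplus> \<one>) z \<in> F \<and> \<phi> z y'" unfolding mem .
    then obtain z where z: "pr (n \<oplus> \<one>) z \<in> F" "\<phi> z y'" by blast
    have "\<phi> x' y'" using z(2) unfolding desc_fun[OF F(2) z(1) x(2)] .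
    then show "R' y' y" using mono[OF desc_step[OF F(2) x]] y by blast
  qed
  ultimately show False using R' unfolding wfd_def by blast
qed

text \<open>A descending sequence from \<open>s\<close> stays at or below \<open>s\<close> by
  transitivity, and its members are not accessible since their tails descend. So the order may be
  restricted to such elements, which disposes of sequences that reach an accessible one.\<close>

lemma acc_wfd:
  assumes B: "ar2 B" and trans: "\<And>x y z. B x y \<Longrightarrow> B y z \<Longrightarrow> B x z"
    and wfd: "wfd (\<lambda>x y. B x y \<and> (B x s \<or> x = s) \<and> (B y s \<or> y = s) \<and> \<not> acc B x \<and> \<not> acc B y)"
  shows "acc B s"
proof -
  have False if F: "F \<in> \<S>" "desc B F" "pr \<zero> s \<in> F" for F
  proof -
    have le: "\<forall>x. pr n x \<in> F \<longrightarrow> B x s \<or> x = s" for n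
    proof (rule A0_induct[where P = "\<lambda>n. \<forall>x. pr n x \<in> F \<longrightarrow> B x s \<or> x = s"])
      show "A0 (\<lambda>v. \<forall>x. pr (v 0) x \<in> F \<longrightarrow> B x s \<or> x = s)" by (intro ar_rules F(1) ar2D[OF B])
      show "\<forall>x. pr \<zero> x \<in> F \<longrightarrow> B x s \<or> x = s" using desc_fun[OF F(2,3)] by blast
      fix n assume "\<forall>x. pr n x \<in> F \<longrightarrow> B x s \<or> x = s"
      then show "\<forall>x. pr (n \<oplus> \<one>) x \<in> F \<longrightarrow> B x s \<or> x = s"
        using desc_ex[OF F(2), of n] desc_step[OF F(2), of n] trans by blast
    qed
    have "desc (\<lambda>x y. B x y \<and> (B x s \<or> x = s) \<and> (B y s \<or> y = s) \<and> \<not> acc B x \<and> \<not> acc B y) F"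
      using F(2) le desc_not_acc[OF F(1,2)] unfolding desc_def by blast
    then show False using wfd F(1) unfolding wfd_def by blast
  qed
  then show ?thesis unfolding acc_def by blast
qed

end

context normal_model
begin

lemma over_mono: "over X s \<Longrightarrow> (\<And>j. Sp s j \<Longrightarrow> X j \<Longrightarrow> Y j) \<Longrightarrow> over Y s"
  unfolding over_def by blast

section \<open>The term system over a well-order\<close>

context
  fixes X R :: "'a set" and B :: "'a \<Rightarrow> 'a \<Rightarrow> bool"
  assumes X: "X \<in> \<S>" and R: "R \<in> \<S>" and wo: "wo (\<lambda>x. x \<in> X) (\<lambda>x y. pr x y \<in> R)" and T_dil: "dil T"
  defines "B \<equiv> \<lambda>s t. over (\<lambda>x. x \<in> X) s \<and> over (\<lambda>x. x \<in> X) t \<and> Bel (\<lambda>x y. pr x y \<in> R) s t"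
begin

abbreviation "lt' x y \<equiv> pr x y \<in> R"
abbreviation "OX \<equiv> over (\<lambda>x. x \<in> X)"

lemma ar2_lt': "ar2 (\<lambda>x y. lt' x y)"
  unfolding ar2_def by (intro ar_rules R)

lemma A0_X: "A0 (\<lambda>v. v 0 \<in> X)"
  by (intro ar_rules X)

lemma lt'_linon: "linon (\<lambda>x y. lt' x y) (\<lambda>x. x \<in> X)"
  using wo unfolding wo_def lin_def linon_def by blast

lemma A0_OX: "af f \<Longrightarrow> A0 (\<lambda>v. OX (f v))"
  by (rule A0_over[OF A0_X])

lemma B_ar2: "ar2 B"
  unfolding B_def ar2_def by (intro ar_rules A0_OX ar2D[OF Bel_ar2[OF ar2_lt']])

lemma Bel_linon_OX: "linon (Bel (\<lambda>x y. lt' x y)) OX"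
  by (rule Bel_linon[OF ar2_lt' A0_X lt'_linon])

lemma B_linon: "linon B OX"
  by (rule linon_cong[OF Bel_linon_OX]) (simp add: B_def)

lemma B_trans: "B x y \<Longrightarrow> B y z \<Longrightarrow> B x z"
  using linonD(2)[OF B_linon, of x y z] unfolding B_def by blast

lemma acc_terms:
  assumes A: "A0 (\<lambda>v. A (v 0))" "\<And>j. A j \<Longrightarrow> j \<in> X" "\<And>j. A j \<Longrightarrow> acc B (mt j)" and s: "over A s"
  shows "acc B s"
proof (rule acc_code_induction[where Q = "over A", OF B_ar2 _ _ s])
  show "A0 (\<lambda>v. over A (v 0))" by (intro A0_over[OF A(1)] ar_rules)
  fix s assume s: "over A s" and IH: "\<And>t. t \<lhd> s \<Longrightarrow> over A t \<Longrightarrow> acc B t"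
  have AX: "OX t" if "over A t" for t using that A(2) over_mono[of A t "\<lambda>x. x \<in> X"] by blast
  show "acc B s" using s
  proof (cases rule: over_cases)
    case (1 m)
    then show ?thesis using A(3) by simp
  next
    case a: (2 a u)
    have OX_s: "OX (xt a u)" using AX s a(1) by blast
    have acc_a: "acc B q" "OX q" if "mem q a" for q
      using IH a(5)[OF that] AX mem_lt_xt[OF that] unfolding a(1) by blast+
    \<comment> \<open>The elements of \<open>W\<close> are accessible, being at or below accessible
      arguments. Thus \<open>W\<close> is well-ordered in the sense of the model, which concerns
      only sequences in \<open>\<S>\<close>.\<close>
    define W where "W = {r. OX r \<and> (\<exists>q. mem q a \<and> (B r q \<or> r = q))}"
    define BW where "BW x y \<longleftrightarrow> x \<in> W \<and> y \<in> W \<and> B x y" for x y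
    have W_S: "W \<in> \<S>" unfolding W_def by (rule A0_CA) (intro ar_rules A0_OX ar2D[OF B_ar2])
    have W_OX: "OX x" if "x \<in> W" for x using that unfolding W_def by blast
    have W_acc: "acc B x" if "x \<in> W" for x
      using that acc_a(1) accD unfolding W_def by blast
    have BW: "ar2 BW" unfolding BW_def ar2_def by (intro ar_rules W_S ar2D[OF B_ar2])
    obtain S where S: "S \<in> \<S>" "\<And>x y. pr x y \<in> S \<longleftrightarrow> BW x y" using A0_set2[of BW] BW unfolding ar2_def by blast
    have BW_S: "(\<lambda>x y. pr x y \<in> S) = BW" by (intro ext, rule S(2))
    have "linon B (\<lambda>x. x \<in> W)" by (rule linon_mono[OF B_linon W_OX])
    then have "lin (\<lambda>x. x \<in> W) BW" unfolding BW_def lin_linon .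
    moreover have "wfd BW"
      by (rule wfdI, rule acc_mono[OF W_acc]) (auto simp: BW_def)
    ultimately have "wo (\<lambda>x. x \<in> W) (\<lambda>x y. pr x y \<in> S)" unfolding wo_def BW_S by blast
    then have wfd: "wfd (Dless T (\<lambda>x. x \<in> W) BW)"
      using T_dil[unfolded dil_def, THEN conjunct2, rule_format, OF W_S S(1)] unfolding BW_S by blast
    \<comment> \<open>A \<open>\<mu>\<close>-term at or below \<open>s\<close> is bounded by an
      argument of \<open>s\<close>, so it belongs to \<open>W\<close> and is accessible. Terms that
      are not accessible are therefore of the form \<open>xt b v\<close>, and \<open>b\<close> lies
      in \<open>W\<close>, by normality or because the term is \<open>s\<close> itself.\<close>
    have xt: "\<exists>b v. t = xt b v \<and> fset b \<and> full T b v \<and> (\<forall>r. mem r b \<longrightarrow> r \<in> W)"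
      if t: "B t s \<or> t = s" "\<not> acc B t" for t
    proof -
      have "OX t" using t(1) OX_s unfolding a(1) B_def by blast
      then show ?thesis
      proof (cases rule: over_cases)
        case (1 m)
        then have "Bel (\<lambda>x y. lt' x y) (mt m) (xt a u)" using t(1) unfolding a(1) B_def by auto
        then obtain q k where q: "mem q a" "Sp q k" "lt' m k \<or> m = k"
          unfolding Bel_mt_xt[OF ar2_lt'] by auto
        have "\<not> lt' m m" using linonD(1)[OF lt'_linon] 1(2) by blast
        then have "Bel (\<lambda>x y. lt' x y) (mt m) q \<or> mt m = q"
          using Bel_from_mt[OF ar2_lt' over_Wf[OF acc_a(2)[OF q(1)]]] q(2,3) by blast
        then have "mt m \<in> W"
          unfolding W_def B_def using q(1) acc_a(2)[OF q(1)] 1(2) by auto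
        then show ?thesis using W_acc t(2) 1(1) by blast
      next
        case (2 b v)
        have "r \<in> W" if r: "mem r b" for r
        proof (cases "t = s")
          case True
          then show ?thesis using 2(1) a(1) r acc_a(2) unfolding W_def by auto
        next
          case False
          then have "Bel (\<lambda>x y. lt' x y) (xt b v) (xt a u)" using t(1) unfolding a(1) 2(1) B_def by auto
          then have l: "linon (Bel (\<lambda>x y. lt' x y)) (\<lambda>x. mem x b \<or> mem x a)"
            and p: "pless T (Bel (\<lambda>x y. lt' x y)) b v a u" unfolding Bel_xt_xt[OF ar2_lt'] by blast+
          obtain q where "mem q a" "Bel (\<lambda>x y. lt' x y) r q \<or> r = q"
            using pless_cofinal[OF Bel_ar2[OF ar2_lt'] l 2(4) a(4) p r] by blast
          then show ?thesis unfolding W_def B_def using 2(5)[OF r] acc_a(2) by blast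
        qed
        then show ?thesis using 2(1,3,4) by blast
      qed
    qed
    show "acc B s"
    proof (rule acc_wfd[OF B_ar2 B_trans], assumption, assumption)
      let ?R = "\<lambda>x y. B x y \<and> (B x s \<or> x = s) \<and> (B y s \<or> y = s) \<and> \<not> acc B x \<and> \<not> acc B y"
      let ?p = "\<lambda>t z. \<exists>b v. t = xt b v \<and> z = pr b v"
      show "wfd ?R"
      \<comment> \<open>Forgetting the constructor sends a term to a pair over \<open>W\<close>, and
        two \<open>\<xi>\<close>-terms are compared exactly like these pairs.\<close>
      proof (rule wfd_map[OF wfd, where \<phi> = ?p])
        show "ar2 ?p" unfolding ar2_def by (intro ar_rules)
        show "\<exists>!z. ?p y z" if "?R x y" for x y
        proof -
          from that have "B y s \<or> y = s" "\<not> acc B y" by iprover+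
          from xt[OF this] obtain b v where "y = xt b v" by blast
          then show ?thesis by auto
        qed
        fix x y x' y' assume xy: "?R x y" and x': "?p x x'" and y': "?p y y'"
        obtain b v where b: "x = xt b v" "x' = pr b v" using x' by blast
        obtain c w where c: "y = xt c w" "y' = pr c w" using y' by blast
        from xy have "B x s \<or> x = s" "\<not> acc B x" "B y s \<or> y = s" "\<not> acc B y"
          by iprover+
        note xts = xt[OF this(1,2), unfolded b(1) term_simps] xt[OF this(3,4), unfolded c(1) term_simps]
        have D: "fset b" "full T b v" "\<And>r. mem r b \<Longrightarrow> r \<in> W" "fset c" "full T c w" "\<And>r. mem r c \<Longrightarrow> r \<in> W"
          using xts by blast+
        have "pless T (Bel (\<lambda>x y. lt' x y)) b v c w"
          using conjunct1[OF xy] unfolding B_def b(1) c(1) Bel_xt_xt[OF ar2_lt'] by blast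
        then have "pless T BW b v c w"
          by (rule pless_cong[OF Bel_ar2[OF ar2_lt'], rotated]) (use D W_OX in \<open>auto simp: BW_def B_def\<close>)
        then show "Dless T (\<lambda>x. x \<in> W) BW x' y'"
          unfolding Dless_def Dfield_def b(2) c(2) using D by blast
      qed
    qed
  qed
qed

lemma acc_mt:
  assumes x: "x \<in> X" shows "acc B (mt x)"
proof (rule acc_bar_induction[OF X R wo B_ar2 _ _ x, where G = "\<lambda>x s. s = mt x"])
  show "ar2 (\<lambda>x s. s = mt x)" unfolding ar2_def by (intro ar_rules)
  fix x s assume x: "x \<in> X" and IH: "\<And>y t. lt' y x \<Longrightarrow> t = mt y \<Longrightarrow> acc B t" and s: "s = mt x"
  show "acc B s"
  proof (rule accI)
    fix t assume t: "B t s"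
    have "over (\<lambda>j. j \<in> X \<and> lt' j x) t"
      using t unfolding B_def s Bel_to_mt[OF ar2_lt'] over_def by blast
    then show "acc B t"
      by (rule acc_terms[rotated -1]) (use IH in \<open>auto intro!: ar_rules X R\<close>)
  qed
qed rule

lemma B_wfd: "wfd B"
proof (rule wfdI)
  fix s t assume "B s t"
  then have t: "OX t" unfolding B_def by blast
  show "acc B t" by (rule acc_terms[where A = "\<lambda>x. x \<in> X", OF A0_X _ acc_mt t])
qed

section \<open>The dilator order embeds into the term system\<close>

lemma enm_emb:
  assumes f: "enm f n a (\<lambda>x y. lt' x y)" and a: "\<And>x. mem x a \<Longrightarrow> x \<in> X"
  shows "emb f (\<lambda>j. j \<lhd> n) (\<lhd>) (\<lambda>x. x \<in> X) (\<lambda>x y. lt' x y)"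
  unfolding emb_def
proof (intro conjI allI impI)
  note ff = enmD(1)[OF f]
  show "\<exists>!k. mem (pr j k) f" if "j \<lhd> n" for j
    using ffunD(4,5)[OF ff, of j] that by blast
  show "k \<in> X" if "mem (pr j k) f" for j k using a ffunD(3)[OF ff that] .
  show "lt' k k'" if "mem (pr j k) f" "mem (pr j' k') f" "j \<lhd> j'" for j k j' k'
    using enmD(3)[OF f] that by blast
qed

text \<open>The relation \<open>\<phi>\<close> renames the indices of a term along the increasing
  enumeration of the finite set with which it is paired. Monotonicity of this map transfers
  descending sequences to the term system over \<open>X\<close>.\<close>

lemma deriv_wfd:
  assumes D: "is_deriv D" shows "wfd (Dless D (\<lambda>x. x \<in> X) (\<lambda>x y. lt' x y))"
proof -
  have D: "\<And>n s. Elt D n s \<longleftrightarrow> E n s" "\<And>n s t. Below D n s t \<longleftrightarrow> BE n s t"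
     "\<And>n l f s t. Act D n l f s t \<longleftrightarrow> mor f n l \<and> E n s \<and> Ac f s t"
    using D unfolding is_deriv_def by blast+
  let ?lt = "\<lambda>x y. lt' x y"
  define \<phi> where "\<phi> z t \<longleftrightarrow> (\<exists>a u f n. z = pr a u \<and> enm f n a ?lt \<and> Ac f u t)" for z t
  have phi: "ar2 \<phi>"
    unfolding \<phi>_def ar2_def by (intro ar_rules A0_enm[OF ar2_rel3[OF ar2_lt']])
  have lin: "linon ?lt (\<lambda>x. mem x a)" if "\<And>x. mem x a \<Longrightarrow> x \<in> X" for a
    by (rule linon_mono[OF lt'_linon that])
  have field: "\<exists>a u. z = pr a u \<and> (\<forall>x. mem x a \<longrightarrow> x \<in> X) \<and> (\<exists>n f. enm f n a ?lt \<and> E n u)"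
    if Dz: "Dfield D (\<lambda>x. x \<in> X) z" for z
  proof -
    obtain a u where z: "z = pr a u" "\<forall>x. mem x a \<longrightarrow> x \<in> X" "full D a u"
      using Dz unfolding Dfield_def by metis
    obtain n where n: "fcard a n" "E n u" using z(3) unfolding full_def D by blast
    have "linon ?lt (\<lambda>x. mem x a)" by (rule lin) (use z(2) in blast)
    then obtain f where "enm f n a ?lt" using enm_ex[OF ar2_lt' _ n(1)] by blast
    then show ?thesis using z n by blast
  qed
  show ?thesis
  proof (rule wfd_map[OF B_wfd phi])
    have ex1: "\<exists>!t. \<phi> z t" if z: "Dfield D (\<lambda>x. x \<in> X) z" for z
    proof -
      obtain a u n f where z: "z = pr a u" "\<And>x. mem x a \<Longrightarrow> x \<in> X" and f: "enm f n a ?lt" "E n u"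
        using field[OF z] by blast
      have "\<exists>!t. Ac f u t"
        by (rule Ac_ex1[OF _ f(2)[unfolded E_def] A0_below])
          (use enm_emb[OF f(1) z(2)] in \<open>simp add: emb_def\<close>)
      moreover have "\<phi> z t \<longleftrightarrow> Ac f u t" for t
        unfolding \<phi>_def z(1) pr_inject using f(1) enm_unique[OF f(1) _ lin[OF z(2)]] by metis
      ultimately show ?thesis by simp
    qed
    show "\<exists>!z. \<phi> y z" if "Dless D (\<lambda>x. x \<in> X) ?lt x y" for x y
      using that ex1 unfolding Dless_def by blast
    fix x y x' y' assume less: "Dless D (\<lambda>x. x \<in> X) ?lt x y" and phix: "\<phi> x x'" and phiy: "\<phi> y y'"
    have fx: "Dfield D (\<lambda>x. x \<in> X) x" and fy: "Dfield D (\<lambda>x. x \<in> X) y"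
      using less unfolding Dless_def by blast+
    obtain a u b v where x: "x = pr a u" and y: "y = pr b v" and pl: "pless D ?lt a u b v"
      using less unfolding Dless_def by blast
    have aX: "\<And>z. mem z a \<Longrightarrow> z \<in> X" and bX: "\<And>z. mem z b \<Longrightarrow> z \<in> X"
      using field[OF fx] field[OF fy] unfolding x y pr_inject by blast+
    obtain c p q r g h u' v' where c: "funion c a b" and g: "inc g p r a c ?lt" and h: "inc h q r b c ?lt"
      and u': "mor g p r" "E p u" "Ac g u u'" and v': "mor h q r" "E q v" "Ac h v v'" and uv: "BE r u' v'"
      using pl unfolding pless_def D by blast
    have cX: "z \<in> X" if "mem z c" for z using that aX bX union_mem[OF c] by blast
    obtain k where k: "enm k r c ?lt" using inc_enm[OF g] by blast
    \<comment> \<open>Renaming along the enumeration of \<open>e\<close> is the same as moving to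
      the union \<open>c\<close> first and then renaming along its enumeration \<open>k\<close>.
      Hence the comparison made at the cardinality \<open>r\<close> of \<open>c\<close> carries over
      to terms over \<open>X\<close>.\<close>
    have compose: "\<exists>w'. OX w' \<and> Ac k w w' \<and> \<phi> (pr e z) w'"
      if inc: "inc i l r e c ?lt" and ec: "\<And>x. mem x e \<Longrightarrow> mem x c" and z: "E l z" "Ac i z w" "E r w"
      for i l e z w
    proof -
      note em = enm_emb[OF k cX]
      obtain w' where w': "Ac k w w'"
        using Ac_ex1[OF emb_ex1[OF ar2_lt A0_below linon_lt ar2_lt' A0_X lt'_linon em] z(3)[unfolded E_def] A0_below]
        by blast
      have "OX w'"
        by (rule Ac_over_mono(1)[OF ar2_lt A0_below linon_lt ar2_lt' A0_X lt'_linon em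
          z(3)[unfolded E_def] z(3)[unfolded E_def] w' w'])
      obtain f where f: "enm f l e ?lt" using inc_enm[OF inc] by blast
      have iff: "mem (pr j m) i \<longleftrightarrow> (\<exists>x. mem (pr j x) f \<and> mem (pr m x) k)" for j m
        by (rule inc_mem_iff[OF inc lin[OF cX] ec f k])
      have "Ac f z w'"
      proof (rule Ac_comp[OF E_Wf[OF z(1)] z(2) w'])
        fix j m y assume "mem (pr j m) i" "mem (pr m y) k"
        then obtain x where x: "mem (pr j x) f" "mem (pr m x) k" using iff by blast
        have "x = y" by (rule ffunD(5)[OF enmD(1)[OF k] x(2) \<open>mem (pr m y) k\<close>])
        then show "mem (pr j y) f" using x(1) by simp
      qed
      then have "\<phi> (pr e z) w'" unfolding \<phi>_def using f by blast
      then show ?thesis using \<open>OX w'\<close> w' by blast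
    qed
    have uvE: "E r u'" "E r v'" "Bel (\<lhd>) u' v'" using uv unfolding BE_def by blast+
    obtain s where s: "OX s" "Ac k u' s" "\<phi> (pr a u) s"
      using compose[OF g _ u'(2,3) uvE(1)] union_mem[OF c] by blast
    obtain t where t: "OX t" "Ac k v' t" "\<phi> (pr b v) t"
      using compose[OF h _ v'(2,3) uvE(2)] union_mem[OF c] by blast
    have "Bel ?lt s t"
      by (rule Ac_over_mono(2)[OF ar2_lt A0_below linon_lt ar2_lt' A0_X lt'_linon enm_emb[OF k cX]
          uvE(1)[unfolded E_def] uvE(2)[unfolded E_def] s(2) t(2) uvE(3)])
    moreover have "x' = s" "y' = t" using ex1[OF fx] ex1[OF fy] phix phiy s(3) t(3) unfolding x y by blast+
    ultimately show "B x' y'" unfolding B_def using s(1) t(1) by blast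
  qed
qed

end

lemma deriv_ndil:
  assumes "dil T" "D \<in> \<S>" "deriv T D" shows "ndil D"
proof -
  have D: "is_deriv D" using deriv_is_deriv assms(2,3) by blast
  then have nprae: "nprae D" by (rule is_deriv_nprae)
  have "wfd (Dless D (\<lambda>x. x \<in> X) (\<lambda>x y. pr x y \<in> R))"
    if "X \<in> \<S>" "R \<in> \<S>" "wo (\<lambda>x. x \<in> X) (\<lambda>x y. pr x y \<in> R)" for X R
    by (rule deriv_wfd[OF that assms(1) D])
  moreover have "prae D" using nprae unfolding nprae_def by blast
  ultimately show ?thesis unfolding ndil_def dil_def using nprae by blast
qed

end

section \<open>The theorem\<close>

text \<open>Below \<open>d\<close> and \<open>e\<close> binders the substitutions \<open>s'\<close>
  and \<open>r'\<close> act as \<open>s\<close> and \<open>r\<close> on the parameters and fix the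
  term \<open>x\<close>. So an instance of a schema becomes the corresponding instance for the
  substituted formula.\<close>

lemma subst_app:
  assumes "subst_tm s' (x d) = x d" "\<And>n. s' (n + d) = subst_tm (\<lambda>m. Var (m + d)) (s n)"
    "\<And>X. r' (X + e) = r X + e"
  shows "subst s' r' (p\<lbrakk>x\<rbrakk> d e) = (subst (case_nat (Var 0) (\<lambda>n. lift_tm (s n))) r p)\<lbrakk>x\<rbrakk> d e"
proof -
  have "(\<lambda>n. subst_tm s' (case_nat (x d) (\<lambda>n. Var (n + d)) n)) =
    (\<lambda>n. subst_tm (case_nat (x d) (\<lambda>n. Var (n + d))) (case_nat (Var 0) (\<lambda>n. lift_tm (s n)) n))"
    by (rule ext) (simp split: nat.split add: assms(1,2) subst_tm_lift_tm)
  then show ?thesis unfolding app_def subst_subst assms(3) by simp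
qed

lemma Sigma01_subst: "Sigma01 p \<Longrightarrow> Sigma01 (subst s r p)"
  unfolding Sigma01_def using Delta00_subst by fastforce

lemma Pi01_subst: "Pi01 p \<Longrightarrow> Pi01 (subst s r p)"
  unfolding Pi01_def using Delta00_subst by fastforce

lemma Pi11_subst: "Pi11 p \<Longrightarrow> Pi11 (subst s r p)"
  unfolding Pi11_def using arithmetical_subst by fastforce

lemmas form_defs = fall_def fex_def fex1_def fallS_def fexS_def fnot_def fand_def fdisj_def fiff_def
  fimp_def fmem_def feq_def fless_def fadd_def fmul_def fone_def fzero_def

lemma subst_basic_axioms: "p \<in> basic_axioms \<Longrightarrow> subst s r p = p"
  unfolding basic_axioms_def by (elim CollectE exE conjE insertE emptyE) (simp_all add: form_defs)

lemma subst_Sigma01_IND: assumes "q \<in> Sigma01_IND" shows "subst s r q \<in> Sigma01_IND"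
proof -
  obtain p where p: "Sigma01 p" "q = (p\<lbrakk>\<^bold>0\<rbrakk> \<^bold>\<and> (\<^bold>\<forall>n. p\<lbrakk>n\<rbrakk> \<^bold>\<longrightarrow> p\<lbrakk>n \<^bold>+ \<^bold>1\<rbrakk>) \<^bold>\<longrightarrow> (\<^bold>\<forall>n. p\<lbrakk>n\<rbrakk>)) 0 0"
    using assms unfolding Sigma01_IND_def by blast
  let ?p = "subst (case_nat (Var 0) (\<lambda>n. lift_tm (s n))) r p"
  have "subst s r q = (?p\<lbrakk>\<^bold>0\<rbrakk> \<^bold>\<and> (\<^bold>\<forall>n. ?p\<lbrakk>n\<rbrakk> \<^bold>\<longrightarrow> ?p\<lbrakk>n \<^bold>+ \<^bold>1\<rbrakk>) \<^bold>\<longrightarrow> (\<^bold>\<forall>n. ?p\<lbrakk>n\<rbrakk>)) 0 0"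
    unfolding p(2) by (simp add: form_defs subst_app[of _ _ _ s _ _ r] lift_tm_def subst_tm_subst_tm)
  then show ?thesis using Sigma01_subst[OF p(1)] unfolding Sigma01_IND_def by blast
qed

lemma subst_Delta01_CA: assumes "a \<in> Delta01_CA" shows "subst s r a \<in> Delta01_CA"
proof -
  obtain p q where p: "Sigma01 p" "Pi01 q"
    "a = ((\<^bold>\<forall>n. p\<lbrakk>n\<rbrakk> \<^bold>\<longleftrightarrow> q\<lbrakk>n\<rbrakk>) \<^bold>\<longrightarrow> (\<^bold>\<exists>\<^sub>2X. \<^bold>\<forall>n. n \<^bold>\<in> X \<^bold>\<longleftrightarrow> p\<lbrakk>n\<rbrakk>)) 0 0"
    using assms unfolding Delta01_CA_def by blast
  let ?p = "subst (case_nat (Var 0) (\<lambda>n. lift_tm (s n))) r p"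
  let ?q = "subst (case_nat (Var 0) (\<lambda>n. lift_tm (s n))) r q"
  have "subst s r a = ((\<^bold>\<forall>n. ?p\<lbrakk>n\<rbrakk> \<^bold>\<longleftrightarrow> ?q\<lbrakk>n\<rbrakk>) \<^bold>\<longrightarrow> (\<^bold>\<exists>\<^sub>2X. \<^bold>\<forall>n. n \<^bold>\<in> X \<^bold>\<longleftrightarrow> ?p\<lbrakk>n\<rbrakk>)) 0 0"
    unfolding p(3) by (simp add: form_defs subst_app[of _ _ _ s _ _ r] lift_tm_def subst_tm_subst_tm)
  then show ?thesis using Sigma01_subst[OF p(1)] Pi01_subst[OF p(2)] unfolding Delta01_CA_def by blast
qed

lemma subst_Pi11_BI: assumes "a \<in> Pi11_BI" shows "subst s r a \<in> Pi11_BI"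
proof -
  define BI where "BI i j p = (let X = param i; R = param j in
      well_order (\<lambda>x. x \<^bold>\<in> X) (\<lambda>y x. \<langle>y, x\<rangle> \<^bold>\<in> R) \<^bold>\<longrightarrow>
      (\<^bold>\<forall>x. x \<^bold>\<in> X \<^bold>\<longrightarrow> (\<^bold>\<forall>y. \<langle>y, x\<rangle> \<^bold>\<in> R \<^bold>\<longrightarrow> p\<lbrakk>y\<rbrakk>) \<^bold>\<longrightarrow> p\<lbrakk>x\<rbrakk>) \<^bold>\<longrightarrow>
      (\<^bold>\<forall>x. x \<^bold>\<in> X \<^bold>\<longrightarrow> p\<lbrakk>x\<rbrakk>)) 0 0" for i j p
  obtain i j p where p: "Pi11 p" "a = BI i j p"
    using assms unfolding Pi11_BI_def BI_def by blast
  let ?p = "subst (case_nat (Var 0) (\<lambda>n. lift_tm (s n))) r p"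
  have "subst s r a = BI (r i) (r j) ?p"
    unfolding p(2) BI_def Let_def
    by (simp add: form_defs well_order_def linear_order_def well_founded_def pair_def param_def
        subst_app[of _ _ _ s _ _ r] lift_tm_def subst_tm_subst_tm)
  then show ?thesis using Pi11_subst[OF p(1)] unfolding Pi11_BI_def BI_def by blast
qed

lemma axioms_subst_closed: "subst_closed (RCA0 \<union> Pi11_BI)"
  by unfold_locales
    (auto simp: RCA0_def subst_basic_axioms subst_Sigma01_IND subst_Delta01_CA subst_Pi11_BI)

text \<open>Derivability is obtained from truth in all models on \<open>nat\<close>. The existence
  clause ensures that the statement on all codes of the derivative is not vacuous.\<close>

theorem theorem5p8:
  shows "RCA0 \<union> Pi11_BI; [] \<turnstile>
    (\<^bold>\<forall>\<^sub>2T. normal_dilator T \<^bold>\<longrightarrow>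
       (\<^bold>\<exists>\<^sub>2D. derivative T D) \<^bold>\<and> (\<^bold>\<forall>\<^sub>2D. derivative T D \<^bold>\<longrightarrow> normal_dilator D)) 0 0"
proof (rule subst_closed.completeness[OF axioms_subst_closed])
  have "(\<^bold>\<forall>n. \<^bold>\<not> n \<^bold>+ \<^bold>1 \<^bold>= \<^bold>0) 0 0 \<in> basic_axioms"
    unfolding basic_axioms_def by blast
  then show "AllN (Neg (Eq (Add (Var 0) One) Zero)) \<in> RCA0 \<union> Pi11_BI"
    by (simp add: form_defs RCA0_def)
  have "(\<^bold>\<forall>m. \<^bold>\<forall>n. m \<^bold>+ \<^bold>1 \<^bold>= n \<^bold>+ \<^bold>1 \<^bold>\<longrightarrow> m \<^bold>= n) 0 0 \<in> basic_axioms"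
    unfolding basic_axioms_def by blast
  then show "AllN (AllN (Imp (Eq (Add (Var 1) One) (Add (Var 0) One)) (Eq (Var 1) (Var 0)))) \<in> RCA0 \<union> Pi11_BI"
    by (simp add: form_defs RCA0_def)
  fix zero one :: nat and plus times lt \<S> v and V :: "nat \<Rightarrow> nat set"
  assume "\<And>p v V. p \<in> RCA0 \<union> Pi11_BI \<Longrightarrow> range V \<subseteq> \<S> \<Longrightarrow> struct.sat zero one plus times lt \<S> v V p"
    and V: "range V \<subseteq> \<S>"
  \<comment> \<open>The given assignment of sets shows that \<open>\<S>\<close> is nonempty.\<close>
  then interpret model zero one plus times lt \<S> by unfold_locales auto
  have "(\<exists>D\<in>\<S>. deriv T D) \<and> (\<forall>D\<in>\<S>. deriv T D \<longrightarrow> ndil D)" if T_ndil: "T \<in> \<S>" "ndil T" for T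
  proof -
    interpret normal_model zero one plus times lt \<S> T
      using T_ndil unfolding ndil_def by unfold_locales auto
    show ?thesis using deriv_ex deriv_ndil T_ndil(2) unfolding ndil_def by blast
  qed
  then show "sat v V ((\<^bold>\<forall>\<^sub>2T. normal_dilator T \<^bold>\<longrightarrow>
       (\<^bold>\<exists>\<^sub>2D. derivative T D) \<^bold>\<and> (\<^bold>\<forall>\<^sub>2D. derivative T D \<^bold>\<longrightarrow> normal_dilator D)) 0 0)"
    using den_sat[OF den_theorem] by blast
qed

end
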